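(* Let $\beta,\gamma>0$ and let $p^g(t,x,dy)$ be the transition kernel on $\mathbb{R}_+$ of the general Brownian motion $B^g$ with parameters $\beta,\gamma$. Then for $t>0$, $x,y\in\mathbb{R}_+$, $$p^g(t,x,dy)=p^D(t,x,y)\,dy+2g_{\beta,\gamma}(t,x+y)\,dy+\gamma\,g_{\beta,\gamma}(t,x)\,\varepsilon_0(dy),$$ where $\varepsilon_0$ is the Dirac measure at $0$, $$p^D(t,x,y)=\frac{1}{\sqrt{2\pi t}}\Bigl(e^{-(x-y)^2/2t}-e^{-(x+y)^2/2t}\Bigr),$$ and $$g_{\beta,\gamma}(t,x)=\frac{1}{\gamma^2}\frac{1}{\sqrt{2\pi}}\int_0^t\frac{s+\gamma x}{(t-s)^{3/2}}\exp\Bigl(-\frac{(s+\gamma x)^2}{2\gamma^2(t-s)}\Bigr)e^{-\beta s/\gamma}\,ds.$$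
   Context: Setting. $(\Omega,\mathcal{A})$ is a measurable space with probability measures $(P_x,\,x\in\mathbb{R})$ and a right continuous filtration $\mathcal{F}=(\mathcal{F}_t,\,t\ge0)$, complete with respect to $(P_x)$; $B=(B_t,\,t\ge0)$ is a standard one-dimensional Brownian motion relative to $\mathcal{F}$ with $P_x(B_0=x)=1$, equipped with shift operators $\theta_t:\Omega\to\Omega$ with $B_s\circ\theta_t=B_{s+t}$. $L=(L_t,\,t\ge0)$ is the local time of $B$ at $0$, normalized so that Tanaka's formula reads $d|B_t|=\operatorname{sign}(B_t)\,dB_t+dL_t$. All paths of $B$ and $L$ are continuous. Let $\tau^{-1}(t)=t+\gamma L_t$, $t\ge0$ (a strictly increasing continuous bijection of $\mathbb{R}_+=[0,+\infty)$), with inverse $\tau$; put $B^s_t=|B_{\tau(t)}|$ and $L^s_t=L_{\tau(t)}$, $t\ge0$. General Brownian motion. Let $P_\beta$ be the exponential law of rate $\beta$ on $\mathbb{R}_+$, $S(s)=s$ the identity random variable on $\mathbb{R}_+$, and $\hat\Omega=\Omega\times\mathbb{R}_+$ with product $\sigma$-algebra and measures $\hat P_x=P_x\otimes P_\beta$; random variables are extended trivially to $\hat\Omega$. Put $\zeta_{\beta,\gamma}=\inf\{t\ge0:\,L^s_t>S\}$, and $B^g_t=B^s_t$ if $t<\zeta_{\beta,\gamma}$, $B^g_t=\Delta$ if $t\ge\zeta_{\beta,\gamma}$, where $\Delta$ is a cemetery point. The transition kernel is $p^g(t,x,C)=\hat P_x(B^g_t\in C)$ for $x\in\mathbb{R}_+$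 and Borel sets $C\subset\mathbb{R}_+$. *)

theory Defs
  imports "HOL-Probability.Probability"
begin

section \<open>Brownian motion under a family of laws\<close>

text \<open>
  \<open>A\<close> is the measurable space underlying all the \<open>P x\<close> (only its space and its sigma-algebra
  matter).  Time is of type \<^typ>\<open>real\<close>; families indexed by time are only constrained, and only
  used, at nonnegative times.  Null sets in the completeness condition are subsets of measurable
  null sets; the condition only refers to sets that are null for every \<open>P x\<close>.
\<close>

locale brownian_family =
  fixes A :: "'a measure"
    and P :: "real \<Rightarrow> 'a measure"
    and F :: "real \<Rightarrow> 'a measure"
    and B :: "real \<Rightarrow> 'a \<Rightarrow> real"
    and \<theta> :: "real \<Rightarrow> 'a \<Rightarrow> 'a"
  assumes prob_P: "\<And>x. prob_space (P x)"
    and sets_P: "\<And>x. sets (P x) = sets A"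
    and filtration_sub: "\<And>t. 0 \<le> t \<Longrightarrow> subalgebra A (F t)"
    and filtration_mono: "\<And>s t. 0 \<le> s \<Longrightarrow> s \<le> t \<Longrightarrow> sets (F s) \<subseteq> sets (F t)"
    and filtration_right_cont: "\<And>t. 0 \<le> t \<Longrightarrow> sets (F t) = (\<Inter>u\<in>{t<..}. sets (F u))"
    and filtration_complete:
      "\<And>N. N \<subseteq> space A \<Longrightarrow> (\<And>x. \<exists>N'\<in>null_sets (P x). N \<subseteq> N') \<Longrightarrow> N \<in> sets (F 0)"
    and B_adapted: "\<And>t. 0 \<le> t \<Longrightarrow> B t \<in> borel_measurable (F t)"
    and B_continuous: "\<And>\<omega>. \<omega> \<in> space A \<Longrightarrow> continuous_on {0..} (\<lambda>t. B t \<omega>)"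
    and B_start: "\<And>x. AE \<omega> in P x. B 0 \<omega> = x"
    and B_increment_normal: "\<And>x s t. 0 \<le> s \<Longrightarrow> s < t \<Longrightarrow>
      distributed (P x) lborel (\<lambda>\<omega>. B t \<omega> - B s \<omega>) (normal_density 0 (sqrt (t - s)))"
    and B_increment_indep: "\<And>x s t. 0 \<le> s \<Longrightarrow> s < t \<Longrightarrow>
      prob_space.indep_set (P x) (sets (F s))
        (sets (vimage_algebra (space A) (\<lambda>\<omega>. B t \<omega> - B s \<omega>) borel))"
    and shift_space: "\<And>t. 0 \<le> t \<Longrightarrow> \<theta> t \<in> space A \<rightarrow> space A"
    and B_shift: "\<And>s t \<omega>. 0 \<le> s \<Longrightarrow> 0 \<le> t \<Longrightarrow> \<omega> \<in> space A \<Longrightarrow> B s (\<theta> t \<omega>) = B (s + t) \<omega>"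


section \<open>Ito integral and local time\<close>

text \<open>
  The data \<open>n\<close>, \<open>r\<close>, \<open>\<xi>\<close> encode the elementary predictable process
  \<open>\<Sum>i<n. \<xi> i * indicator {r i<..r (Suc i)}\<close>.
\<close>

definition elementary_integrand ::
    "(real \<Rightarrow> 'a measure) \<Rightarrow> nat \<Rightarrow> (nat \<Rightarrow> real) \<Rightarrow> (nat \<Rightarrow> 'a \<Rightarrow> real) \<Rightarrow> bool" where
  "elementary_integrand F n r \<xi> \<longleftrightarrow>
     0 \<le> r 0 \<and> (\<forall>i<n. r i \<le> r (Suc i)) \<and>
     (\<forall>i<n. \<xi> i \<in> borel_measurable (F (r i)) \<and> (\<exists>K. \<forall>\<omega>\<in>space (F (r i)). \<bar>\<xi> i \<omega>\<bar> \<le> K))"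

definition elementary_process ::
    "nat \<Rightarrow> (nat \<Rightarrow> real) \<Rightarrow> (nat \<Rightarrow> 'a \<Rightarrow> real) \<Rightarrow> real \<Rightarrow> 'a \<Rightarrow> real" where
  "elementary_process n r \<xi> s \<omega> = (\<Sum>i<n. \<xi> i \<omega> * indicator {r i<..r (Suc i)} s)"

definition elementary_integral ::
    "(real \<Rightarrow> 'a \<Rightarrow> real) \<Rightarrow> nat \<Rightarrow> (nat \<Rightarrow> real) \<Rightarrow> (nat \<Rightarrow> 'a \<Rightarrow> real) \<Rightarrow> real \<Rightarrow> 'a \<Rightarrow> real" where
  "elementary_integral B n r \<xi> t \<omega> =
     (\<Sum>i<n. \<xi> i \<omega> * (B (min t (r (Suc i))) \<omega> - B (min t (r i)) \<omega>))"

text \<open>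
  \<open>has_Ito_integral Q F B H t J\<close>: under the law \<open>Q\<close>, the variable \<open>J\<close> is (a version of) the
  stochastic integral of \<open>H\<close> against the Brownian motion \<open>B\<close> over \<open>[0,t]\<close>, i.e. the mean square
  limit of elementary integrals whose integrands converge to \<open>H\<close> in mean square on
  \<open>\<Omega> \<times> [0,t]\<close>.
\<close>

definition has_Ito_integral ::
    "'a measure \<Rightarrow> (real \<Rightarrow> 'a measure) \<Rightarrow> (real \<Rightarrow> 'a \<Rightarrow> real) \<Rightarrow> (real \<Rightarrow> 'a \<Rightarrow> real) \<Rightarrow> real
      \<Rightarrow> ('a \<Rightarrow> real) \<Rightarrow> bool" where
  "has_Ito_integral Q F B H t J \<longleftrightarrow>
     J \<in> borel_measurable Q \<and>
     (\<exists>n r \<xi>.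
        (\<forall>k. elementary_integrand F (n k) (r k) (\<xi> k)) \<and>
        (\<lambda>k. \<integral>\<^sup>+\<omega>. (\<integral>\<^sup>+s\<in>{0..t}.
                ennreal ((elementary_process (n k) (r k) (\<xi> k) s \<omega> - H s \<omega>)\<^sup>2) \<partial>lborel) \<partial>Q)
          \<longlonglongrightarrow> 0 \<and>
        (\<lambda>k. \<integral>\<^sup>+\<omega>. ennreal ((elementary_integral B (n k) (r k) (\<xi> k) t \<omega> - J \<omega>)\<^sup>2) \<partial>Q)
          \<longlonglongrightarrow> 0)"

text \<open>
  The local time at 0 is the increasing process in Tanaka's formula.  The value of \<^const>\<open>sgn\<close>
  at 0 is irrelevant, because the zero set of Brownian motion is Lebesgue null.
\<close>

locale brownian_local_time = brownian_family A P F B \<theta>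
  for A :: "'a measure" and P F and B :: "real \<Rightarrow> 'a \<Rightarrow> real" and \<theta> +
  fixes L :: "real \<Rightarrow> 'a \<Rightarrow> real"
  assumes L_adapted: "\<And>t. 0 \<le> t \<Longrightarrow> L t \<in> borel_measurable (F t)"
    and L_continuous: "\<And>\<omega>. \<omega> \<in> space A \<Longrightarrow> continuous_on {0..} (\<lambda>t. L t \<omega>)"
    and L_zero: "\<And>\<omega>. \<omega> \<in> space A \<Longrightarrow> L 0 \<omega> = 0"
    and L_mono: "\<And>\<omega>. \<omega> \<in> space A \<Longrightarrow> mono_on {0..} (\<lambda>t. L t \<omega>)"
    and Tanaka: "\<And>x t. 0 \<le> t \<Longrightarrow>
      \<exists>J. has_Ito_integral (P x) F B (\<lambda>s \<omega>. sgn (B s \<omega>)) t J \<and>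
          (AE \<omega> in P x. \<bar>B t \<omega>\<bar> = \<bar>B 0 \<omega>\<bar> + J \<omega> + L t \<omega>)"


section \<open>The general Brownian motion\<close>

definition time_change :: "(real \<Rightarrow> 'a \<Rightarrow> real) \<Rightarrow> real \<Rightarrow> real \<Rightarrow> 'a \<Rightarrow> real" where
  "time_change L \<gamma> t \<omega> = the_inv_into {0..} (\<lambda>u. u + \<gamma> * L u \<omega>) t"

definition sticky_bm ::
    "(real \<Rightarrow> 'a \<Rightarrow> real) \<Rightarrow> (real \<Rightarrow> 'a \<Rightarrow> real) \<Rightarrow> real \<Rightarrow> real \<Rightarrow> 'a \<Rightarrow> real" where
  "sticky_bm B L \<gamma> t \<omega> = \<bar>B (time_change L \<gamma> t \<omega>) \<omega>\<bar>"

definition sticky_local_time :: "(real \<Rightarrow> 'a \<Rightarrow> real) \<Rightarrow> real \<Rightarrow> real \<Rightarrow> 'a \<Rightarrow> real" where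
  "sticky_local_time L \<gamma> t \<omega> = L (time_change L \<gamma> t \<omega>) \<omega>"

definition exponential_law :: "real \<Rightarrow> real measure" where
  "exponential_law \<beta> = restrict_space (density lborel (\<lambda>s. ennreal (exponential_density \<beta> s))) {0..}"

definition extended_law :: "(real \<Rightarrow> 'a measure) \<Rightarrow> real \<Rightarrow> real \<Rightarrow> ('a \<times> real) measure" where
  "extended_law P \<beta> x = P x \<Otimes>\<^sub>M exponential_law \<beta>"

text \<open>
  Points of the extended space are pairs \<open>(\<omega>, s)\<close>, with \<open>S (\<omega>, s) = s\<close>.  The infimum of the
  empty set is \<open>\<infinity>\<close>.  The rate \<open>\<beta>\<close> only enters through the law of \<open>S\<close>.
\<close>

definition lifetime :: "(real \<Rightarrow> 'a \<Rightarrow> real) \<Rightarrow> real \<Rightarrow> 'a \<times> real \<Rightarrow> ereal" where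
  "lifetime L \<gamma> = (\<lambda>(\<omega>, s). Inf (ereal ` {t. 0 \<le> t \<and> sticky_local_time L \<gamma> t \<omega> > s}))"

text \<open>The cemetery point \<open>\<Delta>\<close> is \<^const>\<open>None\<close>.\<close>

definition general_bm ::
    "(real \<Rightarrow> 'a \<Rightarrow> real) \<Rightarrow> (real \<Rightarrow> 'a \<Rightarrow> real) \<Rightarrow> real \<Rightarrow> real \<Rightarrow> 'a \<times> real \<Rightarrow> real option" where
  "general_bm B L \<gamma> t w =
     (if ereal t < lifetime L \<gamma> w then Some (sticky_bm B L \<gamma> t (fst w)) else None)"

definition transition_kernel ::
    "(real \<Rightarrow> 'a measure) \<Rightarrow> (real \<Rightarrow> 'a \<Rightarrow> real) \<Rightarrow> (real \<Rightarrow> 'a \<Rightarrow> real) \<Rightarrow> real \<Rightarrow> real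
      \<Rightarrow> real \<Rightarrow> real \<Rightarrow> real set \<Rightarrow> ennreal" where
  "transition_kernel P B L \<beta> \<gamma> t x C =
     emeasure (extended_law P \<beta> x)
       {w \<in> space (extended_law P \<beta> x). general_bm B L \<gamma> t w \<in> Some ` C}"


section \<open>The explicit densities\<close>

definition p_D :: "real \<Rightarrow> real \<Rightarrow> real \<Rightarrow> real" where
  "p_D t x y = 1 / sqrt (2 * pi * t) *
     (exp (- (x - y)\<^sup>2 / (2 * t)) - exp (- (x + y)\<^sup>2 / (2 * t)))"

definition g_density :: "real \<Rightarrow> real \<Rightarrow> real \<Rightarrow> real \<Rightarrow> real" where
  "g_density \<beta> \<gamma> t x = 1 / \<gamma>\<^sup>2 * (1 / sqrt (2 * pi)) *
     (LBINT s=0..t. (s + \<gamma> * x) / (t - s) powr (3 / 2)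
        * exp (- (s + \<gamma> * x)\<^sup>2 / (2 * \<gamma>\<^sup>2 * (t - s))) * exp (- \<beta> * s / \<gamma>))"

end

theory Submission
  imports Defs
begin

text \<open>By Tanaka's formula \<open>\<bar>B\<bar> - L\<close> is a martingale.  Let \<open>q\<close> be odd, \<open>f = q' + \<beta> q + (\<gamma> / 2) q''\<close>, and let
  \<open>U(r, \<cdot>)\<close> be the heat flow of \<open>f\<close>.  Then \<open>f' - (\<gamma> / 2) f'' - \<beta> f\<close> is odd, so \<open>U\<^sub>y = (\<gamma> / 2) U\<^sub>y\<^sub>y + \<beta> U\<close> at
  \<open>y = 0\<close> for all times.  Hence the \<open>dL\<close> terms cancel in the increments of
  \<open>U(T - t - \<gamma> L\<^sub>t, \<bar>B\<^sub>t\<bar>) exp (- \<beta> L\<^sub>t)\<close>, which is a martingale up to the time \<open>t\<close> with \<open>t + \<gamma> L\<^sub>t = T\<close>,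
  and \<open>E\<^sub>x (f(B\<^sup>s\<^sub>T) exp (- \<beta> L\<^sup>s\<^sub>T)) = U(T, x)\<close>.  Integrating over the independent exponential variable
  \<open>S\<close> shows that the left side is the integral of \<open>f\<close> against the transition kernel.

  The claimed density gives the same value: \<open>g\<close> is an integral of heat kernels along
  \<open>s \<mapsto> (t - s, x + s / \<gamma>)\<close>, and integrating the derivative along this path and in \<open>y\<close> turns the integral
  of \<open>f\<close> against \<open>2 g\<close> into the reflected part of \<open>U(t, x)\<close>.  Finally, every smooth step function on the
  half-line has the form \<open>f\<close>, and \<open>q = sin\<close> has \<open>f(0) \<noteq> 0\<close>, so these \<open>f\<close> determine the density on
  \<open>{0<..}\<close> and the atom at \<open>0\<close>.\<close>

section \<open>The heat semigroup\<close>

text \<open>Write D for the derivative and N = (\<gamma> / 2) D^2 + \<beta>. The boundary condition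
  asks that (D - N) f be odd. For f = (D + N) q it becomes (D^2 - N^2) q, which contains only even
  derivatives of the odd function q; this is where the form of f comes from. The martingale property
  is obtained from increments over the cells of a deterministic grid. A Brownian displacement over a
  cell of width h costs an error of order h sqrt h, and these errors add up to order sqrt h. The
  obstacle is the local time: its increments d add up to L_T whatever the mesh, so an error of order
  d is too large, and each local time error has to be d times a factor that becomes small. Two such
  factors occur, the oscillation of the paths over a cell and the size of |B| at its left end. The
  second is small only because L grows near the zeros of B, and on a grid this holds only in mean:
  the compensator of L shows that the mean of min(1, B^2) times d is of order h sqrt h. In the same
  way the clock t + \<gamma> L_t may overshoot T within a cell, so the flow is run a little longer
  than T and the surplus is removed at the very end.\<close>

definition heat :: "real \<Rightarrow> (real \<Rightarrow> real) \<Rightarrow> real \<Rightarrow> real" where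
  "heat r f y = (\<integral>z. f (y + sqrt r * z) \<partial>std_normal_distribution)"

interpretation std_normal: prob_space std_normal_distribution
  by (rule prob_space_normal_density) simp

lemma std_normal_UNIV [simp]: "measure std_normal_distribution UNIV = 1"
  using std_normal.prob_space by simp

lemma integrable_std_normal_power [simp]: "integrable std_normal_distribution (\<lambda>z. z ^ k)"
  by (rule integrable_std_normal_distribution_moment)

lemma integrable_std_normal_abs_power [simp]:
  "integrable std_normal_distribution (\<lambda>z::real. \<bar>z\<bar> ^ k)"
  using integrable_abs[OF integrable_std_normal_power[of k]] by (simp add: power_abs)

lemma integrable_std_normal_abs [simp]: "integrable std_normal_distribution (\<lambda>z::real. \<bar>z\<bar>)"
  "integrable std_normal_distribution (\<lambda>z::real. z)"
  "integrable std_normal_distribution (\<lambda>z::real. z\<^sup>2)"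
  using integrable_std_normal_abs_power[of 1] integrable_std_normal_power[of 1]
    integrable_std_normal_power[of 2] by simp_all

lemma std_normal_mean [simp]: "(\<integral>z. z \<partial>std_normal_distribution) = 0"
  using integral_std_normal_distribution_moment_odd[of 1] by simp

lemma std_normal_second_moment [simp]: "(\<integral>z. z\<^sup>2 \<partial>std_normal_distribution) = 1"
  using std_normal_distribution_even_moments(1)[of 1] by simp

lemma integral_std_normal_minus:
  fixes f :: "real \<Rightarrow> real"
  assumes [measurable]: "f \<in> borel_measurable borel"
  shows "(\<integral>z. f (- z) \<partial>std_normal_distribution) = (\<integral>z. f z \<partial>std_normal_distribution)"
proof -
  have "(\<integral>z. f z \<partial>std_normal_distribution) = (\<integral>z. std_normal_density z *\<^sub>R f z \<partial>lborel)"
    by (subst integral_density) auto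
  also have "\<dots> = (\<integral>z. std_normal_density (- z) *\<^sub>R f (- z) \<partial>lborel)"
    by (subst lborel_integral_real_affine[of "-1" _ 0]) auto
  also have "\<dots> = (\<integral>z. f (- z) \<partial>std_normal_distribution)"
    by (subst integral_density) (auto simp: std_normal_density_def)
  finally show ?thesis by simp
qed

lemma distr_std_normal_scale:
  assumes "a > 0"
  shows "distr std_normal_distribution borel (\<lambda>z. sqrt a * z) = density lborel (normal_density 0 (sqrt a))"
proof -
  have d: "distributed std_normal_distribution lborel (\<lambda>z. z) (normal_density 0 1)"
    by (auto simp: distributed_def distr_id2)
  have "distributed std_normal_distribution lborel (\<lambda>z. 0 + sqrt a * z)
     (normal_density (0 + sqrt a * 0) (\<bar>sqrt a\<bar> * 1))"
    using assms by (intro std_normal.normal_density_affine d) auto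
  from distributed_distr_eq_density[OF this] assms
  have "distr std_normal_distribution lborel (\<lambda>z. sqrt a * z) = density lborel (normal_density 0 (sqrt a))"
    by simp
  moreover have "distr std_normal_distribution borel (\<lambda>z. sqrt a * z)
      = distr std_normal_distribution lborel (\<lambda>z. sqrt a * z)"
    by (rule distr_cong) auto
  ultimately show ?thesis by simp
qed

lemma integral_normal_density_std:
  fixes f :: "real \<Rightarrow> real"
  assumes "a > 0" and [measurable]: "f \<in> borel_measurable borel"
  shows "(\<integral>z. f z \<partial>density lborel (normal_density 0 (sqrt a)))
    = (\<integral>z. f (sqrt a * z) \<partial>std_normal_distribution)"
  unfolding distr_std_normal_scale[OF assms(1), symmetric] by (subst integral_distr) auto

lemma heat_0 [simp]: "heat 0 f y = f y"
  by (simp add: heat_def)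

lemma bounded_integrable_std_normal:
  fixes f :: "real \<Rightarrow> real"
  assumes "f \<in> borel_measurable borel" "\<And>v. \<bar>f v\<bar> \<le> K"
  shows "integrable std_normal_distribution f"
  using assms by (intro std_normal.integrable_const_bound[of _ K]) auto

lemma abs_heat_le:
  assumes [measurable]: "f \<in> borel_measurable borel" and "\<And>v. \<bar>f v\<bar> \<le> K"
  shows "\<bar>heat r f y\<bar> \<le> K"
proof -
  have i: "integrable std_normal_distribution (\<lambda>z. f (y + sqrt r * z))"
    by (intro bounded_integrable_std_normal[where K = K]) (auto intro: assms)
  have "\<bar>heat r f y\<bar> \<le> (\<integral>z. \<bar>f (y + sqrt r * z)\<bar> \<partial>std_normal_distribution)"
    unfolding heat_def by (rule integral_abs_bound)
  also have "\<dots> \<le> (\<integral>z. K \<partial>std_normal_distribution)"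
    using assms(2) by (intro integral_mono integrable_abs i) auto
  finally show ?thesis by simp
qed

lemma heat_measurable [measurable]:
  assumes [measurable]: "f \<in> borel_measurable borel" "r \<in> borel_measurable M" "y \<in> borel_measurable M"
  shows "(\<lambda>\<omega>. heat (r \<omega>) f (y \<omega>)) \<in> borel_measurable M"
  unfolding heat_def by measurable

text \<open>Variances of independent centred normal variables add, so this is the convolution of two
  normal densities. The cases \<open>a = 0\<close> and \<open>b = 0\<close> are split off because
  the degenerate law has no density; the bound \<open>K\<close> justifies Fubini.\<close>

lemma heat_heat:
  assumes [measurable]: "f \<in> borel_measurable borel" and bd: "\<And>v. \<bar>f v\<bar> \<le> K" and "0 \<le> a" "0 \<le> b"
  shows "heat a (heat b f) y = heat (a + b) f y"
proof (cases "a = 0 \<or> b = 0")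
  case True
  then show ?thesis
  proof
    assume "b = 0" then show ?thesis by (simp add: heat_def[of a] heat_def[of "a+b"])
  qed simp
next
  case False
  with assms have ab: "a > 0" "b > 0" by auto
  let ?N = "\<lambda>a. density lborel (\<lambda>z. ennreal (normal_density 0 (sqrt a) z))"
  interpret A: prob_space "?N a" using ab by (intro prob_space_normal_density) auto
  interpret B: prob_space "?N b" using ab by (intro prob_space_normal_density) auto
  interpret AB: pair_prob_space "?N a" "?N b" ..
  have conv: "?N a \<star> ?N b = ?N (a + b)"
    using ab
    by (subst convolution_density) (auto intro!: A.finite_measure B.finite_measure density_cong
        simp: ennreal_mult[symmetric] conv_normal_density_zero_mean[THEN fun_cong] A.finite_measure_axioms
          B.finite_measure_axioms)
  have "heat (a + b) f y = (\<integral>u. f (y + u) \<partial>(?N a \<star> ?N b))"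
    unfolding heat_def conv using ab by (subst integral_normal_density_std) auto
  also have "\<dots> = (\<integral>p. f (y + (fst p + snd p)) \<partial>(?N a \<Otimes>\<^sub>M ?N b))"
    unfolding convolution_def by (subst integral_distr) (auto simp: case_prod_beta)
  also have "\<dots> = (\<integral>u. (\<integral>v. f (y + (u + v)) \<partial>?N b) \<partial>?N a)"
    by (subst AB.integral_fst'[symmetric])
      (auto intro!: AB.P.integrable_const_bound[where B = K] bd simp: case_prod_beta)
  also have "\<dots> = heat a (heat b f) y"
    unfolding heat_def using ab
    by (subst integral_normal_density_std, simp, measurable)
      (subst integral_normal_density_std, simp, auto simp: add.assoc)
  finally show ?thesis by simp
qed

abbreviation (input) "abs_moment k \<equiv> (\<integral>z. \<bar>z\<bar> ^ k \<partial>std_normal_distribution) :: real"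

lemma abs_moment_nonneg: "0 \<le> abs_moment k"
  by simp

text \<open>The operator \<open>heat r\<close> is linear and does not increase uniform bounds. Hence
  an expansion that holds uniformly in space at time 0 holds at every later time \<open>r\<close>
  with the same error. It is used with \<open>g = heat s f\<close> and the semigroup
  property.\<close>

lemma heat_approx:
  assumes [measurable]: "f \<in> borel_measurable borel" "g \<in> borel_measurable borel" "k \<in> borel_measurable borel"
    and "\<And>v. \<bar>f v\<bar> \<le> K" "\<And>v. \<bar>g v\<bar> \<le> K" "\<And>v. \<bar>k v\<bar> \<le> K"
    and "\<And>v. \<bar>g v - f v - c * k v\<bar> \<le> e"
  shows "\<bar>heat r g y - heat r f y - c * heat r k y\<bar> \<le> e"
proof -
  have [simp]: "integrable std_normal_distribution (\<lambda>z. f (y + sqrt r * z))"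
    "integrable std_normal_distribution (\<lambda>z. g (y + sqrt r * z))"
    "integrable std_normal_distribution (\<lambda>z. k (y + sqrt r * z))"
    by (rule bounded_integrable_std_normal[where K = K], simp, rule assms)+
  have "heat r g y - heat r f y - c * heat r k y = heat r (\<lambda>v. g v - f v - c * k v) y"
    unfolding heat_def by simp
  then show ?thesis using abs_heat_le[of "\<lambda>v. g v - f v - c * k v" e r y] assms by simp
qed

lemma heat_lipschitz_space:
  assumes [measurable]: "f \<in> borel_measurable borel"
    and "\<And>v. \<bar>f v\<bar> \<le> K" "\<And>u v. \<bar>f u - f v\<bar> \<le> M * \<bar>u - v\<bar>"
  shows "\<bar>heat r f x - heat r f y\<bar> \<le> M * \<bar>x - y\<bar>"
proof -
  have [simp]: "integrable std_normal_distribution (\<lambda>z. f (y + sqrt r * z))" for y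
    by (rule bounded_integrable_std_normal[where K = K], simp, rule assms)
  have eq: "heat r f x - heat r f y = (\<integral>z. f (x + sqrt r * z) - f (y + sqrt r * z) \<partial>std_normal_distribution)"
    unfolding heat_def by simp
  have "\<bar>heat r f x - heat r f y\<bar> \<le> (\<integral>z. \<bar>f (x + sqrt r * z) - f (y + sqrt r * z)\<bar> \<partial>std_normal_distribution)"
    unfolding eq by (rule integral_abs_bound)
  also have "\<dots> \<le> (\<integral>z. M * \<bar>x - y\<bar> \<partial>std_normal_distribution)"
  proof (intro integral_mono)
    show "\<bar>f (x + sqrt r * z) - f (y + sqrt r * z)\<bar> \<le> M * \<bar>x - y\<bar>" for z
      using assms(3)[of "x + sqrt r * z" "y + sqrt r * z"] by simp
  qed auto
  finally show ?thesis by simp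
qed

text \<open>Only the case \<open>r = 0\<close> has content, and there
  \<open>f (y + sqrt s * z)\<close> differs from \<open>f y\<close> by at most
  \<open>M * sqrt s * \<bar>z\<bar>\<close>. The order \<open>sqrt s\<close> is what a mere
  Lipschitz condition gives, and a Lipschitz condition is all that will be known about second
  derivatives.\<close>

lemma heat_lipschitz_time:
  assumes [measurable]: "f \<in> borel_measurable borel"
    and bd: "\<And>v. \<bar>f v\<bar> \<le> K" and lip: "\<And>u v. \<bar>f u - f v\<bar> \<le> M * \<bar>u - v\<bar>" and "0 \<le> r" "0 \<le> s"
  shows "\<bar>heat (r + s) f y - heat r f y\<bar> \<le> M * abs_moment 1 * sqrt s"
proof -
  have small: "\<bar>heat s f v - f v\<bar> \<le> M * abs_moment 1 * sqrt s" for v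
  proof -
    have [simp]: "integrable std_normal_distribution (\<lambda>z. f (v + sqrt s * z))"
      by (rule bounded_integrable_std_normal[where K = K], simp, rule assms)
    have eq: "heat s f v - f v = (\<integral>z. f (v + sqrt s * z) - f v \<partial>std_normal_distribution)"
      unfolding heat_def by simp
    have "\<bar>heat s f v - f v\<bar> \<le> (\<integral>z. \<bar>f (v + sqrt s * z) - f v\<bar> \<partial>std_normal_distribution)"
      unfolding eq by (rule integral_abs_bound)
    also have "\<dots> \<le> (\<integral>z. M * (sqrt s * \<bar>z\<bar>) \<partial>std_normal_distribution)"
    proof (intro integral_mono)
      show "\<bar>f (v + sqrt s * z) - f v\<bar> \<le> M * (sqrt s * \<bar>z\<bar>)" for z
        using lip[of "v + sqrt s * z" v] \<open>0 \<le> s\<close> by (simp add: abs_mult)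
    qed auto
    finally show ?thesis by (simp add: mult_ac)
  qed
  have "\<bar>heat r (heat s f) y - heat r f y - 0 * heat r f y\<bar> \<le> M * abs_moment 1 * sqrt s"
    using abs_heat_le[OF assms(1) bd] bd small by (intro heat_approx[where K = K]) auto
  then show ?thesis using assms by (simp add: heat_heat[OF assms(1) bd])
qed

section \<open>Taylor expansion of the heat flow of a smooth function\<close>

lemma abs_add4_le:
  fixes a b c d :: real
  shows "\<bar>a\<bar> \<le> a' \<Longrightarrow> \<bar>b\<bar> \<le> b' \<Longrightarrow> \<bar>c\<bar> \<le> c' \<Longrightarrow> \<bar>d\<bar> \<le> d' \<Longrightarrow> \<bar>a + b + c + d\<bar> \<le> a' + b' + c' + d'"
  by linarith

lemma abs_sqrt_mult_cube: "0 \<le> h \<Longrightarrow> \<bar>sqrt h * z\<bar> ^ 3 = h * sqrt h * \<bar>z\<bar> ^ 3"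
proof -
  assume "0 \<le> h"
  then have "\<bar>sqrt h\<bar> ^ 3 = h * sqrt h" by (simp add: power3_eq_cube)
  then show ?thesis by (simp only: abs_mult power_mult_distrib)
qed

text \<open>A Lipschitz second derivative takes the place of a third derivative: the test functions
  are glued from pieces, and their second derivatives have kinks. A single constant \<open>K\<close>
  bounds everything, at the price of generous constants.\<close>

locale smooth_fun =
  fixes f f1 f2 :: "real \<Rightarrow> real" and K :: real
  assumes der0: "\<And>v. (f has_real_derivative f1 v) (at v)"
    and der1: "\<And>v. (f1 has_real_derivative f2 v) (at v)"
    and bound0: "\<And>v. \<bar>f v\<bar> \<le> K" and bound1: "\<And>v. \<bar>f1 v\<bar> \<le> K" and bound2: "\<And>v. \<bar>f2 v\<bar> \<le> K"
    and lip2: "\<And>u v. \<bar>f2 u - f2 v\<bar> \<le> K * \<bar>u - v\<bar>"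
begin

lemma K_nonneg: "0 \<le> K" using bound0[of 0] by linarith

lemma meas [measurable]: "f \<in> borel_measurable borel" "f1 \<in> borel_measurable borel"
  "f2 \<in> borel_measurable borel"
proof -
  have "continuous_on UNIV f" "continuous_on UNIV f1"
    using der0 der1 by (auto intro!: DERIV_continuous_on simp: has_field_derivative_at_within)
  moreover have "continuous_on UNIV f2"
  proof (rule continuous_on_eq_continuous_within[THEN iffD2], safe)
    fix x :: real
    have "((\<lambda>v. K * \<bar>v - x\<bar>) \<longlongrightarrow> K * \<bar>x - x\<bar>) (at x)" by (intro tendsto_intros)
    then have "((\<lambda>v. f2 v - f2 x) \<longlongrightarrow> 0) (at x)"
      by (intro tendsto_0_le[where K = 1 and g = "\<lambda>v. f2 v - f2 x" and f = "\<lambda>v. K * \<bar>v - x\<bar>"]) 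
        (auto intro!: always_eventually order_trans[OF lip2])
    then show "isCont f2 x" by (simp add: isCont_def LIM_zero_iff)
  qed
  ultimately show "f \<in> borel_measurable borel" "f1 \<in> borel_measurable borel"
    "f2 \<in> borel_measurable borel" by (auto intro: borel_measurable_continuous_onI)
qed

text \<open>Lagrange's form of the remainder gives \<open>f2\<close> at an intermediate point, and
  \<open>lip2\<close> moves it to \<open>v\<close>.\<close>

lemma taylor: "\<bar>f (v + w) - f v - w * f1 v - w\<^sup>2 / 2 * f2 v\<bar> \<le> K * \<bar>w\<bar> ^ 3"
proof (cases "w = 0")
  case False
  define D where "D = (\<lambda>m::nat. if m = 0 then f else if m = 1 then f1 else f2)"
  have "\<exists>t. (if v + w < v then v + w < t \<and> t < v else v < t \<and> t < v + w) \<and>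
      f (v + w) = (\<Sum>m<2. D m v / fact m * (v + w - v) ^ m) + D 2 t / fact 2 * (v + w - v) ^ 2"
    using False
    by (intro Taylor[where a = "min v (v + w)" and b = "max v (v + w)"])
      (auto simp: D_def less_2_cases_iff der0 der1)
  then obtain t where t: "\<bar>t - v\<bar> \<le> \<bar>w\<bar>"
    and eq: "f (v + w) = f v + f1 v * w + f2 t / 2 * w\<^sup>2"
    by (force simp: D_def numeral_2_eq_2 power2_eq_square split: if_splits)
  have "f (v + w) - f v - w * f1 v - w\<^sup>2 / 2 * f2 v = w\<^sup>2 / 2 * (f2 t - f2 v)"
    unfolding eq by (simp add: algebra_simps)
  then have "\<bar>f (v + w) - f v - w * f1 v - w\<^sup>2 / 2 * f2 v\<bar> = \<bar>w\<^sup>2 / 2 * (f2 t - f2 v)\<bar>"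
    by (rule arg_cong)
  also have "\<dots> = w\<^sup>2 / 2 * \<bar>f2 t - f2 v\<bar>"
    by (simp add: abs_mult)
  also have "\<dots> \<le> w\<^sup>2 / 2 * (K * \<bar>w\<bar>)"
    using lip2[of t v] t K_nonneg by (intro mult_left_mono order_trans[OF lip2] mult_left_mono) auto
  also have "\<dots> = K * \<bar>w\<bar> ^ 3 / 2"
    using power2_abs[of w] by (simp add: power3_eq_cube power2_eq_square)
  also have "\<dots> \<le> K * \<bar>w\<bar> ^ 3"
    using K_nonneg by simp
  finally show ?thesis .
qed (simp add: K_nonneg)

lemma lip0: "\<bar>f u - f v\<bar> \<le> K * \<bar>u - v\<bar>"
  using field_differentiable_bound[of UNIV f f1 K u v] der0 bound1 by auto

text \<open>Integrate \<open>taylor\<close> against the normal law: the first moment removes the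
  term in \<open>f1\<close>, the second moment 1 produces \<open>s / 2 * f2 v\<close>, and the third
  absolute moment bounds the rest.\<close>

lemma heat_small: assumes "0 \<le> s"
  shows "\<bar>heat s f v - f v - s / 2 * f2 v\<bar> \<le> K * abs_moment 3 * (s * sqrt s)"
proof -
  have [simp]: "integrable std_normal_distribution (\<lambda>z. f (v + sqrt s * z))"
    by (rule bounded_integrable_std_normal[where K = K], simp, rule bound0)
  have eq: "heat s f v - f v - s / 2 * f2 v =
      (\<integral>z. f (v + sqrt s * z) - f v - sqrt s * z * f1 v - (sqrt s * z)\<^sup>2 / 2 * f2 v \<partial>std_normal_distribution)"
    using assms unfolding heat_def by (simp add: power_mult_distrib)
  have "\<bar>heat s f v - f v - s / 2 * f2 v\<bar> \<le> (\<integral>z. \<bar>f (v + sqrt s * z) - f v - sqrt s * z * f1 v - (sqrt s * z)\<^sup>2 / 2 * f2 v\<bar>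
      \<partial>std_normal_distribution)"
    unfolding eq by (rule integral_abs_bound)
  also have "\<dots> \<le> (\<integral>z. K * (s * sqrt s) * \<bar>z\<bar> ^ 3 \<partial>std_normal_distribution)"
  proof (intro integral_mono)
    fix z :: real
    have "\<bar>sqrt s * z\<bar> ^ 3 = s * sqrt s * \<bar>z\<bar> ^ 3"
      using assms abs_sqrt_mult_cube by simp
    then show "\<bar>f (v + sqrt s * z) - f v - sqrt s * z * f1 v - (sqrt s * z)\<^sup>2 / 2 * f2 v\<bar>
        \<le> K * (s * sqrt s) * \<bar>z\<bar> ^ 3"
      using taylor[of v "sqrt s * z"] by (simp add: mult.assoc)
  qed (use assms in \<open>auto simp: power_mult_distrib\<close>)
  finally show ?thesis by (simp add: mult_ac)
qed

lemma heat_time_taylor: assumes "0 \<le> r" "0 \<le> s"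
  shows "\<bar>heat (r + s) f y - heat r f y - s / 2 * heat r f2 y\<bar> \<le> K * abs_moment 3 * (s * sqrt s)"
proof -
  have "\<bar>heat r (heat s f) y - heat r f y - s / 2 * heat r f2 y\<bar> \<le> K * abs_moment 3 * (s * sqrt s)"
    using abs_heat_le[OF meas(1) bound0] bound0 bound2 heat_small[OF assms(2)]
    by (intro heat_approx[where K = K]) auto
  then show ?thesis using assms by (simp add: heat_heat[OF meas(1) bound0])
qed

text \<open>The even terms of the two expansions around the same point cancel. The estimate compares
  the flow at a negative point with the flow at its mirror image, which is what happens when a path
  crosses 0 and the absolute value is taken.\<close>

lemma heat_reflection:
  assumes "0 \<le> v"
  shows "\<bar>heat r f v - heat r f (- v) - 2 * v * heat r f1 0\<bar> \<le> 2 * K * v ^ 3"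
proof -
  have [simp]: "integrable std_normal_distribution (\<lambda>z. f (y + sqrt r * z))"
    "integrable std_normal_distribution (\<lambda>z. f1 (sqrt r * z))" for y
    by (rule bounded_integrable_std_normal[where K = K], simp, rule bound0 bound1)+
  have eq: "heat r f v - heat r f (- v) - 2 * v * heat r f1 0 =
     (\<integral>z. f (v + sqrt r * z) - f (- v + sqrt r * z) - 2 * v * f1 (sqrt r * z) \<partial>std_normal_distribution)"
    unfolding heat_def by (simp del: uminus_add_conv_diff)
  have "\<bar>heat r f v - heat r f (- v) - 2 * v * heat r f1 0\<bar> \<le> (\<integral>z. \<bar>f (v + sqrt r * z) - f (- v + sqrt r * z) - 2 * v * f1 (sqrt r * z)\<bar>
      \<partial>std_normal_distribution)"
    unfolding eq by (rule integral_abs_bound)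
  also have "\<dots> \<le> (\<integral>z. 2 * K * v ^ 3 \<partial>std_normal_distribution)"
  proof (intro integral_mono)
    fix z :: real
    show "\<bar>f (v + sqrt r * z) - f (- v + sqrt r * z) - 2 * v * f1 (sqrt r * z)\<bar> \<le> 2 * K * v ^ 3"
      using taylor[of "sqrt r * z" v] taylor[of "sqrt r * z" "- v"] assms
      by (simp add: add.commute abs_le_iff algebra_simps)
  qed (auto simp del: uminus_add_conv_diff)
  finally show ?thesis by simp
qed

end

section \<open>Reflection at 0 and the mean increment of the absolute value\<close>

definition abs_drift :: "real \<Rightarrow> real \<Rightarrow> real" where
  "abs_drift h y = (\<integral>z. \<bar>y + sqrt h * z\<bar> \<partial>std_normal_distribution) - \<bar>y\<bar>"

lemma integral_abs_shift:
  fixes G :: "real \<Rightarrow> real"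
  assumes [measurable]: "G \<in> borel_measurable borel"
  shows "(\<integral>z. G \<bar>\<bar>b\<bar> + c * z\<bar> \<partial>std_normal_distribution) = (\<integral>z. G \<bar>b + c * z\<bar> \<partial>std_normal_distribution)"
proof (cases "b \<ge> 0")
  case False
  then have "(\<integral>z. G \<bar>b + c * z\<bar> \<partial>std_normal_distribution) = (\<integral>z. G \<bar>\<bar>b\<bar> + c * (- z)\<bar> \<partial>std_normal_distribution)"
    by (intro Bochner_Integration.integral_cong refl arg_cong[where f = G]) auto
  also have "\<dots> = (\<integral>z. G \<bar>\<bar>b\<bar> + c * z\<bar> \<partial>std_normal_distribution)"
    by (rule integral_std_normal_minus) auto
  finally show ?thesis by simp
qed simp

lemma abs_drift_measurable [measurable]:
  assumes [measurable]: "y \<in> borel_measurable M"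
  shows "(\<lambda>\<omega>. abs_drift h (y \<omega>)) \<in> borel_measurable M"
  unfolding abs_drift_def by measurable

text \<open>\<open>abs_drift h y\<close> is the mean increment of |B| over time \<open>h\<close>
  from the position \<open>y\<close>. Subtracting the term of mean zero \<open>sqrt h * z\<close>
  makes the integrand vanish unless the displacement carries \<open>\<bar>y\<bar>\<close> across 0,
  so the drift comes from crossings only.\<close>

lemma abs_drift_eq:
  "abs_drift h y = (\<integral>z. \<bar>\<bar>y\<bar> + sqrt h * z\<bar> - (\<bar>y\<bar> + sqrt h * z) \<partial>std_normal_distribution)"
proof -
  have [simp]: "integrable std_normal_distribution (\<lambda>z. \<bar>\<bar>y\<bar> + sqrt h * z\<bar>)"
    by (intro integrable_abs) simp
  show ?thesis
    using integral_abs_shift[of "\<lambda>x. x" y "sqrt h"] by (simp add: abs_drift_def)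
qed

text \<open>The integrand lives on crossings, where \<open>\<bar>y\<bar>\<close> is at most the
  displacement \<open>\<bar>sqrt h * z\<bar>\<close>. There the factor \<open>y\<^sup>2\<close> can
  be traded for a factor of order \<open>h\<close>. The bound expresses that local time is hardly
  produced when the cell starts away from 0.\<close>

lemma abs_drift_bounds:
  assumes "0 \<le> h"
  shows "0 \<le> abs_drift h y" "y\<^sup>2 * abs_drift h y \<le> 2 * abs_moment 3 * (h * sqrt h)"
proof -
  have [simp]: "integrable std_normal_distribution (\<lambda>z. \<bar>\<bar>y\<bar> + sqrt h * z\<bar>)"
    by (intro integrable_abs) simp
  show "0 \<le> abs_drift h y"
    unfolding abs_drift_eq by (intro Bochner_Integration.integral_nonneg) simp
  have "y\<^sup>2 * abs_drift h y = (\<integral>z. y\<^sup>2 * (\<bar>\<bar>y\<bar> + sqrt h * z\<bar> - (\<bar>y\<bar> + sqrt h * z)) \<partial>std_normal_distribution)"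
    unfolding abs_drift_eq by simp
  also have "\<dots> \<le> (\<integral>z. 2 * (h * sqrt h) * \<bar>z\<bar> ^ 3 \<partial>std_normal_distribution)"
  proof (intro integral_mono)
    fix z :: real
    let ?w = "\<bar>y\<bar> + sqrt h * z"
    have cube: "2 * (h * sqrt h) * \<bar>z\<bar> ^ 3 = 2 * \<bar>sqrt h * z\<bar> ^ 3"
      using abs_sqrt_mult_cube[OF assms, of z] by simp
    show "y\<^sup>2 * (\<bar>?w\<bar> - ?w) \<le> 2 * (h * sqrt h) * \<bar>z\<bar> ^ 3"
    proof (cases "?w \<ge> 0")
      case False
      then have "\<bar>y\<bar> \<le> \<bar>sqrt h * z\<bar>" "\<bar>?w\<bar> - ?w \<le> 2 * \<bar>sqrt h * z\<bar>" by auto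
      then have "\<bar>y\<bar>\<^sup>2 * (\<bar>?w\<bar> - ?w) \<le> \<bar>sqrt h * z\<bar>\<^sup>2 * (2 * \<bar>sqrt h * z\<bar>)"
        by (intro mult_mono power_mono) auto
      then show ?thesis unfolding cube by (simp add: power3_eq_cube power2_eq_square mult_ac)
    qed (use assms in auto)
  qed auto
  finally show "y\<^sup>2 * abs_drift h y \<le> 2 * abs_moment 3 * (h * sqrt h)" by (simp add: mult_ac)
qed

context smooth_fun
begin

text \<open>By the semigroup property, \<open>heat (r + h) f \<bar>y\<bar>\<close> is the mean of
  the flow at the unreflected point w = \<open>\<bar>y\<bar> + sqrt h * z\<close>. Reflecting
  changes the value only for w < 0, where \<open>heat_reflection\<close> gives the slope at 0 times
  |w| - w, and the mean of |w| - w is \<open>abs_drift h y\<close>.\<close>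

lemma heat_abs_step:
  assumes "0 \<le> r" "0 \<le> h"
  shows "\<bar>(\<integral>z. heat r f \<bar>y + sqrt h * z\<bar> \<partial>std_normal_distribution) - heat (r + h) f \<bar>y\<bar>
      - heat r f1 0 * abs_drift h y\<bar> \<le> 2 * K * abs_moment 3 * (h * sqrt h)"
proof -
  have [simp]: "integrable std_normal_distribution (\<lambda>z. heat r f (\<bar>y\<bar> + sqrt h * z))"
    "integrable std_normal_distribution (\<lambda>z. heat r f \<bar>\<bar>y\<bar> + sqrt h * z\<bar>)"
    by (rule bounded_integrable_std_normal[where K = K], simp, rule abs_heat_le[OF meas(1) bound0])+
  have [simp]: "integrable std_normal_distribution (\<lambda>z. \<bar>\<bar>y\<bar> + sqrt h * z\<bar>)"
    by (intro integrable_abs) simp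
  let ?w = "\<lambda>z. \<bar>y\<bar> + sqrt h * z"
  have sym: "(\<integral>z. heat r f \<bar>y + sqrt h * z\<bar> \<partial>std_normal_distribution)
      = (\<integral>z. heat r f \<bar>\<bar>y\<bar> + sqrt h * z\<bar> \<partial>std_normal_distribution)"
    by (rule integral_abs_shift[symmetric]) simp
  have eq: "(\<integral>z. heat r f \<bar>y + sqrt h * z\<bar> \<partial>std_normal_distribution) - heat (r + h) f \<bar>y\<bar>
      - heat r f1 0 * abs_drift h y
    = (\<integral>z. heat r f \<bar>?w z\<bar> - heat r f (?w z) - heat r f1 0 * (\<bar>?w z\<bar> - ?w z) \<partial>std_normal_distribution)"
    unfolding sym add.commute[of r h] heat_heat[OF meas(1) bound0 assms(2,1), symmetric] abs_drift_eq
    by (simp add: heat_def[of h])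
  have "\<bar>(\<integral>z. heat r f \<bar>y + sqrt h * z\<bar> \<partial>std_normal_distribution) - heat (r + h) f \<bar>y\<bar>
      - heat r f1 0 * abs_drift h y\<bar> \<le> (\<integral>z. \<bar>heat r f \<bar>?w z\<bar> - heat r f (?w z) - heat r f1 0 * (\<bar>?w z\<bar> - ?w z)\<bar>
      \<partial>std_normal_distribution)"
    unfolding eq by (rule integral_abs_bound)
  also have "\<dots> \<le> (\<integral>z. 2 * K * (h * sqrt h) * \<bar>z\<bar> ^ 3 \<partial>std_normal_distribution)"
  proof (intro integral_mono)
    fix z :: real
    have cube: "h * sqrt h * \<bar>z\<bar> ^ 3 = \<bar>sqrt h * z\<bar> ^ 3"
      using assms abs_sqrt_mult_cube by simp
    show "\<bar>heat r f \<bar>?w z\<bar> - heat r f (?w z) - heat r f1 0 * (\<bar>?w z\<bar> - ?w z)\<bar>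
        \<le> 2 * K * (h * sqrt h) * \<bar>z\<bar> ^ 3"
    proof (cases "?w z \<ge> 0")
      case False
      have "\<bar>heat r f \<bar>?w z\<bar> - heat r f (?w z) - heat r f1 0 * (\<bar>?w z\<bar> - ?w z)\<bar> \<le> 2 * K * (- ?w z) ^ 3"
        using heat_reflection[of "- ?w z" r] False by (simp add: algebra_simps)
      also have "\<dots> \<le> 2 * K * \<bar>sqrt h * z\<bar> ^ 3"
        using False K_nonneg by (intro mult_left_mono power_mono) auto
      finally show ?thesis unfolding cube[symmetric] by (simp add: mult_ac)
    qed (use assms K_nonneg in auto)
  qed auto
  finally show ?thesis by (simp add: mult_ac)
qed

end

text \<open>The heat flow preserves the oddness of \<open>f' - (\<gamma> / 2) f'' - \<beta> f\<close>, so it satisfies the elastic, sticky boundary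
  condition at \<open>0\<close> at all times.\<close>

locale boundary_fun = smooth_fun +
  fixes \<beta> \<gamma> :: real
  assumes \<beta>: "\<beta> > 0" and \<gamma>: "\<gamma> > 0"
    and odd_defect: "\<And>v. f1 (- v) - \<gamma> / 2 * f2 (- v) - \<beta> * f (- v) = - (f1 v - \<gamma> / 2 * f2 v - \<beta> * f v)"
begin

text \<open>At the point 0 the flow of the defect is the integral of an odd function against a
  symmetric law.\<close>

lemma heat_boundary: "heat r f1 0 = \<gamma> / 2 * heat r f2 0 + \<beta> * heat r f 0"
proof -
  have [simp]: "integrable std_normal_distribution (\<lambda>z. f (sqrt r * z))"
    "integrable std_normal_distribution (\<lambda>z. f1 (sqrt r * z))"
    "integrable std_normal_distribution (\<lambda>z. f2 (sqrt r * z))"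
    by (rule bounded_integrable_std_normal[where K = K], simp, rule bound0 bound1 bound2)+
  let ?D = "\<lambda>v. f1 v - \<gamma> / 2 * f2 v - \<beta> * f v"
  have "(\<integral>z. ?D (sqrt r * z) \<partial>std_normal_distribution) = (\<integral>z. ?D (sqrt r * (- z)) \<partial>std_normal_distribution)"
    by (rule integral_std_normal_minus[symmetric]) simp
  also have "\<dots> = (\<integral>z. - ?D (sqrt r * z) \<partial>std_normal_distribution)"
    using odd_defect by (intro Bochner_Integration.integral_cong) auto
  also have "\<dots> = - (\<integral>z. ?D (sqrt r * z) \<partial>std_normal_distribution)"
    by (rule Bochner_Integration.integral_minus)
  finally have "(\<integral>z. ?D (sqrt r * z) \<partial>std_normal_distribution) = 0" by linarith
  then show ?thesis by (simp add: heat_def)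
qed

text \<open>A local time increment \<open>d\<close> shortens the remaining time by
  \<open>\<gamma> * d\<close> and multiplies the weight by \<open>exp (- \<beta> * d)\<close>. To
  first order in \<open>d\<close> the change is - d times (\<gamma> / 2) f'' + \<beta> f, and after
  transport to the point 0 this is \<open>- d * heat \<rho> f1 0\<close> by
  \<open>heat_boundary\<close>. The error has to be \<open>d\<close> times something small, because
  the sum of all \<open>d\<close> does not shrink with the mesh. The truncations at 1 keep the error
  integrable against the increments of \<open>L\<close>.\<close>

lemma heat_step:
  assumes "\<epsilon> > 0"
  obtains C where "C \<ge> 0" "\<And>\<rho> d y. \<epsilon> \<le> \<rho> \<Longrightarrow> 0 \<le> d \<Longrightarrow> 0 \<le> y \<Longrightarrow>
    \<bar>heat (max 0 (\<rho> - \<gamma> * d)) f y * exp (- \<beta> * d) - heat \<rho> f y + d * heat \<rho> f1 0\<bar>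
      \<le> C * d * (min 1 (sqrt d) + min 1 y)"
proof -
  \<comment> \<open>\<open>c\<close> is chosen such that
    \<open>sqrt d \<le> c * min 1 (sqrt d)\<close> as long as
    \<open>\<gamma> * d < \<epsilon>\<close>. In the opposite case \<open>m\<close> is a lower bound
    of \<open>min 1 (sqrt d)\<close>, so that dividing by \<open>m\<close> creates the small factor
    out of nothing. \<open>C1\<close> collects the Taylor errors of the first case,
    \<open>C2\<close> the crude bounds of the second.\<close>
  define c where "c = max 1 (sqrt (\<epsilon> / \<gamma>))"
  define C1 where "C1 = K * abs_moment 3 * \<gamma> * (sqrt \<gamma> * c) + \<gamma> / 2 * (K * abs_moment 1 * (sqrt \<gamma> * c) + 2 * K)
    + K * \<beta>\<^sup>2 * c\<^sup>2 + \<beta> * (2 * K + K * abs_moment 1 * (sqrt \<gamma> * c))"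
  define C2 where "C2 = 2 * K * \<gamma> / \<epsilon> + \<gamma> / 2 * K + \<beta> * K"
  define m where "m = min 1 (sqrt (\<epsilon> / \<gamma>))"
  have c: "c \<ge> 1" and m: "m > 0" using assms \<gamma> by (auto simp: c_def m_def)
  have C1: "C1 \<ge> 0" and C2: "C2 \<ge> 0"
    unfolding C1_def C2_def using K_nonneg \<beta> \<gamma> assms c
    by (auto intro!: add_nonneg_nonneg mult_nonneg_nonneg divide_nonneg_nonneg)
  note bd0 = abs_heat_le[OF meas(1) bound0] and bd2 = abs_heat_le[OF meas(3) bound2]
  have "\<bar>heat (max 0 (\<rho> - \<gamma> * d)) f y * exp (- \<beta> * d) - heat \<rho> f y + d * heat \<rho> f1 0\<bar>
      \<le> (C1 + C2 / m) * d * (min 1 (sqrt d) + min 1 y)"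
    if \<rho>: "\<epsilon> \<le> \<rho>" and d: "0 \<le> d" and y: "0 \<le> y" for \<rho> d y
  proof (cases "\<gamma> * d < \<epsilon>")
    case True
    define s where "s = \<gamma> * d"
    define r where "r = \<rho> - s"
    define \<mu> where "\<mu> = min 1 (sqrt d)"
    define k where "k = min 1 y"
    have rs: "0 \<le> r" "0 \<le> s" "\<rho> = r + s" "max 0 (\<rho> - \<gamma> * d) = r"
      using True \<rho> d \<gamma> by (auto simp: r_def s_def)
    have \<mu>: "0 \<le> \<mu>" "0 \<le> k" using d y by (auto simp: \<mu>_def k_def)
    have "d \<le> \<epsilon> / \<gamma>" using True \<gamma> by (simp add: field_simps)
    then have "sqrt d \<le> c" by (auto simp: c_def intro: order_trans[OF real_sqrt_le_mono] max.cobounded2)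
    then have sd: "sqrt d \<le> c * \<mu>"
      using c d by (auto simp: \<mu>_def min_def intro: order_trans[OF _ mult_right_mono[of 1 c]])
    have ss: "sqrt s \<le> sqrt \<gamma> * c * \<mu>"
      unfolding s_def real_sqrt_mult mult.assoc using sd \<gamma> by (intro mult_left_mono) auto
    have dd: "d \<le> c\<^sup>2 * \<mu>"
    proof -
      have "d = sqrt d * sqrt d" using d by simp
      also have "\<dots> \<le> c * (c * \<mu>)" using sd \<open>sqrt d \<le> c\<close> c d by (intro mult_mono) auto
      finally show ?thesis by (simp add: power2_eq_square mult.assoc)
    qed
    have min_bound: "\<bar>heat \<rho> g y - heat \<rho> g 0\<bar> \<le> 2 * K * k"
      if "\<bar>heat \<rho> g y\<bar> \<le> K" "\<bar>heat \<rho> g 0\<bar> \<le> K" "\<bar>heat \<rho> g y - heat \<rho> g 0\<bar> \<le> K * \<bar>y - 0\<bar>" for g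
      using that y K_nonneg by (auto simp: k_def min_def mult_right_mono intro: order_trans[of _ "K * y"])
    have t1: "\<bar>heat \<rho> f y - heat r f y - s / 2 * heat r f2 y\<bar> \<le> K * abs_moment 3 * (s * sqrt s)"
      using heat_time_taylor[OF rs(1,2)] rs(3) by simp
    have t2: "\<bar>heat \<rho> f2 y - heat r f2 y\<bar> \<le> K * abs_moment 1 * sqrt s"
      using heat_lipschitz_time[OF meas(3) bound2 lip2 rs(1,2)] rs(3) by simp
    have t3: "\<bar>heat \<rho> f2 y - heat \<rho> f2 0\<bar> \<le> 2 * K * k"
      by (intro min_bound bd2 heat_lipschitz_space[OF meas(3) bound2 lip2])
    have t4: "\<bar>heat \<rho> f y - heat r f y\<bar> \<le> K * abs_moment 1 * sqrt s"
      using heat_lipschitz_time[OF meas(1) bound0 lip0 rs(1,2)] rs(3) by simp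
    have t5: "\<bar>heat \<rho> f y - heat \<rho> f 0\<bar> \<le> 2 * K * k"
      by (intro min_bound bd0 heat_lipschitz_space[OF meas(1) bound0 lip0])
    have t6: "\<bar>exp (- \<beta> * d) - 1 + \<beta> * d\<bar> \<le> (\<beta> * d)\<^sup>2"
    proof -
      have a: "0 \<le> \<beta> * d" using \<beta> d by simp
      have "1 - \<beta> * d \<le> exp (- (\<beta> * d))" using exp_ge_add_one_self[of "- (\<beta> * d)"] by simp
      moreover have "exp (- (\<beta> * d)) \<le> 1 - \<beta> * d + (\<beta> * d)\<^sup>2"
      proof -
        have "exp (- (\<beta> * d)) \<le> 1 / (1 + \<beta> * d)"
          using a by (simp add: exp_minus field_simps add_pos_nonneg)
        also have "\<dots> \<le> 1 - \<beta> * d + (\<beta> * d)\<^sup>2"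
        proof -
          have "1 + 0 \<le> 1 + (\<beta> * d) ^ 3"
            using a by (intro add_left_mono zero_le_power)
          also have "\<dots> = (1 - \<beta> * d + (\<beta> * d)\<^sup>2) * (1 + \<beta> * d)"
            by (simp add: algebra_simps power2_eq_square power3_eq_cube)
          finally show ?thesis using a by (subst pos_divide_le_eq) auto
        qed
        finally show ?thesis .
      qed
      ultimately show ?thesis by simp
    qed
    \<comment> \<open>With \<open>f2\<close> and \<open>f\<close> moved to time
      \<open>\<rho>\<close> and position 0, the two linear terms add up to \<open>d * (\<gamma> / 2
      * heat \<rho> f2 0 + \<beta> * heat \<rho> f 0)\<close>, which is
      \<open>d * heat \<rho> f1 0\<close>. All that is left are a time expansion, differences in
      time and space, and the second order term of the exponential.\<close>
    have decomp: "heat (max 0 (\<rho> - \<gamma> * d)) f y * exp (- \<beta> * d) - heat \<rho> f y + d * heat \<rho> f1 0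
      = - (heat \<rho> f y - heat r f y - s / 2 * heat r f2 y)
        + s / 2 * ((heat \<rho> f2 y - heat r f2 y) - (heat \<rho> f2 y - heat \<rho> f2 0))
        + heat r f y * (exp (- \<beta> * d) - 1 + \<beta> * d)
        + \<beta> * d * ((heat \<rho> f y - heat r f y) - (heat \<rho> f y - heat \<rho> f 0))"
      unfolding rs(4) heat_boundary by (simp add: s_def algebra_simps)
    have "\<bar>s / 2 * ((heat \<rho> f2 y - heat r f2 y) - (heat \<rho> f2 y - heat \<rho> f2 0))\<bar>
        \<le> s / 2 * (\<bar>heat \<rho> f2 y - heat r f2 y\<bar> + \<bar>heat \<rho> f2 y - heat \<rho> f2 0\<bar>)"
      unfolding abs_mult using rs by (intro mult_mono abs_triangle_ineq4) auto
    moreover have "\<bar>\<beta> * d * ((heat \<rho> f y - heat r f y) - (heat \<rho> f y - heat \<rho> f 0))\<bar>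
        \<le> \<beta> * d * (\<bar>heat \<rho> f y - heat r f y\<bar> + \<bar>heat \<rho> f y - heat \<rho> f 0\<bar>)"
      unfolding abs_mult using \<beta> d by (intro mult_mono abs_triangle_ineq4) auto
    ultimately have "\<bar>heat (max 0 (\<rho> - \<gamma> * d)) f y * exp (- \<beta> * d) - heat \<rho> f y + d * heat \<rho> f1 0\<bar>
      \<le> \<bar>- (heat \<rho> f y - heat r f y - s / 2 * heat r f2 y)\<bar>
        + s / 2 * (\<bar>heat \<rho> f2 y - heat r f2 y\<bar> + \<bar>heat \<rho> f2 y - heat \<rho> f2 0\<bar>)
        + \<bar>heat r f y\<bar> * \<bar>exp (- \<beta> * d) - 1 + \<beta> * d\<bar>
        + \<beta> * d * (\<bar>heat \<rho> f y - heat r f y\<bar> + \<bar>heat \<rho> f y - heat \<rho> f 0\<bar>)"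
      unfolding decomp by (intro abs_add4_le order_refl eq_refl[OF abs_mult])
    also have "\<dots> \<le> K * abs_moment 3 * (s * (sqrt \<gamma> * c * \<mu>))
        + s / 2 * (K * abs_moment 1 * (sqrt \<gamma> * c * \<mu>) + 2 * K * k)
        + K * (\<beta>\<^sup>2 * d * (c\<^sup>2 * \<mu>))
        + \<beta> * d * (K * abs_moment 1 * (sqrt \<gamma> * c * \<mu>) + 2 * K * k)"
    proof (intro add_mono mult_left_mono)
      show "\<bar>- (heat \<rho> f y - heat r f y - s / 2 * heat r f2 y)\<bar> \<le> K * abs_moment 3 * (s * (sqrt \<gamma> * c * \<mu>))"
        unfolding abs_minus_cancel using rs K_nonneg ss by (intro order_trans[OF t1] mult_left_mono) auto
      show "\<bar>heat \<rho> f2 y - heat r f2 y\<bar> \<le> K * abs_moment 1 * (sqrt \<gamma> * c * \<mu>)"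
        using K_nonneg ss by (intro order_trans[OF t2] mult_left_mono) auto
      show "\<bar>heat \<rho> f y - heat r f y\<bar> \<le> K * abs_moment 1 * (sqrt \<gamma> * c * \<mu>)"
        using K_nonneg ss by (intro order_trans[OF t4] mult_left_mono) auto
      have "(\<beta> * d)\<^sup>2 \<le> \<beta>\<^sup>2 * d * (c\<^sup>2 * \<mu>)"
        using dd d by (simp add: power_mult_distrib power2_eq_square[of d] mult.assoc mult_left_mono)
      with t6 show "\<bar>heat r f y\<bar> * \<bar>exp (- \<beta> * d) - 1 + \<beta> * d\<bar> \<le> K * (\<beta>\<^sup>2 * d * (c\<^sup>2 * \<mu>))"
        using K_nonneg by (intro mult_mono bd0) auto
    qed (use t3 t5 rs \<beta> d in auto)
    also have "\<dots> \<le> C1 * d * (\<mu> + k)"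
    proof -
      have "C1 * d * (\<mu> + k) - (K * abs_moment 3 * (s * (sqrt \<gamma> * c * \<mu>))
        + s / 2 * (K * abs_moment 1 * (sqrt \<gamma> * c * \<mu>) + 2 * K * k)
        + K * (\<beta>\<^sup>2 * d * (c\<^sup>2 * \<mu>))
        + \<beta> * d * (K * abs_moment 1 * (sqrt \<gamma> * c * \<mu>) + 2 * K * k))
       = d * (k * (K * abs_moment 3 * \<gamma> * (sqrt \<gamma> * c) + \<gamma> / 2 * (K * abs_moment 1 * (sqrt \<gamma> * c))
          + K * \<beta>\<^sup>2 * c\<^sup>2 + \<beta> * (K * abs_moment 1 * (sqrt \<gamma> * c))) + \<mu> * (\<gamma> * K + 2 * \<beta> * K))"
        by (simp add: C1_def s_def algebra_simps)
      also have "\<dots> \<ge> 0"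
        using d \<mu> K_nonneg \<beta> \<gamma> c abs_moment_nonneg[of 3] abs_moment_nonneg[of 1]
        by (intro mult_nonneg_nonneg add_nonneg_nonneg) auto
      finally show ?thesis by linarith
    qed
    also have "\<dots> \<le> (C1 + C2 / m) * d * (\<mu> + k)"
      using C2 m d \<mu> by (intro mult_right_mono) auto
    finally show ?thesis by (simp add: \<mu>_def k_def)
  next
    case False
    then have big: "\<epsilon> \<le> \<gamma> * d" by simp
    have "\<bar>heat (max 0 (\<rho> - \<gamma> * d)) f y * exp (- \<beta> * d) - heat \<rho> f y + d * heat \<rho> f1 0\<bar>
      \<le> K * 1 + K + d * (\<gamma> / 2 * K + \<beta> * K)"
    proof -
      have "\<bar>heat (max 0 (\<rho> - \<gamma> * d)) f y * exp (- \<beta> * d)\<bar> \<le> K * 1"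
        unfolding abs_mult using \<beta> d K_nonneg by (intro mult_mono bd0) auto
      moreover have "\<bar>d * heat \<rho> f1 0\<bar> \<le> d * (\<gamma> / 2 * K + \<beta> * K)"
      proof -
        have "\<bar>heat \<rho> f1 0\<bar> \<le> \<bar>\<gamma> / 2 * heat \<rho> f2 0\<bar> + \<bar>\<beta> * heat \<rho> f 0\<bar>"
          unfolding heat_boundary by (rule abs_triangle_ineq)
        also have "\<dots> \<le> \<gamma> / 2 * K + \<beta> * K"
          unfolding abs_mult using bd0[of \<rho> 0] bd2[of \<rho> 0] \<beta> \<gamma> by (intro add_mono mult_mono) auto
        finally show ?thesis unfolding abs_mult using d by (intro mult_mono) auto
      qed
      ultimately show ?thesis using bd0[of \<rho> y] by linarith
    qed
    also have "\<dots> \<le> C2 * d"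
    proof -
      \<comment> \<open>For \<open>\<epsilon> \<le> \<gamma> * d\<close> a constant is at most a
        multiple of \<open>d\<close>, which is how a large increment is absorbed.\<close>
      have "2 * K * 1 \<le> 2 * K * (\<gamma> * d / \<epsilon>)"
        using big assms K_nonneg by (intro mult_left_mono) auto
      then show ?thesis by (simp add: C2_def algebra_simps)
    qed
    also have "\<dots> = C2 / m * d * m" using m by simp
    also have "\<dots> \<le> (C1 + C2 / m) * d * (min 1 (sqrt d) + min 1 y)"
    proof (intro mult_mono)
      have "\<epsilon> / \<gamma> \<le> d" using big \<gamma> by (simp add: field_simps)
      then have "m \<le> min 1 (sqrt d)" unfolding m_def by (intro min.mono real_sqrt_le_mono) auto
      then show "m \<le> min 1 (sqrt d) + min 1 y" using y by auto
    qed (use C1 C2 m d in auto)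
    finally show ?thesis .
  qed
  then show thesis using C1 C2 m by (intro that[of "C1 + C2 / m"]) auto
qed

end

section \<open>Stochastic integrals and the compensator of the local time\<close>

text \<open>Rounding the time down to multiples of 1 / (n + 1) leaves countably many values, so
  every approximation is jointly measurable, and continuity of the paths gives the limit. Negative
  times, about which nothing is assumed, are sent to 0 by \<open>max 0\<close>.\<close>

lemma process_jointly_measurable:
  fixes X :: "real \<Rightarrow> 'b \<Rightarrow> real"
  assumes meas: "\<And>t. 0 \<le> t \<Longrightarrow> X t \<in> borel_measurable M"
    and cont: "\<And>\<omega>. \<omega> \<in> space M \<Longrightarrow> continuous_on {0..} (\<lambda>t. X t \<omega>)"
  shows "(\<lambda>(\<omega>, s). X (max 0 s) \<omega>) \<in> borel_measurable (M \<Otimes>\<^sub>M borel)"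
proof (rule borel_measurable_LIMSEQ_real)
  define g where "g = (\<lambda>n (s::real). nat \<lfloor>real (Suc n) * max 0 s\<rfloor>)"
  show "(\<lambda>p. X (real (g n (snd p)) / real (Suc n)) (fst p)) \<in> borel_measurable (M \<Otimes>\<^sub>M borel)" for n
  proof (rule measurable_compose_countable[where g = "\<lambda>p. g n (snd p)"])
    show "(\<lambda>p. X (real i / real (Suc n)) (fst p)) \<in> borel_measurable (M \<Otimes>\<^sub>M borel)" for i
      by (intro measurable_compose[OF measurable_fst meas]) simp
    show "(\<lambda>p. g n (snd p)) \<in> measurable (M \<Otimes>\<^sub>M borel) (count_space UNIV)"
      unfolding g_def by measurable
  qed
  fix p assume p: "p \<in> space (M \<Otimes>\<^sub>M (borel :: real measure))"
  define s where "s = max 0 (snd p)"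
  have lim: "(\<lambda>n. real (g n (snd p)) / real (Suc n)) \<longlonglongrightarrow> s"
  proof (rule tendsto_sandwich)
    show "\<forall>\<^sub>F n in sequentially. s - 1 / real (Suc n) \<le> real (g n (snd p)) / real (Suc n)"
    proof (rule always_eventually, safe)
      fix n
      have "real (Suc n) * s - 1 \<le> real (g n (snd p))"
        unfolding g_def s_def[symmetric] by linarith
      then have "(real (Suc n) * s - 1) / real (Suc n) \<le> real (g n (snd p)) / real (Suc n)"
        by (rule divide_right_mono) simp
      then show "s - 1 / real (Suc n) \<le> real (g n (snd p)) / real (Suc n)"
        by (simp add: diff_divide_distrib del: of_nat_Suc)
    qed
    show "\<forall>\<^sub>F n in sequentially. real (g n (snd p)) / real (Suc n) \<le> s"
    proof (rule always_eventually, safe)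
      fix n
      have "0 \<le> real (Suc n) * s" by (simp add: s_def)
      then have "real (g n (snd p)) \<le> real (Suc n) * s"
        unfolding g_def s_def[symmetric] by linarith
      then show "real (g n (snd p)) / real (Suc n) \<le> s"
        by (simp add: pos_divide_le_eq mult.commute del: of_nat_Suc)
    qed
    show "(\<lambda>n. s - 1 / real (Suc n)) \<longlonglongrightarrow> s"
      using tendsto_diff[OF tendsto_const LIMSEQ_inverse_real_of_nat, of s] by (simp add: inverse_eq_divide)
  qed simp
  have "((\<lambda>t. X t (fst p)) \<longlongrightarrow> X s (fst p)) (at s within {0..})"
    using cont[of "fst p"] p by (auto simp: continuous_on_def s_def space_pair_measure)
  then have "(\<lambda>n. X (real (g n (snd p)) / real (Suc n)) (fst p)) \<longlonglongrightarrow> X s (fst p)"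
    using cont[of "fst p"] p lim
    by (intro continuous_on_tendsto_compose[of "{0..}" "\<lambda>t. X t (fst p)"])
       (auto simp: s_def space_pair_measure)
  then show "(\<lambda>n. X (real (g n (snd p)) / real (Suc n)) (fst p)) \<longlonglongrightarrow> (case p of (\<omega>, s) \<Rightarrow> X (max 0 s) \<omega>)"
    by (simp add: s_def case_prod_beta)
qed

section \<open>Independence of Brownian increments\<close>

context brownian_family
begin

lemma space_P [simp]: "space (P x) = space A"
  using sets_P sets_eq_imp_space_eq by blast

lemma space_F [simp]: "0 \<le> t \<Longrightarrow> space (F t) = space A"
  using filtration_sub by (simp add: subalgebra_def)

lemma sets_P_cong [measurable_cong]: "sets (P x) = sets A"
  by (rule sets_P)

lemma measurable_F_A: "0 \<le> t \<Longrightarrow> f \<in> measurable (F t) N \<Longrightarrow> f \<in> measurable A N"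
  using measurable_from_subalg[OF filtration_sub] .

lemma measurable_F_P: "0 \<le> t \<Longrightarrow> f \<in> measurable (F t) N \<Longrightarrow> f \<in> measurable (P x) N"
  using measurable_F_A measurable_cong_sets[OF sets_P refl] by blast

lemma measurable_F_mono: "0 \<le> s \<Longrightarrow> s \<le> t \<Longrightarrow> f \<in> measurable (F s) N \<Longrightarrow> f \<in> measurable (F t) N"
  using filtration_mono[of s t] by (auto simp: measurable_def)

lemma B_measurable_F: "0 \<le> s \<Longrightarrow> s \<le> t \<Longrightarrow> B s \<in> borel_measurable (F t)"
  using B_adapted measurable_F_mono by blast

lemma B_measurable_A [measurable]: "0 \<le> t \<Longrightarrow> B t \<in> borel_measurable A"
  using B_adapted measurable_F_A by blast

lemma B_measurable_P [measurable]: "0 \<le> t \<Longrightarrow> B t \<in> borel_measurable (P x)"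
  using B_adapted measurable_F_P by blast

text \<open>The increment is independent of \<open>F s\<close>, so the pair of the outcome seen
  through \<open>F s\<close> and the increment has a product law, and the increment may be replaced
  by an independent normal variable with the past held fixed. This serves as the conditional
  expectation given \<open>F s\<close> throughout. The majorant \<open>1 + d\<^sup>2\<close> is
  integrable under the normal law.\<close>

lemma freeze_increment:
  fixes \<Phi> :: "'a \<times> real \<Rightarrow> real"
  assumes st: "0 \<le> s" "s \<le> t"
    and \<Phi>[measurable]: "\<Phi> \<in> borel_measurable (F s \<Otimes>\<^sub>M borel)"
    and Z[measurable]: "Z \<in> borel_measurable (F s)" and Zint: "integrable (P x) Z"
    and bd: "\<And>\<omega> d. \<omega> \<in> space A \<Longrightarrow> \<bar>\<Phi> (\<omega>, d)\<bar> \<le> Z \<omega> * (1 + d\<^sup>2)"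
  shows "integrable (P x) (\<lambda>\<omega>. \<Phi> (\<omega>, B t \<omega> - B s \<omega>))"
    and "(\<integral>\<omega>. \<Phi> (\<omega>, B t \<omega> - B s \<omega>) \<partial>P x)
      = (\<integral>\<omega>. (\<integral>z. \<Phi> (\<omega>, sqrt (t - s) * z) \<partial>std_normal_distribution) \<partial>P x)"
proof -
  interpret Q: prob_space "P x" by (rule prob_P)
  have ZP[measurable]: "Z \<in> borel_measurable (P x)" by (rule measurable_F_P[OF st(1) Z])
  have t: "0 \<le> t" using st by simp
  \<comment> \<open>The image of \<open>P x\<close> under the identity into \<open>F s\<close> is
    the restriction of \<open>P x\<close> to that smaller sigma-algebra.\<close>
  have id[measurable]: "(\<lambda>\<omega>. \<omega>) \<in> measurable (P x) (F s)"
    by (rule measurable_F_P[OF st(1)]) simp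
  let ?N = "distr std_normal_distribution borel (\<lambda>z. sqrt (t - s) * z)"
  let ?\<Delta> = "\<lambda>\<omega>. B t \<omega> - B s \<omega>"
  have \<Delta>[measurable]: "?\<Delta> \<in> borel_measurable (P x)" using st t by simp
  interpret D: prob_space "distr (P x) (F s) (\<lambda>\<omega>. \<omega>)" by (rule Q.prob_space_distr) simp
  interpret N: prob_space ?N by (rule std_normal.prob_space_distr) simp
  interpret PP: pair_prob_space "distr (P x) (F s) (\<lambda>\<omega>. \<omega>)" ?N ..
  have joint: "distr (P x) (F s) (\<lambda>\<omega>. \<omega>) \<Otimes>\<^sub>M ?N = distr (P x) (F s \<Otimes>\<^sub>M borel) (\<lambda>\<omega>. (\<omega>, ?\<Delta> \<omega>))"
  proof (rule pair_measure_eqI[OF D.sigma_finite_measure_axioms N.sigma_finite_measure_axioms])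
    fix U V assume "U \<in> sets (distr (P x) (F s) (\<lambda>\<omega>. \<omega>))" "V \<in> sets ?N"
    then have U[measurable]: "U \<in> sets (F s)" and V[measurable]: "V \<in> sets borel" by auto
    have UA: "U \<inter> space A = U" using sets.sets_into_space[OF U] st by auto
    have eU: "emeasure (distr (P x) (F s) (\<lambda>\<omega>. \<omega>)) U = emeasure (P x) U"
      using UA by (subst emeasure_distr) (auto simp: vimage_def Int_def)
    have "emeasure (distr (P x) (F s \<Otimes>\<^sub>M borel) (\<lambda>\<omega>. (\<omega>, ?\<Delta> \<omega>))) (U \<times> V)
        = emeasure (P x) ((\<lambda>\<omega>. (\<omega>, ?\<Delta> \<omega>)) -` (U \<times> V) \<inter> space (P x))"
      by (rule emeasure_distr) auto
    also have "(\<lambda>\<omega>. (\<omega>, ?\<Delta> \<omega>)) -` (U \<times> V) \<inter> space (P x) = U \<inter> (?\<Delta> -` V \<inter> space A)"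
      using UA by auto
    finally have lhs: "emeasure (distr (P x) (F s \<Otimes>\<^sub>M borel) (\<lambda>\<omega>. (\<omega>, ?\<Delta> \<omega>))) (U \<times> V)
        = emeasure (P x) (U \<inter> (?\<Delta> -` V \<inter> space A))" .
    have "emeasure (P x) (U \<inter> (?\<Delta> -` V \<inter> space A)) = emeasure (P x) U * emeasure ?N V"
    \<comment> \<open>For \<open>s = t\<close> the increment is 0 and the normal law has no density.
      Writing \<open>?N\<close> as the image of the standard normal law covers this case, where it
      is the point mass at 0.\<close>
    proof (cases "s = t")
      case True
      have "emeasure ?N V = emeasure std_normal_distribution (if 0 \<in> V then UNIV else {})"
        using True by (subst emeasure_distr) (auto simp: vimage_def)
      then show ?thesis using True std_normal.emeasure_space_1 UA by (auto simp: vimage_def Int_def)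
    next
      case False
      with st have lt: "s < t" by simp
      have "distr (P x) borel ?\<Delta> = distr (P x) lborel ?\<Delta>" by (rule distr_cong) auto
      also have "\<dots> = density lborel (normal_density 0 (sqrt (t - s)))"
        by (rule distributed_distr_eq_density[OF B_increment_normal[OF st(1) lt]])
      finally have dN: "distr (P x) borel ?\<Delta> = ?N" using lt by (subst distr_std_normal_scale) auto
      have "?\<Delta> -` V \<inter> space A \<in> sets (vimage_algebra (space A) ?\<Delta> borel)"
        by (rule in_vimage_algebra[OF V])
      then have "Q.prob (U \<inter> (?\<Delta> -` V \<inter> space A)) = Q.prob U * Q.prob (?\<Delta> -` V \<inter> space A)"
        by (intro Q.indep_setD[OF B_increment_indep[OF st(1) lt]] U)
      moreover have "emeasure (P x) (?\<Delta> -` V \<inter> space A) = emeasure ?N V"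
        unfolding dN[symmetric] by (subst emeasure_distr) auto
      ultimately show ?thesis by (simp add: Q.emeasure_eq_measure ennreal_mult' N.emeasure_eq_measure)
    qed
    then show "emeasure (distr (P x) (F s) (\<lambda>\<omega>. \<omega>)) U * emeasure ?N V
         = emeasure (distr (P x) (F s \<Otimes>\<^sub>M borel) (\<lambda>\<omega>. (\<omega>, ?\<Delta> \<omega>))) (U \<times> V)"
      using lhs eU by simp
  qed auto
  have sp: "\<omega> \<in> space A" if "\<omega> \<in> space (distr (P x) (F s) (\<lambda>\<omega>. \<omega>))" for \<omega> using that st by simp
  have iN: "integrable ?N (\<lambda>d. 1 + d\<^sup>2)"
    by (subst integrable_distr_eq) (auto simp: power_mult_distrib)
  have Zi: "integrable (distr (P x) (F s) (\<lambda>\<omega>. \<omega>)) Z"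
    by (subst integrable_distr_eq) (auto intro: Zint)
  have inner: "integrable ?N (\<lambda>d. \<Phi> (\<omega>, d))" if "\<omega> \<in> space A" for \<omega>
  proof (rule Bochner_Integration.integrable_bound[OF integrable_mult_right[OF iN, of "Z \<omega>"]])
    show "(\<lambda>d. \<Phi> (\<omega>, d)) \<in> borel_measurable ?N"
      using that st by (auto intro!: measurable_compose[OF _ \<Phi>])
    show "AE d in ?N. norm (\<Phi> (\<omega>, d)) \<le> norm (Z \<omega> * (1 + d\<^sup>2))"
      using bd[OF that] by (auto intro!: AE_I2 order_trans[OF bd[OF that]])
  qed
  have prod_int: "integrable (distr (P x) (F s) (\<lambda>\<omega>. \<omega>) \<Otimes>\<^sub>M ?N) \<Phi>"
  proof (rule PP.Fubini_integrable)
    show "AE \<omega> in distr (P x) (F s) (\<lambda>\<omega>. \<omega>). integrable ?N (\<lambda>d. \<Phi> (\<omega>, d))"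
      using inner sp by (auto intro!: AE_I2)
    show "integrable (distr (P x) (F s) (\<lambda>\<omega>. \<omega>)) (\<lambda>\<omega>. \<integral>d. norm (\<Phi> (\<omega>, d)) \<partial>?N)"
    proof (rule Bochner_Integration.integrable_bound[OF integrable_mult_left[OF Zi, of "\<integral>d. 1 + d\<^sup>2 \<partial>?N"]])
      show "AE \<omega> in distr (P x) (F s) (\<lambda>\<omega>. \<omega>). norm (\<integral>d. norm (\<Phi> (\<omega>, d)) \<partial>?N)
          \<le> norm (Z \<omega> * (\<integral>d. 1 + d\<^sup>2 \<partial>?N))"
      proof (rule AE_I2)
        fix \<omega> assume "\<omega> \<in> space (distr (P x) (F s) (\<lambda>\<omega>. \<omega>))"
        then have \<omega>: "\<omega> \<in> space A" by (rule sp)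
        have "(\<integral>d. norm (\<Phi> (\<omega>, d)) \<partial>?N) \<le> (\<integral>d. Z \<omega> * (1 + d\<^sup>2) \<partial>?N)"
          using inner[OF \<omega>] iN bd[OF \<omega>] by (intro integral_mono) auto
        also have "\<dots> = Z \<omega> * (\<integral>d. 1 + d\<^sup>2 \<partial>?N)" by simp
        finally show "norm (\<integral>d. norm (\<Phi> (\<omega>, d)) \<partial>?N) \<le> norm (Z \<omega> * (\<integral>d. 1 + d\<^sup>2 \<partial>?N))"
          by (simp add: abs_le_iff)
      qed
    qed measurable
  qed measurable
  show "integrable (P x) (\<lambda>\<omega>. \<Phi> (\<omega>, ?\<Delta> \<omega>))"
    using prod_int unfolding joint by (subst (asm) integrable_distr_eq) auto
  have "(\<integral>\<omega>. \<Phi> (\<omega>, ?\<Delta> \<omega>) \<partial>P x) = integral\<^sup>L (distr (P x) (F s \<Otimes>\<^sub>M borel) (\<lambda>\<omega>. (\<omega>, ?\<Delta> \<omega>))) \<Phi>"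
    by (subst integral_distr) auto
  also have "\<dots> = (\<integral>\<omega>. (\<integral>d. \<Phi> (\<omega>, d) \<partial>?N) \<partial>distr (P x) (F s) (\<lambda>\<omega>. \<omega>))"
    unfolding joint[symmetric] by (rule PP.integral_fst'[OF prod_int, symmetric])
  also have "\<dots> = (\<integral>\<omega>. (\<integral>d. \<Phi> (\<omega>, d) \<partial>?N) \<partial>P x)"
    by (subst integral_distr) auto
  also have "\<dots> = (\<integral>\<omega>. (\<integral>z. \<Phi> (\<omega>, sqrt (t - s) * z) \<partial>std_normal_distribution) \<partial>P x)"
  proof (rule Bochner_Integration.integral_cong[OF refl])
    fix \<omega> assume "\<omega> \<in> space (P x)"
    then have [measurable]: "(\<lambda>d. \<Phi> (\<omega>, d)) \<in> borel_measurable borel"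
      using st by (auto intro!: measurable_compose[OF _ \<Phi>])
    show "(\<integral>d. \<Phi> (\<omega>, d) \<partial>?N) = (\<integral>z. \<Phi> (\<omega>, sqrt (t - s) * z) \<partial>std_normal_distribution)"
      by (rule integral_distr) measurable
  qed
  finally show "(\<integral>\<omega>. \<Phi> (\<omega>, ?\<Delta> \<omega>) \<partial>P x) = (\<integral>\<omega>. (\<integral>z. \<Phi> (\<omega>, sqrt (t - s) * z) \<partial>std_normal_distribution) \<partial>P x)" .
qed

lemma increment_moments:
  assumes st: "0 \<le> s" "s \<le> t" and \<zeta>[measurable]: "\<zeta> \<in> borel_measurable (F s)" and int: "integrable (P x) \<zeta>"
  shows "integrable (P x) (\<lambda>\<omega>. \<zeta> \<omega> * (B t \<omega> - B s \<omega>))"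
    and "(\<integral>\<omega>. \<zeta> \<omega> * (B t \<omega> - B s \<omega>) \<partial>P x) = 0"
    and "integrable (P x) (\<lambda>\<omega>. \<zeta> \<omega> * (B t \<omega> - B s \<omega>)\<^sup>2)"
    and "(\<integral>\<omega>. \<zeta> \<omega> * (B t \<omega> - B s \<omega>)\<^sup>2 \<partial>P x) = (t - s) * (\<integral>\<omega>. \<zeta> \<omega> \<partial>P x)"
    and "integrable (P x) (\<lambda>\<omega>. \<zeta> \<omega> * (\<bar>B t \<omega>\<bar> - \<bar>B s \<omega>\<bar>))"
    and "(\<integral>\<omega>. \<zeta> \<omega> * (\<bar>B t \<omega>\<bar> - \<bar>B s \<omega>\<bar>) \<partial>P x) = (\<integral>\<omega>. \<zeta> \<omega> * abs_drift (t - s) (B s \<omega>) \<partial>P x)"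
proof -
  have [measurable]: "B s \<in> borel_measurable (F s)" using st by (simp add: B_adapted)
  have le: "\<bar>d\<bar> \<le> 1 + d\<^sup>2" for d :: real
  proof -
    have "0 \<le> (\<bar>d\<bar> - 1)\<^sup>2" by simp
    then have "2 * \<bar>d\<bar> \<le> 1 + d\<^sup>2" by (simp add: power2_eq_square algebra_simps)
    then show ?thesis by linarith
  qed
  have Z: "(\<lambda>\<omega>. \<bar>\<zeta> \<omega>\<bar>) \<in> borel_measurable (F s)" "integrable (P x) (\<lambda>\<omega>. \<bar>\<zeta> \<omega>\<bar>)"
    using int by auto
  note fr = freeze_increment[OF st _ Z]
  have b1: "\<bar>case (\<omega>, d) of (\<omega>, d) \<Rightarrow> \<zeta> \<omega> * d\<bar> \<le> \<bar>\<zeta> \<omega>\<bar> * (1 + d\<^sup>2)" for \<omega> d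
    by (simp add: abs_mult mult_left_mono le)
  show "integrable (P x) (\<lambda>\<omega>. \<zeta> \<omega> * (B t \<omega> - B s \<omega>))"
    "(\<integral>\<omega>. \<zeta> \<omega> * (B t \<omega> - B s \<omega>) \<partial>P x) = 0"
    using fr[of "\<lambda>(\<omega>, d). \<zeta> \<omega> * d", OF _ b1] by simp_all
  have b2: "\<bar>case (\<omega>, d) of (\<omega>, d) \<Rightarrow> \<zeta> \<omega> * d\<^sup>2\<bar> \<le> \<bar>\<zeta> \<omega>\<bar> * (1 + d\<^sup>2)" for \<omega> d
    by (simp add: abs_mult mult_left_mono)
  show "integrable (P x) (\<lambda>\<omega>. \<zeta> \<omega> * (B t \<omega> - B s \<omega>)\<^sup>2)"
    "(\<integral>\<omega>. \<zeta> \<omega> * (B t \<omega> - B s \<omega>)\<^sup>2 \<partial>P x) = (t - s) * (\<integral>\<omega>. \<zeta> \<omega> \<partial>P x)"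
    using fr[of "\<lambda>(\<omega>, d). \<zeta> \<omega> * d\<^sup>2", OF _ b2] st by (simp_all add: power_mult_distrib mult.commute)
  have b3: "\<bar>case (\<omega>, d) of (\<omega>, d) \<Rightarrow> \<zeta> \<omega> * (\<bar>B s \<omega> + d\<bar> - \<bar>B s \<omega>\<bar>)\<bar> \<le> \<bar>\<zeta> \<omega>\<bar> * (1 + d\<^sup>2)" for \<omega> d
  proof -
    have "\<bar>\<bar>B s \<omega> + d\<bar> - \<bar>B s \<omega>\<bar>\<bar> \<le> 1 + d\<^sup>2" using le[of d] by linarith
    then show ?thesis by (simp add: abs_mult mult_left_mono)
  qed
  have [simp]: "integrable std_normal_distribution (\<lambda>z. \<bar>B s \<omega> + sqrt (t - s) * z\<bar>)" for \<omega>
    by (intro integrable_abs) simp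
  show "integrable (P x) (\<lambda>\<omega>. \<zeta> \<omega> * (\<bar>B t \<omega>\<bar> - \<bar>B s \<omega>\<bar>))"
    "(\<integral>\<omega>. \<zeta> \<omega> * (\<bar>B t \<omega>\<bar> - \<bar>B s \<omega>\<bar>) \<partial>P x) = (\<integral>\<omega>. \<zeta> \<omega> * abs_drift (t - s) (B s \<omega>) \<partial>P x)"
    using fr[of "\<lambda>(\<omega>, d). \<zeta> \<omega> * (\<bar>B s \<omega> + d\<bar> - \<bar>B s \<omega>\<bar>)", OF _ b3] by (simp_all add: abs_drift_def)
qed

text \<open>Statements conditional on \<open>F s\<close> are expressed as identities between
  expectations that hold with every such multiplier.\<close>

definition bounded_at :: "real \<Rightarrow> ('a \<Rightarrow> real) \<Rightarrow> bool" where
  "bounded_at s \<xi> \<longleftrightarrow> \<xi> \<in> borel_measurable (F s) \<and> (\<exists>K. \<forall>\<omega>\<in>space A. \<bar>\<xi> \<omega>\<bar> \<le> K)"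

lemma bounded_at_mono: "0 \<le> s \<Longrightarrow> s \<le> t \<Longrightarrow> bounded_at s \<xi> \<Longrightarrow> bounded_at t \<xi>"
  using measurable_F_mono unfolding bounded_at_def by blast

lemma bounded_at_mult:
  assumes "bounded_at s \<xi>" "bounded_at s \<eta>" shows "bounded_at s (\<lambda>\<omega>. \<xi> \<omega> * \<eta> \<omega>)"
proof -
  obtain K K' where K: "\<And>\<omega>. \<omega> \<in> space A \<Longrightarrow> \<bar>\<xi> \<omega>\<bar> \<le> K" "\<And>\<omega>. \<omega> \<in> space A \<Longrightarrow> \<bar>\<eta> \<omega>\<bar> \<le> K'"
    using assms unfolding bounded_at_def by blast
  have "\<bar>\<xi> \<omega> * \<eta> \<omega>\<bar> \<le> K * K'" if "\<omega> \<in> space A" for \<omega>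
    unfolding abs_mult using K[OF that] by (intro mult_mono) auto
  then show ?thesis using assms unfolding bounded_at_def by auto
qed

lemma bounded_at_measurable_P: "0 \<le> s \<Longrightarrow> bounded_at s \<xi> \<Longrightarrow> \<xi> \<in> borel_measurable (P x)"
  unfolding bounded_at_def by (blast intro: measurable_F_P)

lemma bounded_at_integrable: "0 \<le> s \<Longrightarrow> bounded_at s \<xi> \<Longrightarrow> integrable (P x) \<xi>"
proof -
  assume s: "0 \<le> s" "bounded_at s \<xi>"
  interpret prob_space "P x" by (rule prob_P)
  obtain K where "\<And>\<omega>. \<omega> \<in> space A \<Longrightarrow> \<bar>\<xi> \<omega>\<bar> \<le> K" using s unfolding bounded_at_def by blast
  then show ?thesis
    by (intro integrable_const_bound[where B = K] AE_I2 bounded_at_measurable_P[OF s]) simp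
qed

section \<open>Covariances of increments and the Ito isometry\<close>

lemma integrable_mult_increments:
  assumes s: "0 \<le> s" "bounded_at s \<xi>" and "0 \<le> a" "a \<le> b" "0 \<le> c" "c \<le> d"
  shows "integrable (P x) (\<lambda>\<omega>. \<xi> \<omega> * (B b \<omega> - B a \<omega>) * (B d \<omega> - B c \<omega>))" (is "integrable _ ?f")
    and "integrable (P x) (\<lambda>\<omega>. \<xi> \<omega> * (B b \<omega> - B a \<omega>))" (is "integrable _ ?g")
proof -
  interpret prob_space "P x" by (rule prob_P)
  obtain K where K: "\<And>\<omega>. \<omega> \<in> space A \<Longrightarrow> \<bar>\<xi> \<omega>\<bar> \<le> K" using s unfolding bounded_at_def by blast
  have K0: "\<omega> \<in> space A \<Longrightarrow> 0 \<le> K" for \<omega> using K[of \<omega>] by linarith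
  have [measurable]: "\<xi> \<in> borel_measurable (P x)" by (rule bounded_at_measurable_P[OF s])
  have [measurable]: "B a \<in> borel_measurable (P x)" "B b \<in> borel_measurable (P x)"
    "B c \<in> borel_measurable (P x)" "B d \<in> borel_measurable (P x)"
    by (intro B_measurable_P; use assms in linarith)+
  have sq: "integrable (P x) (\<lambda>\<omega>. (B v \<omega> - B u \<omega>)\<^sup>2)" if "0 \<le> u" "u \<le> v" for u v
  proof -
    have "integrable (P x) (\<lambda>\<omega>. 1 * (B v \<omega> - B u \<omega>)\<^sup>2)"
      by (rule increment_moments(3)[OF that borel_measurable_const integrable_const])
    then show ?thesis by (simp only: mult_1)
  qed
  have xy: "\<bar>u * v\<bar> \<le> u\<^sup>2 + v\<^sup>2" for u v :: real
  proof -
    have "0 \<le> (\<bar>u\<bar> - \<bar>v\<bar>)\<^sup>2" by simp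
    then have "2 * \<bar>u * v\<bar> \<le> u\<^sup>2 + v\<^sup>2" by (simp add: power2_eq_square algebra_simps abs_mult)
    then show ?thesis by linarith
  qed
  show "integrable (P x) ?f"
  proof (rule Bochner_Integration.integrable_bound)
    show "integrable (P x) (\<lambda>\<omega>. K * ((B b \<omega> - B a \<omega>)\<^sup>2 + (B d \<omega> - B c \<omega>)\<^sup>2))"
      using sq assms by auto
    show "AE \<omega> in P x. norm (?f \<omega>) \<le> norm (K * ((B b \<omega> - B a \<omega>)\<^sup>2 + (B d \<omega> - B c \<omega>)\<^sup>2))"
    proof (rule AE_I2)
      fix \<omega> assume "\<omega> \<in> space (P x)"
      then have "\<omega> \<in> space A" by simp
      then have "\<bar>\<xi> \<omega>\<bar> * \<bar>(B b \<omega> - B a \<omega>) * (B d \<omega> - B c \<omega>)\<bar>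
          \<le> K * ((B b \<omega> - B a \<omega>)\<^sup>2 + (B d \<omega> - B c \<omega>)\<^sup>2)"
        by (intro mult_mono K xy K0 abs_ge_zero)
      then show "norm (?f \<omega>) \<le> norm (K * ((B b \<omega> - B a \<omega>)\<^sup>2 + (B d \<omega> - B c \<omega>)\<^sup>2))"
        using K0[OF \<open>\<omega> \<in> space A\<close>] by (simp add: abs_mult mult.assoc)
    qed
  qed measurable
  show "integrable (P x) ?g"
  proof (rule Bochner_Integration.integrable_bound)
    show "integrable (P x) (\<lambda>\<omega>. K * ((B b \<omega> - B a \<omega>)\<^sup>2 + 1\<^sup>2))"
      using sq assms by auto
    show "AE \<omega> in P x. norm (?g \<omega>) \<le> norm (K * ((B b \<omega> - B a \<omega>)\<^sup>2 + 1\<^sup>2))"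
    proof (rule AE_I2)
      fix \<omega> assume "\<omega> \<in> space (P x)"
      then have "\<omega> \<in> space A" by simp
      then have "\<bar>\<xi> \<omega>\<bar> * \<bar>(B b \<omega> - B a \<omega>) * 1\<bar> \<le> K * ((B b \<omega> - B a \<omega>)\<^sup>2 + 1\<^sup>2)"
        by (intro mult_mono K xy K0 abs_ge_zero)
      then show "norm (?g \<omega>) \<le> norm (K * ((B b \<omega> - B a \<omega>)\<^sup>2 + 1\<^sup>2))"
        using K0[OF \<open>\<omega> \<in> space A\<close>] by (simp add: abs_mult)
    qed
  qed measurable
qed

text \<open>Cut both intervals at \<open>c\<close> and at \<open>min b d\<close>. In every product
  of pieces other than the square over the overlap, one increment lies in the future of all
  remaining factors and has mean zero; the square contributes the length of the overlap.\<close>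

lemma increment_covariance_ordered:
  assumes ab: "0 \<le> a" "a \<le> b" "c \<le> d" "a \<le> c"
    and \<xi>: "bounded_at a \<xi>" and \<eta>: "bounded_at c \<eta>"
  shows "(\<integral>\<omega>. \<xi> \<omega> * \<eta> \<omega> * (B b \<omega> - B a \<omega>) * (B d \<omega> - B c \<omega>) \<partial>P x)
    = (\<integral>\<omega>. \<xi> \<omega> * \<eta> \<omega> \<partial>P x) * measure lborel ({a<..b} \<inter> {c<..d})"
proof -
  have c0: "0 \<le> c" using ab by simp
  have \<xi>\<eta>: "bounded_at c (\<lambda>\<omega>. \<xi> \<omega> * \<eta> \<omega>)"
    using bounded_at_mult bounded_at_mono[OF ab(1,4) \<xi>] \<eta> by blast
  have mart: "(\<integral>\<omega>. \<xi> \<omega> * \<eta> \<omega> * (B v \<omega> - B u \<omega>) * (B p \<omega> - B m \<omega>) \<partial>P x) = 0"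
    if "0 \<le> u" "u \<le> v" "v \<le> m" "m \<le> p" "c \<le> m" for u v m p
  proof (rule increment_moments(2)[of m])
    have [measurable]: "(\<lambda>\<omega>. \<xi> \<omega> * \<eta> \<omega>) \<in> borel_measurable (F m)"
      using bounded_at_mono[OF c0 that(5) \<xi>\<eta>] by (simp add: bounded_at_def)
    have [measurable]: "B u \<in> borel_measurable (F m)" "B v \<in> borel_measurable (F m)"
      using that by (auto intro: B_measurable_F)
    show "(\<lambda>\<omega>. \<xi> \<omega> * \<eta> \<omega> * (B v \<omega> - B u \<omega>)) \<in> borel_measurable (F m)" by measurable
  qed (use that integrable_mult_increments(2)[OF c0 \<xi>\<eta>] in auto)
  show ?thesis
  proof (cases "b \<le> c")
    case True
    then have "{a<..b} \<inter> {c<..d} = {}" by auto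
    with mart[of a b c d] True ab show ?thesis by simp
  next
    case False
    define m where "m = min b d"
    have m: "c \<le> m" "m \<le> b" "m \<le> d" "m = b \<or> m = d" using False ab by (auto simp: m_def)
    have "{a<..b} \<inter> {c<..d} = {c<..m}" using ab by (auto simp: m_def)
    then have meas: "measure lborel ({a<..b} \<inter> {c<..d}) = m - c" using m by simp
    have ints: "integrable (P x) (\<lambda>\<omega>. \<xi> \<omega> * \<eta> \<omega> * (B c \<omega> - B a \<omega>) * (B d \<omega> - B c \<omega>))"
      "integrable (P x) (\<lambda>\<omega>. \<xi> \<omega> * \<eta> \<omega> * (B m \<omega> - B c \<omega>) * (B m \<omega> - B c \<omega>))"
      "integrable (P x) (\<lambda>\<omega>. \<xi> \<omega> * \<eta> \<omega> * (B m \<omega> - B c \<omega>) * (B d \<omega> - B m \<omega>))"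
      "integrable (P x) (\<lambda>\<omega>. \<xi> \<omega> * \<eta> \<omega> * (B m \<omega> - B c \<omega>) * (B b \<omega> - B m \<omega>))"
      using integrable_mult_increments(1)[OF c0 \<xi>\<eta>] ab m c0 by auto
    have "(\<integral>\<omega>. \<xi> \<omega> * \<eta> \<omega> * (B b \<omega> - B a \<omega>) * (B d \<omega> - B c \<omega>) \<partial>P x)
      = (\<integral>\<omega>. \<xi> \<omega> * \<eta> \<omega> * (B c \<omega> - B a \<omega>) * (B d \<omega> - B c \<omega>)
          + \<xi> \<omega> * \<eta> \<omega> * (B m \<omega> - B c \<omega>) * (B m \<omega> - B c \<omega>)
          + \<xi> \<omega> * \<eta> \<omega> * (B m \<omega> - B c \<omega>) * (B d \<omega> - B m \<omega>)
          + \<xi> \<omega> * \<eta> \<omega> * (B m \<omega> - B c \<omega>) * (B b \<omega> - B m \<omega>) \<partial>P x)"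
      using m(4) by (intro Bochner_Integration.integral_cong refl) (auto simp: algebra_simps)
    also have "\<dots> = (\<integral>\<omega>. \<xi> \<omega> * \<eta> \<omega> * (B m \<omega> - B c \<omega>) * (B m \<omega> - B c \<omega>) \<partial>P x)"
      using ints mart[of a c c d] mart[of c m m d] mart[of c m m b] ab m c0 by simp
    also have "\<dots> = (\<integral>\<omega>. \<xi> \<omega> * \<eta> \<omega> * (B m \<omega> - B c \<omega>)\<^sup>2 \<partial>P x)"
      by (simp add: power2_eq_square mult.assoc)
    also have "\<dots> = (m - c) * (\<integral>\<omega>. \<xi> \<omega> * \<eta> \<omega> \<partial>P x)"
      using \<xi>\<eta> m c0 bounded_at_integrable[OF c0 \<xi>\<eta>] by (intro increment_moments(4)) (auto simp: bounded_at_def)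
    finally show ?thesis using meas by simp
  qed
qed

lemma increment_covariance:
  assumes "0 \<le> a" "a \<le> b" "0 \<le> c" "c \<le> d" "bounded_at a \<xi>" "bounded_at c \<eta>"
  shows "(\<integral>\<omega>. \<xi> \<omega> * (B b \<omega> - B a \<omega>) * (\<eta> \<omega> * (B d \<omega> - B c \<omega>)) \<partial>P x)
    = (\<integral>\<omega>. \<xi> \<omega> * \<eta> \<omega> \<partial>P x) * measure lborel ({a<..b} \<inter> {c<..d})"
    and "integrable (P x) (\<lambda>\<omega>. \<xi> \<omega> * (B b \<omega> - B a \<omega>) * (\<eta> \<omega> * (B d \<omega> - B c \<omega>)))"
proof -
  show "(\<integral>\<omega>. \<xi> \<omega> * (B b \<omega> - B a \<omega>) * (\<eta> \<omega> * (B d \<omega> - B c \<omega>)) \<partial>P x)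
    = (\<integral>\<omega>. \<xi> \<omega> * \<eta> \<omega> \<partial>P x) * measure lborel ({a<..b} \<inter> {c<..d})"
  proof (cases "a \<le> c")
    case True
    then show ?thesis
      using increment_covariance_ordered[of a b c d \<xi> \<eta> x] assms by (simp add: mult_ac)
  next
    case False
    then show ?thesis
      using increment_covariance_ordered[of c d a b \<eta> \<xi> x] assms by (simp add: mult_ac Int_commute)
  qed
  have "bounded_at (max a c) (\<lambda>\<omega>. \<xi> \<omega> * \<eta> \<omega>)"
    using assms by (intro bounded_at_mult) (auto intro: bounded_at_mono[OF _ max.cobounded1] bounded_at_mono[OF _ max.cobounded2])
  from integrable_mult_increments(1)[OF _ this, of a b c d x] assms
  show "integrable (P x) (\<lambda>\<omega>. \<xi> \<omega> * (B b \<omega> - B a \<omega>) * (\<eta> \<omega> * (B d \<omega> - B c \<omega>)))"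
    by (simp add: mult_ac)
qed

text \<open>Both sides expand into the same double sum, in which the pair (i, j) is weighted by the
  length of the overlap of its intervals. The intervals may overlap and the index set is any finite
  set, so a difference of integrals over two different grids is covered without a common
  refinement.\<close>

lemma Ito_isometry:
  fixes \<xi> :: "'j \<Rightarrow> 'a \<Rightarrow> real"
  assumes "finite I" and ab: "\<And>j. j \<in> I \<Longrightarrow> 0 \<le> a j \<and> a j \<le> b j \<and> b j \<le> T \<and> bounded_at (a j) (\<xi> j)"
  shows "(\<integral>\<^sup>+\<omega>. ennreal ((\<Sum>j\<in>I. \<xi> j \<omega> * (B (b j) \<omega> - B (a j) \<omega>))\<^sup>2) \<partial>P x)
    = (\<integral>\<^sup>+\<omega>. (\<integral>\<^sup>+s\<in>{0..T}. ennreal ((\<Sum>j\<in>I. \<xi> j \<omega> * indicator {a j<..b j} s)\<^sup>2) \<partial>lborel) \<partial>P x)"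
proof -
  let ?m = "\<lambda>i j. measure lborel ({a i<..b i} \<inter> {a j<..b j})"
  have inner: "(\<integral>\<^sup>+s\<in>{0..T}. ennreal ((\<Sum>j\<in>I. \<xi> j \<omega> * indicator {a j<..b j} s)\<^sup>2) \<partial>lborel)
      = ennreal (\<Sum>i\<in>I. \<Sum>j\<in>I. \<xi> i \<omega> * \<xi> j \<omega> * ?m i j)" (is "?L = _")
    and inner_nonneg: "0 \<le> (\<Sum>i\<in>I. \<Sum>j\<in>I. \<xi> i \<omega> * \<xi> j \<omega> * ?m i j)" for \<omega>
  proof -
    have ind: "integrable lborel (\<lambda>s. indicator ({a i<..b i} \<inter> {a j<..b j}) s :: real)" if "i \<in> I" "j \<in> I" for i j
    proof -
      have "{a i<..b i} \<inter> {a j<..b j} = {max (a i) (a j)<..min (b i) (b j)}" by auto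
      moreover have "emeasure lborel {max (a i) (a j)<..min (b i) (b j)} < \<infinity>"
        by (cases "max (a i) (a j) \<le> min (b i) (b j)") (auto simp: emeasure_lborel_Ioc simp del: max.bounded_iff min.bounded_iff)
      ultimately show ?thesis by (auto intro!: integrable_real_indicator)
    qed
    have sq: "(\<Sum>j\<in>I. \<xi> j \<omega> * indicator {a j<..b j} s)\<^sup>2
       = (\<Sum>i\<in>I. \<Sum>j\<in>I. \<xi> i \<omega> * \<xi> j \<omega> * indicator ({a i<..b i} \<inter> {a j<..b j}) s)" for s
      unfolding power2_eq_square sum_product indicator_inter_arith by (intro sum.cong refl) (simp add: mult_ac)
    have int: "integrable lborel (\<lambda>s. (\<Sum>j\<in>I. \<xi> j \<omega> * indicator {a j<..b j} s)\<^sup>2)"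
      unfolding sq using ind by (intro Bochner_Integration.integrable_sum integrable_mult_right) auto
    have eq: "(\<integral>s. (\<Sum>j\<in>I. \<xi> j \<omega> * indicator {a j<..b j} s)\<^sup>2 \<partial>lborel)
       = (\<Sum>i\<in>I. \<Sum>j\<in>I. \<xi> i \<omega> * \<xi> j \<omega> * ?m i j)"
      unfolding sq using ind by (simp add: Bochner_Integration.integral_sum Bochner_Integration.integrable_sum)
    have "?L = (\<integral>\<^sup>+s. ennreal ((\<Sum>j\<in>I. \<xi> j \<omega> * indicator {a j<..b j} s)\<^sup>2) \<partial>lborel)"
    proof (intro nn_integral_cong)
      fix s
      have "indicator {a j<..b j} s = (0::real)" if "j \<in> I" "s \<notin> {0..T}" for j
        using that ab[OF that(1)] by (auto split: split_indicator)
      then show "ennreal ((\<Sum>j\<in>I. \<xi> j \<omega> * indicator {a j<..b j} s)\<^sup>2) * indicator {0..T} s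
         = ennreal ((\<Sum>j\<in>I. \<xi> j \<omega> * indicator {a j<..b j} s)\<^sup>2)"
        by (cases "s \<in> {0..T}") auto
    qed
    also have "\<dots> = ennreal (\<Sum>i\<in>I. \<Sum>j\<in>I. \<xi> i \<omega> * \<xi> j \<omega> * ?m i j)"
      unfolding eq[symmetric] using int by (intro nn_integral_eq_integral) auto
    finally show "?L = \<dots>" .
    show "0 \<le> (\<Sum>i\<in>I. \<Sum>j\<in>I. \<xi> i \<omega> * \<xi> j \<omega> * ?m i j)"
      unfolding eq[symmetric] by (intro Bochner_Integration.integral_nonneg) simp
  qed
  have int_prod: "integrable (P x) (\<lambda>\<omega>. \<xi> i \<omega> * \<xi> j \<omega>)" if "i \<in> I" "j \<in> I" for i j
  proof -
    have "bounded_at (max (a i) (a j)) (\<lambda>\<omega>. \<xi> i \<omega> * \<xi> j \<omega>)"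
      using ab that by (intro bounded_at_mult) (auto intro: bounded_at_mono[OF _ max.cobounded1] bounded_at_mono[OF _ max.cobounded2])
    then show ?thesis using ab that by (intro bounded_at_integrable[of "max (a i) (a j)"]) (auto simp: le_max_iff_disj)
  qed
  have sq: "(\<Sum>j\<in>I. \<xi> j \<omega> * (B (b j) \<omega> - B (a j) \<omega>))\<^sup>2
    = (\<Sum>i\<in>I. \<Sum>j\<in>I. \<xi> i \<omega> * (B (b i) \<omega> - B (a i) \<omega>) * (\<xi> j \<omega> * (B (b j) \<omega> - B (a j) \<omega>)))" for \<omega>
    unfolding power2_eq_square sum_product ..
  have "(\<integral>\<^sup>+\<omega>. ennreal ((\<Sum>j\<in>I. \<xi> j \<omega> * (B (b j) \<omega> - B (a j) \<omega>))\<^sup>2) \<partial>P x)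
    = ennreal (\<integral>\<omega>. (\<Sum>j\<in>I. \<xi> j \<omega> * (B (b j) \<omega> - B (a j) \<omega>))\<^sup>2 \<partial>P x)"
    unfolding sq using ab increment_covariance(2)
    by (intro nn_integral_eq_integral Bochner_Integration.integrable_sum) (auto simp: sq[symmetric])
  also have "(\<integral>\<omega>. (\<Sum>j\<in>I. \<xi> j \<omega> * (B (b j) \<omega> - B (a j) \<omega>))\<^sup>2 \<partial>P x)
    = (\<Sum>i\<in>I. \<Sum>j\<in>I. (\<integral>\<omega>. \<xi> i \<omega> * \<xi> j \<omega> \<partial>P x) * ?m i j)"
    unfolding sq using ab increment_covariance
    by (subst Bochner_Integration.integral_sum, force intro!: Bochner_Integration.integrable_sum)
      (intro sum.cong refl, subst Bochner_Integration.integral_sum, auto)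
  also have "\<dots> = (\<integral>\<omega>. (\<Sum>i\<in>I. \<Sum>j\<in>I. \<xi> i \<omega> * \<xi> j \<omega> * ?m i j) \<partial>P x)"
    using int_prod by (simp add: Bochner_Integration.integral_sum Bochner_Integration.integrable_sum)
  also have "ennreal \<dots> = (\<integral>\<^sup>+\<omega>. ennreal (\<Sum>i\<in>I. \<Sum>j\<in>I. \<xi> i \<omega> * \<xi> j \<omega> * ?m i j) \<partial>P x)"
    using int_prod inner_nonneg
    by (intro nn_integral_eq_integral[symmetric] Bochner_Integration.integrable_sum) auto
  finally show ?thesis unfolding inner .
qed

end

text \<open>This plays the part of the triangle inequality for mean square distances, in the form (a
  - b)^2 \<le> 2 (a - c)^2 + 2 (b - c)^2.\<close>

lemma nn_integral_iterated_triangle: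
  fixes f g h :: "'a \<Rightarrow> 'b \<Rightarrow> ennreal"
  assumes "sigma_finite_measure N"
    and [measurable]: "case_prod g \<in> borel_measurable (M \<Otimes>\<^sub>M N)" "case_prod h \<in> borel_measurable (M \<Otimes>\<^sub>M N)"
    and le: "\<And>x y. x \<in> space M \<Longrightarrow> y \<in> space N \<Longrightarrow> f x y \<le> 2 * g x y + 2 * h x y"
  shows "(\<integral>\<^sup>+x. \<integral>\<^sup>+y. f x y \<partial>N \<partial>M) \<le> 2 * (\<integral>\<^sup>+x. \<integral>\<^sup>+y. g x y \<partial>N \<partial>M) + 2 * (\<integral>\<^sup>+x. \<integral>\<^sup>+y. h x y \<partial>N \<partial>M)"
proof -
  interpret N: sigma_finite_measure N by fact
  have "(\<integral>\<^sup>+x. \<integral>\<^sup>+y. f x y \<partial>N \<partial>M) \<le> (\<integral>\<^sup>+x. \<integral>\<^sup>+y. 2 * g x y + 2 * h x y \<partial>N \<partial>M)"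
    by (intro nn_integral_mono le)
  also have "\<dots> = (\<integral>\<^sup>+x. 2 * (\<integral>\<^sup>+y. g x y \<partial>N) + 2 * (\<integral>\<^sup>+y. h x y \<partial>N) \<partial>M)"
    by (intro nn_integral_cong) (simp add: nn_integral_add nn_integral_cmult)
  also have "\<dots> = 2 * (\<integral>\<^sup>+x. \<integral>\<^sup>+y. g x y \<partial>N \<partial>M) + 2 * (\<integral>\<^sup>+x. \<integral>\<^sup>+y. h x y \<partial>N \<partial>M)"
    by (simp add: nn_integral_add nn_integral_cmult)
  finally show ?thesis .
qed

text \<open>Pointwise |u| \<le> \<delta> + u^2 / \<delta>: either |u| is at most \<delta>, or the
  second term dominates. The factor 2 is harmless where the bound is used.\<close>

lemma (in prob_space) L1_le_L2:
  fixes u :: "'a \<Rightarrow> real"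
  assumes [measurable]: "u \<in> borel_measurable M" and \<delta>: "\<delta> > 0"
    and le: "(\<integral>\<^sup>+\<omega>. ennreal ((u \<omega>)\<^sup>2) \<partial>M) \<le> ennreal (\<delta>\<^sup>2)"
  shows "integrable M u" "(\<integral>\<omega>. \<bar>u \<omega>\<bar> \<partial>M) \<le> 2 * \<delta>"
proof -
  have sq: "integrable M (\<lambda>\<omega>. (u \<omega>)\<^sup>2)"
    using le by (intro integrableI_bounded) (auto simp: le_less_trans)
  have sqle: "(\<integral>\<omega>. (u \<omega>)\<^sup>2 \<partial>M) \<le> \<delta>\<^sup>2"
    using le nn_integral_eq_integral[OF sq] by simp
  have pt: "\<bar>u \<omega>\<bar> \<le> \<delta> + (u \<omega>)\<^sup>2 / \<delta>" for \<omega>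
  proof (cases "\<bar>u \<omega>\<bar> \<le> \<delta>")
    case False
    then have "\<delta> * \<bar>u \<omega>\<bar> \<le> \<bar>u \<omega>\<bar> * \<bar>u \<omega>\<bar>" by (intro mult_right_mono) auto
    then have "\<bar>u \<omega>\<bar> \<le> (u \<omega>)\<^sup>2 / \<delta>" using \<delta> by (simp add: field_simps power2_eq_square)
    then show ?thesis using \<delta> by simp
  qed (use \<delta> in \<open>simp add: add_increasing2\<close>)
  have bi: "integrable M (\<lambda>\<omega>. \<delta> + (u \<omega>)\<^sup>2 / \<delta>)" using sq by simp
  show int: "integrable M u"
    by (rule Bochner_Integration.integrable_bound[OF bi]) (use pt \<delta> in \<open>auto intro!: AE_I2\<close>)
  have "(\<integral>\<omega>. \<bar>u \<omega>\<bar> \<partial>M) \<le> (\<integral>\<omega>. \<delta> + (u \<omega>)\<^sup>2 / \<delta> \<partial>M)"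
    using int bi pt by (intro integral_mono) auto
  also have "\<dots> = \<delta> + (\<integral>\<omega>. (u \<omega>)\<^sup>2 \<partial>M) / \<delta>" using sq by (simp add: prob_space)
  also have "\<dots> \<le> 2 * \<delta>" using sqle \<delta> by (simp add: field_simps power2_eq_square)
  finally show "(\<integral>\<omega>. \<bar>u \<omega>\<bar> \<partial>M) \<le> 2 * \<delta>" .
qed

section \<open>Elementary stochastic integrals\<close>

context brownian_family
begin

lemma elementary_grid_nonneg:
  assumes "elementary_integrand F n r \<xi>" "i \<le> n" shows "0 \<le> r i"
  using assms(2)
proof (induction i)
  case (Suc i)
  then have "0 \<le> r i" "r i \<le> r (Suc i)"
    using assms(1) unfolding elementary_integrand_def by simp_all
  then show ?case by simp
qed (use assms(1) in \<open>simp add: elementary_integrand_def\<close>)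

lemma elementary_bounded_at:
  assumes "elementary_integrand F n r \<xi>" "i < n" shows "bounded_at (r i) (\<xi> i)"
proof -
  have "space (F (r i)) = space A" using elementary_grid_nonneg[OF assms(1), of i] assms(2) by simp
  moreover have "\<xi> i \<in> borel_measurable (F (r i))" "\<exists>K. \<forall>\<omega>\<in>space (F (r i)). \<bar>\<xi> i \<omega>\<bar> \<le> K"
    using assms unfolding elementary_integrand_def by blast+
  ultimately show ?thesis unfolding bounded_at_def by simp
qed

lemma elementary_integral_measurable:
  assumes "elementary_integrand F n r \<xi>" "0 \<le> t"
  shows "elementary_integral B n r \<xi> t \<in> borel_measurable (P x)"
proof -
  have "(\<lambda>\<omega>. \<Sum>i<n. \<xi> i \<omega> * (B (min t (r (Suc i))) \<omega> - B (min t (r i)) \<omega>)) \<in> borel_measurable (P x)"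
  proof (intro borel_measurable_sum borel_measurable_times borel_measurable_diff)
    fix i assume "i \<in> {..<n}"
    then have i: "i < n" by simp
    show "\<xi> i \<in> borel_measurable (P x)"
      using i by (intro bounded_at_measurable_P[OF elementary_grid_nonneg[OF assms(1)] elementary_bounded_at[OF assms(1)]]) auto
    show "B (min t (r (Suc i))) \<in> borel_measurable (P x)" "B (min t (r i)) \<in> borel_measurable (P x)"
      using elementary_grid_nonneg[OF assms(1), of i] elementary_grid_nonneg[OF assms(1), of "Suc i"] i assms(2)
      by (auto intro!: B_measurable_P)
  qed
  then show ?thesis unfolding elementary_integral_def[abs_def] .
qed

text \<open>The difference is one elementary sum over the disjoint union of the two index sets, the
  second family carrying the opposite sign; the isometry applies to it directly.\<close>

lemma elementary_isometry_diff:
  assumes e: "elementary_integrand F n r \<xi>" and e': "elementary_integrand F n' r' \<xi>'" and s: "0 \<le> s"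
  shows "(\<integral>\<^sup>+\<omega>. ennreal ((elementary_integral B n r \<xi> s \<omega> - elementary_integral B n' r' \<xi>' s \<omega>)\<^sup>2) \<partial>P x)
    = (\<integral>\<^sup>+\<omega>. (\<integral>\<^sup>+u\<in>{0..s}. ennreal ((elementary_process n r \<xi> u \<omega> - elementary_process n' r' \<xi>' u \<omega>)\<^sup>2) \<partial>lborel) \<partial>P x)"
proof -
  let ?I = "{..<n} <+> {..<n'}"
  define a where "a = case_sum (\<lambda>i. min s (r i)) (\<lambda>i. min s (r' i))"
  define b where "b = case_sum (\<lambda>i. min s (r (Suc i))) (\<lambda>i. min s (r' (Suc i)))"
  \<comment> \<open>A cell that starts at or after \<open>s\<close> is truncated to the empty
    interval at \<open>s\<close>. Its coefficient need not be known at time \<open>s\<close>, so it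
    is set to 0, which changes neither sum.\<close>
  define X where "X = case_sum (\<lambda>i \<omega>. if r i < s then \<xi> i \<omega> else 0) (\<lambda>i \<omega>. if r' i < s then - \<xi>' i \<omega> else (0::real))"
  have mono: "r i \<le> r (Suc i)" if "i < n" for i using e that by (simp add: elementary_integrand_def)
  have mono': "r' i \<le> r' (Suc i)" if "i < n'" for i using e' that by (simp add: elementary_integrand_def)
  have bd0: "bounded_at u (\<lambda>_. 0)" for u unfolding bounded_at_def by auto
  have bdm: "bounded_at u (\<lambda>\<omega>. - \<eta> \<omega>)" if "bounded_at u \<eta>" for u \<eta> using that unfolding bounded_at_def by auto
  have ab: "0 \<le> a j \<and> a j \<le> b j \<and> b j \<le> s \<and> bounded_at (a j) (X j)" if "j \<in> ?I" for j
    using that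
  proof (rule PlusE)
    fix i assume j: "j = Inl i" and "i \<in> {..<n}"
    then have i: "i < n" by simp
    show ?thesis using mono[OF i] s elementary_grid_nonneg[OF e, of i] elementary_bounded_at[OF e i] i bd0
      by (auto simp: j a_def b_def X_def min_def)
  next
    fix i assume j: "j = Inr i" and "i \<in> {..<n'}"
    then have i: "i < n'" by simp
    show ?thesis using mono'[OF i] s elementary_grid_nonneg[OF e', of i] elementary_bounded_at[OF e' i] i bd0 bdm
      by (auto simp: j a_def b_def X_def min_def)
  qed
  have 1: "elementary_integral B n r \<xi> s \<omega> - elementary_integral B n' r' \<xi>' s \<omega>
      = (\<Sum>j\<in>?I. X j \<omega> * (B (b j) \<omega> - B (a j) \<omega>))" for \<omega>
  proof -
    have "elementary_integral B n r \<xi> s \<omega> = (\<Sum>i<n. X (Inl i) \<omega> * (B (b (Inl i)) \<omega> - B (a (Inl i)) \<omega>))"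
      unfolding elementary_integral_def using mono by (intro sum.cong refl) (force simp: a_def b_def X_def min_def)
    moreover have "elementary_integral B n' r' \<xi>' s \<omega> = - (\<Sum>i<n'. X (Inr i) \<omega> * (B (b (Inr i)) \<omega> - B (a (Inr i)) \<omega>))"
      unfolding elementary_integral_def sum_negf[symmetric] using mono'
      by (intro sum.cong refl) (force simp: a_def b_def X_def min_def algebra_simps)
    ultimately show ?thesis by (simp add: sum.Plus)
  qed
  have 2: "elementary_process n r \<xi> u \<omega> - elementary_process n' r' \<xi>' u \<omega>
      = (\<Sum>j\<in>?I. X j \<omega> * indicator {a j<..b j} u)" if "u \<in> {0..s}" for \<omega> u
  proof -
    have "elementary_process n r \<xi> u \<omega> = (\<Sum>i<n. X (Inl i) \<omega> * indicator {a (Inl i)<..b (Inl i)} u)"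
      unfolding elementary_process_def using mono that
      by (intro sum.cong refl) (force simp: a_def b_def X_def split: split_indicator)
    moreover have "elementary_process n' r' \<xi>' u \<omega> = - (\<Sum>i<n'. X (Inr i) \<omega> * indicator {a (Inr i)<..b (Inr i)} u)"
      unfolding elementary_process_def sum_negf[symmetric] using mono' that
      by (intro sum.cong refl) (force simp: a_def b_def X_def split: split_indicator)
    ultimately show ?thesis by (simp only: sum.Plus[OF finite_lessThan finite_lessThan] o_def)
  qed
  have "(\<integral>\<^sup>+\<omega>. (\<integral>\<^sup>+u\<in>{0..s}. ennreal ((elementary_process n r \<xi> u \<omega> - elementary_process n' r' \<xi>' u \<omega>)\<^sup>2) \<partial>lborel) \<partial>P x)
    = (\<integral>\<^sup>+\<omega>. (\<integral>\<^sup>+u\<in>{0..s}. ennreal ((\<Sum>j\<in>?I. X j \<omega> * indicator {a j<..b j} u)\<^sup>2) \<partial>lborel) \<partial>P x)"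
    by (intro nn_integral_cong) (auto simp: 2 split: split_indicator)
  then show ?thesis unfolding 1 using Ito_isometry[of ?I a b s X x] ab by simp
qed

text \<open>A cell that ends before \<open>s\<close> or starts after \<open>t\<close> contributes
  nothing. Any other cell contributes the increment between \<open>max s (r i)\<close> and
  \<open>min t (r (Suc i))\<close>, with a factor already known at the left end.\<close>

lemma elementary_martingale:
  assumes e: "elementary_integrand F n r \<xi>" and st: "0 \<le> s" "s \<le> t" and \<zeta>: "bounded_at s \<zeta>"
  shows "integrable (P x) (\<lambda>\<omega>. \<zeta> \<omega> * (elementary_integral B n r \<xi> t \<omega> - elementary_integral B n r \<xi> s \<omega>))"
    and "(\<integral>\<omega>. \<zeta> \<omega> * (elementary_integral B n r \<xi> t \<omega> - elementary_integral B n r \<xi> s \<omega>) \<partial>P x) = 0"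
proof -
  let ?D = "\<lambda>i \<omega>. \<zeta> \<omega> * (\<xi> i \<omega> * (B (min t (r (Suc i))) \<omega> - B (min t (r i)) \<omega> - (B (min s (r (Suc i))) \<omega> - B (min s (r i)) \<omega>)))"
  have eq: "\<zeta> \<omega> * (elementary_integral B n r \<xi> t \<omega> - elementary_integral B n r \<xi> s \<omega>) = (\<Sum>i<n. ?D i \<omega>)" for \<omega>
    unfolding elementary_integral_def by (simp add: sum_subtractf[symmetric] sum_distrib_left algebra_simps)
  have D: "integrable (P x) (?D i) \<and> (\<integral>\<omega>. ?D i \<omega> \<partial>P x) = 0" if i: "i < n" for i
  proof -
    have mono: "r i \<le> r (Suc i)" using e i by (simp add: elementary_integrand_def)
    have r0: "0 \<le> r i" using elementary_grid_nonneg[OF e, of i] i by simp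
    show ?thesis
    proof (cases "t \<le> r i \<or> r (Suc i) \<le> s")
      case True
      then have "min t (r (Suc i)) = min t (r i) \<and> min s (r (Suc i)) = min s (r i)
          \<or> min t (r (Suc i)) = min s (r (Suc i)) \<and> min t (r i) = min s (r i)"
        using mono st by (auto simp: min_def)
      then have "?D i = (\<lambda>_. 0)" by auto
      then show ?thesis by simp
    next
      case False
      define a where "a = max s (r i)"
      define b where "b = min t (r (Suc i))"
      have ab: "0 \<le> a" "a \<le> b" "s \<le> a" "r i \<le> a" using False mono st by (auto simp: a_def b_def)
      have bd: "bounded_at a (\<lambda>\<omega>. \<zeta> \<omega> * \<xi> i \<omega>)"
        using bounded_at_mono[OF st(1) ab(3) \<zeta>] bounded_at_mono[OF r0 ab(4) elementary_bounded_at[OF e i]]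
        by (rule bounded_at_mult)
      have "?D i = (\<lambda>\<omega>. \<zeta> \<omega> * \<xi> i \<omega> * (B b \<omega> - B a \<omega>))"
        using False mono st by (auto simp: a_def b_def min_def max_def)
      then show ?thesis
        using increment_moments(1,2)[OF ab(1,2) _ bounded_at_integrable[OF ab(1) bd], of x] bd
        by (simp add: bounded_at_def)
    qed
  qed
  show "integrable (P x) (\<lambda>\<omega>. \<zeta> \<omega> * (elementary_integral B n r \<xi> t \<omega> - elementary_integral B n r \<xi> s \<omega>))"
    "(\<integral>\<omega>. \<zeta> \<omega> * (elementary_integral B n r \<xi> t \<omega> - elementary_integral B n r \<xi> s \<omega>) \<partial>P x) = 0"
    unfolding eq using D by (auto simp: Bochner_Integration.integral_sum intro!: Bochner_Integration.integrable_sum)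
qed

lemma elementary_integrable:
  assumes e: "elementary_integrand F n r \<xi>" and t: "0 \<le> t"
  shows "integrable (P x) (elementary_integral B n r \<xi> t)"
proof -
  have "(\<lambda>\<omega>. elementary_integral B n r \<xi> 0 \<omega>) = (\<lambda>_. 0)"
    using elementary_grid_nonneg[OF e] unfolding elementary_integral_def
    by (intro ext sum.neutral) (auto simp: min_def)
  moreover have "bounded_at 0 (\<lambda>_. 1)" unfolding bounded_at_def by auto
  ultimately show ?thesis using elementary_martingale(1)[OF e order_refl t, of "\<lambda>_. 1" x] by (simp add: fun_eq_iff)
qed

lemma sgn_process_measurable:
  "(\<lambda>(\<omega>, u). sgn (B (max 0 u) \<omega>)) \<in> borel_measurable (P x \<Otimes>\<^sub>M borel)"
proof -
  have "(\<lambda>(\<omega>, s). B (max 0 s) \<omega>) \<in> borel_measurable (P x \<Otimes>\<^sub>M borel)"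
    by (rule process_jointly_measurable) (auto intro: B_continuous)
  then show ?thesis by (simp add: case_prod_beta)
qed

lemma elementary_process_measurable:
  assumes e: "elementary_integrand F n r \<xi>"
  shows "(\<lambda>(\<omega>, u). elementary_process n r \<xi> u \<omega>) \<in> borel_measurable (P x \<Otimes>\<^sub>M borel)"
proof -
  have [measurable]: "\<xi> i \<in> borel_measurable (P x)" if "i \<in> {..<n}" for i
    using bounded_at_measurable_P[OF elementary_grid_nonneg[OF e] elementary_bounded_at[OF e]] that by auto
  have "(\<lambda>p. \<Sum>i<n. \<xi> i (fst p) * indicator {r i<..r (Suc i)} (snd p)) \<in> borel_measurable (P x \<Otimes>\<^sub>M borel)"
    by (intro borel_measurable_sum) simp
  then show ?thesis unfolding elementary_process_def by (simp add: case_prod_beta)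
qed

end

section \<open>Conditional means of Ito integrals and of the local time\<close>

context brownian_local_time
begin

text \<open>\<open>Jt\<close> and \<open>Js\<close> are given through unrelated approximating
  sequences. By the isometry, the sequence for \<open>t\<close>, integrated only up to
  \<open>s\<close>, comes close to the sequence for \<open>s\<close>, since both integrands
  approximate the same process on [0, s]. The martingale property of elementary integrals then
  passes to the limit in mean.\<close>

lemma Ito_remainder_martingale:
  assumes st: "0 \<le> s" "s \<le> t" and \<zeta>: "bounded_at s \<zeta>"
    and Jt: "has_Ito_integral (P x) F B (\<lambda>s \<omega>. sgn (B s \<omega>)) t Jt"
    and Js: "has_Ito_integral (P x) F B (\<lambda>s \<omega>. sgn (B s \<omega>)) s Js"
  shows "integrable (P x) Jt" "integrable (P x) Js"
    "(\<integral>\<omega>. \<zeta> \<omega> * (Jt \<omega> - Js \<omega>) \<partial>P x) = 0"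
proof -
  interpret prob_space "P x" by (rule prob_P)
  have t: "0 \<le> t" using st by simp
  obtain n r \<xi> where e: "\<And>k. elementary_integrand F (n k) (r k) (\<xi> k)"
    and lim1: "(\<lambda>k. \<integral>\<^sup>+\<omega>. (\<integral>\<^sup>+u\<in>{0..t}. ennreal ((elementary_process (n k) (r k) (\<xi> k) u \<omega> - sgn (B u \<omega>))\<^sup>2) \<partial>lborel) \<partial>P x) \<longlonglongrightarrow> 0"
    and lim2: "(\<lambda>k. \<integral>\<^sup>+\<omega>. ennreal ((elementary_integral B (n k) (r k) (\<xi> k) t \<omega> - Jt \<omega>)\<^sup>2) \<partial>P x) \<longlonglongrightarrow> 0"
    and [measurable]: "Jt \<in> borel_measurable (P x)"
    using Jt unfolding has_Ito_integral_def by blast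
  obtain n' r' \<xi>' where e': "\<And>k. elementary_integrand F (n' k) (r' k) (\<xi>' k)"
    and lim1': "(\<lambda>k. \<integral>\<^sup>+\<omega>. (\<integral>\<^sup>+u\<in>{0..s}. ennreal ((elementary_process (n' k) (r' k) (\<xi>' k) u \<omega> - sgn (B u \<omega>))\<^sup>2) \<partial>lborel) \<partial>P x) \<longlonglongrightarrow> 0"
    and lim2': "(\<lambda>k. \<integral>\<^sup>+\<omega>. ennreal ((elementary_integral B (n' k) (r' k) (\<xi>' k) s \<omega> - Js \<omega>)\<^sup>2) \<partial>P x) \<longlonglongrightarrow> 0"
    and [measurable]: "Js \<in> borel_measurable (P x)"
    using Js unfolding has_Ito_integral_def by blast
  define I where "I k v = elementary_integral B (n k) (r k) (\<xi> k) v" for k v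
  define I' where "I' k = elementary_integral B (n' k) (r' k) (\<xi>' k) s" for k
  have [measurable]: "0 \<le> v \<Longrightarrow> I k v \<in> borel_measurable (P x)" "I' k \<in> borel_measurable (P x)" for k v
    unfolding I_def I'_def using elementary_integral_measurable[OF e] elementary_integral_measurable[OF e' st(1)] by auto
  have [measurable]: "I k s \<in> borel_measurable (P x)" "I k t \<in> borel_measurable (P x)" for k
    using st t by simp_all
  have close: "(\<integral>\<^sup>+\<omega>. ennreal ((I k s \<omega> - I' k \<omega>)\<^sup>2) \<partial>P x)
    \<le> 2 * (\<integral>\<^sup>+\<omega>. (\<integral>\<^sup>+u\<in>{0..t}. ennreal ((elementary_process (n k) (r k) (\<xi> k) u \<omega> - sgn (B u \<omega>))\<^sup>2) \<partial>lborel) \<partial>P x)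
    + 2 * (\<integral>\<^sup>+\<omega>. (\<integral>\<^sup>+u\<in>{0..s}. ennreal ((elementary_process (n' k) (r' k) (\<xi>' k) u \<omega> - sgn (B u \<omega>))\<^sup>2) \<partial>lborel) \<partial>P x)" for k
  proof -
    note [measurable] = sgn_process_measurable[of x] elementary_process_measurable[OF e[of k], of x]
      elementary_process_measurable[OF e'[of k], of x]
    let ?H = "\<lambda>p. elementary_process (n k) (r k) (\<xi> k) (snd p) (fst p)"
    let ?H' = "\<lambda>p. elementary_process (n' k) (r' k) (\<xi>' k) (snd p) (fst p)"
    let ?S = "\<lambda>p. sgn (B (max 0 (snd p)) (fst p))"
    have [measurable]: "?H \<in> borel_measurable (P x \<Otimes>\<^sub>M lborel)" "?H' \<in> borel_measurable (P x \<Otimes>\<^sub>M lborel)"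
      "?S \<in> borel_measurable (P x \<Otimes>\<^sub>M lborel)"
      using sgn_process_measurable[of x] elementary_process_measurable[OF e[of k], of x]
      elementary_process_measurable[OF e'[of k], of x] by (simp_all add: case_prod_beta cong: measurable_cong_sets)
    have "(\<integral>\<^sup>+\<omega>. ennreal ((I k s \<omega> - I' k \<omega>)\<^sup>2) \<partial>P x)
      = (\<integral>\<^sup>+\<omega>. \<integral>\<^sup>+u. ennreal ((?H (\<omega>, u) - ?H' (\<omega>, u))\<^sup>2) * indicator {0..s} u \<partial>lborel \<partial>P x)"
      unfolding I_def I'_def using elementary_isometry_diff[OF e e' st(1)] by simp
    also have "\<dots> \<le> 2 * (\<integral>\<^sup>+\<omega>. \<integral>\<^sup>+u. ennreal ((?H (\<omega>, u) - ?S (\<omega>, u))\<^sup>2) * indicator {0..t} u \<partial>lborel \<partial>P x)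
        + 2 * (\<integral>\<^sup>+\<omega>. \<integral>\<^sup>+u. ennreal ((?H' (\<omega>, u) - ?S (\<omega>, u))\<^sup>2) * indicator {0..s} u \<partial>lborel \<partial>P x)"
    proof (rule nn_integral_iterated_triangle)
      show "sigma_finite_measure (lborel :: real measure)" ..
      fix \<omega> and u :: real
      have "(a - b)\<^sup>2 \<le> 2 * (a - c)\<^sup>2 + 2 * (b - c)\<^sup>2" for a b c :: real
      proof -
        have "0 \<le> (a + b - 2 * c)\<^sup>2" by simp
        then show ?thesis by (simp add: power2_eq_square algebra_simps)
      qed
      then have "ennreal ((elementary_process (n k) (r k) (\<xi> k) u \<omega> - elementary_process (n' k) (r' k) (\<xi>' k) u \<omega>)\<^sup>2)
        \<le> 2 * ennreal ((elementary_process (n k) (r k) (\<xi> k) u \<omega> - sgn (B (max 0 u) \<omega>))\<^sup>2)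
         + 2 * ennreal ((elementary_process (n' k) (r' k) (\<xi>' k) u \<omega> - sgn (B (max 0 u) \<omega>))\<^sup>2)"
        by (simp add: ennreal_leI flip: ennreal_plus ennreal_mult'[of 2, simplified])
      then show "ennreal ((?H (\<omega>, u) - ?H' (\<omega>, u))\<^sup>2) * indicator {0..s} u
        \<le> 2 * (ennreal ((?H (\<omega>, u) - ?S (\<omega>, u))\<^sup>2) * indicator {0..t} u)
         + 2 * (ennreal ((?H' (\<omega>, u) - ?S (\<omega>, u))\<^sup>2) * indicator {0..s} u)"
        using st by (auto split: split_indicator)
    qed measurable
    also have "(\<integral>\<^sup>+\<omega>. \<integral>\<^sup>+u. ennreal ((?H (\<omega>, u) - ?S (\<omega>, u))\<^sup>2) * indicator {0..t} u \<partial>lborel \<partial>P x)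
      = (\<integral>\<^sup>+\<omega>. (\<integral>\<^sup>+u\<in>{0..t}. ennreal ((elementary_process (n k) (r k) (\<xi> k) u \<omega> - sgn (B u \<omega>))\<^sup>2) \<partial>lborel) \<partial>P x)"
      by (intro nn_integral_cong) (auto split: split_indicator simp: max_def)
    also have "(\<integral>\<^sup>+\<omega>. \<integral>\<^sup>+u. ennreal ((?H' (\<omega>, u) - ?S (\<omega>, u))\<^sup>2) * indicator {0..s} u \<partial>lborel \<partial>P x)
      = (\<integral>\<^sup>+\<omega>. (\<integral>\<^sup>+u\<in>{0..s}. ennreal ((elementary_process (n' k) (r' k) (\<xi>' k) u \<omega> - sgn (B u \<omega>))\<^sup>2) \<partial>lborel) \<partial>P x)"
      by (intro nn_integral_cong) (auto split: split_indicator simp: max_def)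
    finally show ?thesis .
  qed
  have lim3: "(\<lambda>k. \<integral>\<^sup>+\<omega>. ennreal ((I k s \<omega> - I' k \<omega>)\<^sup>2) \<partial>P x) \<longlonglongrightarrow> 0"
  proof (rule tendsto_sandwich[OF _ always_eventually[OF allI[OF close]] tendsto_const])
    show "(\<lambda>k. 2 * (\<integral>\<^sup>+\<omega>. (\<integral>\<^sup>+u\<in>{0..t}. ennreal ((elementary_process (n k) (r k) (\<xi> k) u \<omega> - sgn (B u \<omega>))\<^sup>2) \<partial>lborel) \<partial>P x)
      + 2 * (\<integral>\<^sup>+\<omega>. (\<integral>\<^sup>+u\<in>{0..s}. ennreal ((elementary_process (n' k) (r' k) (\<xi>' k) u \<omega> - sgn (B u \<omega>))\<^sup>2) \<partial>lborel) \<partial>P x)) \<longlonglongrightarrow> 0"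
      using tendsto_add[OF ennreal_tendsto_cmult[OF _ lim1, of 2] ennreal_tendsto_cmult[OF _ lim1', of 2]] by simp
  qed simp
  have small: "\<exists>k. integrable (P x) (\<lambda>\<omega>. I k t \<omega> - Jt \<omega>) \<and> (\<integral>\<omega>. \<bar>I k t \<omega> - Jt \<omega>\<bar> \<partial>P x) \<le> 2 * \<delta> \<and>
      integrable (P x) (\<lambda>\<omega>. I' k \<omega> - Js \<omega>) \<and> (\<integral>\<omega>. \<bar>I' k \<omega> - Js \<omega>\<bar> \<partial>P x) \<le> 2 * \<delta> \<and>
      integrable (P x) (\<lambda>\<omega>. I k s \<omega> - I' k \<omega>) \<and> (\<integral>\<omega>. \<bar>I k s \<omega> - I' k \<omega>\<bar> \<partial>P x) \<le> 2 * \<delta>"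
    if \<delta>: "\<delta> > 0" for \<delta>
  proof -
    have "ennreal (\<delta>\<^sup>2) > 0" using \<delta> by simp
    then have "\<forall>\<^sub>F k in sequentially. (\<integral>\<^sup>+\<omega>. ennreal ((I k t \<omega> - Jt \<omega>)\<^sup>2) \<partial>P x) < ennreal (\<delta>\<^sup>2) \<and>
       (\<integral>\<^sup>+\<omega>. ennreal ((I' k \<omega> - Js \<omega>)\<^sup>2) \<partial>P x) < ennreal (\<delta>\<^sup>2) \<and>
       (\<integral>\<^sup>+\<omega>. ennreal ((I k s \<omega> - I' k \<omega>)\<^sup>2) \<partial>P x) < ennreal (\<delta>\<^sup>2)"
      using order_tendstoD(2)[OF lim2] order_tendstoD(2)[OF lim2'] order_tendstoD(2)[OF lim3]
      unfolding I_def[symmetric] I'_def[symmetric] by (intro eventually_conj) auto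
    then obtain k where k: "(\<integral>\<^sup>+\<omega>. ennreal ((I k t \<omega> - Jt \<omega>)\<^sup>2) \<partial>P x) < ennreal (\<delta>\<^sup>2)"
       "(\<integral>\<^sup>+\<omega>. ennreal ((I' k \<omega> - Js \<omega>)\<^sup>2) \<partial>P x) < ennreal (\<delta>\<^sup>2)"
       "(\<integral>\<^sup>+\<omega>. ennreal ((I k s \<omega> - I' k \<omega>)\<^sup>2) \<partial>P x) < ennreal (\<delta>\<^sup>2)"
      unfolding eventually_sequentially by blast
    show ?thesis
      using k[THEN less_imp_le] \<delta> by (intro exI[of _ k] conjI L1_le_L2) measurable
  qed
  have intI: "integrable (P x) (I k t)" "integrable (P x) (I k s)" "integrable (P x) (I' k)" for k
    unfolding I_def I'_def using elementary_integrable[OF e] elementary_integrable[OF e'] st t by auto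
  obtain k0 where k0: "integrable (P x) (\<lambda>\<omega>. I k0 t \<omega> - Jt \<omega>)" "integrable (P x) (\<lambda>\<omega>. I' k0 \<omega> - Js \<omega>)"
    using small[of 1] by auto
  have "integrable (P x) (\<lambda>\<omega>. I k0 t \<omega> - (I k0 t \<omega> - Jt \<omega>))" "integrable (P x) (\<lambda>\<omega>. I' k0 \<omega> - (I' k0 \<omega> - Js \<omega>))"
    by (intro Bochner_Integration.integrable_diff intI k0)+
  then show iJ: "integrable (P x) Jt" "integrable (P x) Js" by simp_all
  obtain K where K: "\<And>\<omega>. \<omega> \<in> space A \<Longrightarrow> \<bar>\<zeta> \<omega>\<bar> \<le> K" using \<zeta> unfolding bounded_at_def by blast
  have K0: "0 \<le> K" using K not_empty by fastforce
  have [measurable]: "\<zeta> \<in> borel_measurable (P x)" by (rule bounded_at_measurable_P[OF st(1) \<zeta>])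
  have int\<zeta>: "integrable (P x) (\<lambda>\<omega>. \<zeta> \<omega> * u \<omega>)" and abs\<zeta>: "\<bar>\<integral>\<omega>. \<zeta> \<omega> * u \<omega> \<partial>P x\<bar> \<le> K * (\<integral>\<omega>. \<bar>u \<omega>\<bar> \<partial>P x)"
    if u: "integrable (P x) u" for u
  proof -
    have [measurable]: "u \<in> borel_measurable (P x)" using u by simp
    have le: "\<bar>\<zeta> \<omega> * u \<omega>\<bar> \<le> K * \<bar>u \<omega>\<bar>" if "\<omega> \<in> space A" for \<omega>
      unfolding abs_mult using K[OF that] by (intro mult_right_mono) auto
    show i: "integrable (P x) (\<lambda>\<omega>. \<zeta> \<omega> * u \<omega>)"
      by (rule Bochner_Integration.integrable_bound[OF integrable_mult_right[OF integrable_abs[OF u], of K]])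
        (use le K0 in \<open>auto intro!: AE_I2\<close>)
    have "\<bar>\<integral>\<omega>. \<zeta> \<omega> * u \<omega> \<partial>P x\<bar> \<le> (\<integral>\<omega>. \<bar>\<zeta> \<omega> * u \<omega>\<bar> \<partial>P x)" by (rule integral_abs_bound)
    also have "\<dots> \<le> (\<integral>\<omega>. K * \<bar>u \<omega>\<bar> \<partial>P x)"
      using i u le by (intro integral_mono) auto
    finally show "\<bar>\<integral>\<omega>. \<zeta> \<omega> * u \<omega> \<partial>P x\<bar> \<le> K * (\<integral>\<omega>. \<bar>u \<omega>\<bar> \<partial>P x)" by simp
  qed
  have "\<bar>\<integral>\<omega>. \<zeta> \<omega> * (Jt \<omega> - Js \<omega>) \<partial>P x\<bar> \<le> 6 * K * \<delta>" if \<delta>: "\<delta> > 0" for \<delta>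
  proof -
    obtain k where k: "integrable (P x) (\<lambda>\<omega>. I k t \<omega> - Jt \<omega>)" "(\<integral>\<omega>. \<bar>I k t \<omega> - Jt \<omega>\<bar> \<partial>P x) \<le> 2 * \<delta>"
      "integrable (P x) (\<lambda>\<omega>. I' k \<omega> - Js \<omega>)" "(\<integral>\<omega>. \<bar>I' k \<omega> - Js \<omega>\<bar> \<partial>P x) \<le> 2 * \<delta>"
      "integrable (P x) (\<lambda>\<omega>. I k s \<omega> - I' k \<omega>)" "(\<integral>\<omega>. \<bar>I k s \<omega> - I' k \<omega>\<bar> \<partial>P x) \<le> 2 * \<delta>"
      using small[OF \<delta>] by blast
    have m: "integrable (P x) (\<lambda>\<omega>. \<zeta> \<omega> * (I k t \<omega> - I k s \<omega>))" "(\<integral>\<omega>. \<zeta> \<omega> * (I k t \<omega> - I k s \<omega>) \<partial>P x) = 0"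
      unfolding I_def by (rule elementary_martingale[OF e st \<zeta>])+
    \<comment> \<open>One martingale increment of the first sequence, plus three approximation
      errors. Each error has mean absolute value at most \<open>2 * \<delta>\<close>, whence the
      constant 6.\<close>
    have "(\<integral>\<omega>. \<zeta> \<omega> * (Jt \<omega> - Js \<omega>) \<partial>P x)
      = (\<integral>\<omega>. \<zeta> \<omega> * (I k t \<omega> - I k s \<omega>) - \<zeta> \<omega> * (I k t \<omega> - Jt \<omega>) + \<zeta> \<omega> * (I k s \<omega> - I' k \<omega>) + \<zeta> \<omega> * (I' k \<omega> - Js \<omega>) \<partial>P x)"
      by (intro Bochner_Integration.integral_cong refl) (simp add: algebra_simps)
    also have "\<dots> = - (\<integral>\<omega>. \<zeta> \<omega> * (I k t \<omega> - Jt \<omega>) \<partial>P x) + (\<integral>\<omega>. \<zeta> \<omega> * (I k s \<omega> - I' k \<omega>) \<partial>P x)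
        + (\<integral>\<omega>. \<zeta> \<omega> * (I' k \<omega> - Js \<omega>) \<partial>P x)"
      using m int\<zeta>[OF k(1)] int\<zeta>[OF k(3)] int\<zeta>[OF k(5)] by simp
    finally have eq: "(\<integral>\<omega>. \<zeta> \<omega> * (Jt \<omega> - Js \<omega>) \<partial>P x) = \<dots>" .
    have "\<bar>\<integral>\<omega>. \<zeta> \<omega> * (I k t \<omega> - Jt \<omega>) \<partial>P x\<bar> \<le> K * (2 * \<delta>)" "\<bar>\<integral>\<omega>. \<zeta> \<omega> * (I k s \<omega> - I' k \<omega>) \<partial>P x\<bar> \<le> K * (2 * \<delta>)"
      "\<bar>\<integral>\<omega>. \<zeta> \<omega> * (I' k \<omega> - Js \<omega>) \<partial>P x\<bar> \<le> K * (2 * \<delta>)"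
      using abs\<zeta>[OF k(1)] abs\<zeta>[OF k(3)] abs\<zeta>[OF k(5)] mult_left_mono[OF k(2) K0] mult_left_mono[OF k(4) K0]
        mult_left_mono[OF k(6) K0] by (meson order_trans)+
    then show ?thesis unfolding eq by linarith
  qed
  note * = this
  have "\<bar>\<integral>\<omega>. \<zeta> \<omega> * (Jt \<omega> - Js \<omega>) \<partial>P x\<bar> \<le> 0 + \<delta>" if "\<delta> > 0" for \<delta>
  proof -
    have "\<bar>\<integral>\<omega>. \<zeta> \<omega> * (Jt \<omega> - Js \<omega>) \<partial>P x\<bar> \<le> 6 * K * (\<delta> / (6 * K + 1))"
      using K0 that by (intro *) simp
    also have "\<dots> \<le> \<delta>" using K0 that by (simp add: field_simps)
    finally show ?thesis by simp
  qed
  then have "\<bar>\<integral>\<omega>. \<zeta> \<omega> * (Jt \<omega> - Js \<omega>) \<partial>P x\<bar> \<le> 0" by (rule field_le_epsilon)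
  then show "(\<integral>\<omega>. \<zeta> \<omega> * (Jt \<omega> - Js \<omega>) \<partial>P x) = 0" by simp
qed

lemma L_integrable: assumes "0 \<le> t" shows "integrable (P x) (L t)"
proof -
  interpret prob_space "P x" by (rule prob_P)
  obtain J where J: "has_Ito_integral (P x) F B (\<lambda>s \<omega>. sgn (B s \<omega>)) t J"
    and ae: "AE \<omega> in P x. \<bar>B t \<omega>\<bar> = \<bar>B 0 \<omega>\<bar> + J \<omega> + L t \<omega>"
    using Tanaka[OF assms] by blast
  have one: "bounded_at t (\<lambda>_. 1)" unfolding bounded_at_def by auto
  have iJ: "integrable (P x) J" by (rule Ito_remainder_martingale(1)[OF assms order_refl one J J])
  have iB: "integrable (P x) (\<lambda>\<omega>. 1 * (\<bar>B t \<omega>\<bar> - \<bar>B 0 \<omega>\<bar>))"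
    by (rule increment_moments(5)[OF order_refl assms borel_measurable_const integrable_const])
  have "L t \<in> borel_measurable (P x)" by (rule measurable_F_P[OF assms L_adapted[OF assms]])
  moreover have "integrable (P x) (\<lambda>\<omega>. 1 * (\<bar>B t \<omega>\<bar> - \<bar>B 0 \<omega>\<bar>) - J \<omega>)"
    by (rule Bochner_Integration.integrable_diff[OF iB iJ])
  moreover have "AE \<omega> in P x. 1 * (\<bar>B t \<omega>\<bar> - \<bar>B 0 \<omega>\<bar>) - J \<omega> = L t \<omega>" using ae by auto
  ultimately show ?thesis by (blast intro: integrable_cong_AE_imp)
qed

text \<open>By Tanaka's formula the increment of \<open>L\<close> is the increment of |B| minus an
  Ito increment of conditional mean zero, and freezing the past turns the increment of |B| into
  \<open>abs_drift\<close>. All later knowledge of how \<open>L\<close> depends on \<open>B\<close>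
  is drawn from this identity.\<close>

lemma local_time_compensator:
  assumes st: "0 \<le> s" "s \<le> t" and \<zeta>: "bounded_at s \<zeta>"
  shows "integrable (P x) (\<lambda>\<omega>. \<zeta> \<omega> * (L t \<omega> - L s \<omega>))"
    and "(\<integral>\<omega>. \<zeta> \<omega> * (L t \<omega> - L s \<omega>) \<partial>P x) = (\<integral>\<omega>. \<zeta> \<omega> * abs_drift (t - s) (B s \<omega>) \<partial>P x)"
proof -
  interpret prob_space "P x" by (rule prob_P)
  have t: "0 \<le> t" using st by simp
  have [measurable]: "\<zeta> \<in> borel_measurable (P x)" by (rule bounded_at_measurable_P[OF st(1) \<zeta>])
  obtain K where K: "\<And>\<omega>. \<omega> \<in> space A \<Longrightarrow> \<bar>\<zeta> \<omega>\<bar> \<le> K" using \<zeta> unfolding bounded_at_def by blast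
  have int\<zeta>: "integrable (P x) (\<lambda>\<omega>. \<zeta> \<omega> * u \<omega>)" if u: "integrable (P x) u" for u
  proof (rule Bochner_Integration.integrable_bound[OF integrable_mult_right[OF u, of K]])
    show "AE \<omega> in P x. norm (\<zeta> \<omega> * u \<omega>) \<le> norm (K * u \<omega>)"
    proof (rule AE_I2)
      fix \<omega> assume "\<omega> \<in> space (P x)"
      then have "\<bar>\<zeta> \<omega>\<bar> \<le> \<bar>K\<bar>" using K[of \<omega>] by simp
      then show "norm (\<zeta> \<omega> * u \<omega>) \<le> norm (K * u \<omega>)" by (simp add: abs_mult mult_right_mono)
    qed
  qed (use u in measurable)
  have iL: "integrable (P x) (\<lambda>\<omega>. L t \<omega> - L s \<omega>)"
    by (intro Bochner_Integration.integrable_diff L_integrable st t)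
  show "integrable (P x) (\<lambda>\<omega>. \<zeta> \<omega> * (L t \<omega> - L s \<omega>))" by (rule int\<zeta>[OF iL])
  obtain Jt where Jt: "has_Ito_integral (P x) F B (\<lambda>s \<omega>. sgn (B s \<omega>)) t Jt"
    and aet: "AE \<omega> in P x. \<bar>B t \<omega>\<bar> = \<bar>B 0 \<omega>\<bar> + Jt \<omega> + L t \<omega>"
    using Tanaka[OF t] by blast
  obtain Js where Js: "has_Ito_integral (P x) F B (\<lambda>s \<omega>. sgn (B s \<omega>)) s Js"
    and aes: "AE \<omega> in P x. \<bar>B s \<omega>\<bar> = \<bar>B 0 \<omega>\<bar> + Js \<omega> + L s \<omega>"
    using Tanaka[OF st(1)] by blast
  note J = Ito_remainder_martingale[OF st \<zeta> Jt Js]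
  have iB: "integrable (P x) (\<lambda>\<omega>. \<zeta> \<omega> * (\<bar>B t \<omega>\<bar> - \<bar>B s \<omega>\<bar>))"
    "(\<integral>\<omega>. \<zeta> \<omega> * (\<bar>B t \<omega>\<bar> - \<bar>B s \<omega>\<bar>) \<partial>P x) = (\<integral>\<omega>. \<zeta> \<omega> * abs_drift (t - s) (B s \<omega>) \<partial>P x)"
    using increment_moments(5,6)[OF st _ bounded_at_integrable[OF st(1) \<zeta>]] \<zeta> by (auto simp: bounded_at_def)
  have "(\<integral>\<omega>. \<zeta> \<omega> * (L t \<omega> - L s \<omega>) \<partial>P x) = (\<integral>\<omega>. \<zeta> \<omega> * (\<bar>B t \<omega>\<bar> - \<bar>B s \<omega>\<bar>) - \<zeta> \<omega> * (Jt \<omega> - Js \<omega>) \<partial>P x)"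
  proof (rule integral_cong_AE)
    show "AE \<omega> in P x. \<zeta> \<omega> * (L t \<omega> - L s \<omega>) = \<zeta> \<omega> * (\<bar>B t \<omega>\<bar> - \<bar>B s \<omega>\<bar>) - \<zeta> \<omega> * (Jt \<omega> - Js \<omega>)"
      using aet aes by eventually_elim (simp add: algebra_simps)
    show "(\<lambda>\<omega>. \<zeta> \<omega> * (L t \<omega> - L s \<omega>)) \<in> borel_measurable (P x)"
      by (rule borel_measurable_integrable[OF int\<zeta>[OF iL]])
    show "(\<lambda>\<omega>. \<zeta> \<omega> * (\<bar>B t \<omega>\<bar> - \<bar>B s \<omega>\<bar>) - \<zeta> \<omega> * (Jt \<omega> - Js \<omega>)) \<in> borel_measurable (P x)"
      by (intro borel_measurable_integrable Bochner_Integration.integrable_diff iB int\<zeta> J)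
  qed
  also have "\<dots> = (\<integral>\<omega>. \<zeta> \<omega> * abs_drift (t - s) (B s \<omega>) \<partial>P x)"
    using iB J(3) int\<zeta>[OF Bochner_Integration.integrable_diff[OF J(1,2)]] by simp
  finally show "(\<integral>\<omega>. \<zeta> \<omega> * (L t \<omega> - L s \<omega>) \<partial>P x) = (\<integral>\<omega>. \<zeta> \<omega> * abs_drift (t - s) (B s \<omega>) \<partial>P x)" .
qed

end

section \<open>Martingale property up to the time change\<close>

lemma abs_drift_le: assumes "0 \<le> h" shows "abs_drift h y \<le> sqrt h * abs_moment 1"
proof -
  have [simp]: "integrable std_normal_distribution (\<lambda>z. \<bar>y + sqrt h * z\<bar>)"
    by (intro integrable_abs) simp
  have "abs_drift h y = (\<integral>z. \<bar>y + sqrt h * z\<bar> - \<bar>y\<bar> \<partial>std_normal_distribution)"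
    by (simp add: abs_drift_def)
  also have "\<dots> \<le> (\<integral>z. sqrt h * \<bar>z\<bar> \<partial>std_normal_distribution)"
  proof (intro integral_mono)
    show "\<bar>y + sqrt h * z\<bar> - \<bar>y\<bar> \<le> sqrt h * \<bar>z\<bar>" for z
      using abs_triangle_ineq[of y "sqrt h * z"] assms by (simp add: abs_mult)
  qed auto
  finally show ?thesis by simp
qed

text \<open>As \<open>heat\<close> integrates against one fixed normal law, joint continuity in time
  and space, time 0 included, is a matter of bounded convergence.\<close>

lemma (in smooth_fun) heat_tendsto:
  assumes "r \<longlonglongrightarrow> r0" "y \<longlonglongrightarrow> y0"
  shows "(\<lambda>n. heat (r n) f (y n)) \<longlonglongrightarrow> heat r0 f y0"
  unfolding heat_def
proof (rule integral_dominated_convergence[where w = "\<lambda>_. K"])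
  have "isCont f v" for v using der0 DERIV_isCont by blast
  then have "(\<lambda>n. f (y n + sqrt (r n) * z)) \<longlonglongrightarrow> f (y0 + sqrt r0 * z)" for z
    by (rule isCont_tendsto_compose) (intro tendsto_intros assms)
  then show "AE z in std_normal_distribution. (\<lambda>n. f (y n + sqrt (r n) * z)) \<longlonglongrightarrow> f (y0 + sqrt r0 * z)"
    by simp
qed (use bound0 in auto)

text \<open>Discrete stopping: the condition \<open>E\<close> is downward closed, so the selected
  increments form an initial segment and telescope to the value at the first index where
  \<open>E\<close> fails.\<close>

lemma telescope_until_exit:
  fixes N :: "nat \<Rightarrow> real"
  assumes anti: "\<And>i j. i \<le> j \<Longrightarrow> E j \<Longrightarrow> E i" and last: "\<not> E n"
  shows "\<exists>m. m \<le> n \<and> \<not> E m \<and> (\<forall>i<m. E i) \<and>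
    N 0 + (\<Sum>i<n. (if E i then 1 else 0) * (N (Suc i) - N i)) = N m"
proof -
  define m where "m = (LEAST i. \<not> E i)"
  have m: "\<not> E m" "\<And>i. i < m \<Longrightarrow> E i" "m \<le> n"
    unfolding m_def using last LeastI[of "\<lambda>i. \<not> E i" n] by (auto intro: Least_le dest: not_less_Least)
  have "(\<Sum>i<n. (if E i then 1 else 0) * (N (Suc i) - N i)) = (\<Sum>i<m. N (Suc i) - N i)"
    using m anti by (intro sum.mono_neutral_cong_right) (auto simp: not_less)
  then show ?thesis using m by (intro exI[of _ m]) (simp add: sum_lessThan_telescope)
qed

section \<open>The clock and its inverse\<close>

context brownian_local_time
begin

lemma L_measurable_P: "0 \<le> t \<Longrightarrow> L t \<in> borel_measurable (P x)"
  using L_adapted measurable_F_P by blast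

lemma L_measurable_A: "0 \<le> t \<Longrightarrow> L t \<in> borel_measurable A"
  using L_adapted measurable_F_A by blast

lemma L_le: "\<omega> \<in> space A \<Longrightarrow> 0 \<le> s \<Longrightarrow> s \<le> t \<Longrightarrow> L s \<omega> \<le> L t \<omega>"
  using L_mono unfolding mono_on_def by auto

lemma L_nonneg: "\<omega> \<in> space A \<Longrightarrow> 0 \<le> t \<Longrightarrow> 0 \<le> L t \<omega>"
  using L_le[of \<omega> 0 t] L_zero by simp

lemma clock_strict_mono:
  assumes "0 < \<gamma>" "\<omega> \<in> space A" "0 \<le> u"
  shows "u < v \<Longrightarrow> u + \<gamma> * L u \<omega> < v + \<gamma> * L v \<omega>"
    and "u \<le> v \<Longrightarrow> u + \<gamma> * L u \<omega> \<le> v + \<gamma> * L v \<omega>"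
  using L_le[OF assms(2,3)] assms(1) by (auto intro!: add_less_le_mono add_mono mult_left_mono)

text \<open>\<open>the_inv_into\<close> is meaningful only on the range of the clock. The clock
  starts at 0 and is at least \<open>T\<close> at time \<open>T\<close>, so the intermediate value
  theorem puts \<open>T\<close> into the range. The last claim allows comparisons with the inverse
  to be read off from the clock itself.\<close>

lemma time_change:
  assumes \<gamma>: "0 < \<gamma>" and \<omega>: "\<omega> \<in> space A" and T: "0 \<le> T"
  shows "0 \<le> time_change L \<gamma> T \<omega>" "time_change L \<gamma> T \<omega> \<le> T"
    and "time_change L \<gamma> T \<omega> + \<gamma> * L (time_change L \<gamma> T \<omega>) \<omega> = T"
    and "\<And>u. 0 \<le> u \<Longrightarrow> u + \<gamma> * L u \<omega> < T \<longleftrightarrow> u < time_change L \<gamma> T \<omega>"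
proof -
  let ?\<sigma> = "\<lambda>u. u + \<gamma> * L u \<omega>"
  have inj: "inj_on ?\<sigma> {0..}"
    using clock_strict_mono(1)[OF \<gamma> \<omega>] by (intro inj_onI) (metis atLeast_iff less_irrefl linorder_neqE)
  have "continuous_on {0..T} ?\<sigma>"
    using L_continuous[OF \<omega>] by (intro continuous_intros) (auto intro: continuous_on_subset)
  then have "\<exists>u\<ge>0. u \<le> T \<and> ?\<sigma> u = T"
    using T \<gamma> L_nonneg[OF \<omega> T] L_zero[OF \<omega>] by (intro IVT') auto
  then have "T \<in> ?\<sigma> ` {0..}" by force
  then have *: "0 \<le> time_change L \<gamma> T \<omega>" "?\<sigma> (time_change L \<gamma> T \<omega>) = T"
    unfolding time_change_def using the_inv_into_into[OF inj, of T "{0..}"] f_the_inv_into_f[OF inj, of T] by auto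
  show "0 \<le> time_change L \<gamma> T \<omega>" "?\<sigma> (time_change L \<gamma> T \<omega>) = T" by fact+
  show "time_change L \<gamma> T \<omega> \<le> T"
    using * \<gamma> L_nonneg[OF \<omega>, of "time_change L \<gamma> T \<omega>"] by (smt (verit) mult_nonneg_nonneg)
  show "?\<sigma> u < T \<longleftrightarrow> u < time_change L \<gamma> T \<omega>" if "0 \<le> u" for u
    using clock_strict_mono[OF \<gamma> \<omega> that, of "time_change L \<gamma> T \<omega>"]
      clock_strict_mono(2)[OF \<gamma> \<omega> *(1), of u] *(2) by (smt (verit))
qed

text \<open>The inverse is below \<open>a\<close> exactly when the clock at the fixed time
  \<open>a\<close> has passed \<open>T\<close>.\<close>

lemma time_change_measurable:
  assumes "0 < \<gamma>" "0 \<le> T" shows "time_change L \<gamma> T \<in> borel_measurable A"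
proof (rule borel_measurable_iff_less[THEN iffD2], safe)
  fix a :: real
  show "{\<omega> \<in> space A. time_change L \<gamma> T \<omega> < a} \<in> sets A"
  proof (cases "0 < a")
    case True
    have "(\<lambda>\<omega>. a + \<gamma> * L a \<omega>) \<in> borel_measurable A" using L_measurable_A[of a] True by simp
    then have "{\<omega> \<in> space A. T < a + \<gamma> * L a \<omega>} \<in> sets A" by measurable
    moreover have "{\<omega> \<in> space A. time_change L \<gamma> T \<omega> < a} = {\<omega> \<in> space A. T < a + \<gamma> * L a \<omega>}"
    proof -
      have "time_change L \<gamma> T \<omega> < a \<longleftrightarrow> T < a + \<gamma> * L a \<omega>" if \<omega>: "\<omega> \<in> space A" for \<omega>
        using time_change[OF assms(1) \<omega> assms(2)] True
          clock_strict_mono[OF assms(1) \<omega>, of "time_change L \<gamma> T \<omega>" a]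
          clock_strict_mono[OF assms(1) \<omega>, of a "time_change L \<gamma> T \<omega>"] by (smt (verit))
      then show ?thesis by auto
    qed
    ultimately show ?thesis by simp
  next
    case False
    then have "{\<omega> \<in> space A. time_change L \<gamma> T \<omega> < a} = {}"
      using time_change(1)[OF assms(1) _ assms(2)] by force
    then show ?thesis by (simp only: sets.empty_sets)
  qed
qed

lemma sticky_measurable:
  assumes "0 < \<gamma>" "0 \<le> T"
  shows "sticky_bm B L \<gamma> T \<in> borel_measurable A" "sticky_local_time L \<gamma> T \<in> borel_measurable A"
proof -
  note [measurable] = time_change_measurable[OF assms]
  have "(\<lambda>(\<omega>, s). B (max 0 s) \<omega>) \<in> borel_measurable (A \<Otimes>\<^sub>M borel)"
    by (rule process_jointly_measurable) (auto intro: B_continuous)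
  from measurable_compose[OF _ this, of "\<lambda>\<omega>. (\<omega>, time_change L \<gamma> T \<omega>)" A]
  have "(\<lambda>\<omega>. \<bar>B (max 0 (time_change L \<gamma> T \<omega>)) \<omega>\<bar>) \<in> borel_measurable A" by simp
  then show "sticky_bm B L \<gamma> T \<in> borel_measurable A"
    by (rule measurable_cong[THEN iffD1, rotated]) (simp add: sticky_bm_def time_change[OF assms(1) _ assms(2)])
  have "(\<lambda>(\<omega>, s). L (max 0 s) \<omega>) \<in> borel_measurable (A \<Otimes>\<^sub>M borel)"
    by (rule process_jointly_measurable) (auto intro: L_continuous L_measurable_A)
  from measurable_compose[OF _ this, of "\<lambda>\<omega>. (\<omega>, time_change L \<gamma> T \<omega>)" A]
  have "(\<lambda>\<omega>. L (max 0 (time_change L \<gamma> T \<omega>)) \<omega>) \<in> borel_measurable A" by simp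
  then show "sticky_local_time L \<gamma> T \<in> borel_measurable A"
    by (rule measurable_cong[THEN iffD1, rotated]) (simp add: sticky_local_time_def time_change[OF assms(1) _ assms(2)])
qed

end

section \<open>One time step of the verification process\<close>

locale sticky_verification = brownian_local_time A P F B \<theta> L + boundary_fun f f1 f2 K \<beta> \<gamma>
  for A :: "'a measure" and P F B \<theta> L f f1 f2 K \<beta> \<gamma> +
  fixes x T \<epsilon> :: real
  assumes x: "0 \<le> x" and T: "0 < T" and \<epsilon>: "0 < \<epsilon>"
begin

interpretation Px: prob_space "P x" by (rule prob_P)

lemma prob_space_A [simp]: "measure (P x) (space A) = 1"
  using Px.prob_space by simp

text \<open>The shift by \<open>\<epsilon>\<close> keeps the heat flow away from time \<open>0\<close>, where the estimate \<open>heat_step\<close> is not uniform.\<close>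

definition verif :: "real \<Rightarrow> 'a \<Rightarrow> real" where
  "verif s \<omega> = heat (max 0 (T + \<epsilon> - (s + \<gamma> * L s \<omega>))) f \<bar>B s \<omega>\<bar> * exp (- \<beta> * L s \<omega>)"

text \<open>The threshold is a full step \<open>h\<close>, not 0: while it is respected, the
  remaining time is still at least \<open>\<epsilon>\<close> after the deterministic part
  \<open>h\<close> of the step has been used up, as \<open>heat_step\<close> requires.\<close>

definition alive :: "real \<Rightarrow> real \<Rightarrow> 'a \<Rightarrow> real" where
  "alive h s \<omega> = (if h \<le> T - (s + \<gamma> * L s \<omega>) then 1 else 0)"

lemma verif_measurable: "0 \<le> s \<Longrightarrow> verif s \<in> borel_measurable (P x)"
proof -
  assume "0 \<le> s"
  then have [measurable]: "L s \<in> borel_measurable (P x)" "B s \<in> borel_measurable (P x)"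
    by (auto intro: L_measurable_P)
  show ?thesis unfolding verif_def[abs_def] by measurable
qed

lemma verif_bound: "\<omega> \<in> space A \<Longrightarrow> 0 \<le> s \<Longrightarrow> \<bar>verif s \<omega>\<bar> \<le> K"
proof -
  assume \<omega>: "\<omega> \<in> space A" and "0 \<le> s"
  then have "0 \<le> \<beta> * L s \<omega>" using L_nonneg \<beta> by simp
  then have "\<bar>verif s \<omega>\<bar> \<le> K * 1"
    unfolding verif_def abs_mult using K_nonneg by (intro mult_mono abs_heat_le[OF meas(1) bound0]) auto
  then show ?thesis by simp
qed

lemma verif_integrable: "0 \<le> s \<Longrightarrow> integrable (P x) (verif s)"
  by (intro Px.integrable_const_bound[where B = K] verif_measurable AE_I2) (auto simp: verif_bound)

lemma alive_measurable: "0 \<le> s \<Longrightarrow> alive h s \<in> borel_measurable (P x)"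
proof -
  assume "0 \<le> s"
  then have [measurable]: "L s \<in> borel_measurable (P x)" by (rule L_measurable_P)
  show ?thesis unfolding alive_def[abs_def] by measurable
qed

definition local_error :: "real \<Rightarrow> real \<Rightarrow> 'a \<Rightarrow> real" where
  "local_error s t \<omega> = (L t \<omega> - L s \<omega>) * (min 1 (sqrt (L t \<omega> - L s \<omega>)) + min 1 \<bar>B t \<omega>\<bar>)"

lemma local_error_integrable: assumes "0 \<le> s" "s \<le> t" shows "integrable (P x) (local_error s t)"
proof -
  have t: "0 \<le> t" using assms by simp
  have [measurable]: "L s \<in> borel_measurable (P x)" "L t \<in> borel_measurable (P x)" "B t \<in> borel_measurable (P x)"
    using assms t by (auto intro: L_measurable_P)
  show ?thesis
  proof (rule Bochner_Integration.integrable_bound)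
    show "integrable (P x) (\<lambda>\<omega>. 2 * (L t \<omega> - L s \<omega>))"
      using L_integrable assms t by auto
    show "AE \<omega> in P x. norm (local_error s t \<omega>) \<le> norm (2 * (L t \<omega> - L s \<omega>))"
    proof (rule AE_I2)
      fix \<omega> assume "\<omega> \<in> space (P x)"
      then have d: "0 \<le> L t \<omega> - L s \<omega>" using L_le assms by simp
      have "(L t \<omega> - L s \<omega>) * (min 1 (sqrt (L t \<omega> - L s \<omega>)) + min 1 \<bar>B t \<omega>\<bar>) \<le> (L t \<omega> - L s \<omega>) * 2"
        using d by (intro mult_left_mono) auto
      moreover have "0 \<le> (L t \<omega> - L s \<omega>) * (min 1 (sqrt (L t \<omega> - L s \<omega>)) + min 1 \<bar>B t \<omega>\<bar>)"
        using d by (intro mult_nonneg_nonneg) auto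
      ultimately show "norm (local_error s t \<omega>) \<le> norm (2 * (L t \<omega> - L s \<omega>))"
        using d unfolding local_error_def by simp
    qed
  qed (unfold local_error_def[abs_def], measurable)
qed

text \<open>The step is taken in two moves. First \<open>B\<close> moves while the clock gains only
  \<open>h\<close>: by \<open>heat_abs_step\<close> the mean change is the slope \<open>W\<close> at
  0 times \<open>abs_drift\<close>. Then the local time increment \<open>d\<close> acts at the new
  position: by \<open>heat_step\<close> the change is \<open>- d * W\<close>. The compensator
  identity makes the two means equal and opposite.\<close>

lemma one_step:
  assumes s: "0 \<le> s" and h: "0 < h" and C0: "C \<ge> 0"
    and C: "\<And>\<rho> d y. \<epsilon> \<le> \<rho> \<Longrightarrow> 0 \<le> d \<Longrightarrow> 0 \<le> y \<Longrightarrow>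
    \<bar>heat (max 0 (\<rho> - \<gamma> * d)) f y * exp (- \<beta> * d) - heat \<rho> f y + d * heat \<rho> f1 0\<bar>
      \<le> C * d * (min 1 (sqrt d) + min 1 y)"
  shows "\<bar>\<integral>\<omega>. alive h s \<omega> * (verif (s + h) \<omega> - verif s \<omega>) \<partial>P x\<bar>
    \<le> C * (\<integral>\<omega>. local_error s (s + h) \<omega> \<partial>P x) + 2 * K * abs_moment 3 * (h * sqrt h)"
proof -
  let ?t = "s + h"
  have t: "0 \<le> ?t" "s \<le> ?t" using s h by auto
  note mF[measurable] = B_adapted[OF s] L_adapted[OF s]
  note mP[measurable] = B_measurable_P[OF s, of x] B_measurable_P[OF t(1), of x] L_measurable_P[OF s, of x] L_measurable_P[OF t(1), of x]
    alive_measurable[OF s, of h] verif_measurable[OF s] verif_measurable[OF t(1)]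
  \<comment> \<open>\<open>\<rho>\<close> is the remaining time after the step if no local time were
    gained. It is known at time \<open>s\<close>, so the slope \<open>W\<close> is an admissible
    multiplier for the compensator.\<close>
  define \<rho> where "\<rho> \<omega> = max 0 (T + \<epsilon> - (s + \<gamma> * L s \<omega>) - h)" for \<omega>
  define G where "G \<omega> = alive h s \<omega> * exp (- \<beta> * L s \<omega>)" for \<omega>
  define d where "d \<omega> = L ?t \<omega> - L s \<omega>" for \<omega>
  define W where "W \<omega> = heat (\<rho> \<omega>) f1 0" for \<omega>
  have [measurable]: "\<rho> \<in> borel_measurable (F s)" "G \<in> borel_measurable (F s)"
    unfolding \<rho>_def G_def alive_def by measurable
  then have [measurable]: "W \<in> borel_measurable (F s)" unfolding W_def by measurable
  have mP2[measurable]: "\<rho> \<in> borel_measurable (P x)" "G \<in> borel_measurable (P x)" "W \<in> borel_measurable (P x)"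
    by (rule measurable_F_P[OF s]; measurable)+
  have G: "0 \<le> G \<omega>" "G \<omega> \<le> 1" if "\<omega> \<in> space A" for \<omega>
  proof -
    have "0 \<le> \<beta> * L s \<omega>" using L_nonneg[OF that s] \<beta> by simp
    then show "0 \<le> G \<omega>" "G \<omega> \<le> 1" by (auto simp: G_def alive_def)
  qed
  have d0: "0 \<le> d \<omega>" if "\<omega> \<in> space A" for \<omega> using L_le[OF that s t(2)] by (simp add: d_def)
  have W: "\<bar>W \<omega>\<bar> \<le> K" for \<omega> unfolding W_def by (rule abs_heat_le[OF meas(2) bound1])
  have hb: "\<bar>heat r f y\<bar> \<le> K" for r y by (rule abs_heat_le[OF meas(1) bound0])
  have bnd: "integrable (P x) u" if [measurable]: "u \<in> borel_measurable (P x)" and "\<And>\<omega>. \<omega> \<in> space A \<Longrightarrow> \<bar>u \<omega>\<bar> \<le> c" for u :: "'a \<Rightarrow> real" and c :: real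
    using that(2) by (intro Px.integrable_const_bound[where B = c] AE_I2) auto
  have Gh: "\<bar>G \<omega> * u\<bar> \<le> K" if "\<omega> \<in> space A" "\<bar>u\<bar> \<le> K" for \<omega> u
    using G[OF that(1)] that(2) K_nonneg mult_mono[of "\<bar>G \<omega>\<bar>" 1 "\<bar>u\<bar>" K] by (simp add: abs_mult)
  let ?S1 = "\<lambda>\<omega>. G \<omega> * (heat (max 0 (\<rho> \<omega> - \<gamma> * d \<omega>)) f \<bar>B ?t \<omega>\<bar> * exp (- \<beta> * d \<omega>) - heat (\<rho> \<omega>) f \<bar>B ?t \<omega>\<bar> + d \<omega> * W \<omega>)"
  let ?S2 = "\<lambda>\<omega>. G \<omega> * heat (\<rho> \<omega>) f \<bar>B ?t \<omega>\<bar>"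
  let ?S3 = "\<lambda>\<omega>. G \<omega> * heat (\<rho> \<omega> + h) f \<bar>B s \<omega>\<bar>"
  let ?S4 = "\<lambda>\<omega>. G \<omega> * W \<omega> * d \<omega>"
  have dmeas[measurable]: "d \<in> borel_measurable (P x)" unfolding d_def by measurable
  have i2: "integrable (P x) ?S2" "integrable (P x) ?S3"
    by (rule bnd[of _ K]; (rule Gh, assumption, rule hb | measurable))+
  have GW: "bounded_at s (\<lambda>\<omega>. G \<omega> * W \<omega>)"
    unfolding bounded_at_def using Gh[OF _ W] by (intro conjI exI[of _ K]) auto
  have i4: "integrable (P x) ?S4" "(\<integral>\<omega>. ?S4 \<omega> \<partial>P x) = (\<integral>\<omega>. G \<omega> * W \<omega> * abs_drift h (B s \<omega>) \<partial>P x)"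
    using local_time_compensator[OF s t(2) GW, of x] by (simp_all add: d_def)
  have S1: "\<bar>?S1 \<omega>\<bar> \<le> C * local_error s ?t \<omega>" if \<omega>: "\<omega> \<in> space A" for \<omega>
  proof (cases "h \<le> T - (s + \<gamma> * L s \<omega>)")
    case True
    then have "\<epsilon> \<le> \<rho> \<omega>" by (auto simp: \<rho>_def)
    from C[OF this d0[OF \<omega>], of "\<bar>B ?t \<omega>\<bar>"]
    have "\<bar>heat (max 0 (\<rho> \<omega> - \<gamma> * d \<omega>)) f \<bar>B ?t \<omega>\<bar> * exp (- \<beta> * d \<omega>) - heat (\<rho> \<omega>) f \<bar>B ?t \<omega>\<bar> + d \<omega> * W \<omega>\<bar>
      \<le> C * local_error s ?t \<omega>"
      by (simp add: W_def local_error_def d_def mult.assoc)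
    then show ?thesis
      unfolding abs_mult[of "G \<omega>"] using G[OF \<omega>] mult_mono[of "\<bar>G \<omega>\<bar>" 1] by fastforce
  next
    case False
    have "0 \<le> local_error s ?t \<omega>"
      using d0[OF \<omega>] unfolding local_error_def d_def by (intro mult_nonneg_nonneg) auto
    then show ?thesis using False C0 by (simp add: G_def alive_def)
  qed
  have i1: "integrable (P x) ?S1"
    by (rule Bochner_Integration.integrable_bound[OF integrable_mult_right[OF local_error_integrable[OF s t(2)], of C]])
      (measurable, use S1 in \<open>fastforce intro!: AE_I2\<close>)
  have "(\<integral>\<omega>. alive h s \<omega> * (verif ?t \<omega> - verif s \<omega>) \<partial>P x) = (\<integral>\<omega>. ?S1 \<omega> + ?S2 \<omega> - ?S3 \<omega> - ?S4 \<omega> \<partial>P x)"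
  proof (intro Bochner_Integration.integral_cong refl)
    fix \<omega> assume "\<omega> \<in> space (P x)"
    show "alive h s \<omega> * (verif ?t \<omega> - verif s \<omega>) = ?S1 \<omega> + ?S2 \<omega> - ?S3 \<omega> - ?S4 \<omega>"
    proof (cases "h \<le> T - (s + \<gamma> * L s \<omega>)")
      case True
      then have "max 0 (T + \<epsilon> - (s + \<gamma> * L s \<omega>)) = \<rho> \<omega> + h"
        "max 0 (T + \<epsilon> - (?t + \<gamma> * L ?t \<omega>)) = max 0 (\<rho> \<omega> - \<gamma> * d \<omega>)"
        using h \<epsilon> by (auto simp: \<rho>_def d_def algebra_simps)
      moreover have "exp (- \<beta> * L ?t \<omega>) = exp (- \<beta> * L s \<omega>) * exp (- \<beta> * d \<omega>)"
        by (simp add: d_def algebra_simps flip: exp_add)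
      ultimately show ?thesis unfolding verif_def by (simp add: G_def algebra_simps)
    qed (simp add: G_def alive_def)
  qed
  also have "\<dots> = (\<integral>\<omega>. ?S1 \<omega> \<partial>P x) + ((\<integral>\<omega>. ?S2 \<omega> \<partial>P x) - (\<integral>\<omega>. ?S3 \<omega> \<partial>P x) - (\<integral>\<omega>. ?S4 \<omega> \<partial>P x))"
    using i1 i2 i4 by simp
  finally have eq: "(\<integral>\<omega>. alive h s \<omega> * (verif ?t \<omega> - verif s \<omega>) \<partial>P x) = \<dots>" .
  have b1: "\<bar>\<integral>\<omega>. ?S1 \<omega> \<partial>P x\<bar> \<le> C * (\<integral>\<omega>. local_error s ?t \<omega> \<partial>P x)"
  proof -
    have "\<bar>\<integral>\<omega>. ?S1 \<omega> \<partial>P x\<bar> \<le> (\<integral>\<omega>. \<bar>?S1 \<omega>\<bar> \<partial>P x)" by (rule integral_abs_bound)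
    also have "\<dots> \<le> (\<integral>\<omega>. C * local_error s ?t \<omega> \<partial>P x)"
      using S1 local_error_integrable[OF s t(2)] by (intro integral_mono integrable_abs i1) auto
    finally show ?thesis by simp
  qed
  have b2: "\<bar>(\<integral>\<omega>. ?S2 \<omega> \<partial>P x) - (\<integral>\<omega>. ?S3 \<omega> \<partial>P x) - (\<integral>\<omega>. ?S4 \<omega> \<partial>P x)\<bar> \<le> 2 * K * abs_moment 3 * (h * sqrt h)"
  proof -
    let ?M = "\<lambda>\<omega>. \<integral>z. heat (\<rho> \<omega>) f \<bar>B s \<omega> + sqrt h * z\<bar> \<partial>std_normal_distribution"
    have m1: "(\<lambda>(\<omega>, \<delta>). G \<omega> * heat (\<rho> \<omega>) f \<bar>B s \<omega> + \<delta>\<bar>) \<in> borel_measurable (F s \<Otimes>\<^sub>M borel)"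
      by measurable
    have b: "\<bar>case (\<omega>, \<delta>) of (\<omega>, \<delta>) \<Rightarrow> G \<omega> * heat (\<rho> \<omega>) f \<bar>B s \<omega> + \<delta>\<bar>\<bar> \<le> K * (1 + \<delta>\<^sup>2)" if "\<omega> \<in> space A" for \<omega> \<delta>
    proof -
      have "K * 1 \<le> K * (1 + \<delta>\<^sup>2)" using K_nonneg by (intro mult_left_mono) auto
      with Gh[OF that hb[of "\<rho> \<omega>" "\<bar>B s \<omega> + \<delta>\<bar>"]] show ?thesis by simp
    qed
    have e2: "(\<integral>\<omega>. ?S2 \<omega> \<partial>P x) = (\<integral>\<omega>. G \<omega> * ?M \<omega> \<partial>P x)"
      using freeze_increment(2)[OF s t(2) m1 borel_measurable_const Px.integrable_const b] by simp
    have Mb: "\<bar>?M \<omega>\<bar> \<le> K" for \<omega>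
    proof -
      have "\<bar>?M \<omega>\<bar> \<le> (\<integral>z. \<bar>heat (\<rho> \<omega>) f \<bar>B s \<omega> + sqrt h * z\<bar>\<bar> \<partial>std_normal_distribution)" by (rule integral_abs_bound)
      also have "\<dots> \<le> (\<integral>z. K \<partial>std_normal_distribution)"
        by (intro integral_mono bounded_integrable_std_normal[where K = K]) (auto intro: hb simp: K_nonneg)
      finally show ?thesis by simp
    qed
    have iM: "integrable (P x) (\<lambda>\<omega>. G \<omega> * ?M \<omega>)"
      by (rule bnd[of _ K]) (measurable, rule Gh, assumption, rule Mb)
    have iD: "integrable (P x) (\<lambda>\<omega>. G \<omega> * W \<omega> * abs_drift h (B s \<omega>))"
    proof (rule bnd[of _ "K * (sqrt h * abs_moment 1)"])
      show "\<bar>G \<omega> * W \<omega> * abs_drift h (B s \<omega>)\<bar> \<le> K * (sqrt h * abs_moment 1)" if "\<omega> \<in> space A" for \<omega>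
        unfolding abs_mult[of "_ * _"] using Gh[OF that W] abs_drift_le[of h "B s \<omega>"] abs_drift_bounds(1)[of h "B s \<omega>"] h K_nonneg
        by (intro mult_mono) auto
    qed measurable
    have "\<bar>(\<integral>\<omega>. ?S2 \<omega> \<partial>P x) - (\<integral>\<omega>. ?S3 \<omega> \<partial>P x) - (\<integral>\<omega>. ?S4 \<omega> \<partial>P x)\<bar>
      = \<bar>\<integral>\<omega>. G \<omega> * (?M \<omega> - heat (\<rho> \<omega> + h) f \<bar>B s \<omega>\<bar> - W \<omega> * abs_drift h (B s \<omega>)) \<partial>P x\<bar>"
      unfolding e2 i4(2) using iM i2(2) iD by (simp add: right_diff_distrib mult.assoc)
    also have "\<dots> \<le> (\<integral>\<omega>. \<bar>G \<omega> * (?M \<omega> - heat (\<rho> \<omega> + h) f \<bar>B s \<omega>\<bar> - W \<omega> * abs_drift h (B s \<omega>))\<bar> \<partial>P x)"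
      by (rule integral_abs_bound)
    also have "\<dots> \<le> (\<integral>\<omega>. 2 * K * abs_moment 3 * (h * sqrt h) \<partial>P x)"
    proof (intro integral_mono integrable_abs)
      show "integrable (P x) (\<lambda>\<omega>. G \<omega> * (?M \<omega> - heat (\<rho> \<omega> + h) f \<bar>B s \<omega>\<bar> - W \<omega> * abs_drift h (B s \<omega>)))"
        unfolding right_diff_distrib using iM i2(2) iD by (intro Bochner_Integration.integrable_diff) (auto simp: mult.assoc)
      fix \<omega> assume "\<omega> \<in> space (P x)"
      then have \<omega>: "\<omega> \<in> space A" by simp
      have "\<bar>?M \<omega> - heat (\<rho> \<omega> + h) f \<bar>B s \<omega>\<bar> - W \<omega> * abs_drift h (B s \<omega>)\<bar> \<le> 2 * K * abs_moment 3 * (h * sqrt h)"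
        unfolding W_def by (rule heat_abs_step) (use h in \<open>auto simp: \<rho>_def\<close>)
      then show "\<bar>G \<omega> * (?M \<omega> - heat (\<rho> \<omega> + h) f \<bar>B s \<omega>\<bar> - W \<omega> * abs_drift h (B s \<omega>))\<bar> \<le> 2 * K * abs_moment 3 * (h * sqrt h)"
        unfolding abs_mult[of "G \<omega>"] using G[OF \<omega>] mult_mono[of "\<bar>G \<omega>\<bar>" 1] by fastforce
    qed simp
    finally show ?thesis by simp
  qed
  show ?thesis unfolding eq using b1 b2 by linarith
qed

section \<open>Summation over a grid\<close>

definition grid :: "nat \<Rightarrow> nat \<Rightarrow> real" where "grid n i = real i * (T / real (Suc n))"

abbreviation (input) mesh :: "nat \<Rightarrow> real" where "mesh n \<equiv> T / real (Suc n)"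

lemma mesh_pos: "0 < mesh n" using T by simp

lemma mesh_tendsto: "mesh \<longlonglongrightarrow> 0"
  using tendsto_mult_right[OF LIMSEQ_inverse_real_of_nat, of T] by (simp add: divide_inverse mult.commute)

lemma grid_Suc: "grid n (Suc i) = grid n i + mesh n"
  by (simp add: grid_def algebra_simps add_divide_distrib)

lemma grid_nonneg: "0 \<le> grid n i" using T by (simp add: grid_def)

lemma grid_mono: "i \<le> j \<Longrightarrow> grid n i \<le> grid n j"
  unfolding grid_def using T by (intro mult_right_mono) auto

lemma grid_0: "grid n 0 = 0" by (simp add: grid_def)

lemma grid_last: "grid n (Suc n) = T" by (simp add: grid_def)

text \<open>Written as a sum, it has an expectation that can be estimated cell by cell; by
  telescoping it is also the value of \<open>verif\<close> at a random grid time, which gives the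
  pathwise limit.\<close>

definition stopped :: "nat \<Rightarrow> 'a \<Rightarrow> real" where
  "stopped n \<omega> = verif 0 \<omega> + (\<Sum>i<Suc n. alive (mesh n) (grid n i) \<omega> * (verif (grid n (Suc i)) \<omega> - verif (grid n i) \<omega>))"

definition total_error :: "nat \<Rightarrow> 'a \<Rightarrow> real" where
  "total_error n \<omega> = (\<Sum>i<Suc n. local_error (grid n i) (grid n (Suc i)) \<omega>)"

lemma grid_oscillation:
  fixes X :: "real \<Rightarrow> real"
  assumes c: "continuous_on {0..} X" and \<eta>: "0 < \<eta>"
  shows "\<forall>\<^sub>F n in sequentially. \<forall>i<Suc n. \<bar>X (grid n (Suc i)) - X (grid n i)\<bar> < \<eta>"
proof -
  have "uniformly_continuous_on {0..T} X"
    using continuous_on_subset[OF c, of "{0..T}"] by (intro compact_uniformly_continuous) auto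
  then obtain \<delta> where \<delta>: "0 < \<delta>" "\<And>u v. u \<in> {0..T} \<Longrightarrow> v \<in> {0..T} \<Longrightarrow> dist v u < \<delta> \<Longrightarrow> dist (X v) (X u) < \<eta>"
    unfolding uniformly_continuous_on_def using \<eta> by metis
  show ?thesis
    using order_tendstoD(2)[OF mesh_tendsto \<delta>(1)]
  proof eventually_elim
    case (elim n)
    show ?case
    proof (intro allI impI)
      fix i assume "i < Suc n"
      then have "grid n (Suc i) \<le> T" using grid_mono[of "Suc i" "Suc n" n] grid_last[of n] by simp
      moreover have "grid n i \<le> grid n (Suc i)" by (rule grid_mono) simp
      ultimately have "grid n i \<in> {0..T}" "grid n (Suc i) \<in> {0..T}" using grid_nonneg by auto
      then show "\<bar>X (grid n (Suc i)) - X (grid n i)\<bar> < \<eta>"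
        using \<delta>(2)[of "grid n i" "grid n (Suc i)"] elim mesh_pos[of n] by (simp add: grid_Suc dist_real_def)
    qed
  qed
qed

lemma L_increments_sum: "(\<Sum>i<Suc n. L (grid n (Suc i)) \<omega> - L (grid n i) \<omega>) = L T \<omega> - L 0 \<omega>"
  by (subst sum_lessThan_telescope) (simp add: grid_0 grid_last)

text \<open>Compared with \<open>total_error\<close>, the position at the right end of a cell is
  replaced by the displacement over the cell. The difference is governed by the position at the left
  end.\<close>

definition oscillation_error :: "nat \<Rightarrow> 'a \<Rightarrow> real" where
  "oscillation_error n \<omega> = (\<Sum>i<Suc n. (L (grid n (Suc i)) \<omega> - L (grid n i) \<omega>)
    * (min 1 (sqrt (L (grid n (Suc i)) \<omega> - L (grid n i) \<omega>)) + min 1 \<bar>B (grid n (Suc i)) \<omega> - B (grid n i) \<omega>\<bar>))"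

lemma grid_measurable:
  "L (grid n i) \<in> borel_measurable (P x)" "B (grid n i) \<in> borel_measurable (P x)"
  using grid_nonneg by (auto intro: L_measurable_P)

text \<open>The increments of \<open>L\<close> add up to \<open>L T\<close>, so the error is at most
  \<open>L T\<close> times the largest oscillation on a cell. It tends to 0 on every path by uniform
  continuity, and \<open>2 * L T\<close> is an integrable majorant.\<close>

lemma oscillation_error_tendsto: "(\<lambda>n. \<integral>\<omega>. oscillation_error n \<omega> \<partial>P x) \<longlonglongrightarrow> 0"
  and oscillation_error_integrable: "integrable (P x) (oscillation_error n)"
proof -
  have m[measurable]: "oscillation_error n \<in> borel_measurable (P x)" for n
    unfolding oscillation_error_def[abs_def]
  proof (intro borel_measurable_sum)
    fix i
    note [measurable] = grid_measurable[of n i] grid_measurable[of n "Suc i"]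
    show "(\<lambda>\<omega>. (L (grid n (Suc i)) \<omega> - L (grid n i) \<omega>)
        * (min 1 (sqrt (L (grid n (Suc i)) \<omega> - L (grid n i) \<omega>)) + min 1 \<bar>B (grid n (Suc i)) \<omega> - B (grid n i) \<omega>\<bar>))
      \<in> borel_measurable (P x)"
      by measurable
  qed
  have inc: "0 \<le> L (grid n (Suc i)) \<omega> - L (grid n i) \<omega>" if "\<omega> \<in> space A" for n i \<omega>
    using L_le[OF that grid_nonneg grid_mono[of i "Suc i"]] by simp
  have LT: "L T \<omega> - L 0 \<omega> = L T \<omega>" if "\<omega> \<in> space A" for \<omega> using L_zero[OF that] by simp
  have bound: "\<bar>oscillation_error n \<omega>\<bar> \<le> c * L T \<omega>"
    if \<omega>: "\<omega> \<in> space A" and c: "\<And>i. i < Suc n \<Longrightarrow> min 1 (sqrt (L (grid n (Suc i)) \<omega> - L (grid n i) \<omega>)) + min 1 \<bar>B (grid n (Suc i)) \<omega> - B (grid n i) \<omega>\<bar> \<le> c"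
    for n \<omega> c
  proof -
    have "oscillation_error n \<omega> \<le> (\<Sum>i<Suc n. (L (grid n (Suc i)) \<omega> - L (grid n i) \<omega>) * c)"
      unfolding oscillation_error_def using inc[OF \<omega>] c by (intro sum_mono mult_left_mono) auto
    also have "\<dots> = c * L T \<omega>"
      unfolding sum_distrib_right[symmetric] L_increments_sum LT[OF \<omega>] by simp
    finally have "oscillation_error n \<omega> \<le> c * L T \<omega>" .
    moreover have "0 \<le> oscillation_error n \<omega>"
      unfolding oscillation_error_def using inc[OF \<omega>] by (intro sum_nonneg mult_nonneg_nonneg add_nonneg_nonneg) auto
    ultimately show ?thesis by simp
  qed
  have bound2: "\<bar>oscillation_error n \<omega>\<bar> \<le> 2 * L T \<omega>" if "\<omega> \<in> space A" for n \<omega>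
    by (rule bound[OF that]) linarith
  have iL: "integrable (P x) (\<lambda>\<omega>. 2 * L T \<omega>)" using L_integrable[of T x] T by simp
  show "integrable (P x) (oscillation_error n)"
  proof (rule Bochner_Integration.integrable_bound[OF iL m], rule AE_I2)
    fix \<omega> assume "\<omega> \<in> space (P x)"
    then show "norm (oscillation_error n \<omega>) \<le> norm (2 * L T \<omega>)"
      using order_trans[OF bound2 abs_ge_self] by simp
  qed
  have "(\<lambda>n. \<integral>\<omega>. oscillation_error n \<omega> \<partial>P x) \<longlonglongrightarrow> (\<integral>\<omega>. 0 \<partial>P x)"
  proof (rule integral_dominated_convergence[OF _ m iL])
    show "AE \<omega> in P x. norm (oscillation_error n \<omega>) \<le> 2 * L T \<omega>" for n using bound2 by (intro AE_I2) simp
    show "AE \<omega> in P x. (\<lambda>n. oscillation_error n \<omega>) \<longlonglongrightarrow> 0"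
    proof (rule AE_I2)
      fix \<omega> assume "\<omega> \<in> space (P x)"
      then have \<omega>: "\<omega> \<in> space A" by simp
      have LT0: "0 \<le> L T \<omega>" using L_nonneg[OF \<omega>, of T] T by simp
      show "(\<lambda>n. oscillation_error n \<omega>) \<longlonglongrightarrow> 0"
      proof (rule tendstoI)
        fix e :: real assume e: "0 < e"
        \<comment> \<open>Two small factors of size \<open>\<eta>\<close> occur in each cell. The
          increments of \<open>L\<close> have to be below \<open>\<eta>\<^sup>2\<close>, since they
          enter through a square root.\<close>
        define \<eta> where "\<eta> = e / (2 * (L T \<omega> + 1))"
        have \<eta>: "0 < \<eta>" "2 * \<eta> * L T \<omega> < e" using e LT0 by (auto simp: \<eta>_def field_simps)
        have "0 < \<eta>\<^sup>2" using \<eta> by simp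
        from grid_oscillation[OF L_continuous[OF \<omega>] this] grid_oscillation[OF B_continuous[OF \<omega>] \<eta>(1)]
        show "\<forall>\<^sub>F n in sequentially. dist (oscillation_error n \<omega>) 0 < e"
        proof eventually_elim
          case (elim n)
          have "\<bar>oscillation_error n \<omega>\<bar> \<le> 2 * \<eta> * L T \<omega>"
          proof (rule bound[OF \<omega>])
            fix i assume i: "i < Suc n"
            have "sqrt (L (grid n (Suc i)) \<omega> - L (grid n i) \<omega>) \<le> \<eta>"
              using elim(1) i \<eta> by (intro real_le_lsqrt) (auto simp: abs_less_iff less_imp_le)
            moreover have "\<bar>B (grid n (Suc i)) \<omega> - B (grid n i) \<omega>\<bar> \<le> \<eta>" using elim(2) i by (simp add: less_imp_le)
            ultimately show "min 1 (sqrt (L (grid n (Suc i)) \<omega> - L (grid n i) \<omega>)) + min 1 \<bar>B (grid n (Suc i)) \<omega> - B (grid n i) \<omega>\<bar> \<le> 2 * \<eta>"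
              by linarith
          qed
          then show ?case using \<eta> by simp
        qed
      qed
    qed
  qed simp
  then show "(\<lambda>n. \<integral>\<omega>. oscillation_error n \<omega> \<partial>P x) \<longlonglongrightarrow> 0" by simp
qed

text \<open>Split min(1, |b|) \<le> \<delta> + min(1, b^2) / \<delta>. The first part costs \<delta>
  times the mean of \<open>L T\<close>. For the second, the compensator replaces the increment of
  \<open>L\<close> by \<open>abs_drift\<close>, and \<open>abs_drift_bounds\<close> gives order h
  sqrt h in each cell, hence order sqrt h in total. The truncation at 1 makes the factors bounded
  multipliers.\<close>

lemma position_error:
  assumes \<delta>: "0 < \<delta>" "\<delta> \<le> 1"
  shows "(\<integral>\<omega>. (\<Sum>i<Suc n. (L (grid n (Suc i)) \<omega> - L (grid n i) \<omega>) * min 1 \<bar>B (grid n i) \<omega>\<bar>) \<partial>P x)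
      \<le> \<delta> * (\<integral>\<omega>. L T \<omega> \<partial>P x) + 2 * abs_moment 3 * T * sqrt (mesh n) / \<delta>"
    and "integrable (P x) (\<lambda>\<omega>. (L (grid n (Suc i)) \<omega> - L (grid n i) \<omega>) * min 1 \<bar>B (grid n i) \<omega>\<bar>)"
proof -
  let ?d = "\<lambda>i \<omega>. L (grid n (Suc i)) \<omega> - L (grid n i) \<omega>"
  have ineq: "min 1 \<bar>b\<bar> \<le> \<delta> + min 1 (b\<^sup>2) / \<delta>" for b :: real
  proof (cases "\<bar>b\<bar> \<le> \<delta>")
    case False
    then have b: "\<delta> < \<bar>b\<bar>" by simp
    have "min 1 \<bar>b\<bar> * \<delta> \<le> min 1 (b\<^sup>2)"
    proof (cases "\<bar>b\<bar> \<le> 1")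
      case True
      have "\<bar>b\<bar> * \<delta> \<le> \<bar>b\<bar> * \<bar>b\<bar>" using b by (intro mult_left_mono) auto
      moreover have "\<bar>b\<bar> * \<delta> \<le> 1 * 1" using True \<delta> by (intro mult_mono) auto
      ultimately show ?thesis using True by (simp add: power2_eq_square)
    next
      case False
      then have "1 \<le> \<bar>b\<bar>\<^sup>2" by (intro one_le_power) simp
      then show ?thesis using False \<delta> by simp
    qed
    then have "min 1 \<bar>b\<bar> \<le> min 1 (b\<^sup>2) / \<delta>" using \<delta> by (simp add: pos_le_divide_eq)
    then show ?thesis using \<delta> by linarith
  qed (use \<delta> in \<open>simp add: add_increasing2 min_le_iff_disj\<close>)
  have g: "0 \<le> grid n i" "grid n i \<le> grid n (Suc i)" for i using grid_nonneg grid_mono[of i "Suc i"] by auto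
  have bd1: "bounded_at (grid n i) (\<lambda>\<omega>. min 1 \<bar>B (grid n i) \<omega>\<bar>)" for i
    using B_adapted[OF g(1), of i] unfolding bounded_at_def by (auto intro!: exI[of _ 1])
  have bd2: "bounded_at (grid n i) (\<lambda>\<omega>. min 1 ((B (grid n i) \<omega>)\<^sup>2))" for i
    using B_adapted[OF g(1), of i] unfolding bounded_at_def by (auto intro!: exI[of _ 1])
  note lc1 = local_time_compensator(1)[OF g bd1, where x = x]
  note lc2 = local_time_compensator[OF g bd2, where x = x]
  show i1: "integrable (P x) (\<lambda>\<omega>. ?d i \<omega> * min 1 \<bar>B (grid n i) \<omega>\<bar>)" for i
    using lc1[of i] by (simp add: mult.commute)
  have id: "integrable (P x) (?d i)" for i using L_integrable[of _ x] g order_trans[OF g] by auto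
  have each: "(\<integral>\<omega>. min 1 ((B (grid n i) \<omega>)\<^sup>2) * ?d i \<omega> \<partial>P x) \<le> 2 * abs_moment 3 * (mesh n * sqrt (mesh n))" for i
  proof -
    have "(\<integral>\<omega>. min 1 ((B (grid n i) \<omega>)\<^sup>2) * ?d i \<omega> \<partial>P x) = (\<integral>\<omega>. min 1 ((B (grid n i) \<omega>)\<^sup>2) * abs_drift (mesh n) (B (grid n i) \<omega>) \<partial>P x)"
      using lc2(2)[of i] by (simp add: grid_Suc)
    also have "\<dots> \<le> (\<integral>\<omega>. 2 * abs_moment 3 * (mesh n * sqrt (mesh n)) \<partial>P x)"
    proof (rule integral_mono)
      have h: "0 \<le> mesh n" using mesh_pos less_imp_le by blast
      have le: "min 1 (b\<^sup>2) * abs_drift (mesh n) b \<le> 2 * abs_moment 3 * (mesh n * sqrt (mesh n))" for b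
        using mult_right_mono[OF min.cobounded2[of 1 "b\<^sup>2"] abs_drift_bounds(1)[OF h, of b]] abs_drift_bounds(2)[OF h, of b]
        by linarith
      note [measurable] = grid_measurable(2)[of n i]
      show "integrable (P x) (\<lambda>\<omega>. min 1 ((B (grid n i) \<omega>)\<^sup>2) * abs_drift (mesh n) (B (grid n i) \<omega>))"
        using le abs_drift_bounds(1)[OF h]
        by (intro Px.integrable_const_bound[where B = "2 * abs_moment 3 * (mesh n * sqrt (mesh n))"] AE_I2) auto
      show "min 1 ((B (grid n i) \<omega>)\<^sup>2) * abs_drift (mesh n) (B (grid n i) \<omega>) \<le> 2 * abs_moment 3 * (mesh n * sqrt (mesh n))" for \<omega>
        by (rule le)
    qed simp
    finally show ?thesis by simp
  qed
  have "(\<integral>\<omega>. (\<Sum>i<Suc n. ?d i \<omega> * min 1 \<bar>B (grid n i) \<omega>\<bar>) \<partial>P x)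
     \<le> (\<integral>\<omega>. (\<Sum>i<Suc n. \<delta> * ?d i \<omega> + (min 1 ((B (grid n i) \<omega>)\<^sup>2) * ?d i \<omega>) / \<delta>) \<partial>P x)"
  proof (rule integral_mono)
    show "integrable (P x) (\<lambda>\<omega>. \<Sum>i<Suc n. ?d i \<omega> * min 1 \<bar>B (grid n i) \<omega>\<bar>)"
      by (intro Bochner_Integration.integrable_sum i1)
    show "integrable (P x) (\<lambda>\<omega>. \<Sum>i<Suc n. \<delta> * ?d i \<omega> + (min 1 ((B (grid n i) \<omega>)\<^sup>2) * ?d i \<omega>) / \<delta>)"
      by (intro Bochner_Integration.integrable_sum Bochner_Integration.integrable_add integrable_mult_right integrable_divide_zero id impI lc2(1))
    fix \<omega> assume "\<omega> \<in> space (P x)"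
    then have "0 \<le> ?d i \<omega>" for i using L_le[OF _ g] by simp
    then have "?d i \<omega> * min 1 \<bar>B (grid n i) \<omega>\<bar> \<le> ?d i \<omega> * (\<delta> + min 1 ((B (grid n i) \<omega>)\<^sup>2) / \<delta>)" for i
      by (intro mult_left_mono ineq)
    then show "(\<Sum>i<Suc n. ?d i \<omega> * min 1 \<bar>B (grid n i) \<omega>\<bar>) \<le> (\<Sum>i<Suc n. \<delta> * ?d i \<omega> + (min 1 ((B (grid n i) \<omega>)\<^sup>2) * ?d i \<omega>) / \<delta>)"
      by (intro sum_mono) (simp add: algebra_simps)
  qed
  also have "\<dots> = (\<Sum>i<Suc n. \<delta> * (\<integral>\<omega>. ?d i \<omega> \<partial>P x)) + (\<Sum>i<Suc n. (\<integral>\<omega>. min 1 ((B (grid n i) \<omega>)\<^sup>2) * ?d i \<omega> \<partial>P x) / \<delta>)"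
    by (subst Bochner_Integration.integral_sum, intro Bochner_Integration.integrable_add integrable_mult_right integrable_divide_zero id impI lc2(1))
      (simp only: Bochner_Integration.integral_add integrable_mult_right integrable_divide_zero id lc2(1) sum.distrib
        integral_mult_right_zero integral_divide_zero)
  also have "\<dots> \<le> \<delta> * (\<integral>\<omega>. L T \<omega> \<partial>P x) + (\<Sum>i<Suc n. 2 * abs_moment 3 * (mesh n * sqrt (mesh n)) / \<delta>)"
  proof (intro add_mono sum_mono divide_right_mono each)
    have "(\<Sum>i<Suc n. \<delta> * (\<integral>\<omega>. ?d i \<omega> \<partial>P x)) = \<delta> * (\<integral>\<omega>. (\<Sum>i<Suc n. ?d i \<omega>) \<partial>P x)"
      by (subst Bochner_Integration.integral_sum, rule id) (simp only: sum_distrib_left)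
    also have "(\<integral>\<omega>. (\<Sum>i<Suc n. ?d i \<omega>) \<partial>P x) = (\<integral>\<omega>. L T \<omega> \<partial>P x)"
      unfolding L_increments_sum by (intro Bochner_Integration.integral_cong refl) (simp add: L_zero)
    finally show "(\<Sum>i<Suc n. \<delta> * (\<integral>\<omega>. ?d i \<omega> \<partial>P x)) \<le> \<delta> * (\<integral>\<omega>. L T \<omega> \<partial>P x)" by simp
  qed (use \<delta> in auto)
  also have "(\<Sum>i<Suc n. 2 * abs_moment 3 * (mesh n * sqrt (mesh n)) / \<delta>) = 2 * abs_moment 3 * T * sqrt (mesh n) / \<delta>"
  proof -
    have "real (Suc n) * (c * (m * q) / \<delta>) = c * (real (Suc n) * m) * q / \<delta>" for c m q :: real
      by simp
    from this[of "2 * abs_moment 3" "mesh n" "sqrt (mesh n)"]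
    have "real (Suc n) * (2 * abs_moment 3 * (mesh n * sqrt (mesh n)) / \<delta>) = 2 * abs_moment 3 * (real (Suc n) * mesh n) * sqrt (mesh n) / \<delta>" .
    also have "real (Suc n) * mesh n = T" by (simp del: of_nat_Suc)
    finally show ?thesis by (simp only: sum_constant card_lessThan)
  qed
  finally show "(\<integral>\<omega>. (\<Sum>i<Suc n. ?d i \<omega> * min 1 \<bar>B (grid n i) \<omega>\<bar>) \<partial>P x)
      \<le> \<delta> * (\<integral>\<omega>. L T \<omega> \<partial>P x) + 2 * abs_moment 3 * T * sqrt (mesh n) / \<delta>" .
qed

lemma total_error_tendsto: "(\<lambda>n. \<integral>\<omega>. total_error n \<omega> \<partial>P x) \<longlonglongrightarrow> 0"
proof (rule tendstoI)
  fix e :: real assume e: "0 < e"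
  let ?l = "\<integral>\<omega>. L T \<omega> \<partial>P x"
  have l0: "0 \<le> ?l" using L_nonneg[of _ T] T by (intro Bochner_Integration.integral_nonneg_AE AE_I2) auto
  \<comment> \<open>\<open>\<delta>\<close> is fixed before the mesh tends to 0, because the second
    part of the position error carries the factor 1 / \<delta>.\<close>
  define \<delta> where "\<delta> = min 1 (e / (2 * (?l + 1)))"
  have \<delta>: "0 < \<delta>" "\<delta> \<le> 1" using e l0 by (auto simp: \<delta>_def)
  have "\<delta> * ?l \<le> e / (2 * (?l + 1)) * ?l" using l0 by (intro mult_right_mono) (auto simp: \<delta>_def)
  also have "\<dots> < e / 2" using e l0 by (simp add: field_simps)
  finally have \<delta>l: "\<delta> * ?l < e / 2" .
  have "(\<lambda>n. (\<integral>\<omega>. oscillation_error n \<omega> \<partial>P x) + 2 * abs_moment 3 * T * sqrt (mesh n) / \<delta>) \<longlonglongrightarrow> 0 + 2 * abs_moment 3 * T * sqrt 0 / \<delta>"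
    using \<delta> by (intro tendsto_intros oscillation_error_tendsto mesh_tendsto) auto
  then have "\<forall>\<^sub>F n in sequentially. (\<integral>\<omega>. oscillation_error n \<omega> \<partial>P x) + 2 * abs_moment 3 * T * sqrt (mesh n) / \<delta> < e / 2"
    using e by (intro order_tendstoD(2)) auto
  then show "\<forall>\<^sub>F n in sequentially. dist (\<integral>\<omega>. total_error n \<omega> \<partial>P x) 0 < e"
  proof eventually_elim
    case (elim n)
    let ?d = "\<lambda>i \<omega>. L (grid n (Suc i)) \<omega> - L (grid n i) \<omega>"
    have g: "0 \<le> grid n i" "grid n i \<le> grid n (Suc i)" for i using grid_nonneg grid_mono[of i "Suc i"] by auto
    have d0: "0 \<le> ?d i \<omega>" if "\<omega> \<in> space A" for i \<omega> using L_le[OF that g] by simp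
    have it: "integrable (P x) (total_error n)"
      unfolding total_error_def[abs_def] by (intro Bochner_Integration.integrable_sum local_error_integrable g)
    have "(\<integral>\<omega>. total_error n \<omega> \<partial>P x) \<le> (\<integral>\<omega>. oscillation_error n \<omega> + (\<Sum>i<Suc n. ?d i \<omega> * min 1 \<bar>B (grid n i) \<omega>\<bar>) \<partial>P x)"
    proof (rule integral_mono[OF it])
      show "integrable (P x) (\<lambda>\<omega>. oscillation_error n \<omega> + (\<Sum>i<Suc n. ?d i \<omega> * min 1 \<bar>B (grid n i) \<omega>\<bar>))"
        using \<delta> by (intro Bochner_Integration.integrable_add Bochner_Integration.integrable_sum oscillation_error_integrable position_error(2))
      fix \<omega> assume "\<omega> \<in> space (P x)"
      then have \<omega>: "\<omega> \<in> space A" by simp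
      have "min 1 \<bar>u\<bar> \<le> min 1 \<bar>u - v\<bar> + min 1 \<bar>v\<bar>" for u v :: real by linarith
      then show "total_error n \<omega> \<le> oscillation_error n \<omega> + (\<Sum>i<Suc n. ?d i \<omega> * min 1 \<bar>B (grid n i) \<omega>\<bar>)"
        unfolding total_error_def oscillation_error_def local_error_def sum.distrib[symmetric] distrib_left[symmetric]
        by (intro sum_mono mult_left_mono d0[OF \<omega>]) (simp add: add.assoc)
    qed
    also have "\<dots> = (\<integral>\<omega>. oscillation_error n \<omega> \<partial>P x) + (\<integral>\<omega>. (\<Sum>i<Suc n. ?d i \<omega> * min 1 \<bar>B (grid n i) \<omega>\<bar>) \<partial>P x)"
      by (intro Bochner_Integration.integral_add oscillation_error_integrable Bochner_Integration.integrable_sum position_error(2)[OF \<delta>])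
    also have "\<dots> < e" using position_error(1)[OF \<delta>, of n] elim \<delta>l by linarith
    finally have "(\<integral>\<omega>. total_error n \<omega> \<partial>P x) < e" .
    moreover have "0 \<le> (\<integral>\<omega>. total_error n \<omega> \<partial>P x)"
      using d0 unfolding total_error_def local_error_def
      by (intro Bochner_Integration.integral_nonneg_AE AE_I2 sum_nonneg mult_nonneg_nonneg add_nonneg_nonneg) auto
    ultimately show ?case by simp
  qed
qed

section \<open>Stopping at the time change\<close>

lemma expectation_verif_0: "(\<integral>\<omega>. verif 0 \<omega> \<partial>P x) = heat (T + \<epsilon>) f x"
proof -
  have "(\<integral>\<omega>. verif 0 \<omega> \<partial>P x) = (\<integral>\<omega>. heat (T + \<epsilon>) f x \<partial>P x)"
  proof (rule integral_cong_AE)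
    show "AE \<omega> in P x. verif 0 \<omega> = heat (T + \<epsilon>) f x"
      using B_start[of x] AE_space
    proof eventually_elim
      case (elim \<omega>)
      then show ?case using x T \<epsilon> by (simp add: verif_def L_zero)
    qed
  qed (auto intro: verif_measurable)
  then show ?thesis by simp
qed

text \<open>There are T / h cells, so the Brownian errors of order h sqrt h add up to order sqrt h,
  and the local time errors add up to \<open>total_error\<close>.\<close>

lemma expectation_stopped: "(\<lambda>n. \<integral>\<omega>. stopped n \<omega> \<partial>P x) \<longlonglongrightarrow> heat (T + \<epsilon>) f x"
proof -
  obtain C where C0: "C \<ge> 0" and C: "\<And>\<rho> d y. \<epsilon> \<le> \<rho> \<Longrightarrow> 0 \<le> d \<Longrightarrow> 0 \<le> y \<Longrightarrow>
    \<bar>heat (max 0 (\<rho> - \<gamma> * d)) f y * exp (- \<beta> * d) - heat \<rho> f y + d * heat \<rho> f1 0\<bar>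
      \<le> C * d * (min 1 (sqrt d) + min 1 y)"
    using heat_step[OF \<epsilon>] by blast
  have bound: "\<bar>(\<integral>\<omega>. stopped n \<omega> \<partial>P x) - heat (T + \<epsilon>) f x\<bar> \<le> C * (\<integral>\<omega>. total_error n \<omega> \<partial>P x) + 2 * K * abs_moment 3 * T * sqrt (mesh n)" for n
  proof -
    let ?D = "\<lambda>i \<omega>. alive (mesh n) (grid n i) \<omega> * (verif (grid n (Suc i)) \<omega> - verif (grid n i) \<omega>)"
    have iD: "integrable (P x) (?D i)" for i
    proof (rule Px.integrable_const_bound[where B = "2 * K"])
      show "?D i \<in> borel_measurable (P x)"
        by (intro borel_measurable_times borel_measurable_diff alive_measurable verif_measurable grid_nonneg)
      show "AE \<omega> in P x. norm (?D i \<omega>) \<le> 2 * K"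
      proof (rule AE_I2)
        fix \<omega> assume "\<omega> \<in> space (P x)"
        then have "\<omega> \<in> space A" by simp
        from verif_bound[OF this grid_nonneg, of n i] verif_bound[OF this grid_nonneg, of n "Suc i"]
        show "norm (?D i \<omega>) \<le> 2 * K" using K_nonneg by (auto simp: alive_def)
      qed
    qed
    have "(\<integral>\<omega>. stopped n \<omega> \<partial>P x) = heat (T + \<epsilon>) f x + (\<Sum>i<Suc n. \<integral>\<omega>. ?D i \<omega> \<partial>P x)"
      unfolding stopped_def expectation_verif_0[symmetric]
      by (subst Bochner_Integration.integral_add, rule verif_integrable, simp, rule Bochner_Integration.integrable_sum, rule iD,
        subst Bochner_Integration.integral_sum, rule iD, rule refl)
    then have "\<bar>(\<integral>\<omega>. stopped n \<omega> \<partial>P x) - heat (T + \<epsilon>) f x\<bar> = \<bar>\<Sum>i<Suc n. \<integral>\<omega>. ?D i \<omega> \<partial>P x\<bar>" by simp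
    also have "\<dots> \<le> (\<Sum>i<Suc n. \<bar>\<integral>\<omega>. ?D i \<omega> \<partial>P x\<bar>)" by (rule sum_abs)
    also have "\<dots> \<le> (\<Sum>i<Suc n. C * (\<integral>\<omega>. local_error (grid n i) (grid n (Suc i)) \<omega> \<partial>P x) + 2 * K * abs_moment 3 * (mesh n * sqrt (mesh n)))"
      unfolding grid_Suc by (intro sum_mono one_step[OF grid_nonneg mesh_pos C0 C])
    also have "\<dots> = C * (\<integral>\<omega>. total_error n \<omega> \<partial>P x) + 2 * K * abs_moment 3 * T * sqrt (mesh n)"
    proof -
      have total: "(\<integral>\<omega>. total_error n \<omega> \<partial>P x) = (\<Sum>i<Suc n. \<integral>\<omega>. local_error (grid n i) (grid n (Suc i)) \<omega> \<partial>P x)"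
        unfolding total_error_def using grid_mono[OF le_SucI[OF order_refl]]
        by (intro Bochner_Integration.integral_sum local_error_integrable grid_nonneg)
      have "real (Suc n) * (c * (m * q)) = c * (real (Suc n) * m) * q" for c m q :: real by simp
      from this[of "2 * K * abs_moment 3" "mesh n" "sqrt (mesh n)"]
      have "real (Suc n) * (2 * K * abs_moment 3 * (mesh n * sqrt (mesh n))) = 2 * K * abs_moment 3 * (real (Suc n) * mesh n) * sqrt (mesh n)" .
      moreover have "real (Suc n) * mesh n = T" by (simp del: of_nat_Suc)
      ultimately have "(\<Sum>i<Suc n. 2 * K * abs_moment 3 * (mesh n * sqrt (mesh n))) = 2 * K * abs_moment 3 * T * sqrt (mesh n)"
        by (simp only: sum_constant card_lessThan)
      with total show ?thesis by (simp only: sum.distrib sum_distrib_left)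
    qed
    finally show ?thesis .
  qed
  have "(\<lambda>n. C * (\<integral>\<omega>. total_error n \<omega> \<partial>P x) + 2 * K * abs_moment 3 * T * sqrt (mesh n)) \<longlonglongrightarrow> C * 0 + 2 * K * abs_moment 3 * T * sqrt 0"
    by (intro tendsto_intros total_error_tendsto mesh_tendsto)
  then have lim: "(\<lambda>n. C * (\<integral>\<omega>. total_error n \<omega> \<partial>P x) + 2 * K * abs_moment 3 * T * sqrt (mesh n)) \<longlonglongrightarrow> 0"
    by simp
  have "(\<lambda>n. (\<integral>\<omega>. stopped n \<omega> \<partial>P x) - heat (T + \<epsilon>) f x) \<longlonglongrightarrow> 0"
    by (rule Lim_null_comparison[OF always_eventually[OF allI] lim], unfold real_norm_def, rule bound)
  then show ?thesis by (simp add: LIM_zero_iff)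
qed

text \<open>The witness is the first grid time at which less than one mesh is left on the clock. At
  the preceding grid time the clock was still below \<open>T\<close>, so the inverse clock is
  exceeded by at most one mesh.\<close>

lemma stopped_exit:
  assumes \<omega>: "\<omega> \<in> space A"
  obtains u where "0 \<le> u" "u \<le> T" "stopped n \<omega> = verif u \<omega>" "T - mesh n < u + \<gamma> * L u \<omega>"
    "u \<le> time_change L \<gamma> T \<omega> + mesh n"
proof -
  let ?E = "\<lambda>i. mesh n \<le> T - (grid n i + \<gamma> * L (grid n i) \<omega>)"
  have anti: "?E i" if "i \<le> j" "?E j" for i j
    using clock_strict_mono(2)[OF \<gamma> \<omega> grid_nonneg grid_mono[OF that(1), of n]] that(2) by linarith
  have last: "\<not> ?E (Suc n)"
  proof -
    have "0 \<le> \<gamma> * L T \<omega>" using L_nonneg[OF \<omega>, of T] T \<gamma> by simp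
    then show ?thesis unfolding grid_last using mesh_pos[of n] by linarith
  qed
  have "\<exists>m. m \<le> Suc n \<and> \<not> ?E m \<and> (\<forall>i<m. ?E i) \<and>
    verif (grid n 0) \<omega> + (\<Sum>i<Suc n. (if ?E i then 1 else 0) * (verif (grid n (Suc i)) \<omega> - verif (grid n i) \<omega>)) = verif (grid n m) \<omega>"
    by (rule telescope_until_exit[where E = ?E and N = "\<lambda>i. verif (grid n i) \<omega>", OF anti last])
  then obtain m where m: "m \<le> Suc n" "\<not> ?E m" "\<forall>i<m. ?E i"
    "verif (grid n 0) \<omega> + (\<Sum>i<Suc n. (if ?E i then 1 else 0) * (verif (grid n (Suc i)) \<omega> - verif (grid n i) \<omega>)) = verif (grid n m) \<omega>"
    by (elim exE conjE) (rule that)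
  show thesis
  proof (rule that[of "grid n m"])
    show "0 \<le> grid n m" by (rule grid_nonneg)
    show "grid n m \<le> T" using grid_mono[OF m(1), of n] by (simp add: grid_last)
    show "stopped n \<omega> = verif (grid n m) \<omega>"
      using m(4) unfolding stopped_def alive_def grid_0 .
    show "T - mesh n < grid n m + \<gamma> * L (grid n m) \<omega>" using m(2) by linarith
    show "grid n m \<le> time_change L \<gamma> T \<omega> + mesh n"
    proof (cases m)
      case 0
      then show ?thesis using time_change(1)[OF \<gamma> \<omega>, of T] T mesh_pos[of n] by (simp add: grid_0)
    next
      case (Suc k)
      then have "grid n k + \<gamma> * L (grid n k) \<omega> < T" using m(3)[rule_format, of k] mesh_pos[of n] by linarith
      then have "grid n k < time_change L \<gamma> T \<omega>" using time_change(4)[OF \<gamma> \<omega> _ grid_nonneg] T by simp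
      then show ?thesis using Suc by (simp add: grid_Suc)
    qed
  qed
qed

text \<open>The exit times converge to the inverse clock. From above this is the bound of one mesh;
  from below, a time short of the inverse clock leaves a positive gap to \<open>T\<close>, which the
  mesh eventually undercuts. In the limit the clock shows exactly \<open>T\<close>, so the heat flow
  is left with time \<open>\<epsilon>\<close>.\<close>

lemma stopped_tendsto:
  assumes \<omega>: "\<omega> \<in> space A"
  shows "(\<lambda>n. stopped n \<omega>) \<longlonglongrightarrow> heat \<epsilon> f (sticky_bm B L \<gamma> T \<omega>) * exp (- \<beta> * sticky_local_time L \<gamma> T \<omega>)"
proof -
  have T0: "0 \<le> T" using T by simp
  let ?\<tau> = "time_change L \<gamma> T \<omega>"
  note \<tau> = time_change[OF \<gamma> \<omega> T0]
  have "\<exists>u. \<forall>n. 0 \<le> u n \<and> u n \<le> T \<and> stopped n \<omega> = verif (u n) \<omega> \<and> T - mesh n < u n + \<gamma> * L (u n) \<omega> \<and> u n \<le> ?\<tau> + mesh n"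
    by (intro choice allI) (metis stopped_exit[OF \<omega>])
  then obtain u where u: "\<And>n. 0 \<le> u n" "\<And>n. u n \<le> T" "\<And>n. stopped n \<omega> = verif (u n) \<omega>"
    "\<And>n. T - mesh n < u n + \<gamma> * L (u n) \<omega>" "\<And>n. u n \<le> ?\<tau> + mesh n" by blast
  have lim: "u \<longlonglongrightarrow> ?\<tau>"
  proof (rule tendstoI)
    fix e :: real assume e: "0 < e"
    have "\<forall>\<^sub>F n in sequentially. ?\<tau> - e < u n"
    proof (cases "?\<tau> - e < 0")
      case True
      then show ?thesis using u(1) by (intro always_eventually allI) (smt (verit))
    next
      case False
      define v where "v = ?\<tau> - e"
      have v: "0 \<le> v" "v + \<gamma> * L v \<omega> < T" using False e \<tau>(4)[of v] by (auto simp: v_def)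
      then have "\<forall>\<^sub>F n in sequentially. mesh n < T - (v + \<gamma> * L v \<omega>)"
        by (intro order_tendstoD(2)[OF mesh_tendsto]) simp
      then show ?thesis
      proof eventually_elim
        case (elim n)
        then have "v + \<gamma> * L v \<omega> < u n + \<gamma> * L (u n) \<omega>" using u(4)[of n] by linarith
        then have "\<not> u n \<le> v" using clock_strict_mono(2)[OF \<gamma> \<omega> u(1), of n v] by linarith
        then show ?case by (simp add: v_def)
      qed
    qed
    moreover have "\<forall>\<^sub>F n in sequentially. mesh n < e" using e by (intro order_tendstoD(2)[OF mesh_tendsto])
    ultimately show "\<forall>\<^sub>F n in sequentially. dist (u n) ?\<tau> < e"
    proof eventually_elim
      case (elim n)
      then show ?case using u(5)[of n] by (simp add: dist_real_def)
    qed
  qed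
  have limB: "(\<lambda>n. B (u n) \<omega>) \<longlonglongrightarrow> B ?\<tau> \<omega>"
    using B_continuous[OF \<omega>] lim \<tau>(1) u(1) by (intro continuous_on_tendsto_compose[where f = "\<lambda>t. B t \<omega>"]) auto
  have limL: "(\<lambda>n. L (u n) \<omega>) \<longlonglongrightarrow> L ?\<tau> \<omega>"
    using L_continuous[OF \<omega>] lim \<tau>(1) u(1) by (intro continuous_on_tendsto_compose[where f = "\<lambda>t. L t \<omega>"]) auto
  have "(\<lambda>n. verif (u n) \<omega>) \<longlonglongrightarrow> heat (max 0 (T + \<epsilon> - (?\<tau> + \<gamma> * L ?\<tau> \<omega>))) f \<bar>B ?\<tau> \<omega>\<bar> * exp (- \<beta> * L ?\<tau> \<omega>)"
    unfolding verif_def by (intro tendsto_intros heat_tendsto limB limL lim)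
  then show ?thesis using u(3) \<tau>(3) \<epsilon> by (simp add: sticky_bm_def sticky_local_time_def)
qed

lemma verification:
  "(\<integral>\<omega>. heat \<epsilon> f (sticky_bm B L \<gamma> T \<omega>) * exp (- \<beta> * sticky_local_time L \<gamma> T \<omega>) \<partial>P x) = heat (T + \<epsilon>) f x"
proof (rule LIMSEQ_unique[OF _ expectation_stopped])
  have T0: "0 \<le> T" using T by simp
  note [measurable] = sticky_measurable[OF \<gamma> T0]
  show "(\<lambda>n. \<integral>\<omega>. stopped n \<omega> \<partial>P x) \<longlonglongrightarrow> (\<integral>\<omega>. heat \<epsilon> f (sticky_bm B L \<gamma> T \<omega>) * exp (- \<beta> * sticky_local_time L \<gamma> T \<omega>) \<partial>P x)"
  proof (rule integral_dominated_convergence[where w = "\<lambda>_. K"])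
    show "stopped n \<in> borel_measurable (P x)" for n
      unfolding stopped_def[abs_def]
      by (intro borel_measurable_add borel_measurable_sum borel_measurable_times borel_measurable_diff
        alive_measurable verif_measurable grid_nonneg order_refl)
    show "AE \<omega> in P x. norm (stopped n \<omega>) \<le> K" for n
    proof (rule AE_I2)
      fix \<omega> assume "\<omega> \<in> space (P x)"
      then have \<omega>: "\<omega> \<in> space A" by simp
      show "norm (stopped n \<omega>) \<le> K" by (rule stopped_exit[OF \<omega>, of n]) (simp add: verif_bound[OF \<omega>])
    qed
    show "AE \<omega> in P x. (\<lambda>n. stopped n \<omega>) \<longlonglongrightarrow> heat \<epsilon> f (sticky_bm B L \<gamma> T \<omega>) * exp (- \<beta> * sticky_local_time L \<gamma> T \<omega>)"
      using stopped_tendsto by (intro AE_I2) simp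
  qed simp_all
qed

end

text \<open>The surplus time 1 / (n + 1) tends to 0 on both sides of \<open>verification\<close>;
  the bound \<open>K\<close> dominates.\<close>

lemma (in brownian_local_time) sticky_expectation:
  assumes bf: "boundary_fun f f1 f2 K \<beta> \<gamma>" and x: "0 \<le> x" and T: "0 < T"
  shows "(\<integral>\<omega>. f (sticky_bm B L \<gamma> T \<omega>) * exp (- \<beta> * sticky_local_time L \<gamma> T \<omega>) \<partial>P x) = heat T f x"
proof -
  interpret boundary_fun f f1 f2 K \<beta> \<gamma> by (rule bf)
  interpret Px: prob_space "P x" by (rule prob_P)
  have T0: "0 \<le> T" using T by simp
  note [measurable] = sticky_measurable[OF \<gamma> T0]
  let ?\<epsilon> = "\<lambda>n. inverse (real (Suc n))"
  have eq: "(\<integral>\<omega>. heat (?\<epsilon> n) f (sticky_bm B L \<gamma> T \<omega>) * exp (- \<beta> * sticky_local_time L \<gamma> T \<omega>) \<partial>P x) = heat (T + ?\<epsilon> n) f x" for n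
  proof -
    interpret sticky_verification A P F B \<theta> L f f1 f2 K \<beta> \<gamma> x T "?\<epsilon> n"
      by unfold_locales (use x T in auto)
    show ?thesis by (rule verification)
  qed
  have "(\<lambda>n. heat (T + ?\<epsilon> n) f x) \<longlonglongrightarrow> heat (T + 0) f x"
    by (intro heat_tendsto tendsto_intros LIMSEQ_inverse_real_of_nat)
  moreover have "(\<lambda>n. heat (T + ?\<epsilon> n) f x) \<longlonglongrightarrow> (\<integral>\<omega>. f (sticky_bm B L \<gamma> T \<omega>) * exp (- \<beta> * sticky_local_time L \<gamma> T \<omega>) \<partial>P x)"
    unfolding eq[symmetric]
  proof (rule integral_dominated_convergence[where w = "\<lambda>_. K"])
    fix n
    show "AE \<omega> in P x. norm (heat (?\<epsilon> n) f (sticky_bm B L \<gamma> T \<omega>) * exp (- \<beta> * sticky_local_time L \<gamma> T \<omega>)) \<le> K"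
    proof (rule AE_I2)
      fix \<omega> assume "\<omega> \<in> space (P x)"
      then have "0 \<le> sticky_local_time L \<gamma> T \<omega>"
        using L_nonneg time_change(1)[OF \<gamma> _ T0] by (simp add: sticky_local_time_def)
      then have "\<bar>heat (?\<epsilon> n) f (sticky_bm B L \<gamma> T \<omega>)\<bar> * \<bar>exp (- \<beta> * sticky_local_time L \<gamma> T \<omega>)\<bar> \<le> K * 1"
        using \<beta> K_nonneg by (intro mult_mono abs_heat_le[OF meas(1) bound0]) auto
      then show "norm (heat (?\<epsilon> n) f (sticky_bm B L \<gamma> T \<omega>) * exp (- \<beta> * sticky_local_time L \<gamma> T \<omega>)) \<le> K"
        by (simp add: abs_mult)
    qed
  next
    have "(\<lambda>n. heat (?\<epsilon> n) f y) \<longlonglongrightarrow> f y" for y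
      using heat_tendsto[OF LIMSEQ_inverse_real_of_nat tendsto_const, of y] by simp
    then show "AE \<omega> in P x. (\<lambda>n. heat (?\<epsilon> n) f (sticky_bm B L \<gamma> T \<omega>) * exp (- \<beta> * sticky_local_time L \<gamma> T \<omega>))
        \<longlonglongrightarrow> f (sticky_bm B L \<gamma> T \<omega>) * exp (- \<beta> * sticky_local_time L \<gamma> T \<omega>)"
      by (intro AE_I2 tendsto_intros)
  qed simp_all
  ultimately show ?thesis using LIMSEQ_unique by fastforce
qed

section \<open>The kernel as a law weighted by the local time\<close>

text \<open>Points carry no mass, so every set between the open and the closed half-line has the
  same mass. This generality is convenient because whether the endpoint belongs to the section of
  the survival event depends on the path.\<close>

lemma exponential_law_tail:
  assumes \<beta>: "0 < \<beta>" and l: "0 \<le> l" and Q: "{l<..} \<subseteq> Q" "Q \<subseteq> {l..}" and [measurable]: "Q \<in> sets borel"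
  shows "emeasure (exponential_law \<beta>) Q = ennreal (exp (- \<beta> * l))"
proof -
  let ?D = "density lborel (\<lambda>s. ennreal (exponential_density \<beta> s))"
  interpret prob_space ?D by (rule prob_space_exponential_density[OF \<beta>])
  have tail: "emeasure ?D {l<..} = ennreal (exp (- \<beta> * l))"
  proof -
    have "emeasure ?D {..l} = ennreal (1 - exp (- \<beta> * l))"
      using emeasure_erlang_density[OF \<beta>, of 0 l] l by (simp add: erlang_CDF_0 mult.commute)
    moreover have "prob {l<..} = 1 - prob {..l}"
      using prob_compl[of "{..l}"] by (simp add: Compl_eq_Diff_UNIV[symmetric] not_le Collect_neg_eq[symmetric] greaterThan_def atMost_def)
    moreover have "exp (- \<beta> * l) \<le> 1" using \<beta> l by simp
    ultimately show ?thesis by (simp add: emeasure_eq_measure)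
  qed
  have "emeasure ?D {l} = 0"
  proof -
    have "AE s in lborel. s \<noteq> l" by (rule AE_lborel_singleton)
    then show ?thesis by (subst emeasure_density) (auto intro!: nn_integral_0_iff_AE[THEN iffD2] elim: eventually_mono split: split_indicator)
  qed
  moreover have "{l..} = {l<..} \<union> {l}" by auto
  ultimately have "emeasure ?D {l..} \<le> ennreal (exp (- \<beta> * l))"
    using emeasure_subadditive[of "{l<..}" ?D "{l}"] tail by simp
  moreover have "emeasure ?D {l<..} \<le> emeasure ?D Q" "emeasure ?D Q \<le> emeasure ?D {l..}"
    using Q by (auto intro!: emeasure_mono)
  ultimately have "emeasure ?D Q = ennreal (exp (- \<beta> * l))" using tail by simp
  moreover have "Q \<subseteq> {0..}" using Q l by auto
  ultimately show ?thesis unfolding exponential_law_def by (subst emeasure_restrict_space) auto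
qed

lemma space_exponential_law: "space (exponential_law \<beta>) = {0..}"
  by (simp add: exponential_law_def space_restrict_space)

lemma sets_exponential_law: "sets (exponential_law \<beta>) = sets (restrict_space borel {0..})"
  unfolding exponential_law_def by (intro sets_restrict_space_cong) simp

section \<open>The lifetime and the exponential weight\<close>

context brownian_local_time
begin

text \<open>Between the times \<open>t\<close> and \<open>q\<close> the clock advances by
  \<open>q - t\<close>, of which \<gamma> times the gain of local time is a part. Thus the local
  time of the sticky process is Lipschitz with constant 1 / \<gamma>.\<close>

lemma sticky_local_time_bounds:
  assumes \<gamma>: "0 < \<gamma>" and \<omega>: "\<omega> \<in> space A" and "0 \<le> t" "t \<le> q"
  shows "0 \<le> sticky_local_time L \<gamma> t \<omega>"
    and "sticky_local_time L \<gamma> t \<omega> \<le> sticky_local_time L \<gamma> q \<omega>"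
    and "sticky_local_time L \<gamma> q \<omega> \<le> sticky_local_time L \<gamma> t \<omega> + (q - t) / \<gamma>"
proof -
  have q: "0 \<le> q" using assms by simp
  note \<tau>t = time_change[OF \<gamma> \<omega> \<open>0 \<le> t\<close>] and \<tau>q = time_change[OF \<gamma> \<omega> q]
  have le: "time_change L \<gamma> t \<omega> \<le> time_change L \<gamma> q \<omega>"
  proof (rule ccontr)
    assume "\<not> ?thesis"
    then have "time_change L \<gamma> q \<omega> + \<gamma> * L (time_change L \<gamma> q \<omega>) \<omega> < t"
      using \<tau>t(4)[OF \<tau>q(1)] by simp
    then show False using \<tau>q(3) assms by simp
  qed
  show "0 \<le> sticky_local_time L \<gamma> t \<omega>" "sticky_local_time L \<gamma> t \<omega> \<le> sticky_local_time L \<gamma> q \<omega>"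
    unfolding sticky_local_time_def using L_nonneg[OF \<omega> \<tau>t(1)] L_le[OF \<omega> \<tau>t(1) le] by auto
  have "\<gamma> * (sticky_local_time L \<gamma> q \<omega> - sticky_local_time L \<gamma> t \<omega>) \<le> q - t"
    unfolding sticky_local_time_def using \<tau>t(3) \<tau>q(3) le by (simp add: right_diff_distrib)
  then show "sticky_local_time L \<gamma> q \<omega> \<le> sticky_local_time L \<gamma> t \<omega> + (q - t) / \<gamma>"
    using \<gamma> by (simp add: field_simps)
qed

text \<open>The infimum exceeds \<open>t\<close> exactly if the local time has not passed
  \<open>s\<close> at some later time. By monotonicity one rational witness is enough, and this
  makes the event a countable union.\<close>

lemma less_lifetime_iff:
  assumes \<gamma>: "0 < \<gamma>" and \<omega>: "\<omega> \<in> space A" and t: "0 \<le> t"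
  shows "ereal t < lifetime L \<gamma> (\<omega>, s) \<longleftrightarrow> (\<exists>q::rat. t < of_rat q \<and> sticky_local_time L \<gamma> (of_rat q) \<omega> \<le> s)"
proof
  assume "ereal t < lifetime L \<gamma> (\<omega>, s)"
  then obtain c where c: "ereal t < ereal c" "ereal c < lifetime L \<gamma> (\<omega>, s)"
    using ereal_dense2 by blast
  then obtain q :: rat where q: "t < of_rat q" "of_rat q < c" using of_rat_dense[of t c] by auto
  have "sticky_local_time L \<gamma> (of_rat q) \<omega> \<le> s"
  proof (rule ccontr)
    assume "\<not> ?thesis"
    then have "lifetime L \<gamma> (\<omega>, s) \<le> ereal (of_rat q)"
      unfolding lifetime_def prod.case using q t by (intro Inf_lower imageI) (simp del: zero_le_of_rat_iff)
    also have "\<dots> < ereal c" using q by simp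
    finally show False using c by simp
  qed
  then show "\<exists>q::rat. t < of_rat q \<and> sticky_local_time L \<gamma> (of_rat q) \<omega> \<le> s" using q by blast
next
  assume "\<exists>q::rat. t < of_rat q \<and> sticky_local_time L \<gamma> (of_rat q) \<omega> \<le> s"
  then obtain q :: rat where q: "t < of_rat q" "sticky_local_time L \<gamma> (of_rat q) \<omega> \<le> s" by blast
  have "ereal (of_rat q) \<le> lifetime L \<gamma> (\<omega>, s)"
    unfolding lifetime_def prod.case
  proof (rule Inf_greatest, safe)
    fix r assume r: "0 \<le> r" "s < sticky_local_time L \<gamma> r \<omega>"
    show "ereal (real_of_rat q) \<le> ereal r"
      using sticky_local_time_bounds(2)[OF \<gamma> \<omega> r(1), of "real_of_rat q"] q r by (force simp: not_le[symmetric])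
  qed
  moreover have "ereal t < ereal (of_rat q)" using q(1) by simp
  ultimately show "ereal t < lifetime L \<gamma> (\<omega>, s)" by (rule less_le_trans[rotated])
qed

lemma transition_kernel_eq:
  assumes \<beta>: "0 < \<beta>" and \<gamma>: "0 < \<gamma>" and t: "0 \<le> t" and C[measurable]: "C \<in> sets borel"
  shows "transition_kernel P B L \<beta> \<gamma> t x C
    = (\<integral>\<^sup>+\<omega>. ennreal (exp (- \<beta> * sticky_local_time L \<gamma> t \<omega>)) * indicator C (sticky_bm B L \<gamma> t \<omega>) \<partial>P x)"
proof -
  interpret Px: prob_space "P x" by (rule prob_P)
  let ?X = "exponential_law \<beta>"
  have "emeasure ?X {0..} = 1"
    using exponential_law_tail[OF \<beta> order_refl _ order_refl] by (auto simp: subset_eq)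
  then interpret X: prob_space ?X by (intro prob_spaceI) (simp add: space_exponential_law)
  have m[measurable]: "sticky_local_time L \<gamma> q \<in> borel_measurable (P x)" "sticky_bm B L \<gamma> q \<in> borel_measurable (P x)" if "0 \<le> q" for q
    using sticky_measurable[OF \<gamma> that] by (simp_all cong: measurable_cong_sets add: sets_P)
  have snd_m: "snd \<in> borel_measurable (P x \<Otimes>\<^sub>M ?X)"
  proof (rule measurable_compose[OF measurable_snd])
    show "(\<lambda>s. s) \<in> borel_measurable ?X"
      unfolding measurable_cong_sets[OF sets_exponential_law refl] by (rule measurable_restrict_space1) simp
  qed
  define D where "D = {w \<in> space (extended_law P \<beta> x). general_bm B L \<gamma> t w \<in> Some ` C}"
  have sp: "space (extended_law P \<beta> x) = space A \<times> {0..}"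
    by (simp add: extended_law_def space_pair_measure space_exponential_law)
  have D_iff: "(\<omega>, s) \<in> D \<longleftrightarrow> \<omega> \<in> space A \<and> 0 \<le> s \<and> sticky_bm B L \<gamma> t \<omega> \<in> C \<and>
      (\<exists>q\<in>{q::rat. t < of_rat q}. sticky_local_time L \<gamma> (of_rat q) \<omega> \<le> s)" for \<omega> s
    unfolding D_def sp using less_lifetime_iff[OF \<gamma> _ t, of \<omega> s] by (auto simp: general_bm_def)
  have D_meas: "D \<in> sets (P x \<Otimes>\<^sub>M ?X)"
  proof -
    \<comment> \<open>For the rationals in question the maximum changes nothing; it provides a
      nonnegative time for every rational, so that measurability holds for all members of the
      countable family.\<close>
    have "D = {w \<in> space (P x \<Otimes>\<^sub>M ?X). sticky_bm B L \<gamma> t (fst w) \<in> C \<and>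
        (\<exists>q\<in>{q::rat. t < of_rat q}. sticky_local_time L \<gamma> (max t (of_rat q)) (fst w) \<le> snd w)}"
      using D_iff by (auto simp: max_def space_pair_measure space_exponential_law)
    also have "\<dots> \<in> sets (P x \<Otimes>\<^sub>M ?X)"
    proof (intro sets.sets_Collect_conj sets.sets_Collect_countable_Bex)
      show "{w \<in> space (P x \<Otimes>\<^sub>M ?X). sticky_bm B L \<gamma> t (fst w) \<in> C} \<in> sets (P x \<Otimes>\<^sub>M ?X)"
        using m(2)[OF t] by measurable
      fix q :: rat
      have "0 \<le> max t (real_of_rat q)" using t by simp
      from m(1)[OF this] snd_m
      show "{w \<in> space (P x \<Otimes>\<^sub>M ?X). sticky_local_time L \<gamma> (max t (real_of_rat q)) (fst w) \<le> snd w} \<in> sets (P x \<Otimes>\<^sub>M ?X)"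
        by measurable
    qed
    finally show ?thesis .
  qed
  have "transition_kernel P B L \<beta> \<gamma> t x C = emeasure (P x \<Otimes>\<^sub>M ?X) D"
    unfolding transition_kernel_def D_def by (simp add: extended_law_def)
  also have "\<dots> = (\<integral>\<^sup>+\<omega>. emeasure ?X (Pair \<omega> -` D) \<partial>P x)"
    by (rule X.emeasure_pair_measure_alt[OF D_meas])
  also have "\<dots> = (\<integral>\<^sup>+\<omega>. ennreal (exp (- \<beta> * sticky_local_time L \<gamma> t \<omega>)) * indicator C (sticky_bm B L \<gamma> t \<omega>) \<partial>P x)"
  proof (rule nn_integral_cong)
    fix \<omega> assume "\<omega> \<in> space (P x)"
    then have \<omega>: "\<omega> \<in> space A" by simp
    show "emeasure ?X (Pair \<omega> -` D) = ennreal (exp (- \<beta> * sticky_local_time L \<gamma> t \<omega>)) * indicator C (sticky_bm B L \<gamma> t \<omega>)"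
    proof (cases "sticky_bm B L \<gamma> t \<omega> \<in> C")
      case True
      let ?l = "sticky_local_time L \<gamma> t \<omega>"
      let ?Q = "{s. \<exists>q\<in>{q::rat. t < of_rat q}. sticky_local_time L \<gamma> (of_rat q) \<omega> \<le> s}"
      have l0: "0 \<le> ?l" using sticky_local_time_bounds(1)[OF \<gamma> \<omega> t order_refl] .
      have Q1: "?Q \<subseteq> {?l..}"
      proof safe
        fix s and q :: rat assume "t < of_rat q" "sticky_local_time L \<gamma> (of_rat q) \<omega> \<le> s"
        then show "?l \<le> s" using sticky_local_time_bounds(2)[OF \<gamma> \<omega> t, of "of_rat q"] by linarith
      qed
      have Q2: "{?l<..} \<subseteq> ?Q"
      proof
        fix s assume "s \<in> {?l<..}"
        \<comment> \<open>By the Lipschitz bound, local time stays below \<open>s\<close> for a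
          duration of \<open>\<gamma> * (s - ?l)\<close> after \<open>t\<close>.\<close>
        then have "t < t + \<gamma> * (s - ?l)" using \<gamma> by simp
        then obtain q :: rat where q: "t < of_rat q" "of_rat q < t + \<gamma> * (s - ?l)" using of_rat_dense by blast
        have "sticky_local_time L \<gamma> (of_rat q) \<omega> \<le> ?l + (of_rat q - t) / \<gamma>"
          using q by (intro sticky_local_time_bounds(3)[OF \<gamma> \<omega> t]) simp
        also have "\<dots> \<le> s" using q \<gamma> by (simp add: field_simps)
        finally show "s \<in> ?Q" using q by auto
      qed
      have "?Q = (\<Union>q\<in>{q::rat. t < of_rat q}. {sticky_local_time L \<gamma> (of_rat q) \<omega>..})" by auto
      also have "\<dots> \<in> sets borel" by (intro sets.countable_UN') auto
      finally have "emeasure ?X ?Q = ennreal (exp (- \<beta> * ?l))"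
        by (rule exponential_law_tail[OF \<beta> l0 Q2 Q1])
      moreover have "Pair \<omega> -` D = ?Q"
      proof (rule set_eqI)
        fix s
        have "s \<in> Pair \<omega> -` D \<longleftrightarrow> 0 \<le> s \<and> s \<in> ?Q" using True \<omega> by (simp add: D_iff)
        moreover have "0 \<le> s" if "s \<in> ?Q" using subsetD[OF Q1 that] l0 by simp
        ultimately show "s \<in> Pair \<omega> -` D \<longleftrightarrow> s \<in> ?Q" by blast
      qed
      ultimately show ?thesis using True by simp
    next
      case False
      then have "Pair \<omega> -` D = {}" using D_iff by auto
      then show ?thesis using False by simp
    qed
  qed
  finally show ?thesis .
qed

text \<open>The kernel as a genuine finite measure on the line, which can then be identified through
  its integrals. Its total mass is the probability of not having reached the cemetery.\<close>

definition sticky_law :: "real \<Rightarrow> real \<Rightarrow> real \<Rightarrow> real \<Rightarrow> real measure" where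
  "sticky_law \<beta> \<gamma> t x = distr (density (P x) (\<lambda>\<omega>. ennreal (exp (- \<beta> * sticky_local_time L \<gamma> t \<omega>)))) borel (sticky_bm B L \<gamma> t)"

lemma sticky_law:
  assumes \<beta>: "0 < \<beta>" and \<gamma>: "0 < \<gamma>" and t: "0 \<le> t"
  shows "sets (sticky_law \<beta> \<gamma> t x) = sets borel"
    and "C \<in> sets borel \<Longrightarrow> emeasure (sticky_law \<beta> \<gamma> t x) C = transition_kernel P B L \<beta> \<gamma> t x C"
    and "finite_measure (sticky_law \<beta> \<gamma> t x)"
    and "f \<in> borel_measurable borel \<Longrightarrow> (\<integral>y. f y \<partial>sticky_law \<beta> \<gamma> t x)
      = (\<integral>\<omega>. f (sticky_bm B L \<gamma> t \<omega>) * exp (- \<beta> * sticky_local_time L \<gamma> t \<omega>) \<partial>P x)"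
    and "emeasure (sticky_law \<beta> \<gamma> t x) {..<0} = 0"
proof -
  interpret Px: prob_space "P x" by (rule prob_P)
  have [measurable]: "sticky_local_time L \<gamma> t \<in> borel_measurable (P x)" "sticky_bm B L \<gamma> t \<in> borel_measurable (P x)"
    using sticky_measurable[OF \<gamma> t] by (simp_all cong: measurable_cong_sets add: sets_P)
  show "sets (sticky_law \<beta> \<gamma> t x) = sets borel" by (simp add: sticky_law_def)
  have em: "emeasure (sticky_law \<beta> \<gamma> t x) C
    = (\<integral>\<^sup>+\<omega>. ennreal (exp (- \<beta> * sticky_local_time L \<gamma> t \<omega>)) * indicator C (sticky_bm B L \<gamma> t \<omega>) \<partial>P x)"
    if [measurable]: "C \<in> sets borel" for C
    unfolding sticky_law_def
    by (subst emeasure_distr, simp, simp, subst emeasure_density, simp, simp)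
      (intro nn_integral_cong, auto split: split_indicator)
  show "emeasure (sticky_law \<beta> \<gamma> t x) C = transition_kernel P B L \<beta> \<gamma> t x C" if "C \<in> sets borel" for C
    using em[OF that] transition_kernel_eq[OF \<beta> \<gamma> t that] by simp
  have "emeasure (sticky_law \<beta> \<gamma> t x) UNIV \<le> (\<integral>\<^sup>+\<omega>. 1 \<partial>P x)"
    unfolding em[of UNIV, simplified indicator_UNIV mult_1_right, OF sets.top[of borel, simplified space_borel]] using \<beta> sticky_local_time_bounds(1)[OF \<gamma> _ t order_refl]
    by (intro nn_integral_mono) (auto split: split_indicator)
  then have "emeasure (sticky_law \<beta> \<gamma> t x) UNIV \<le> 1" using Px.emeasure_space_1 by simp
  then show "finite_measure (sticky_law \<beta> \<gamma> t x)"
    by (intro finite_measureI) (auto simp: sticky_law_def top_unique)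
  show "(\<integral>y. f y \<partial>sticky_law \<beta> \<gamma> t x) = (\<integral>\<omega>. f (sticky_bm B L \<gamma> t \<omega>) * exp (- \<beta> * sticky_local_time L \<gamma> t \<omega>) \<partial>P x)"
    if [measurable]: "f \<in> borel_measurable borel" for f
    unfolding sticky_law_def by (subst integral_distr, simp, simp, subst integral_density) (auto simp: mult.commute)
  show "emeasure (sticky_law \<beta> \<gamma> t x) {..<0} = 0"
    by (subst em) (auto simp: sticky_bm_def)
qed

end

section \<open>The explicit kernel\<close>

definition gauss :: "real \<Rightarrow> real \<Rightarrow> real" where
  "gauss r w = exp (- w\<^sup>2 / (2 * r)) / sqrt (2 * pi * r)"

text \<open>Minus the derivative in \<open>w\<close>, hence nonnegative for
  \<open>w \<ge> 0\<close>. For \<open>w > 0\<close>, as a function of \<open>r\<close>, it is the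
  density of the time at which Brownian motion first hits the level \<open>w\<close>.\<close>

definition gauss1 :: "real \<Rightarrow> real \<Rightarrow> real" where "gauss1 r w = w / r * gauss r w"

text \<open>The second derivative in \<open>w\<close>, and by the heat equation twice the derivative
  in \<open>r\<close>.\<close>

definition gauss2 :: "real \<Rightarrow> real \<Rightarrow> real" where "gauss2 r w = (w\<^sup>2 / r\<^sup>2 - 1 / r) * gauss r w"

lemma gauss_measurable [measurable (raw)]:
  assumes [measurable]: "r \<in> borel_measurable M" "w \<in> borel_measurable M"
  shows "(\<lambda>x. gauss (r x) (w x)) \<in> borel_measurable M" "(\<lambda>x. gauss1 (r x) (w x)) \<in> borel_measurable M"
    "(\<lambda>x. gauss2 (r x) (w x)) \<in> borel_measurable M"
  unfolding gauss1_def gauss2_def gauss_def by measurable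

lemma gauss_nonneg: "0 \<le> r \<Longrightarrow> 0 \<le> gauss r w" by (simp add: gauss_def)

lemma gauss_deriv:
  assumes r: "0 < r"
  shows "(gauss r has_real_derivative - gauss1 r w) (at w within S)"
    and "(gauss1 r has_real_derivative - gauss2 r w) (at w within S)"
proof -
  show g: "(gauss r has_real_derivative - gauss1 r w) (at w within S)"
    unfolding gauss_def[abs_def] gauss1_def using r
    by (auto intro!: derivative_eq_intros simp: field_simps)
  show "(gauss1 r has_real_derivative - gauss2 r w) (at w within S)"
    unfolding gauss1_def[abs_def] gauss2_def using r
    by (auto intro!: derivative_eq_intros g simp: gauss1_def field_simps power2_eq_square)
qed

text \<open>Time runs backwards at unit speed, which by the heat equation gives half of
  \<open>gauss2\<close> with a minus sign; space moves at speed 1 / \<gamma>, which gives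
  \<open>gauss1\<close>; the exponential weight gives the term in \<beta>.\<close>

lemma gauss_path_deriv:
  assumes s: "s < T" and \<gamma>: "0 < \<gamma>"
  shows "((\<lambda>s. exp (- \<beta> * s / \<gamma>) * gauss (T - s) (a + s / \<gamma>)) has_real_derivative
     - (exp (- \<beta> * s / \<gamma>) * (\<beta> / \<gamma> * gauss (T - s) (a + s / \<gamma>) + 1 / 2 * gauss2 (T - s) (a + s / \<gamma>)
       + 1 / \<gamma> * gauss1 (T - s) (a + s / \<gamma>)))) (at s)"
proof -
  define r where "r = T - s"
  have r: "0 < r" using s by (simp add: r_def)
  define w where "w = a + s / \<gamma>"
  have dsqrt: "((\<lambda>s. sqrt (2 * pi * (T - s))) has_real_derivative (- pi / sqrt (2 * pi * r))) (at s)"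
    using r pi_gt_zero by (auto intro!: derivative_eq_intros simp: r_def field_simps)
  have dexp: "((\<lambda>s. exp (- (a + s / \<gamma>)\<^sup>2 / (2 * (T - s)))) has_real_derivative
     exp (- w\<^sup>2 / (2 * r)) * (- (w / \<gamma>) / r - w\<^sup>2 / (2 * r\<^sup>2))) (at s)"
  proof -
    have n: "((\<lambda>s. - (a + s / \<gamma>)\<^sup>2) has_real_derivative - (2 * w / \<gamma>)) (at s)"
      using \<gamma> by (auto intro!: derivative_eq_intros simp: w_def)
    have d: "((\<lambda>s. 2 * (T - s)) has_real_derivative - 2) (at s)"
      by (auto intro!: derivative_eq_intros)
    have "(- (2 * w / \<gamma>) * (2 * r) - - w\<^sup>2 * - 2) / (2 * r * (2 * r)) = - (w / \<gamma>) / r - w\<^sup>2 / (2 * r\<^sup>2)"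
      using r \<gamma> by (simp add: divide_simps power2_eq_square)
    with DERIV_divide[OF n d] r
    have "((\<lambda>s. - (a + s / \<gamma>)\<^sup>2 / (2 * (T - s))) has_real_derivative - (w / \<gamma>) / r - w\<^sup>2 / (2 * r\<^sup>2)) (at s)"
      by (simp add: r_def w_def)
    from DERIV_fun_exp[OF this] show ?thesis by (simp add: r_def w_def)
  qed
  have sq: "sqrt (2 * pi * r) * sqrt (2 * pi * r) = 2 * pi * r" using r by simp
  have "((\<lambda>s. gauss (T - s) (a + s / \<gamma>)) has_real_derivative
     (exp (- w\<^sup>2 / (2 * r)) * (- (w / \<gamma>) / r - w\<^sup>2 / (2 * r\<^sup>2)) * sqrt (2 * pi * r)
       - exp (- w\<^sup>2 / (2 * r)) * (- pi / sqrt (2 * pi * r))) / (sqrt (2 * pi * r) * sqrt (2 * pi * r))) (at s)"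
    unfolding gauss_def using DERIV_divide[OF dexp dsqrt] r by (simp add: r_def w_def)
  moreover have "(exp (- w\<^sup>2 / (2 * r)) * (- (w / \<gamma>) / r - w\<^sup>2 / (2 * r\<^sup>2)) * sqrt (2 * pi * r)
       - exp (- w\<^sup>2 / (2 * r)) * (- pi / sqrt (2 * pi * r))) / (sqrt (2 * pi * r) * sqrt (2 * pi * r))
     = - (1 / 2 * gauss2 r w + 1 / \<gamma> * gauss1 r w)"
  proof -
    define Q where "Q = sqrt (2 * pi * r)"
    have Q: "0 < Q" "Q * Q = 2 * pi * r" using r sq by (auto simp: Q_def)
    have "- pi / Q = - (Q / (2 * r))" using Q r by (simp add: field_simps)
    moreover have "(X * Q - Y * - (Q / (2 * r))) / (Q * Q) = (X + Y / (2 * r)) / Q" for X Y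
    proof -
      have "(X * Q - Y * - (Q / (2 * r))) / (Q * Q) = ((X + Y / (2 * r)) * Q) / (Q * Q)"
        by (simp add: algebra_simps)
      also have "\<dots> = (X + Y / (2 * r)) / Q" using Q(1) by simp
      finally show ?thesis .
    qed
    ultimately have "(exp (- w\<^sup>2 / (2 * r)) * (- (w / \<gamma>) / r - w\<^sup>2 / (2 * r\<^sup>2)) * Q - exp (- w\<^sup>2 / (2 * r)) * (- pi / Q)) / (Q * Q)
      = (exp (- w\<^sup>2 / (2 * r)) * (- (w / \<gamma>) / r - w\<^sup>2 / (2 * r\<^sup>2)) + exp (- w\<^sup>2 / (2 * r)) / (2 * r)) / Q"
      by (simp only:)
    then show ?thesis unfolding gauss1_def gauss2_def gauss_def Q_def[symmetric]
      by (simp add: algebra_simps add_divide_distrib diff_divide_distrib)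
  qed
  ultimately have g: "((\<lambda>s. gauss (T - s) (a + s / \<gamma>)) has_real_derivative - (1 / 2 * gauss2 r w + 1 / \<gamma> * gauss1 r w)) (at s)"
    by simp
  have "((\<lambda>s. exp (- \<beta> * s / \<gamma>)) has_real_derivative - (\<beta> / \<gamma>) * exp (- \<beta> * s / \<gamma>)) (at s)"
    using \<gamma> by (auto intro!: derivative_eq_intros)
  from DERIV_mult[OF this g] show ?thesis
    by (rule DERIV_cong) (simp add: r_def w_def algebra_simps)
qed

lemma exp_minus_le_inverse_power: assumes "0 < (a::real)" shows "exp (- a) \<le> fact n / a ^ n"
proof -
  have "a ^ n / fact n \<le> exp a"
    using sum_le_suminf[of "\<lambda>n. a ^ n /\<^sub>R fact n" "{n}"] summable_exp_generic[of a] assms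
    by (simp add: exp_def divide_inverse mult.commute)
  then show ?thesis using assms by (simp add: exp_minus field_simps)
qed

text \<open>One common factor for all three kernels: the coefficients of \<open>gauss\<close> are at
  most (1 + w)^2 (1 + 1 / r)^2, the normalisation is at most 1 + 1 / r, and 1 + 1 / r \<le> (T + 1)
  / r.\<close>

lemma gauss_decay:
  assumes r: "0 < r" "r \<le> T" and w: "0 \<le> w"
  shows "\<bar>gauss r w\<bar> \<le> (T + 1) ^ 3 * (1 + w)\<^sup>2 / r ^ 3 * exp (- w\<^sup>2 / (2 * r))"
    and "\<bar>gauss1 r w\<bar> \<le> (T + 1) ^ 3 * (1 + w)\<^sup>2 / r ^ 3 * exp (- w\<^sup>2 / (2 * r))"
    and "\<bar>gauss2 r w\<bar> \<le> (T + 1) ^ 3 * (1 + w)\<^sup>2 / r ^ 3 * exp (- w\<^sup>2 / (2 * r))"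
    and "\<bar>gauss r w\<bar> \<le> (1 + 1 / r) * exp (- w\<^sup>2 / (2 * r))"
proof -
  define E where "E = exp (- w\<^sup>2 / (2 * r))"
  define v where "v = 1 / r"
  have v: "0 < v" using r by (simp add: v_def)
  have E: "0 \<le> E" by (simp add: E_def)
  have "gauss r w \<le> (1 + v) * E"
  proof -
    have "r \<le> 2 * pi * r" using r pi_gt3 by simp
    then have "1 / sqrt (2 * pi * r) \<le> 1 / sqrt r" using r by (intro divide_left_mono) auto
    also have "1 / sqrt r \<le> 1 + v"
    proof (cases "r \<ge> 1")
      case True
      then have "1 / sqrt r \<le> 1" by simp
      then show ?thesis using v by simp
    next
      case False
      then have "r * r \<le> r" using r mult_left_le[of r r] by simp
      then have "r \<le> sqrt r" using r by (intro real_le_rsqrt) (simp add: power2_eq_square)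
      then have "1 / sqrt r \<le> v" unfolding v_def using r by (intro divide_left_mono) auto
      then show ?thesis by simp
    qed
    finally have "1 / sqrt (2 * pi * r) * E \<le> (1 + v) * E" using E by (rule mult_right_mono)
    then show ?thesis by (simp add: gauss_def E_def)
  qed
  moreover have "0 \<le> gauss r w" using r by (simp add: gauss_nonneg)
  ultimately have g: "\<bar>gauss r w\<bar> \<le> (1 + v) * E" by simp
  then show "\<bar>gauss r w\<bar> \<le> (1 + 1 / r) * exp (- w\<^sup>2 / (2 * r))" by (simp add: v_def E_def)
  have "1 + v \<le> (T + 1) / r" unfolding v_def using r by (simp add: field_simps)
  then have "(1 + v) ^ 3 \<le> ((T + 1) / r) ^ 3" using v by (intro power_mono) auto
  then have "(1 + v) ^ 3 * ((1 + w)\<^sup>2 * E) \<le> ((T + 1) / r) ^ 3 * ((1 + w)\<^sup>2 * E)" using E by (intro mult_right_mono) auto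
  also have "\<dots> = (T + 1) ^ 3 * (1 + w)\<^sup>2 / r ^ 3 * E" by (simp add: power_divide)
  finally have fin: "(1 + v) ^ 3 * ((1 + w)\<^sup>2 * E) \<le> (T + 1) ^ 3 * (1 + w)\<^sup>2 / r ^ 3 * E" .
  have bound: "\<bar>c\<bar> * \<bar>gauss r w\<bar> \<le> (T + 1) ^ 3 * (1 + w)\<^sup>2 / r ^ 3 * E"
    if "\<bar>c\<bar> \<le> (1 + w)\<^sup>2 * (1 + v)\<^sup>2" for c
  proof -
    have "\<bar>c\<bar> * \<bar>gauss r w\<bar> \<le> ((1 + w)\<^sup>2 * (1 + v)\<^sup>2) * ((1 + v) * E)"
      using that g by (intro mult_mono) auto
    also have "\<dots> = (1 + v) ^ 3 * ((1 + w)\<^sup>2 * E)" by (simp add: power3_eq_cube power2_eq_square)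
    finally show ?thesis using fin by simp
  qed
  have p1: "1 \<le> (1 + w)\<^sup>2 * (1 + v)\<^sup>2"
    using w v mult_mono[of 1 "(1 + w)\<^sup>2" 1 "(1 + v)\<^sup>2"] one_le_power[of "1 + w" 2] one_le_power[of "1 + v" 2] by simp
  have p2: "w * v \<le> (1 + w)\<^sup>2 * (1 + v)\<^sup>2"
    using w v by (intro mult_mono) (auto simp: power2_eq_square algebra_simps)
  have p3: "w\<^sup>2 * v\<^sup>2 + v \<le> (1 + w)\<^sup>2 * (1 + v)\<^sup>2"
    using w v by (simp add: power2_eq_square algebra_simps)
  show "\<bar>gauss r w\<bar> \<le> (T + 1) ^ 3 * (1 + w)\<^sup>2 / r ^ 3 * exp (- w\<^sup>2 / (2 * r))"
    using bound[of 1] p1 by (simp add: E_def)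
  show "\<bar>gauss1 r w\<bar> \<le> (T + 1) ^ 3 * (1 + w)\<^sup>2 / r ^ 3 * exp (- w\<^sup>2 / (2 * r))"
    using bound[of "w * v"] p2 w v by (simp add: gauss1_def abs_mult E_def v_def)
  have "\<bar>w\<^sup>2 * v\<^sup>2 - v\<bar> \<le> w\<^sup>2 * v\<^sup>2 + v" using v by (simp add: abs_le_iff)
  then show "\<bar>gauss2 r w\<bar> \<le> (T + 1) ^ 3 * (1 + w)\<^sup>2 / r ^ 3 * exp (- w\<^sup>2 / (2 * r))"
    using bound[of "w\<^sup>2 * v\<^sup>2 - v"] p3 by (simp add: gauss2_def abs_mult E_def v_def power_divide)
qed

text \<open>Along the path \<open>s \<mapsto> (T - s, y + s / \<gamma>)\<close> the heat kernel stays away from its singularity at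
  \<open>(0, 0)\<close>.\<close>

lemma gauss_path_bound:
  assumes T: "0 < T" and \<gamma>: "0 < \<gamma>"
  obtains C where "0 \<le> C" "\<And>s w y. 0 \<le> s \<Longrightarrow> s < T \<Longrightarrow> 0 \<le> y \<Longrightarrow> y + s / \<gamma> \<le> w \<Longrightarrow>
    \<bar>gauss (T - s) w\<bar> \<le> C * exp (- y\<^sup>2 / (8 * T)) \<and> \<bar>gauss1 (T - s) w\<bar> \<le> C * exp (- y\<^sup>2 / (8 * T)) \<and>
    \<bar>gauss2 (T - s) w\<bar> \<le> C * exp (- y\<^sup>2 / (8 * T))"
proof -
  \<comment> \<open>In the second half of the time interval the path is at distance at least
    \<open>w0\<close> from 0, which controls the inverse powers of \<open>r\<close>; in the first
    half \<open>r\<close> is at least \<open>T / 2\<close>. The two entries of \<open>M\<close>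
    belong to these cases, with 384 = 3! * 4^3.\<close>
  define w0 where "w0 = T / (2 * \<gamma>)"
  have w0: "0 < w0" using T \<gamma> by (simp add: w0_def)
  define M where "M = max ((2 / T) ^ 3) (384 / w0 ^ 6)"
  define C where "C = (T + 1) ^ 3 * M * (2 + 16 * T)"
  have M0: "0 < M" using T by (simp add: M_def less_max_iff_disj)
  have C0: "0 \<le> C" unfolding C_def using T M0 by (intro mult_nonneg_nonneg) auto
  have core: "(T + 1) ^ 3 * (1 + w)\<^sup>2 / r ^ 3 * exp (- w\<^sup>2 / (2 * r)) \<le> C * exp (- y\<^sup>2 / (8 * T))"
    if s: "0 \<le> s" "s < T" and y: "0 \<le> y" and w: "y + s / \<gamma> \<le> w" and r: "r = T - s" for s w y r
  proof -
    have r0: "0 < r" "r \<le> T" using s r by auto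
    have wy: "y \<le> w" "s / \<gamma> \<le> w" "0 \<le> w" using w y s \<gamma> by (auto intro: order_trans[rotated] add_nonneg_nonneg)
    have e1: "exp (- w\<^sup>2 / (4 * r)) / r ^ 3 \<le> M"
    proof (cases "s \<le> T / 2")
      case True
      then have "T / 2 \<le> r" using r by simp
      then have "1 / r \<le> 2 / T" using T r0 by (simp add: field_simps)
      then have "(1 / r) ^ 3 \<le> (2 / T) ^ 3" using r0 by (intro power_mono) auto
      moreover have "exp (- w\<^sup>2 / (4 * r)) / r ^ 3 \<le> 1 / r ^ 3" using r0 by (intro divide_right_mono) auto
      ultimately show ?thesis by (simp add: M_def power_one_over)
    next
      case False
      then have "T / 2 / \<gamma> \<le> s / \<gamma>" using \<gamma> by (intro divide_right_mono) auto
      then have ww: "w0 \<le> w" using wy by (simp add: w0_def)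
      then have wp: "0 < w" using w0 by simp
      have "exp (- (w\<^sup>2 / (4 * r))) \<le> fact 3 / (w\<^sup>2 / (4 * r)) ^ 3"
        using wp r0 by (intro exp_minus_le_inverse_power) auto
      also have "\<dots> = 384 * r ^ 3 / w ^ 6"
        by (simp add: power_divide power_mult_distrib fact_numeral flip: power_mult)
      finally have "exp (- w\<^sup>2 / (4 * r)) / r ^ 3 \<le> 384 / w ^ 6" using r0 by (simp add: field_simps)
      also have "\<dots> \<le> 384 / w0 ^ 6" using w0 ww by (intro divide_left_mono power_mono mult_pos_pos zero_less_power) auto
      finally show ?thesis by (simp add: M_def)
    qed
    \<comment> \<open>The Gaussian factor is spent three times: one half of the exponent has
      absorbed the inverse powers of \<open>r\<close>. The other half, weakened by
      \<open>r \<le> T\<close>, is split into a quarter against the polynomial in \<open>w\<close>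
      and a quarter for the decay in \<open>y\<close>.\<close>
    have e2: "exp (- w\<^sup>2 / (4 * r)) \<le> exp (- w\<^sup>2 / (8 * T)) * exp (- w\<^sup>2 / (8 * T))"
    proof -
      have "w\<^sup>2 / (4 * T) \<le> w\<^sup>2 / (4 * r)" using r0 by (intro divide_left_mono) auto
      then show ?thesis by (simp flip: exp_add)
    qed
    have e3: "(1 + w)\<^sup>2 * exp (- w\<^sup>2 / (8 * T)) \<le> 2 + 16 * T"
    proof -
      have "w\<^sup>2 / (8 * T) \<le> exp (w\<^sup>2 / (8 * T))" using exp_ge_add_one_self[of "w\<^sup>2 / (8 * T)"] by linarith
      then have "w\<^sup>2 / (8 * T) * exp (- w\<^sup>2 / (8 * T)) \<le> exp (w\<^sup>2 / (8 * T)) * exp (- w\<^sup>2 / (8 * T))"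
        by (intro mult_right_mono) auto
      also have "\<dots> = 1" by (simp flip: exp_add)
      finally have "w\<^sup>2 * exp (- w\<^sup>2 / (8 * T)) \<le> 8 * T" using T by (simp add: field_simps)
      moreover have "exp (- w\<^sup>2 / (8 * T)) \<le> 1" using T by simp
      moreover have "(1 + w)\<^sup>2 * exp (- w\<^sup>2 / (8 * T)) \<le> (2 + 2 * w\<^sup>2) * exp (- w\<^sup>2 / (8 * T))"
      proof (rule mult_right_mono)
        have "0 \<le> (1 - w)\<^sup>2" by simp
        then show "(1 + w)\<^sup>2 \<le> 2 + 2 * w\<^sup>2" by (simp add: power2_eq_square algebra_simps)
      qed simp
      ultimately show ?thesis unfolding distrib_right by linarith
    qed
    have e4: "exp (- w\<^sup>2 / (8 * T)) \<le> exp (- y\<^sup>2 / (8 * T))"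
      using T wy y by (simp add: divide_right_mono power_mono)
    have "(T + 1) ^ 3 * (1 + w)\<^sup>2 / r ^ 3 * exp (- w\<^sup>2 / (2 * r))
      = (T + 1) ^ 3 * ((exp (- w\<^sup>2 / (4 * r)) / r ^ 3) * ((1 + w)\<^sup>2 * exp (- w\<^sup>2 / (4 * r))))"
      using r0 by (simp add: mult_ac flip: exp_add) 
    also have "\<dots> \<le> (T + 1) ^ 3 * (M * ((2 + 16 * T) * exp (- y\<^sup>2 / (8 * T))))"
    proof (rule mult_left_mono, rule mult_mono[OF e1])
      have "(1 + w)\<^sup>2 * exp (- w\<^sup>2 / (4 * r)) \<le> (1 + w)\<^sup>2 * (exp (- w\<^sup>2 / (8 * T)) * exp (- w\<^sup>2 / (8 * T)))"
        by (intro mult_left_mono e2) simp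
      also have "\<dots> = ((1 + w)\<^sup>2 * exp (- w\<^sup>2 / (8 * T))) * exp (- w\<^sup>2 / (8 * T))" by simp
      also have "\<dots> \<le> (2 + 16 * T) * exp (- y\<^sup>2 / (8 * T))"
        using T by (intro mult_mono e3 e4) auto
      finally show "(1 + w)\<^sup>2 * exp (- w\<^sup>2 / (4 * r)) \<le> (2 + 16 * T) * exp (- y\<^sup>2 / (8 * T))" .
    qed (use T M0 in auto)
    finally show ?thesis by (simp add: C_def mult.assoc)
  qed
  show thesis
  proof (rule that[OF C0], intro conjI)
    fix s w y assume a: "0 \<le> s" "s < T" "0 \<le> y" "y + s / \<gamma> \<le> w"
    have w: "0 \<le> w" using a \<gamma> by (smt (verit) divide_nonneg_pos)
    have r: "0 < T - s" "T - s \<le> T" using a by auto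
    note c = core[OF a refl]
    show "\<bar>gauss (T - s) w\<bar> \<le> C * exp (- y\<^sup>2 / (8 * T))" by (rule order_trans[OF gauss_decay(1)[OF r w] c])
    show "\<bar>gauss1 (T - s) w\<bar> \<le> C * exp (- y\<^sup>2 / (8 * T))" by (rule order_trans[OF gauss_decay(2)[OF r w] c])
    show "\<bar>gauss2 (T - s) w\<bar> \<le> C * exp (- y\<^sup>2 / (8 * T))" by (rule order_trans[OF gauss_decay(3)[OF r w] c])
  qed
qed

text \<open>Near the end of the path the variance vanishes while the position stays above
  \<open>w0\<close>, so the exponential wins over the normalisation.\<close>

lemma gauss_path_tendsto_0:
  assumes T: "0 < T" and \<gamma>: "0 < \<gamma>" and a: "0 \<le> a"
  shows "((\<lambda>s. exp (- \<beta> * s / \<gamma>) * gauss (T - s) (a + s / \<gamma>)) \<longlongrightarrow> 0) (at_left T)"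
proof -
  define w0 where "w0 = T / (2 * \<gamma>)"
  have w0: "0 < w0" using T \<gamma> by (simp add: w0_def)
  have ev: "\<forall>\<^sub>F s in at_left T. s \<in> {T / 2<..<T}"
    using T by (intro eventually_at_left_real) simp
  have "((\<lambda>s. gauss (T - s) (a + s / \<gamma>)) \<longlongrightarrow> 0) (at_left T)"
  proof (rule Lim_null_comparison)
    show "\<forall>\<^sub>F s in at_left T. norm (gauss (T - s) (a + s / \<gamma>)) \<le> 8 / w0 ^ 4 * ((T - s)\<^sup>2 + (T - s))"
      using ev
    proof eventually_elim
      case (elim s)
      then have s: "T / 2 < s \<and> s < T" by simp
      define r where "r = T - s"
      define w where "w = a + s / \<gamma>"
      have r: "0 < r" "r \<le> T" using s T by (auto simp: r_def)
      have "T / 2 / \<gamma> \<le> s / \<gamma>" using \<gamma> s by (intro divide_right_mono) auto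
      then have ww: "w0 \<le> w" using a by (simp add: w0_def w_def)
      then have wp: "0 < w" using w0 by simp
      have "exp (- (w\<^sup>2 / (2 * r))) \<le> fact 2 / (w\<^sup>2 / (2 * r)) ^ 2"
        using wp r by (intro exp_minus_le_inverse_power) auto
      also have "\<dots> = 8 * r\<^sup>2 / w ^ 4"
        by (simp add: power_divide power_mult_distrib fact_numeral flip: power_mult)
      also have "\<dots> \<le> 8 * r\<^sup>2 / w0 ^ 4" using w0 ww by (intro divide_left_mono power_mono mult_pos_pos zero_less_power) auto
      finally have e: "exp (- w\<^sup>2 / (2 * r)) \<le> 8 * r\<^sup>2 / w0 ^ 4" by simp
      have "\<bar>gauss r w\<bar> \<le> (1 + 1 / r) * exp (- w\<^sup>2 / (2 * r))" using gauss_decay(4)[OF r] wp by simp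
      also have "\<dots> \<le> (1 + 1 / r) * (8 * r\<^sup>2 / w0 ^ 4)" using r by (intro mult_left_mono e) auto
      also have "\<dots> = 8 / w0 ^ 4 * ((1 + 1 / r) * r\<^sup>2)" by simp
      also have "(1 + 1 / r) * r\<^sup>2 = r\<^sup>2 + r" using r by (simp add: field_simps power2_eq_square)
      finally show ?case
        by (simp add: r_def w_def)
    qed
    have "((\<lambda>s. 8 / w0 ^ 4 * ((T - s)\<^sup>2 + (T - s))) \<longlongrightarrow> 8 / w0 ^ 4 * ((T - T)\<^sup>2 + (T - T))) (at_left T)"
      by (intro tendsto_intros)
    then show "((\<lambda>s. 8 / w0 ^ 4 * ((T - s)\<^sup>2 + (T - s))) \<longlongrightarrow> 0) (at_left T)" by simp
  qed
  moreover have "((\<lambda>s. exp (- \<beta> * s / \<gamma>)) \<longlongrightarrow> exp (- \<beta> * T / \<gamma>)) (at_left T)"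
    using \<gamma> by (intro tendsto_intros) auto
  ultimately show ?thesis using tendsto_mult by fastforce
qed

lemma integrable_exp_square: "0 < (c::real) \<Longrightarrow> integrable lborel (\<lambda>y. exp (- y\<^sup>2 / c))"
proof -
  assume c: "0 < c"
  have "integrable lborel (normal_density 0 (sqrt (c / 2)))" using c by (intro integrable_normal_density) simp
  then have "integrable lborel (\<lambda>y. sqrt (pi * c) * normal_density 0 (sqrt (c / 2)) y)" by simp
  moreover have "sqrt (pi * c) * normal_density 0 (sqrt (c / 2)) y = exp (- y\<^sup>2 / c)" for y
    using c by (simp add: normal_density_def)
  ultimately show ?thesis by simp
qed

lemma heat_eq_integral:
  assumes r: "0 < r" and [measurable]: "f \<in> borel_measurable borel"
  shows "heat r f x = (\<integral>z. gauss r (x - z) * f z \<partial>lborel)"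
proof -
  have "heat r f x = (\<integral>u. f (x + u) \<partial>density lborel (normal_density 0 (sqrt r)))"
    unfolding heat_def using r by (subst integral_normal_density_std) auto
  also have "\<dots> = (\<integral>u. normal_density 0 (sqrt r) u * f (x + u) \<partial>lborel)"
    by (subst integral_density) auto
  also have "\<dots> = (\<integral>z. normal_density 0 (sqrt r) (z - x) * f z \<partial>lborel)"
    by (subst lborel_integral_real_affine[of 1 _ "- x"]) (auto simp: algebra_simps)
  also have "\<dots> = (\<integral>z. gauss r (x - z) * f z \<partial>lborel)"
    using r by (intro Bochner_Integration.integral_cong refl)
      (simp add: normal_density_def gauss_def power2_commute)
  finally show ?thesis .
qed

section \<open>Images: integration along the path and in space\<close>

locale image_data =
  fixes q0 q1 q2 :: "real \<Rightarrow> real" and K \<beta> \<gamma> T x :: real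
  assumes d0: "\<And>v. (q0 has_real_derivative q1 v) (at v)"
    and d1: "\<And>v. (q1 has_real_derivative q2 v) (at v)"
    and c2: "continuous_on UNIV q2"
    and b0: "\<And>v. \<bar>q0 v\<bar> \<le> K" and b1: "\<And>v. \<bar>q1 v\<bar> \<le> K" and b2: "\<And>v. \<bar>q2 v\<bar> \<le> K"
    and odd0: "\<And>v. q0 (- v) = - q0 v" and even1: "\<And>v. q1 (- v) = q1 v" and odd2: "\<And>v. q2 (- v) = - q2 v"
    and \<beta>: "0 < \<beta>" and \<gamma>: "0 < \<gamma>" and T: "0 < T" and x: "0 \<le> x"
begin

definition fe :: "real \<Rightarrow> real" where "fe v = q1 v + \<beta> * q0 v + \<gamma> / 2 * q2 v"

lemma K_nonneg: "0 \<le> K" using b0[of 0] by linarith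

lemma q_cont: "continuous_on UNIV q0" "continuous_on UNIV q1" "isCont q0 v" "isCont q1 v" "isCont q2 v"
  using d0 d1 c2 by (auto intro!: DERIV_continuous_on DERIV_isCont simp: has_field_derivative_at_within continuous_on_eq_continuous_at)

lemma q_meas [measurable]: "q0 \<in> borel_measurable borel" "q1 \<in> borel_measurable borel" "q2 \<in> borel_measurable borel"
  "fe \<in> borel_measurable borel"
proof -
  show [measurable]: "q0 \<in> borel_measurable borel" "q1 \<in> borel_measurable borel" "q2 \<in> borel_measurable borel"
    using q_cont c2 by (auto intro: borel_measurable_continuous_onI)
  show "fe \<in> borel_measurable borel" unfolding fe_def[abs_def] by measurable
qed

lemma q0_0: "q0 0 = 0" and fe_0: "fe 0 = q1 0"
  using odd0[of 0] odd2[of 0] by (auto simp: fe_def)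

text \<open>\<open>q1\<close> is the even part of \<open>fe\<close>, and the remaining two terms are
  its odd part. In the heat flow on the whole line, the negative half-line therefore contributes
  minus the reflected kernel against \<open>fe\<close>, which completes \<open>p_D\<close>, and
  twice the reflected kernel against \<open>q1\<close>.\<close>

lemma fe_reflect: "fe (- v) = 2 * q1 v - fe v"
  by (simp add: fe_def odd0 even1 odd2)

definition Kf :: real where "Kf = K + \<beta> * K + \<gamma> / 2 * K"

lemma fe_bound: "\<bar>fe v\<bar> \<le> Kf"
proof -
  have "\<bar>fe v\<bar> \<le> \<bar>q1 v\<bar> + \<bar>\<beta> * q0 v\<bar> + \<bar>\<gamma> / 2 * q2 v\<bar>" unfolding fe_def by linarith
  also have "\<dots> \<le> Kf" unfolding Kf_def abs_mult using \<beta> \<gamma> b0 b1 b2 by (intro add_mono mult_mono) auto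
  finally show ?thesis .
qed

definition decay :: "real \<Rightarrow> real" where
  "decay s = exp (- \<beta> * s / \<gamma>)"

lemma decay_bound: "0 \<le> s \<Longrightarrow> \<bar>decay s\<bar> \<le> 1" "0 < decay s"
  using \<beta> \<gamma> by (auto simp: decay_def)

text \<open>\<open>decay s * flux s y\<close> is minus the derivative in \<open>s\<close> of the
  weighted heat kernel \<open>decay s * gauss (T - s) (x + y + s / \<gamma>)\<close>.\<close>

definition flux :: "real \<Rightarrow> real \<Rightarrow> real" where
  "flux s y = \<beta> / \<gamma> * gauss (T - s) (x + y + s / \<gamma>) + 1 / 2 * gauss2 (T - s) (x + y + s / \<gamma>)
       + 1 / \<gamma> * gauss1 (T - s) (x + y + s / \<gamma>)"

lemma kernel_bound:
  obtains C where "0 \<le> C" "\<And>s y. 0 \<le> s \<Longrightarrow> s < T \<Longrightarrow> 0 \<le> y \<Longrightarrow>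
    \<bar>gauss (T - s) (x + y + s / \<gamma>)\<bar> \<le> C * exp (- y\<^sup>2 / (8 * T)) \<and>
    \<bar>gauss1 (T - s) (x + y + s / \<gamma>)\<bar> \<le> C * exp (- y\<^sup>2 / (8 * T)) \<and>
    \<bar>gauss2 (T - s) (x + y + s / \<gamma>)\<bar> \<le> C * exp (- y\<^sup>2 / (8 * T)) \<and>
    \<bar>flux s y\<bar> \<le> C * exp (- y\<^sup>2 / (8 * T))"
proof -
  obtain C where C: "0 \<le> C" "\<And>s w y. 0 \<le> s \<Longrightarrow> s < T \<Longrightarrow> 0 \<le> y \<Longrightarrow> y + s / \<gamma> \<le> w \<Longrightarrow>
    \<bar>gauss (T - s) w\<bar> \<le> C * exp (- y\<^sup>2 / (8 * T)) \<and> \<bar>gauss1 (T - s) w\<bar> \<le> C * exp (- y\<^sup>2 / (8 * T)) \<and>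
    \<bar>gauss2 (T - s) w\<bar> \<le> C * exp (- y\<^sup>2 / (8 * T))"
    using gauss_path_bound[OF T \<gamma>] by blast
  define C' where "C' = C * (1 + \<beta> / \<gamma> + 1 / 2 + 1 / \<gamma>)"
  have pos: "0 \<le> \<beta> / \<gamma>" "0 \<le> 1 / \<gamma>" using \<beta> \<gamma> by auto
  have "1 \<le> 1 + \<beta> / \<gamma> + 1 / 2 + 1 / \<gamma>" using pos by linarith
  then have "C * 1 \<le> C'" unfolding C'_def using C(1) by (rule mult_left_mono)
  then have CC: "C * exp (- y\<^sup>2 / (8 * T)) \<le> C' * exp (- y\<^sup>2 / (8 * T))" for y by (simp add: mult_right_mono)
  show thesis
  proof (rule that[of C'])
    show "0 \<le> C'" unfolding C'_def using C(1) pos by (intro mult_nonneg_nonneg) auto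
    fix s y :: real assume a: "0 \<le> s" "s < T" "0 \<le> y"
    define E where "E = C * exp (- y\<^sup>2 / (8 * T))"
    note b = C(2)[OF a, of "x + y + s / \<gamma>", folded E_def]
    have b: "\<bar>gauss (T - s) (x + y + s / \<gamma>)\<bar> \<le> E" "\<bar>gauss1 (T - s) (x + y + s / \<gamma>)\<bar> \<le> E" "\<bar>gauss2 (T - s) (x + y + s / \<gamma>)\<bar> \<le> E"
      using b x by auto
    have "\<bar>flux s y\<bar> \<le> \<bar>\<beta> / \<gamma> * gauss (T - s) (x + y + s / \<gamma>)\<bar> + \<bar>1 / 2 * gauss2 (T - s) (x + y + s / \<gamma>)\<bar>
       + \<bar>1 / \<gamma> * gauss1 (T - s) (x + y + s / \<gamma>)\<bar>"
      unfolding flux_def by linarith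
    also have "\<dots> \<le> \<beta> / \<gamma> * E + 1 / 2 * E + 1 / \<gamma> * E"
      unfolding abs_mult using b pos by (intro add_mono mult_mono) auto
    also have "\<dots> \<le> C' * exp (- y\<^sup>2 / (8 * T))"
    proof -
      have "0 \<le> E" using C(1) by (simp add: E_def)
      moreover have "C' * exp (- y\<^sup>2 / (8 * T)) = E + (\<beta> / \<gamma> * E + 1 / 2 * E + 1 / \<gamma> * E)"
        by (simp add: C'_def E_def algebra_simps)
      ultimately show ?thesis by linarith
    qed
    finally have "\<bar>flux s y\<bar> \<le> C' * exp (- y\<^sup>2 / (8 * T))" .
    with b CC[of y] show "\<bar>gauss (T - s) (x + y + s / \<gamma>)\<bar> \<le> C' * exp (- y\<^sup>2 / (8 * T)) \<and>
      \<bar>gauss1 (T - s) (x + y + s / \<gamma>)\<bar> \<le> C' * exp (- y\<^sup>2 / (8 * T)) \<and>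
      \<bar>gauss2 (T - s) (x + y + s / \<gamma>)\<bar> \<le> C' * exp (- y\<^sup>2 / (8 * T)) \<and>
      \<bar>flux s y\<bar> \<le> C' * exp (- y\<^sup>2 / (8 * T))"
      unfolding E_def by linarith
  qed
qed

abbreviation (input) "ST \<equiv> indicator {0<..<T} :: real \<Rightarrow> real"
abbreviation (input) "HY \<equiv> indicator {0<..} :: real \<Rightarrow> real"

lemma integrable_dominated_space:
  assumes [measurable]: "u \<in> borel_measurable borel" and "\<And>y. 0 < y \<Longrightarrow> \<bar>u y\<bar> \<le> c * exp (- y\<^sup>2 / (8 * T))"
  shows "integrable lborel (\<lambda>y. HY y * u y)"
proof (rule Bochner_Integration.integrable_bound[OF integrable_mult_right[OF integrable_exp_square[of "8 * T"], of c]])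
  show "AE y in lborel. norm (HY y * u y) \<le> norm (c * exp (- y\<^sup>2 / (8 * T)))"
    using assms(2) by (intro AE_I2) (auto split: split_indicator intro: order_trans[OF _ abs_ge_self])
qed (use T in auto)

lemma integrable_bounded_time:
  assumes [measurable]: "u \<in> borel_measurable borel" and "\<And>s. 0 < s \<Longrightarrow> s < T \<Longrightarrow> \<bar>u s\<bar> \<le> c"
  shows "integrable lborel (\<lambda>s. ST s * u s)"
proof (rule Bochner_Integration.integrable_bound)
  show "integrable lborel (\<lambda>s. c * ST s)" using T by (intro integrable_mult_right integrable_real_indicator) auto
  show "AE s in lborel. norm (ST s * u s) \<le> norm (c * ST s)"
    using assms(2) by (intro AE_I2) (auto split: split_indicator intro: order_trans[OF _ abs_ge_self])
qed simp

text \<open>The majorant is independent of \<open>s\<close> and integrable in \<open>y\<close>, and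
  the time interval is bounded, so Fubini applies.\<close>

lemma swap_integrals:
  assumes [measurable]: "case_prod u \<in> borel_measurable (borel \<Otimes>\<^sub>M borel)"
    and b: "\<And>s y. 0 < s \<Longrightarrow> s < T \<Longrightarrow> 0 < y \<Longrightarrow> \<bar>u s y\<bar> \<le> c * exp (- y\<^sup>2 / (8 * T))"
  shows "(\<integral>y. HY y * (\<integral>s. ST s * u s y \<partial>lborel) \<partial>lborel) = (\<integral>s. ST s * (\<integral>y. HY y * u s y \<partial>lborel) \<partial>lborel)"
    and "integrable lborel (\<lambda>s. ST s * (\<integral>y. HY y * u s y \<partial>lborel))"
    and "integrable lborel (\<lambda>y. HY y * (\<integral>s. ST s * u s y \<partial>lborel))"
proof -
  have [measurable]: "(\<lambda>p. u (fst p) (snd p)) \<in> borel_measurable (borel \<Otimes>\<^sub>M borel)"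
    using assms(1) by (simp add: case_prod_beta)
  have [measurable]: "(\<lambda>y. u s y) \<in> borel_measurable borel" for s
    using assms(1) by measurable
  let ?U = "\<lambda>(s, y). ST s * (HY y * u s y)"
  have int: "integrable (lborel \<Otimes>\<^sub>M lborel) ?U"
  proof (rule lborel_pair.Fubini_integrable)
    show "AE s in lborel. integrable lborel (\<lambda>y. ?U (s, y))"
    proof (rule AE_I2)
      fix s show "integrable lborel (\<lambda>y. ?U (s, y))"
        using integrable_dominated_space[of "u s" c] b by (cases "s \<in> {0<..<T}") auto
    qed
    let ?M = "\<integral>y. HY y * (c * exp (- y\<^sup>2 / (8 * T))) \<partial>lborel"
    have iM: "integrable lborel (\<lambda>y. HY y * (\<bar>c\<bar> * exp (- y\<^sup>2 / (8 * T))))"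
      by (rule integrable_dominated_space[of _ "\<bar>c\<bar>"]) auto
    have "integrable lborel (\<lambda>s. ST s * (\<integral>y. \<bar>HY y * u s y\<bar> \<partial>lborel))"
    proof (rule integrable_bounded_time[where c = "\<integral>y. HY y * (\<bar>c\<bar> * exp (- y\<^sup>2 / (8 * T))) \<partial>lborel"])
      show "(\<lambda>s. \<integral>y. \<bar>HY y * u s y\<bar> \<partial>lborel) \<in> borel_measurable borel" by measurable
      fix s assume s: "0 < s" "s < T"
      have "(\<integral>y. \<bar>HY y * u s y\<bar> \<partial>lborel) \<le> (\<integral>y. HY y * (\<bar>c\<bar> * exp (- y\<^sup>2 / (8 * T))) \<partial>lborel)"
      proof (rule integral_mono[OF _ iM])
        show "integrable lborel (\<lambda>y. \<bar>HY y * u s y\<bar>)" using integrable_dominated_space[of "u s" c] b s by (intro integrable_abs) auto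
        show "\<bar>HY y * u s y\<bar> \<le> HY y * (\<bar>c\<bar> * exp (- y\<^sup>2 / (8 * T)))" for y
          using b[OF s, of y] by (auto split: split_indicator intro: order_trans[OF _ mult_right_mono[OF abs_ge_self]])
      qed
      then show "\<bar>\<integral>y. \<bar>HY y * u s y\<bar> \<partial>lborel\<bar> \<le> (\<integral>y. HY y * (\<bar>c\<bar> * exp (- y\<^sup>2 / (8 * T))) \<partial>lborel)" by simp
    qed
    then show "integrable lborel (\<lambda>s. \<integral>y. norm (?U (s, y)) \<partial>lborel)"
      by (simp add: abs_mult[of "ST _"])
  qed measurable
  have "(\<integral>y. (\<integral>s. ?U (s, y) \<partial>lborel) \<partial>lborel) = (\<integral>s. (\<integral>y. ?U (s, y) \<partial>lborel) \<partial>lborel)"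
    using lborel_pair.Fubini_integral[of "\<lambda>s y. ?U (s, y)"] int by simp
  moreover have "(\<integral>y. ?U (s, y) \<partial>lborel) = ST s * (\<integral>y. HY y * u s y \<partial>lborel)" for s by simp
  moreover have "(\<integral>s. ?U (s, y) \<partial>lborel) = HY y * (\<integral>s. ST s * u s y \<partial>lborel)" for y
    by (simp add: mult.left_commute[of "ST _" "HY _"])
  ultimately show "(\<integral>y. HY y * (\<integral>s. ST s * u s y \<partial>lborel) \<partial>lborel) = (\<integral>s. ST s * (\<integral>y. HY y * u s y \<partial>lborel) \<partial>lborel)"
    by (simp only:)
  show "integrable lborel (\<lambda>s. ST s * (\<integral>y. HY y * u s y \<partial>lborel))"
    using lborel_pair.integrable_fst'[OF int] by simp
  show "integrable lborel (\<lambda>y. HY y * (\<integral>s. ST s * u s y \<partial>lborel))"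
    using lborel_pair.integrable_snd[of "\<lambda>s y. ?U (s, y)"] int by (simp add: mult.left_commute[of "ST _" "HY _"])
qed

text \<open>The weighted kernel vanishes at the end of the path and equals
  \<open>gauss T (x + y)\<close> at its start. The end is reached only as a limit, because the
  kernel degenerates at variance 0.\<close>

lemma path_FTC:
  assumes y: "0 < y"
  shows "gauss T (x + y) = (\<integral>s. ST s * (decay s * flux s y) \<partial>lborel)"
proof -
  let ?F = "\<lambda>s. decay s * gauss (T - s) (x + y + s / \<gamma>)"
  let ?f = "\<lambda>s. - (decay s * flux s y)"
  obtain C where C: "0 \<le> C" "\<And>s y. 0 \<le> s \<Longrightarrow> s < T \<Longrightarrow> 0 \<le> y \<Longrightarrow> \<bar>flux s y\<bar> \<le> C * exp (- y\<^sup>2 / (8 * T))"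
    using kernel_bound by metis
  have [measurable]: "(\<lambda>s. decay s * flux s y) \<in> borel_measurable borel" unfolding decay_def flux_def by measurable
  have int: "integrable lborel (\<lambda>s. ST s * ?f s)"
  proof (rule integrable_bounded_time[where c = "C * exp (- y\<^sup>2 / (8 * T))"])
    fix s assume s: "0 < s" "s < T"
    have "\<bar>decay s\<bar> * \<bar>flux s y\<bar> \<le> 1 * (C * exp (- y\<^sup>2 / (8 * T)))"
      using s y C by (intro mult_mono decay_bound) auto
    then show "\<bar>?f s\<bar> \<le> C * exp (- y\<^sup>2 / (8 * T))" by (simp add: abs_mult)
  qed measurable
  have der: "(?F has_real_derivative ?f s) (at s)" if "s < T" for s
    using gauss_path_deriv[OF that \<gamma>, of \<beta> "x + y"] by (simp add: decay_def flux_def)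
  have "(LBINT s=ereal 0..ereal T. ?f s) = 0 - ?F 0"
  proof (rule interval_integral_FTC_integrable[where F = ?F])
    show "ereal 0 < ereal T" using T by simp
    show "(?F has_vector_derivative ?f s) (at s)" if "ereal 0 < ereal s" "ereal s < ereal T" for s
      using der[of s] that by (simp add: has_real_derivative_iff_has_vector_derivative)
    show "isCont ?f s" if "ereal 0 < ereal s" "ereal s < ereal T" for s
      using that \<gamma> unfolding decay_def flux_def gauss1_def gauss2_def gauss_def by (intro continuous_intros) auto
    show "set_integrable lborel (einterval (ereal 0) (ereal T)) ?f"
      using int unfolding set_integrable_def by (simp add: einterval_eq)
    have "(?F \<longlongrightarrow> ?F 0) (at_right 0)"
      using DERIV_isCont[OF der[of 0]] T by (auto simp: isCont_def intro: tendsto_mono[OF at_le])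
    then show "((?F \<circ> real_of_ereal) \<longlongrightarrow> ?F 0) (at_right (ereal 0))"
      by (simp add: ereal_tendsto_simps1)
    have "(?F \<longlongrightarrow> 0) (at_left T)"
      using gauss_path_tendsto_0[OF T \<gamma>, of "x + y" \<beta>] x y by (simp add: decay_def)
    then show "((?F \<circ> real_of_ereal) \<longlongrightarrow> 0) (at_left (ereal T))"
      by (simp add: ereal_tendsto_simps1)
  qed
  moreover have "(LBINT s=ereal 0..ereal T. ?f s) = (\<integral>s. ST s * ?f s \<partial>lborel)"
    using T by (simp add: interval_lebesgue_integral_def set_lebesgue_integral_def einterval_eq)
  ultimately show ?thesis by (simp add: decay_def)
qed

lemma exp_square_tendsto: "((\<lambda>y. c * exp (- y\<^sup>2 / (8 * T))) \<longlongrightarrow> 0) at_top"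
proof -
  have "filterlim (\<lambda>y::real. y\<^sup>2) at_top at_top" by (rule filterlim_pow_at_top[OF _ filterlim_ident]) simp
  then have "filterlim (\<lambda>y::real. 1 / (8 * T) * y\<^sup>2) at_top at_top"
    by (rule filterlim_tendsto_pos_mult_at_top[OF tendsto_const, rotated]) (use T in simp)
  then have "filterlim (\<lambda>y::real. - (1 / (8 * T) * y\<^sup>2)) at_bot at_top" by (simp only: filterlim_uminus_at_top)
  then have "((\<lambda>y. exp (- (1 / (8 * T) * y\<^sup>2))) \<longlongrightarrow> 0) at_top" by (rule filterlim_compose[OF exp_at_bot])
  then have "((\<lambda>y. c * exp (- (1 / (8 * T) * y\<^sup>2))) \<longlongrightarrow> c * 0) at_top" by (intro tendsto_mult tendsto_const)
  then show ?thesis by simp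
qed

text \<open>The combination \<open>?M\<close> is an antiderivative in \<open>y\<close> of
  \<open>flux s y * q1 y\<close> minus 1 / \<gamma> times \<open>gauss1\<close> times
  \<open>fe\<close>: the terms with \<open>gauss2\<close> and with \<open>q1\<close> cancel because
  of the form of \<open>fe\<close>. As \<open>q0\<close> vanishes at 0, the boundary contributes
  only the \<open>gauss1\<close> term, out of which the atom at 0 arises.\<close>

lemma space_FTC:
  assumes s: "0 < s" "s < T"
  shows "(\<integral>y. HY y * (flux s y * q1 y) \<partial>lborel)
    = 1 / \<gamma> * (\<integral>y. HY y * (gauss1 (T - s) (x + y + s / \<gamma>) * fe y) \<partial>lborel) + 1 / 2 * gauss1 (T - s) (x + s / \<gamma>) * q1 0"
proof -
  define r where "r = T - s"
  have r: "0 < r" using s by (simp add: r_def)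
  let ?w = "\<lambda>y. x + y + s / \<gamma>"
  let ?M = "\<lambda>y. \<beta> / \<gamma> * gauss r (?w y) * q0 y - 1 / 2 * gauss1 r (?w y) * q1 y"
  let ?m = "\<lambda>y. flux s y * q1 y - 1 / \<gamma> * (gauss1 r (?w y) * fe y)"
  obtain C where C: "0 \<le> C" "\<And>s y. 0 \<le> s \<Longrightarrow> s < T \<Longrightarrow> 0 \<le> y \<Longrightarrow>
    \<bar>gauss (T - s) (x + y + s / \<gamma>)\<bar> \<le> C * exp (- y\<^sup>2 / (8 * T)) \<and>
    \<bar>gauss1 (T - s) (x + y + s / \<gamma>)\<bar> \<le> C * exp (- y\<^sup>2 / (8 * T)) \<and>
    \<bar>gauss2 (T - s) (x + y + s / \<gamma>)\<bar> \<le> C * exp (- y\<^sup>2 / (8 * T)) \<and>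
    \<bar>flux s y\<bar> \<le> C * exp (- y\<^sup>2 / (8 * T))"
    using kernel_bound by metis
  have prod_le: "\<bar>u * v\<bar> \<le> D * C * exp (- y\<^sup>2 / (8 * T))" if "\<bar>u\<bar> \<le> C * exp (- y\<^sup>2 / (8 * T))" "\<bar>v\<bar> \<le> D" for u v D y
  proof -
    have "\<bar>u\<bar> * \<bar>v\<bar> \<le> (C * exp (- y\<^sup>2 / (8 * T))) * D" using that C(1) by (intro mult_mono) auto
    then show ?thesis by (simp add: abs_mult mult_ac)
  qed
  have i1: "integrable lborel (\<lambda>y. HY y * (flux s y * q1 y))"
  proof (rule integrable_dominated_space[where c = "K * C"])
    show "(\<lambda>y. flux s y * q1 y) \<in> borel_measurable borel" unfolding flux_def by measurable
    show "\<bar>flux s y * q1 y\<bar> \<le> K * C * exp (- y\<^sup>2 / (8 * T))" if "0 < y" for y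
      using C(2)[of s y] s that b1 by (intro prod_le) auto
  qed
  have i2: "integrable lborel (\<lambda>y. HY y * (gauss1 r (?w y) * fe y))"
  proof (rule integrable_dominated_space[where c = "Kf * C"])
    show "\<bar>gauss1 r (?w y) * fe y\<bar> \<le> Kf * C * exp (- y\<^sup>2 / (8 * T))" if "0 < y" for y
      using C(2)[of s y] s that fe_bound unfolding r_def by (intro prod_le) auto
  qed measurable
  have der: "(?M has_real_derivative ?m y) (at y)" for y
  proof -
    have w: "(?w has_real_derivative 1) (at y)" by (auto intro!: derivative_eq_intros)
    note g = DERIV_chain2[OF gauss_deriv(1)[OF r] w] and g1 = DERIV_chain2[OF gauss_deriv(2)[OF r] w]
    have "(?M has_real_derivative (\<beta> / \<gamma> * (- gauss1 r (?w y) * 1) * q0 y + \<beta> / \<gamma> * gauss r (?w y) * q1 y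
       - (1 / 2 * (- gauss2 r (?w y) * 1) * q1 y + 1 / 2 * gauss1 r (?w y) * q2 y))) (at y)"
      by (rule derivative_eq_intros g g1 d0 d1 refl)+ (simp add: algebra_simps)
    then show ?thesis
      by (rule DERIV_cong) (use \<gamma> in \<open>simp add: flux_def fe_def r_def algebra_simps\<close>)
  qed
  have "(LBINT y=ereal 0..\<infinity>. ?m y) = 0 - ?M 0"
  proof (rule interval_integral_FTC_integrable[where F = ?M])
    show "(?M has_vector_derivative ?m y) (at y)" for y
      using der[of y] by (simp add: has_real_derivative_iff_has_vector_derivative)
    show "isCont ?m y" for y
      using r \<gamma> s unfolding flux_def fe_def gauss1_def gauss2_def gauss_def by (intro continuous_intros q_cont) auto
    show "set_integrable lborel (einterval (ereal 0) \<infinity>) ?m"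
      using Bochner_Integration.integrable_diff[OF i1 integrable_mult_right[OF i2, of "1 / \<gamma>"]]
      unfolding set_integrable_def by (simp add: einterval_eq algebra_simps)
    have "(?M \<longlongrightarrow> ?M 0) (at_right 0)"
      using DERIV_isCont[OF der[of 0]] by (auto simp: isCont_def intro: tendsto_mono[OF at_le])
    then show "((?M \<circ> real_of_ereal) \<longlongrightarrow> ?M 0) (at_right (ereal 0))"
      by (simp add: ereal_tendsto_simps1)
    have "(?M \<longlongrightarrow> 0) at_top"
    proof (rule Lim_null_comparison)
      show "((\<lambda>y. (\<beta> / \<gamma> * K * C + 1 / 2 * (K * C)) * exp (- y\<^sup>2 / (8 * T))) \<longlongrightarrow> 0) at_top" by (rule exp_square_tendsto)
      show "\<forall>\<^sub>F y in at_top. norm (?M y) \<le> (\<beta> / \<gamma> * K * C + 1 / 2 * (K * C)) * exp (- y\<^sup>2 / (8 * T))"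
        using eventually_ge_at_top[of 0]
      proof eventually_elim
        case (elim y)
        note Cy = C(2)[OF less_imp_le[OF s(1)] s(2) elim]
        have "\<bar>gauss r (?w y) * q0 y\<bar> \<le> K * C * exp (- y\<^sup>2 / (8 * T))" "\<bar>gauss1 r (?w y) * q1 y\<bar> \<le> K * C * exp (- y\<^sup>2 / (8 * T))"
          using prod_le[OF conjunct1[OF Cy] b0] prod_le[OF conjunct1[OF conjunct2[OF Cy]] b1] unfolding r_def .
        then have "\<beta> / \<gamma> * \<bar>gauss r (?w y) * q0 y\<bar> + 1 / 2 * \<bar>gauss1 r (?w y) * q1 y\<bar>
          \<le> \<beta> / \<gamma> * (K * C * exp (- y\<^sup>2 / (8 * T))) + 1 / 2 * (K * C * exp (- y\<^sup>2 / (8 * T)))"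
          using \<beta> \<gamma> by (intro add_mono mult_left_mono) auto
        moreover have "\<bar>?M y\<bar> \<le> \<beta> / \<gamma> * \<bar>gauss r (?w y) * q0 y\<bar> + 1 / 2 * \<bar>gauss1 r (?w y) * q1 y\<bar>"
          using abs_triangle_ineq4[of "\<beta> / \<gamma> * (gauss r (?w y) * q0 y)" "1 / 2 * (gauss1 r (?w y) * q1 y)"] \<beta> \<gamma>
          unfolding abs_mult[of "\<beta> / \<gamma>"] abs_mult[of "1 / 2"] by (simp add: mult.assoc)
        ultimately show ?case by (simp add: algebra_simps)
      qed
    qed
    then show "((?M \<circ> real_of_ereal) \<longlongrightarrow> 0) (at_left \<infinity>)"
      by (simp add: ereal_tendsto_simps1)
  qed simp
  moreover have "(LBINT y=ereal 0..\<infinity>. ?m y) = (\<integral>y. HY y * (flux s y * q1 y) - 1 / \<gamma> * (HY y * (gauss1 r (?w y) * fe y)) \<partial>lborel)"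
    by (simp add: interval_lebesgue_integral_def set_lebesgue_integral_def einterval_eq algebra_simps)
  moreover have "\<dots> = (\<integral>y. HY y * (flux s y * q1 y) \<partial>lborel) - 1 / \<gamma> * (\<integral>y. HY y * (gauss1 r (?w y) * fe y) \<partial>lborel)"
    using i1 i2 by simp
  ultimately show ?thesis by (simp add: r_def q0_0)
qed

text \<open>With \<open>s + \<gamma> * a = \<gamma> * w\<close> the integrand becomes a hitting time
  density along the path, discounted exponentially.\<close>

lemma g_density_eq: "g_density \<beta> \<gamma> T a = 1 / \<gamma> * (\<integral>s. ST s * (decay s * gauss1 (T - s) (a + s / \<gamma>)) \<partial>lborel)"
proof -
  let ?h = "\<lambda>s. (s + \<gamma> * a) / (T - s) powr (3 / 2) * exp (- (s + \<gamma> * a)\<^sup>2 / (2 * \<gamma>\<^sup>2 * (T - s))) * exp (- \<beta> * s / \<gamma>)"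
  have pt: "1 / \<gamma>\<^sup>2 * (1 / sqrt (2 * pi)) * ?h s = 1 / \<gamma> * (decay s * gauss1 (T - s) (a + s / \<gamma>))" if s: "s < T" for s
  proof -
    define r where "r = T - s"
    define w where "w = a + s / \<gamma>"
    have r: "0 < r" using s by (simp add: r_def)
    have sw: "s + \<gamma> * a = \<gamma> * w" using \<gamma> by (simp add: w_def field_simps)
    have "r powr (3 / 2) = r powr (1 + 1 / 2)" by simp
    also have "\<dots> = r * sqrt r" unfolding powr_add using r by (simp add: powr_half_sqrt)
    finally have rp: "r powr (3 / 2) = r * sqrt r" .
    have ex: "- (\<gamma> * w)\<^sup>2 / (2 * \<gamma>\<^sup>2 * r) = - w\<^sup>2 / (2 * r)" using \<gamma> by (simp add: power_mult_distrib)
    show ?thesis unfolding r_def[symmetric] sw rp ex w_def[symmetric] decay_def gauss1_def gauss_def real_sqrt_mult[of "2 * pi"]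
      using \<gamma> r by (simp add: field_simps power2_eq_square)
  qed
  have "(LBINT s=0..T. ?h s) = (\<integral>s. ST s * ?h s \<partial>lborel)"
    using T by (simp add: interval_lebesgue_integral_def set_lebesgue_integral_def einterval_eq zero_ereal_def)
  then have "g_density \<beta> \<gamma> T a = 1 / \<gamma>\<^sup>2 * (1 / sqrt (2 * pi)) * (\<integral>s. ST s * ?h s \<partial>lborel)"
    by (simp only: g_density_def)
  also have "\<dots> = (\<integral>s. 1 / \<gamma>\<^sup>2 * (1 / sqrt (2 * pi)) * (ST s * ?h s) \<partial>lborel)"
    by (rule integral_mult_right_zero[symmetric])
  also have "\<dots> = (\<integral>s. 1 / \<gamma> * (ST s * (decay s * gauss1 (T - s) (a + s / \<gamma>))) \<partial>lborel)"
  proof (intro Bochner_Integration.integral_cong refl)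
    fix s show "1 / \<gamma>\<^sup>2 * (1 / sqrt (2 * pi)) * (ST s * ?h s) = 1 / \<gamma> * (ST s * (decay s * gauss1 (T - s) (a + s / \<gamma>)))"
      using pt[of s] by (cases "s \<in> {0<..<T}") auto
  qed
  finally show ?thesis by simp
qed

text \<open>After \<open>path_FTC\<close> and an exchange of integrals, \<open>space_FTC\<close>
  trades \<open>q1\<close> for \<open>fe\<close> inside the integral. The boundary terms integrate
  to \<open>\<gamma> * g_density \<beta> \<gamma> T x * q1 0\<close>, and \<open>q1 0 = fe 0\<close>
  because \<open>q0\<close> and \<open>q2\<close> vanish at 0; hence the weight of the atom.\<close>

lemma image_identity:
  "2 * (\<integral>y. HY y * (gauss T (x + y) * q1 y) \<partial>lborel)
    = (\<integral>y. HY y * (2 * g_density \<beta> \<gamma> T (x + y) * fe y) \<partial>lborel) + \<gamma> * g_density \<beta> \<gamma> T x * fe 0"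
proof -
  obtain C where C: "0 \<le> C" "\<And>s y. 0 \<le> s \<Longrightarrow> s < T \<Longrightarrow> 0 \<le> y \<Longrightarrow>
    \<bar>gauss (T - s) (x + y + s / \<gamma>)\<bar> \<le> C * exp (- y\<^sup>2 / (8 * T)) \<and>
    \<bar>gauss1 (T - s) (x + y + s / \<gamma>)\<bar> \<le> C * exp (- y\<^sup>2 / (8 * T)) \<and>
    \<bar>gauss2 (T - s) (x + y + s / \<gamma>)\<bar> \<le> C * exp (- y\<^sup>2 / (8 * T)) \<and>
    \<bar>flux s y\<bar> \<le> C * exp (- y\<^sup>2 / (8 * T))"
    using kernel_bound by metis
  have triple: "\<bar>decay s * (k * v)\<bar> \<le> C * D * exp (- y\<^sup>2 / (8 * T))"
    if "0 < s" "\<bar>k\<bar> \<le> C * exp (- y\<^sup>2 / (8 * T))" "\<bar>v\<bar> \<le> D" for s k v D y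
  proof -
    have "\<bar>decay s\<bar> * (\<bar>k\<bar> * \<bar>v\<bar>) \<le> 1 * ((C * exp (- y\<^sup>2 / (8 * T))) * D)"
      using that C(1) decay_bound(1)[of s] by (intro mult_mono) auto
    then show ?thesis by (simp add: abs_mult mult_ac)
  qed
  let ?u = "\<lambda>s y. decay s * (flux s y * q1 y)"
  let ?v = "\<lambda>s y. decay s * (gauss1 (T - s) (x + y + s / \<gamma>) * fe y)"
  have mu: "case_prod ?u \<in> borel_measurable (borel \<Otimes>\<^sub>M borel)" "case_prod ?v \<in> borel_measurable (borel \<Otimes>\<^sub>M borel)"
    unfolding decay_def flux_def by measurable
  have bu: "\<bar>?u s y\<bar> \<le> C * K * exp (- y\<^sup>2 / (8 * T))" if "0 < s" "s < T" "0 < y" for s y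
    using C(2)[of s y] that by (intro triple b1) auto
  have bv: "\<bar>?v s y\<bar> \<le> C * Kf * exp (- y\<^sup>2 / (8 * T))" if "0 < s" "s < T" "0 < y" for s y
    using C(2)[of s y] that by (intro triple fe_bound) auto
  note su = swap_integrals[OF mu(1) bu] and sv = swap_integrals[OF mu(2) bv]
  have w: "integrable lborel (\<lambda>s. ST s * (decay s * gauss1 (T - s) (x + s / \<gamma>)))"
  proof (rule integrable_bounded_time[where c = C])
    show "(\<lambda>s. decay s * gauss1 (T - s) (x + s / \<gamma>)) \<in> borel_measurable borel" unfolding decay_def by measurable
    show "\<bar>decay s * gauss1 (T - s) (x + s / \<gamma>)\<bar> \<le> C" if "0 < s" "s < T" for s
      using triple[of s "gauss1 (T - s) (x + s / \<gamma>)" 0 1 1] C(2)[of s 0] that by simp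
  qed
  have "(\<integral>y. HY y * (gauss T (x + y) * q1 y) \<partial>lborel) = (\<integral>y. HY y * (\<integral>s. ST s * ?u s y \<partial>lborel) \<partial>lborel)"
  proof (intro Bochner_Integration.integral_cong refl)
    fix y
    have "(\<integral>s. ST s * ?u s y \<partial>lborel) = (\<integral>s. ST s * (decay s * flux s y) \<partial>lborel) * q1 y"
      by (subst integral_mult_left_zero[symmetric]) (simp add: mult_ac)
    then show "HY y * (gauss T (x + y) * q1 y) = HY y * (\<integral>s. ST s * ?u s y \<partial>lborel)"
      using path_FTC[of y] by (cases "0 < y") auto
  qed
  also have "\<dots> = (\<integral>s. ST s * (\<integral>y. HY y * ?u s y \<partial>lborel) \<partial>lborel)" by (rule su(1))
  also have "\<dots> = (\<integral>s. 1 / \<gamma> * (ST s * (\<integral>y. HY y * ?v s y \<partial>lborel)) + 1 / 2 * q1 0 * (ST s * (decay s * gauss1 (T - s) (x + s / \<gamma>))) \<partial>lborel)"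
  proof (intro Bochner_Integration.integral_cong refl)
    fix s
    have "(\<integral>y. HY y * ?u s y \<partial>lborel) = decay s * (\<integral>y. HY y * (flux s y * q1 y) \<partial>lborel)"
      by (subst integral_mult_right_zero[symmetric]) (simp add: mult_ac)
    moreover have "(\<integral>y. HY y * ?v s y \<partial>lborel) = decay s * (\<integral>y. HY y * (gauss1 (T - s) (x + y + s / \<gamma>) * fe y) \<partial>lborel)"
      by (subst integral_mult_right_zero[symmetric]) (simp add: mult_ac)
    ultimately show "ST s * (\<integral>y. HY y * ?u s y \<partial>lborel)
      = 1 / \<gamma> * (ST s * (\<integral>y. HY y * ?v s y \<partial>lborel)) + 1 / 2 * q1 0 * (ST s * (decay s * gauss1 (T - s) (x + s / \<gamma>)))"
      using space_FTC[of s] by (cases "s \<in> {0<..<T}") (simp_all add: algebra_simps)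
  qed
  also have "\<dots> = 1 / \<gamma> * (\<integral>s. ST s * (\<integral>y. HY y * ?v s y \<partial>lborel) \<partial>lborel) + 1 / 2 * q1 0 * (\<integral>s. ST s * (decay s * gauss1 (T - s) (x + s / \<gamma>)) \<partial>lborel)"
    using sv(2) w by simp
  also have "(\<integral>s. ST s * (\<integral>y. HY y * ?v s y \<partial>lborel) \<partial>lborel) = (\<integral>y. HY y * (\<integral>s. ST s * ?v s y \<partial>lborel) \<partial>lborel)"
    by (rule sv(1)[symmetric])
  also have "\<dots> = (\<integral>y. \<gamma> / 2 * (HY y * (2 * g_density \<beta> \<gamma> T (x + y) * fe y)) \<partial>lborel)"
  proof (intro Bochner_Integration.integral_cong refl)
    fix y
    have "(\<integral>s. ST s * ?v s y \<partial>lborel) = (\<integral>s. ST s * (decay s * gauss1 (T - s) (x + y + s / \<gamma>)) \<partial>lborel) * fe y"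
      by (subst integral_mult_left_zero[symmetric]) (simp add: mult_ac)
    then show "HY y * (\<integral>s. ST s * ?v s y \<partial>lborel) = \<gamma> / 2 * (HY y * (2 * g_density \<beta> \<gamma> T (x + y) * fe y))"
      using \<gamma> by (simp add: g_density_eq)
  qed
  also have "\<dots> = \<gamma> / 2 * (\<integral>y. HY y * (2 * g_density \<beta> \<gamma> T (x + y) * fe y) \<partial>lborel)"
    by (rule integral_mult_right_zero)
  finally show ?thesis using \<gamma> by (simp add: g_density_eq[of x] fe_0)
qed

lemma g_density_measurable [measurable]: "(\<lambda>y. g_density \<beta> \<gamma> T (x + y)) \<in> borel_measurable borel"
  unfolding g_density_eq decay_def by measurable

lemma g_density_nonneg: "0 \<le> a \<Longrightarrow> 0 \<le> g_density \<beta> \<gamma> T a"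
proof -
  assume a: "0 \<le> a"
  have "0 \<le> ST s * (decay s * gauss1 (T - s) (a + s / \<gamma>))" for s
  proof (cases "s \<in> {0<..<T}")
    case True
    then have "0 \<le> gauss1 (T - s) (a + s / \<gamma>)"
      unfolding gauss1_def using a \<gamma> by (intro mult_nonneg_nonneg divide_nonneg_pos gauss_nonneg) auto
    then show ?thesis using decay_bound(2)[of s] by (simp add: True)
  qed simp
  then have "0 \<le> (\<integral>s. ST s * (decay s * gauss1 (T - s) (a + s / \<gamma>)) \<partial>lborel)"
    by (rule Bochner_Integration.integral_nonneg)
  then show ?thesis unfolding g_density_eq using \<gamma> by simp
qed

lemma g_density_integrable: "integrable lborel (\<lambda>y. HY y * g_density \<beta> \<gamma> T (x + y))"
proof -
  obtain C where C: "0 \<le> C" "\<And>s y. 0 \<le> s \<Longrightarrow> s < T \<Longrightarrow> 0 \<le> y \<Longrightarrow>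
    \<bar>gauss1 (T - s) (x + y + s / \<gamma>)\<bar> \<le> C * exp (- y\<^sup>2 / (8 * T))"
    using kernel_bound by metis
  have "integrable lborel (\<lambda>y. HY y * (\<integral>s. ST s * (decay s * gauss1 (T - s) (x + y + s / \<gamma>)) \<partial>lborel))"
  proof (rule swap_integrals(3))
    show "(\<lambda>(s, y). decay s * gauss1 (T - s) (x + y + s / \<gamma>)) \<in> borel_measurable (borel \<Otimes>\<^sub>M borel)"
      unfolding decay_def by measurable
    fix s y :: real assume "0 < s" "s < T" "0 < y"
    then have "\<bar>decay s\<bar> * \<bar>gauss1 (T - s) (x + y + s / \<gamma>)\<bar> \<le> 1 * (C * exp (- y\<^sup>2 / (8 * T)))"
      using C decay_bound(1)[of s] by (intro mult_mono) auto
    then show "\<bar>decay s * gauss1 (T - s) (x + y + s / \<gamma>)\<bar> \<le> C * exp (- y\<^sup>2 / (8 * T))" by (simp add: abs_mult)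
  qed
  from integrable_mult_right[OF this, of "1 / \<gamma>"] show ?thesis
    unfolding g_density_eq by (simp add: mult_ac)
qed

lemma p_D_eq: "p_D T x y = gauss T (x - y) - gauss T (x + y)"
  by (simp add: p_D_def gauss_def diff_divide_distrib right_diff_distrib)

lemma p_D_nonneg: assumes "0 \<le> y" shows "0 \<le> p_D T x y"
proof -
  have "(x - y)\<^sup>2 \<le> (x + y)\<^sup>2" using x assms by (simp add: power2_eq_square algebra_simps)
  then have "exp (- (x + y)\<^sup>2 / (2 * T)) \<le> exp (- (x - y)\<^sup>2 / (2 * T))" using T by (simp add: divide_right_mono)
  then show ?thesis unfolding p_D_def using T by simp
qed

lemma gauss_integrable: "integrable lborel (\<lambda>z. gauss T (x - z))" "integrable lborel (\<lambda>z. gauss T (x + z))"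
proof -
  have eq: "normal_density x (sqrt T) = (\<lambda>z. gauss T (x - z))" "normal_density (- x) (sqrt T) = (\<lambda>z. gauss T (x + z))"
    using T by (simp_all add: fun_eq_iff normal_density_def gauss_def power2_commute add.commute)
  show "integrable lborel (\<lambda>z. gauss T (x - z))" "integrable lborel (\<lambda>z. gauss T (x + z))"
    unfolding eq[symmetric] using T by (auto intro!: integrable_normal_density)
qed

lemma integrable_mult_bounded:
  assumes "integrable lborel k" and [measurable]: "v \<in> borel_measurable borel" and "\<And>z. \<bar>v z\<bar> \<le> c"
  shows "integrable lborel (\<lambda>z. k z * v z :: real)"
proof (rule Bochner_Integration.integrable_bound[OF integrable_mult_left[OF assms(1), of c]])
  show "AE z in lborel. norm (k z * v z) \<le> norm (k z * c)"
  proof (rule AE_I2)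
    fix z
    have "\<bar>v z\<bar> \<le> \<bar>c\<bar>" using assms(3)[of z] by linarith
    then show "norm (k z * v z) \<le> norm (k z * c)" by (simp add: abs_mult mult_left_mono)
  qed
qed (use assms(1) in measurable)

lemma HY_bound: "\<bar>HY z * v\<bar> \<le> \<bar>v\<bar>"
  by (auto split: split_indicator)

lemma p_D_integrable: "integrable lborel (\<lambda>y. HY y * p_D T x y)"
  unfolding p_D_eq using integrable_mult_bounded[OF gauss_integrable(1), of HY 1] integrable_mult_bounded[OF gauss_integrable(2), of HY 1]
  by (auto simp: right_diff_distrib mult.commute intro!: Bochner_Integration.integrable_diff)

lemma explicit_heat:
  "(\<integral>y. HY y * (p_D T x y + 2 * g_density \<beta> \<gamma> T (x + y)) * fe y \<partial>lborel) + \<gamma> * g_density \<beta> \<gamma> T x * fe 0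
    = heat T fe x"
proof -
  have ia: "integrable lborel (\<lambda>z. gauss T (x - z) * (HY z * fe z))"
    by (rule integrable_mult_bounded[OF gauss_integrable(1), where c = Kf]) (auto intro: order_trans[OF HY_bound fe_bound])
  have ib: "integrable lborel (\<lambda>z. gauss T (x + z) * (HY z * fe z))"
    by (rule integrable_mult_bounded[OF gauss_integrable(2), where c = Kf]) (auto intro: order_trans[OF HY_bound fe_bound])
  have ic: "integrable lborel (\<lambda>z. gauss T (x + z) * (HY z * q1 z))"
    by (rule integrable_mult_bounded[OF gauss_integrable(2), where c = K]) (auto intro: order_trans[OF HY_bound b1])
  have ie: "integrable lborel (\<lambda>z. gauss T (x - z) * (HY (- z) * fe z))"
    by (rule integrable_mult_bounded[OF gauss_integrable(1), where c = Kf]) (auto intro: order_trans[OF HY_bound fe_bound])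
  have "heat T fe x = (\<integral>z. gauss T (x - z) * fe z \<partial>lborel)" by (rule heat_eq_integral[OF T q_meas(4)])
  also have "\<dots> = (\<integral>z. gauss T (x - z) * (HY z * fe z) + gauss T (x - z) * (HY (- z) * fe z) \<partial>lborel)"
  proof (rule integral_cong_AE)
    show "AE z in lborel. gauss T (x - z) * fe z = gauss T (x - z) * (HY z * fe z) + gauss T (x - z) * (HY (- z) * fe z)"
      using AE_lborel_singleton[of "0::real"] by eventually_elim (auto split: split_indicator)
  qed measurable
  also have "\<dots> = (\<integral>z. gauss T (x - z) * (HY z * fe z) \<partial>lborel) + (\<integral>z. gauss T (x - z) * (HY (- z) * fe z) \<partial>lborel)"
    using ia ie by simp
  also have "(\<integral>z. gauss T (x - z) * (HY (- z) * fe z) \<partial>lborel) = (\<integral>y. gauss T (x + y) * (HY y * fe (- y)) \<partial>lborel)"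
    by (subst lborel_integral_real_affine[of "- 1" _ 0]) auto
  also have "\<dots> = (\<integral>y. 2 * (HY y * (gauss T (x + y) * q1 y)) - gauss T (x + y) * (HY y * fe y) \<partial>lborel)"
    by (intro Bochner_Integration.integral_cong refl) (simp add: fe_reflect algebra_simps)
  also have "\<dots> = 2 * (\<integral>y. HY y * (gauss T (x + y) * q1 y) \<partial>lborel) - (\<integral>y. gauss T (x + y) * (HY y * fe y) \<partial>lborel)"
    using ib ic by (simp add: mult.left_commute)
  finally have "heat T fe x = (\<integral>z. gauss T (x - z) * (HY z * fe z) \<partial>lborel) - (\<integral>y. gauss T (x + y) * (HY y * fe y) \<partial>lborel)
      + (\<integral>y. HY y * (2 * g_density \<beta> \<gamma> T (x + y) * fe y) \<partial>lborel) + \<gamma> * g_density \<beta> \<gamma> T x * fe 0"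
    unfolding image_identity by simp
  moreover have "(\<integral>y. HY y * (p_D T x y + 2 * g_density \<beta> \<gamma> T (x + y)) * fe y \<partial>lborel)
     = (\<integral>z. gauss T (x - z) * (HY z * fe z) - gauss T (x + z) * (HY z * fe z) + 2 * (HY z * g_density \<beta> \<gamma> T (x + z) * fe z) \<partial>lborel)"
    by (intro Bochner_Integration.integral_cong refl) (simp add: p_D_eq algebra_simps)
  moreover have "\<dots> = (\<integral>z. gauss T (x - z) * (HY z * fe z) \<partial>lborel) - (\<integral>y. gauss T (x + y) * (HY y * fe y) \<partial>lborel)
      + 2 * (\<integral>y. HY y * g_density \<beta> \<gamma> T (x + y) * fe y \<partial>lborel)"
    using ia ib integrable_mult_bounded[OF g_density_integrable q_meas(4) fe_bound] by simp
  moreover have "2 * (\<integral>y. HY y * g_density \<beta> \<gamma> T (x + y) * fe y \<partial>lborel) = (\<integral>y. HY y * (2 * g_density \<beta> \<gamma> T (x + y) * fe y) \<partial>lborel)"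
    by (subst integral_mult_right_zero[symmetric]) (simp add: mult_ac)
  ultimately show ?thesis by simp
qed

end

section \<open>A measure-determining class of boundary functions\<close>

text \<open>Variation of constants: u(v) is the integral of exp(r (v - w)) h(w) over w from
  \<open>a\<close> to v. The negative real part of \<open>r\<close> bounds it to the right, and the
  vanishing of \<open>h\<close> up to \<open>a\<close> makes it zero to the left.\<close>

lemma bounded_linear_ode:
  fixes h :: "real \<Rightarrow> complex"
  assumes r: "Re r < 0" and cont: "\<And>v. isCont h v" and bd: "\<And>v. norm (h v) \<le> M" and zero: "\<And>v. v \<le> a \<Longrightarrow> h v = 0"
  obtains u where "\<And>v. (u has_vector_derivative r * u v + h v) (at v)" "\<And>v. norm (u v) \<le> M / - Re r"
    "\<And>v. v \<le> a \<Longrightarrow> u v = 0"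
proof -
  have M: "0 \<le> M" using bd[of 0] norm_ge_zero order_trans by blast
  have dexp: "((\<lambda>v. exp (c * of_real v)) has_vector_derivative c * exp (c * of_real v)) (at v)" for c :: complex and v
    by (rule has_vector_derivative_real_field) (auto intro!: derivative_eq_intros)
  have "\<exists>H. \<forall>v :: real. - \<infinity> < ereal v \<longrightarrow> ereal v < \<infinity> \<longrightarrow> (H has_vector_derivative exp (- r * of_real v) * h v) (at v)"
    by (rule einterval_antiderivative) (auto intro!: continuous_intros cont)
  then obtain H where H: "\<And>v. (H has_vector_derivative exp (- r * of_real v) * h v) (at v)" by auto
  have Hcont: "continuous_on S H" for S
    using H by (meson continuous_at_imp_continuous_on has_vector_derivative_continuous)
  have H0: "(H has_vector_derivative 0) (at v)" if "v < a" for v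
    using H[of v] zero[of v] that by simp
  define u where "u v = exp (r * of_real v) * (H v - H a)" for v
  have u0: "u v = 0" if "v \<le> a" for v
  proof (cases "v = a")
    case False
    then have "norm (H a - H v) \<le> 0 - 0"
      using that H0 by (intro differentiable_bound_general[where \<phi> = "\<lambda>_. 0" and f' = "\<lambda>_. 0" and \<phi>' = "\<lambda>_. 0"] Hcont) auto
    then show ?thesis by (simp add: u_def)
  qed (simp add: u_def)
  have bound: "norm (u v) \<le> M / - Re r" for v
  proof (cases "v \<le> a")
    case True
    then show ?thesis using u0 M r by (simp add: divide_nonneg_neg)
  next
    case False
    \<comment> \<open>An antiderivative of \<open>M * exp (- Re r * v)\<close>, which bounds the
      norm of the derivative of \<open>H\<close>; the mean value inequality then compares
      increments.\<close>
    let ?\<phi> = "\<lambda>v. M / - Re r * exp (- Re r * v)"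
    have "norm (H v - H a) \<le> ?\<phi> v - ?\<phi> a"
    proof (rule differentiable_bound_general[where f' = "\<lambda>v. exp (- r * of_real v) * h v" and \<phi>' = "\<lambda>v. M * exp (- Re r * v)"])
      show "a < v" using False by simp
      show "(?\<phi> has_vector_derivative M * exp (- Re r * y)) (at y)" for y
        using r by (auto intro!: derivative_eq_intros simp flip: has_real_derivative_iff_has_vector_derivative)
      show "(H has_vector_derivative exp (- r * of_real y) * h y) (at y)" for y by (rule H)
      show "norm (exp (- r * of_real y) * h y) \<le> M * exp (- Re r * y)" for y
        using bd[of y] by (simp add: norm_mult mult.commute mult_right_mono)
    qed (auto intro!: Hcont continuous_intros simp: r[THEN less_imp_neq])
    also have "\<dots> \<le> ?\<phi> v" using M r by (simp add: divide_nonneg_neg)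
    finally have "norm (H v - H a) \<le> ?\<phi> v" .
    then have "exp (Re r * v) * norm (H v - H a) \<le> exp (Re r * v) * ?\<phi> v" by (rule mult_left_mono) simp
    moreover have "norm (u v) = exp (Re r * v) * norm (H v - H a)" by (simp add: u_def norm_mult)
    ultimately have "norm (u v) \<le> exp (Re r * v) * ?\<phi> v" by simp
    also have "\<dots> = M / - Re r * (exp (Re r * v) * exp (- Re r * v))" by simp
    also have "exp (Re r * v) * exp (- Re r * v) = 1" by (simp flip: exp_add)
    finally show ?thesis by simp
  qed
  have "(u has_vector_derivative r * u v + h v) (at v)" for v
  proof -
    have "((\<lambda>v. H v - H a) has_vector_derivative exp (- r * of_real v) * h v) (at v)"
      using has_vector_derivative_diff[OF H has_vector_derivative_const] by simp
    from has_vector_derivative_mult[OF dexp[of r v] this]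
    have "(u has_vector_derivative exp (r * of_real v) * (exp (- r * of_real v) * h v) + r * exp (r * of_real v) * (H v - H a)) (at v)"
      unfolding u_def .
    moreover have e: "exp (r * of_real v) * (exp (- r * of_real v) * h v) = h v"
      by (simp add: mult.assoc[symmetric] flip: exp_add)
    ultimately show ?thesis unfolding e u_def[of v] by (simp only: add.commute mult.assoc)
  qed
  with bound u0 show thesis using that by blast
qed

text \<open>The roots of (\<gamma> / 2) X^2 + X + \<beta>. If they are real, the root D of the
  scaled discriminant is below 1, so both are negative; otherwise both have real part - 1 /
  \<gamma>.\<close>

lemma characteristic_roots:
  assumes "0 < (\<beta>::real)" "0 < \<gamma>"
  obtains r1 r2 :: complex where "Re r1 < 0" "Re r2 < 0" "r1 + r2 = of_real (- 2 / \<gamma>)" "r1 * r2 = of_real (2 * \<beta> / \<gamma>)"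
proof (cases "2 * \<beta> * \<gamma> \<le> 1")
  case True
  define D where "D = sqrt (1 - 2 * \<beta> * \<gamma>)"
  have D: "0 \<le> D" "D < 1" "D\<^sup>2 = 1 - 2 * \<beta> * \<gamma>" using True assms by (auto simp: D_def)
  show thesis
  proof (rule that[of "of_real ((- 1 + D) / \<gamma>)" "of_real ((- 1 - D) / \<gamma>)"])
    show "complex_of_real ((- 1 + D) / \<gamma>) * of_real ((- 1 - D) / \<gamma>) = of_real (2 * \<beta> / \<gamma>)"
    proof -
      have "(- 1 + D) / \<gamma> * ((- 1 - D) / \<gamma>) = (1 - D\<^sup>2) / \<gamma>\<^sup>2" by (simp add: field_simps power2_eq_square)
      also have "\<dots> = 2 * \<beta> / \<gamma>" unfolding D(3) using assms by (simp add: power2_eq_square)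
      finally show ?thesis by (metis of_real_mult)
    qed
    have "(- 1 + D) / \<gamma> + (- 1 - D) / \<gamma> = - 2 / \<gamma>" using assms by (simp add: field_simps)
    then show "complex_of_real ((- 1 + D) / \<gamma>) + of_real ((- 1 - D) / \<gamma>) = of_real (- 2 / \<gamma>)"
      by (metis of_real_add)
    show "Re (of_real ((- 1 + D) / \<gamma>)) < 0" "Re (of_real ((- 1 - D) / \<gamma>)) < 0"
      using D assms by (simp_all add: divide_neg_pos)
  qed
next
  case False
  define D where "D = sqrt (2 * \<beta> * \<gamma> - 1)"
  have D: "D\<^sup>2 = 2 * \<beta> * \<gamma> - 1" using False by (simp add: D_def)
  have "1 + D * D = 2 * \<beta> * \<gamma>" using D by (simp add: power2_eq_square)
  then have "1 / \<gamma> * (1 / \<gamma>) + D / \<gamma> * (D / \<gamma>) = 2 * \<beta> / \<gamma>"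
    using assms by (simp add: add_divide_distrib[symmetric])
  then show thesis
    using assms by (intro that[of "Complex (- 1 / \<gamma>) (D / \<gamma>)" "Complex (- 1 / \<gamma>) (- (D / \<gamma>))"])
      (auto simp: complex_eq_iff)
qed

text \<open>Smooth approximation of the indicator of \<open>{0<..}\<close>: the distribution function of the Gamma law
  of shape 3.\<close>

definition step0 :: "real \<Rightarrow> real" where "step0 v = 1 - exp (- max 0 v) * (1 + max 0 v + (max 0 v)\<^sup>2 / 2)"
definition step1 :: "real \<Rightarrow> real" where "step1 v = exp (- max 0 v) * (max 0 v)\<^sup>2 / 2"
definition step2 :: "real \<Rightarrow> real" where "step2 v = exp (- max 0 v) * (max 0 v - (max 0 v)\<^sup>2 / 2)"

text \<open>Continuation by zero to the left is differentiable at 0 if value and slope vanish there.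
  It is applied to the distribution function and to the density; shape 3 is the least integer shape
  for which the density has slope 0 at the origin.\<close>

lemma has_derivative_positive_part:
  assumes d: "\<And>v. (F has_real_derivative F' v) (at v)" and "F 0 = 0" "F' 0 = 0"
  shows "((\<lambda>v. F (max 0 v)) has_real_derivative F' (max 0 v)) (at v)"
proof -
  consider "v < 0" | "v = 0" | "0 < v" by linarith
  then show ?thesis
  proof cases
    case 1
    have "((\<lambda>_. 0) has_real_derivative 0) (at v)" by simp
    then have "((\<lambda>v. F (max 0 v)) has_real_derivative 0) (at v)"
      by (rule has_field_derivative_transform_within_open[where S = "{..<0}"]) (use 1 assms in auto)
    then show ?thesis using 1 assms by simp
  next
    case 3
    have "((\<lambda>v. F (max 0 v)) has_real_derivative F' v) (at v)"
      by (rule has_field_derivative_transform_within_open[OF d, where S = "{0<..}"]) (use 3 in auto)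
    then show ?thesis using 3 by simp
  next
    case 2
    have "(\<lambda>h. F h / h) \<midarrow>0\<rightarrow> 0" using DERIV_D[OF d[of 0]] assms by simp
    then have "(\<lambda>h. F (max 0 h) / h) \<midarrow>0\<rightarrow> 0"
      by (rule tendsto_0_le[where K = 1]) (use assms in \<open>auto intro!: always_eventually simp: max_def divide_nonneg_neg\<close>)
    then show ?thesis using 2 assms by (simp add: DERIV_def)
  qed
qed

lemma step_deriv: "(step0 has_real_derivative step1 v) (at v)" "(step1 has_real_derivative step2 v) (at v)"
proof -
  have "((\<lambda>v. 1 - exp (- v) * (1 + v + v\<^sup>2 / 2)) has_real_derivative exp (- v) * v\<^sup>2 / 2) (at v)" for v :: real
    by (auto intro!: derivative_eq_intros simp: algebra_simps add_divide_distrib diff_divide_distrib)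
  from has_derivative_positive_part[OF this, of v]
  show "(step0 has_real_derivative step1 v) (at v)" by (simp add: step0_def[abs_def] step1_def)
  have "((\<lambda>v. exp (- v) * v\<^sup>2 / 2) has_real_derivative exp (- v) * (v - v\<^sup>2 / 2)) (at v)" for v :: real
    by (auto intro!: derivative_eq_intros simp: algebra_simps add_divide_distrib diff_divide_distrib)
  from has_derivative_positive_part[OF this, of v]
  show "(step1 has_real_derivative step2 v) (at v)" by (simp add: step1_def[abs_def] step2_def)
qed

lemma exp_power_bounds:
  assumes "0 \<le> (v::real)" shows "exp (- v) \<le> 1" "exp (- v) * v \<le> 1" "exp (- v) * v\<^sup>2 \<le> 2"
proof -
  show "exp (- v) \<le> 1" using assms by simp
  have "v \<le> exp v" using exp_ge_add_one_self[of v] by linarith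
  then show "exp (- v) * v \<le> 1" by (simp add: exp_minus field_simps)
  have "1 + v + v\<^sup>2 / 2 \<le> exp v" by (rule exp_lower_Taylor_quadratic[OF assms])
  then have "v\<^sup>2 \<le> 2 * exp v" using assms by linarith
  then show "exp (- v) * v\<^sup>2 \<le> 2" by (simp add: exp_minus field_simps)
qed

lemma step_bounds: "0 \<le> step0 v" "step0 v \<le> 1" "\<bar>step1 v\<bar> \<le> 1" "\<bar>step2 v\<bar> \<le> 2"
proof -
  define w where "w = max 0 v"
  have w: "0 \<le> w" by (simp add: w_def)
  note b = exp_power_bounds[OF w]
  have "exp (- w) * (1 + w + w\<^sup>2 / 2) \<le> exp (- w) * exp w"
    by (intro mult_left_mono exp_lower_Taylor_quadratic w) simp
  then show "0 \<le> step0 v" by (simp add: step0_def w_def[symmetric] flip: exp_add)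
  show "step0 v \<le> 1" using w by (simp add: step0_def w_def[symmetric])
  show "\<bar>step1 v\<bar> \<le> 1" using b by (simp add: step1_def w_def[symmetric])
  have "\<bar>exp (- w) * (w - w\<^sup>2 / 2)\<bar> \<le> exp (- w) * w + exp (- w) * w\<^sup>2 / 2"
    using w by (simp add: right_diff_distrib abs_le_iff)
  then show "\<bar>step2 v\<bar> \<le> 2" using b by (simp add: step2_def w_def[symmetric])
qed

lemma step2_lipschitz: "\<bar>step2 u - step2 v\<bar> \<le> 4 * \<bar>u - v\<bar>"
proof -
  have "norm (exp (- max 0 u) * (max 0 u - (max 0 u)\<^sup>2 / 2) - exp (- max 0 v) * (max 0 v - (max 0 v)\<^sup>2 / 2)) \<le> 4 * norm (max 0 u - max 0 v)"
  proof (rule field_differentiable_bound[where S = "{0..}" and f' = "\<lambda>v. exp (- v) * (1 - 2 * v + v\<^sup>2 / 2)"])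
    fix z :: real assume z: "z \<in> {0..}"
    show "((\<lambda>v. exp (- v) * (v - v\<^sup>2 / 2)) has_real_derivative exp (- z) * (1 - 2 * z + z\<^sup>2 / 2)) (at z within {0..})"
      by (auto intro!: derivative_eq_intros simp: algebra_simps add_divide_distrib diff_divide_distrib)
    have z0: "0 \<le> z" using z by simp
    have "\<bar>exp (- z) * (1 - 2 * z + z\<^sup>2 / 2)\<bar> \<le> exp (- z) + 2 * (exp (- z) * z) + exp (- z) * z\<^sup>2 / 2"
      using z0 mult_nonneg_nonneg[of "exp (- z)" z] mult_nonneg_nonneg[of "exp (- z)" "z\<^sup>2"] by (simp add: algebra_simps abs_le_iff)
    also have "\<dots> \<le> 4" using exp_power_bounds[OF z0] by linarith
    finally show "norm (exp (- z) * (1 - 2 * z + z\<^sup>2 / 2)) \<le> 4" by simp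
  qed auto
  moreover have "\<bar>max 0 u - max 0 v\<bar> \<le> \<bar>u - v\<bar>" by linarith
  ultimately show ?thesis unfolding step2_def by simp
qed

lemma step_nonpos: "v \<le> 0 \<Longrightarrow> step0 v = 0" "v \<le> 0 \<Longrightarrow> step1 v = 0" "v \<le> 0 \<Longrightarrow> step2 v = 0"
  by (simp_all add: step0_def step1_def step2_def)

lemma step0_tendsto: assumes "0 < c" shows "(\<lambda>n. step0 (real n * c)) \<longlonglongrightarrow> 1"
proof -
  have "(\<lambda>n. exp (- (real n * c)) * (1 + real n * c + (real n * c)\<^sup>2 / 2)) \<longlonglongrightarrow> 0"
  proof (rule Lim_null_comparison)
    show "\<forall>\<^sub>F n in sequentially. norm (exp (- (real n * c)) * (1 + real n * c + (real n * c)\<^sup>2 / 2)) \<le> 24 / (real n * c)"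
      using eventually_gt_at_top[of 0]
    proof eventually_elim
      case (elim n)
      define v where "v = real n * c"
      have v: "0 < v" using elim assms by (simp add: v_def)
      have 1: "v * exp (- v) \<le> 1" "v\<^sup>2 * exp (- v) \<le> 2" using exp_power_bounds[of v] v by (simp_all add: mult.commute)
      have "v ^ 3 * exp (- v) \<le> 6" using exp_minus_le_inverse_power[OF v, of 3] v by (simp add: field_simps fact_numeral)
      then have "v * (exp (- v) * (1 + v + v\<^sup>2 / 2)) \<le> 24"
        using 1 by (simp add: algebra_simps power2_eq_square power3_eq_cube)
      then show ?case using v unfolding v_def[symmetric] by (simp add: pos_le_divide_eq mult.commute abs_mult)
    qed
    have "(\<lambda>n. 24 / c * (1 / real n)) \<longlonglongrightarrow> 24 / c * 0" by (intro tendsto_mult tendsto_const lim_1_over_n)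
    then show "(\<lambda>n. 24 / (real n * c)) \<longlonglongrightarrow> 0" by (simp add: field_simps)
  qed
  from tendsto_diff[OF tendsto_const this, of 1]
  show ?thesis using assms by (simp add: step0_def)
qed

section \<open>Odd generators of the boundary functions\<close>

locale odd_smooth =
  fixes q0 q1 q2 q3 q4 :: "real \<Rightarrow> real" and K \<beta> \<gamma> :: real
  assumes d0: "\<And>v. (q0 has_real_derivative q1 v) (at v)" and d1: "\<And>v. (q1 has_real_derivative q2 v) (at v)"
    and d2: "\<And>v. (q2 has_real_derivative q3 v) (at v)" and d3: "\<And>v. (q3 has_real_derivative q4 v) (at v)"
    and b0: "\<And>v. \<bar>q0 v\<bar> \<le> K" and b1: "\<And>v. \<bar>q1 v\<bar> \<le> K" and b2: "\<And>v. \<bar>q2 v\<bar> \<le> K"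
    and b3: "\<And>v. \<bar>q3 v\<bar> \<le> K" and b4: "\<And>v. \<bar>q4 v\<bar> \<le> K"
    and lip4: "\<And>u v. \<bar>q4 u - q4 v\<bar> \<le> K * \<bar>u - v\<bar>"
    and odd0: "\<And>v. q0 (- v) = - q0 v"
    and \<beta>: "0 < \<beta>" and \<gamma>: "0 < \<gamma>"
begin

lemma deriv_odd_even:
  assumes "\<And>v. (g has_real_derivative g' v) (at v)" "\<And>v. g (- v) = c * g v"
  shows "g' (- v) = - c * g' v"
proof -
  have "((\<lambda>v. g (- v)) has_real_derivative g' (- v) * - 1) (at v)"
    by (rule DERIV_chain2[OF assms(1)]) (auto intro!: derivative_eq_intros)
  moreover have "((\<lambda>v. g (- v)) has_real_derivative c * g' v) (at v)"
    unfolding assms(2) by (rule DERIV_cmult[OF assms(1)])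
  ultimately have "g' (- v) * - 1 = c * g' v" by (rule DERIV_unique)
  then show ?thesis by simp
qed

lemma parity: "q1 (- v) = q1 v" "q2 (- v) = - q2 v" "q4 (- v) = - q4 v"
proof -
  have q1: "q1 (- v) = 1 * q1 v" for v using deriv_odd_even[OF d0, of "- 1" v] odd0 by simp
  have q2: "q2 (- v) = - 1 * q2 v" for v using deriv_odd_even[OF d1 q1, of v] by simp
  have q3: "q3 (- v) = 1 * q3 v" for v using deriv_odd_even[OF d2 q2, of v] by simp
  show "q1 (- v) = q1 v" "q2 (- v) = - q2 v" "q4 (- v) = - q4 v"
    using q1 q2 deriv_odd_even[OF d3 q3, of v] by simp_all
qed

lemma image_data: assumes "0 < T" "0 \<le> x" shows "image_data q0 q1 q2 K \<beta> \<gamma> T x"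
proof
  show "continuous_on UNIV q2" using d2 by (auto intro!: DERIV_continuous_on simp: has_field_derivative_at_within)
qed (use d0 d1 b0 b1 b2 odd0 parity \<beta> \<gamma> assms in auto)

text \<open>\<open>f\<close> takes up two derivatives of \<open>q0\<close>, and
  \<open>boundary_fun\<close> asks for two more with a Lipschitz bound on the last, which explains
  the four derivatives in the locale.\<close>

definition f :: "real \<Rightarrow> real" where "f v = q1 v + \<beta> * q0 v + \<gamma> / 2 * q2 v"

lemma boundary_fun:
  "boundary_fun f (\<lambda>v. q2 v + \<beta> * q1 v + \<gamma> / 2 * q3 v) (\<lambda>v. q3 v + \<beta> * q2 v + \<gamma> / 2 * q4 v) (K + \<beta> * K + \<gamma> / 2 * K) \<beta> \<gamma>"
proof
  have comb: "\<bar>a + \<beta> * b + \<gamma> / 2 * c\<bar> \<le> k + \<beta> * k + \<gamma> / 2 * k" if "\<bar>a\<bar> \<le> k" "\<bar>b\<bar> \<le> k" "\<bar>c\<bar> \<le> k" for a b c k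
  proof -
    have "\<bar>a + \<beta> * b + \<gamma> / 2 * c\<bar> \<le> \<bar>a\<bar> + \<bar>\<beta> * b\<bar> + \<bar>\<gamma> / 2 * c\<bar>" by linarith
    also have "\<dots> \<le> k + \<beta> * k + \<gamma> / 2 * k"
      unfolding abs_mult using that \<beta> \<gamma> by (intro add_mono mult_mono) auto
    finally show ?thesis .
  qed
  show "(f has_real_derivative q2 v + \<beta> * q1 v + \<gamma> / 2 * q3 v) (at v)" for v
    unfolding f_def[abs_def] by (auto intro!: derivative_eq_intros d0 d1 d2)
  show "((\<lambda>v. q2 v + \<beta> * q1 v + \<gamma> / 2 * q3 v) has_real_derivative q3 v + \<beta> * q2 v + \<gamma> / 2 * q4 v) (at v)" for v
    by (auto intro!: derivative_eq_intros d1 d2 d3)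
  show "\<bar>f v\<bar> \<le> K + \<beta> * K + \<gamma> / 2 * K" "\<bar>q2 v + \<beta> * q1 v + \<gamma> / 2 * q3 v\<bar> \<le> K + \<beta> * K + \<gamma> / 2 * K"
    "\<bar>q3 v + \<beta> * q2 v + \<gamma> / 2 * q4 v\<bar> \<le> K + \<beta> * K + \<gamma> / 2 * K" for v
    unfolding f_def by (intro comb b0 b1 b2 b3 b4)+
  have lip2: "\<bar>q2 u - q2 v\<bar> \<le> K * \<bar>u - v\<bar>" and lip3: "\<bar>q3 u - q3 v\<bar> \<le> K * \<bar>u - v\<bar>" for u v
    using field_differentiable_bound[of UNIV q2 q3 K u v] field_differentiable_bound[of UNIV q3 q4 K u v] d2 d3 b3 b4 by auto
  show "\<bar>(q3 u + \<beta> * q2 u + \<gamma> / 2 * q4 u) - (q3 v + \<beta> * q2 v + \<gamma> / 2 * q4 v)\<bar> \<le> (K + \<beta> * K + \<gamma> / 2 * K) * \<bar>u - v\<bar>" for u v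
  proof -
    have "(q3 u + \<beta> * q2 u + \<gamma> / 2 * q4 u) - (q3 v + \<beta> * q2 v + \<gamma> / 2 * q4 v)
      = (q3 u - q3 v) + \<beta> * (q2 u - q2 v) + \<gamma> / 2 * (q4 u - q4 v)"
      by (simp add: right_diff_distrib diff_divide_distrib)
    moreover have "(K + \<beta> * K + \<gamma> / 2 * K) * \<bar>u - v\<bar> = K * \<bar>u - v\<bar> + \<beta> * (K * \<bar>u - v\<bar>) + \<gamma> / 2 * (K * \<bar>u - v\<bar>)"
      by (simp add: distrib_right mult.assoc)
    ultimately show ?thesis using comb[OF lip3[of u v] lip2[of u v] lip4[of u v]] by (simp only:)
  qed
  \<comment> \<open>The terms of odd order, \<open>q1\<close> and \<open>q3\<close>, cancel within
    the defect; a combination of \<open>q0\<close>, \<open>q2\<close> and \<open>q4\<close> is left,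
    all of them odd.\<close>
  show "(q2 (- v) + \<beta> * q1 (- v) + \<gamma> / 2 * q3 (- v)) - \<gamma> / 2 * (q3 (- v) + \<beta> * q2 (- v) + \<gamma> / 2 * q4 (- v)) - \<beta> * f (- v)
    = - ((q2 v + \<beta> * q1 v + \<gamma> / 2 * q3 v) - \<gamma> / 2 * (q3 v + \<beta> * q2 v + \<gamma> / 2 * q4 v) - \<beta> * f v)" for v
    unfolding f_def parity odd0 by (simp add: algebra_simps)
qed (use \<beta> \<gamma> in auto)

end

text \<open>The solution of \<open>(\<gamma> / 2) Q'' + Q' + \<beta> Q = f\<close> that vanishes on \<open>{..a}\<close> is bounded, because both characteristic roots
  have negative real part, and \<open>q(v) = Q(v) - Q(- v)\<close> solves the same equation on \<open>{0..}\<close>.  The roots may be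
  complex.\<close>

lemma odd_smooth_step:
  assumes \<beta>: "0 < \<beta>" and \<gamma>: "0 < \<gamma>" and a: "0 < a"
  obtains q0 q1 q2 q3 q4 K where "odd_smooth q0 q1 q2 q3 q4 K \<beta> \<gamma>"
    "\<And>y. 0 \<le> y \<Longrightarrow> odd_smooth.f q0 q1 q2 \<beta> \<gamma> y = step0 (real n * (y - a))"
proof -
  define m where "m = real n"
  have m: "0 \<le> m" by (simp add: m_def)
  define f0 where "f0 v = step0 (m * (v - a))" for v
  define f1 where "f1 v = m * step1 (m * (v - a))" for v
  define f2 where "f2 v = m * (m * step2 (m * (v - a)))" for v
  have lin: "((\<lambda>v. m * (v - a)) has_real_derivative m) (at v)" for v by (auto intro!: derivative_eq_intros)
  have df0: "(f0 has_real_derivative f1 v) (at v)" for v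
    using DERIV_chain2[OF step_deriv(1) lin] unfolding f0_def f1_def by (simp add: mult.commute)
  have df1: "(f1 has_real_derivative f2 v) (at v)" for v
    using DERIV_cmult[OF DERIV_chain2[OF step_deriv(2) lin], of m] unfolding f1_def f2_def by (simp add: mult.commute)
  have bf0: "\<bar>f0 v\<bar> \<le> 1" for v using step_bounds(1,2)[of "m * (v - a)"] by (simp add: f0_def)
  have bf1: "\<bar>f1 v\<bar> \<le> m * 1" for v
    unfolding f1_def abs_mult using m step_bounds(3) by (intro mult_mono) auto
  have bf2: "\<bar>f2 v\<bar> \<le> m * (m * 2)" for v
    unfolding f2_def abs_mult using m step_bounds(4) by (intro mult_mono) auto
  have lf2: "\<bar>f2 u - f2 v\<bar> \<le> m * m * 4 * m * \<bar>u - v\<bar>" for u v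
  proof -
    have "\<bar>f2 u - f2 v\<bar> = m * m * \<bar>step2 (m * (u - a)) - step2 (m * (v - a))\<bar>"
      unfolding f2_def using m by (simp add: abs_mult flip: right_diff_distrib mult.assoc)
    also have "\<dots> \<le> m * m * (4 * \<bar>m * (u - a) - m * (v - a)\<bar>)"
      using m by (intro mult_left_mono step2_lipschitz) auto
    also have "\<bar>m * (u - a) - m * (v - a)\<bar> = m * \<bar>u - v\<bar>" using m by (simp add: abs_mult flip: right_diff_distrib)
    finally show ?thesis by (simp add: mult_ac)
  qed
  have zf: "f0 v = 0" "f1 v = 0" "f2 v = 0" if "v \<le> a" for v
  proof -
    have "m * (v - a) \<le> 0" using m that by (simp add: mult_nonneg_nonpos)
    then show "f0 v = 0" "f1 v = 0" "f2 v = 0" by (simp_all add: f0_def f1_def f2_def step_nonpos)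
  qed
  obtain r1 r2 where r: "Re r1 < 0" "Re r2 < 0" "r1 + r2 = of_real (- 2 / \<gamma>)" "r1 * r2 = of_real (2 * \<beta> / \<gamma>)"
    using characteristic_roots[OF \<beta> \<gamma>] by blast
  have c0: "isCont (\<lambda>v. complex_of_real (f0 v)) v" for v using DERIV_isCont[OF df0] by (intro continuous_intros)
  obtain u1 where u1: "\<And>v. (u1 has_vector_derivative r1 * u1 v + of_real (f0 v)) (at v)" "\<And>v. norm (u1 v) \<le> 1 / - Re r1"
    "\<And>v. v \<le> a \<Longrightarrow> u1 v = 0"
    using bounded_linear_ode[OF r(1), of "\<lambda>v. of_real (f0 v)" 1 a] c0 bf0 zf by auto
  have c1: "isCont u1 v" for v using u1(1) has_vector_derivative_continuous by blast
  define M1 where "M1 = 1 / - Re r1"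
  define M2 where "M2 = M1 / - Re r2"
  obtain u2 where u2: "\<And>v. (u2 has_vector_derivative r2 * u2 v + u1 v) (at v)" "\<And>v. norm (u2 v) \<le> M2"
    "\<And>v. v \<le> a \<Longrightarrow> u2 v = 0"
    using bounded_linear_ode[OF r(2), of u1 M1 a] c1 u1 unfolding M1_def[symmetric] M2_def by blast
  \<comment> \<open>\<open>u2\<close> solves the equation factored as (D - r1) (D - r2) u2 = f0. The
    sum and the product of the roots are real, so the real part solves it as well, and the factor 2
    / \<gamma> restores the leading coefficient.\<close>
  define Q0 where "Q0 v = 2 / \<gamma> * Re (u2 v)" for v
  define Q1 where "Q1 v = 2 / \<gamma> * Re (r2 * u2 v + u1 v)" for v
  \<comment> \<open>From here on the derivatives are read off from the equation and its derivatives,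
    so that bounds and Lipschitz constants are inherited from \<open>f0\<close>, \<open>f1\<close>,
    \<open>f2\<close> and the lower orders.\<close>
  define Q2 where "Q2 v = 2 / \<gamma> * (f0 v - Q1 v - \<beta> * Q0 v)" for v
  define Q3 where "Q3 v = 2 / \<gamma> * (f1 v - Q2 v - \<beta> * Q1 v)" for v
  define Q4 where "Q4 v = 2 / \<gamma> * (f2 v - Q3 v - \<beta> * Q2 v)" for v
  have dQ0: "(Q0 has_real_derivative Q1 v) (at v)" for v
  proof -
    have "((\<lambda>v. Re (u2 v)) has_real_derivative Re (r2 * u2 v + u1 v)) (at v)"
      unfolding has_real_derivative_iff_has_vector_derivative
      by (rule bounded_linear.has_vector_derivative[OF bounded_linear_Re u2(1)])
    from DERIV_cmult[OF this, of "2 / \<gamma>"] show ?thesis unfolding Q0_def Q1_def .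
  qed
  have dQ1: "(Q1 has_real_derivative Q2 v) (at v)" for v
  proof -
    let ?w = "r2 * u2 v + u1 v"
    have re: "Re (of_real c * w - of_real d * z + of_real e) = c * Re w - d * Re z + e" for c d e w z
      by simp
    have "((\<lambda>v. r2 * u2 v + u1 v) has_vector_derivative r2 * ?w + (r1 * u1 v + of_real (f0 v))) (at v)"
      by (intro has_vector_derivative_add bounded_linear.has_vector_derivative[OF bounded_linear_mult_right] u1 u2)
    from bounded_linear.has_vector_derivative[OF bounded_linear_Re this]
    have dRe: "((\<lambda>v. Re (r2 * u2 v + u1 v)) has_real_derivative Re (r2 * ?w + (r1 * u1 v + of_real (f0 v)))) (at v)"
      unfolding has_real_derivative_iff_has_vector_derivative .
    have "r2 * ?w + (r1 * u1 v + of_real (f0 v)) = (r1 + r2) * ?w - (r1 * r2) * u2 v + of_real (f0 v)"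
      by (simp add: algebra_simps)
    then have "Re (r2 * ?w + (r1 * u1 v + of_real (f0 v))) = - 2 / \<gamma> * Re ?w - 2 * \<beta> / \<gamma> * Re (u2 v) + f0 v"
      unfolding r(3,4) by (simp only: re)
    also have "\<dots> = f0 v - Q1 v - \<beta> * Q0 v" by (simp add: Q1_def Q0_def)
    finally have e: "Re (r2 * ?w + (r1 * u1 v + of_real (f0 v))) = f0 v - Q1 v - \<beta> * Q0 v" .
    have Q1: "Q1 = (\<lambda>v. 2 / \<gamma> * Re (r2 * u2 v + u1 v))" by (rule ext) (rule Q1_def)
    have "((\<lambda>v. 2 / \<gamma> * Re (r2 * u2 v + u1 v)) has_real_derivative 2 / \<gamma> * (f0 v - Q1 v - \<beta> * Q0 v)) (at v)"
      unfolding e[symmetric] by (rule DERIV_cmult[OF dRe])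
    then show ?thesis unfolding Q1[symmetric] Q2_def .
  qed
  have dQ2: "(Q2 has_real_derivative Q3 v) (at v)" for v
  proof -
    have Q2: "Q2 = (\<lambda>v. 2 / \<gamma> * (f0 v - Q1 v - \<beta> * Q0 v))" by (rule ext) (rule Q2_def)
    show ?thesis unfolding Q3_def by (subst (1) Q2) (intro DERIV_cmult DERIV_diff df0 dQ1 dQ0)
  qed
  have dQ3: "(Q3 has_real_derivative Q4 v) (at v)" for v
  proof -
    have Q3: "Q3 = (\<lambda>v. 2 / \<gamma> * (f1 v - Q2 v - \<beta> * Q1 v))" by (rule ext) (rule Q3_def)
    show ?thesis unfolding Q4_def by (subst (1) Q3) (intro DERIV_cmult DERIV_diff df1 dQ2 dQ1)
  qed
  have comb: "\<bar>2 / \<gamma> * (p - q - \<beta> * w)\<bar> \<le> 2 / \<gamma> * (p' + q' + \<beta> * w')" if "\<bar>p\<bar> \<le> p'" "\<bar>q\<bar> \<le> q'" "\<bar>w\<bar> \<le> w'" for p q w p' q' w'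
  proof -
    have "\<bar>\<beta> * w\<bar> \<le> \<beta> * w'" unfolding abs_mult using \<beta> that by simp
    then have "\<bar>p - q - \<beta> * w\<bar> \<le> p' + q' + \<beta> * w'" using that by linarith
    then show ?thesis unfolding abs_mult[of "2 / \<gamma>"] using \<gamma> by (intro mult_mono) auto
  qed
  define B0 where "B0 = 2 / \<gamma> * M2"
  define B1 where "B1 = 2 / \<gamma> * (norm r2 * M2 + M1)"
  define B2 where "B2 = 2 / \<gamma> * (1 + B1 + \<beta> * B0)"
  define B3 where "B3 = 2 / \<gamma> * (m * 1 + B2 + \<beta> * B1)"
  define B4 where "B4 = 2 / \<gamma> * (m * (m * 2) + B3 + \<beta> * B2)"
  define L4 where "L4 = 2 / \<gamma> * (m * m * 4 * m + B4 + \<beta> * B3)"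
  have bQ0: "\<bar>Q0 v\<bar> \<le> B0" for v
    unfolding Q0_def B0_def abs_mult using \<gamma> order_trans[OF abs_Re_le_cmod u2(2)] by (intro mult_mono) auto
  have bQ1: "\<bar>Q1 v\<bar> \<le> B1" for v
  proof -
    have "norm (r2 * u2 v + u1 v) \<le> norm r2 * norm (u2 v) + norm (u1 v)" by (metis norm_mult norm_triangle_ineq)
    also have "\<dots> \<le> norm r2 * M2 + M1" using u1(2) u2(2) unfolding M1_def by (intro add_mono mult_left_mono) auto
    finally have "\<bar>Re (r2 * u2 v + u1 v)\<bar> \<le> norm r2 * M2 + M1" using abs_Re_le_cmod order_trans by blast
    then show ?thesis unfolding Q1_def B1_def abs_mult using \<gamma> by (intro mult_mono) auto
  qed
  have bQ2: "\<bar>Q2 v\<bar> \<le> B2" for v unfolding Q2_def B2_def by (intro comb bf0 bQ1 bQ0)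
  have bQ3: "\<bar>Q3 v\<bar> \<le> B3" for v unfolding Q3_def B3_def by (intro comb bf1 bQ2 bQ1)
  have bQ4: "\<bar>Q4 v\<bar> \<le> B4" for v unfolding Q4_def B4_def by (intro comb bf2 bQ3 bQ2)
  have lQ4: "\<bar>Q4 u - Q4 v\<bar> \<le> L4 * \<bar>u - v\<bar>" for u v
  proof -
    have l3: "\<bar>Q3 u - Q3 v\<bar> \<le> B4 * \<bar>u - v\<bar>" and l2: "\<bar>Q2 u - Q2 v\<bar> \<le> B3 * \<bar>u - v\<bar>"
      using field_differentiable_bound[of UNIV Q3 Q4 B4 u v] field_differentiable_bound[of UNIV Q2 Q3 B3 u v] dQ2 dQ3 bQ3 bQ4 by auto
    have "Q4 u - Q4 v = 2 / \<gamma> * ((f2 u - f2 v) - (Q3 u - Q3 v) - \<beta> * (Q2 u - Q2 v))"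
      unfolding Q4_def by (simp add: right_diff_distrib)
    moreover have "L4 * \<bar>u - v\<bar> = 2 / \<gamma> * (m * m * 4 * m * \<bar>u - v\<bar> + B4 * \<bar>u - v\<bar> + \<beta> * (B3 * \<bar>u - v\<bar>))"
      by (simp add: L4_def algebra_simps)
    ultimately show ?thesis using comb[OF lf2 l3 l2] by (simp only:)
  qed
  have nn: "0 \<le> B0" "0 \<le> B1" "0 \<le> B2" "0 \<le> B3" "0 \<le> B4" "0 \<le> L4"
  proof -
    show b: "0 \<le> B0" "0 \<le> B1" "0 \<le> B2" "0 \<le> B3" "0 \<le> B4"
      using bQ0[of 0] bQ1[of 0] bQ2[of 0] bQ3[of 0] bQ4[of 0] by linarith+
    show "0 \<le> L4" using lQ4[of 1 0] by simp
  qed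
  define K where "K = 2 * (B0 + B1 + B2 + B3 + B4 + L4)"
  have chain: "((\<lambda>v. g (- v)) has_real_derivative - g' (- v)) (at v)" if "\<And>v. (g has_real_derivative g' v) (at v)" for g g' :: "real \<Rightarrow> real" and v
  proof -
    have "(uminus has_real_derivative - 1) (at v)" by (auto intro!: derivative_eq_intros)
    from DERIV_chain2[OF that this] show ?thesis by simp
  qed
  let ?q0 = "\<lambda>v. Q0 v - Q0 (- v)" and ?q1 = "\<lambda>v. Q1 v + Q1 (- v)" and ?q2 = "\<lambda>v. Q2 v - Q2 (- v)"
    and ?q3 = "\<lambda>v. Q3 v + Q3 (- v)" and ?q4 = "\<lambda>v. Q4 v - Q4 (- v)"
  have os: "odd_smooth ?q0 ?q1 ?q2 ?q3 ?q4 K \<beta> \<gamma>"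
  proof
    show "(?q0 has_real_derivative ?q1 v) (at v)" "(?q2 has_real_derivative ?q3 v) (at v)" for v
      using DERIV_diff[OF dQ0 chain[OF dQ0]] DERIV_diff[OF dQ2 chain[OF dQ2]] by simp_all
    show "(?q1 has_real_derivative ?q2 v) (at v)" "(?q3 has_real_derivative ?q4 v) (at v)" for v
      using DERIV_add[OF dQ1 chain[OF dQ1]] DERIV_add[OF dQ3 chain[OF dQ3]] by simp_all
    have bound: "\<bar>x + y\<bar> \<le> K \<and> \<bar>x - y\<bar> \<le> K" if "\<bar>x\<bar> \<le> B" "\<bar>y\<bar> \<le> B" "2 * B \<le> K" for x y B
      using that by (auto simp: abs_le_iff)
    show "\<bar>?q0 v\<bar> \<le> K" "\<bar>?q1 v\<bar> \<le> K" "\<bar>?q2 v\<bar> \<le> K" "\<bar>?q3 v\<bar> \<le> K" "\<bar>?q4 v\<bar> \<le> K" for v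
      using bound[OF bQ0 bQ0] bound[OF bQ1 bQ1] bound[OF bQ2 bQ2] bound[OF bQ3 bQ3] bound[OF bQ4 bQ4] nn
      by (simp_all add: K_def)
    show "\<bar>?q4 u - ?q4 v\<bar> \<le> K * \<bar>u - v\<bar>" for u v
    proof -
      have "\<bar>?q4 u - ?q4 v\<bar> \<le> L4 * \<bar>u - v\<bar> + L4 * \<bar>u - v\<bar>"
        using lQ4[of u v] lQ4[of "- u" "- v"] by (simp add: abs_minus_commute)
      also have "\<dots> = (2 * L4) * \<bar>u - v\<bar>" by simp
      also have "\<dots> \<le> K * \<bar>u - v\<bar>" using nn by (intro mult_right_mono) (auto simp: K_def)
      finally show ?thesis .
    qed
  qed (use \<beta> \<gamma> in auto)
  have zQ: "Q0 v = 0" "Q1 v = 0" "Q2 v = 0" if "v \<le> a" for v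
    using u1(3)[OF that] u2(3)[OF that] zf[OF that] by (simp_all add: Q0_def Q1_def Q2_def)
  show thesis
  proof (rule that[OF os])
    fix y :: real assume "0 \<le> y"
    then have "- y \<le> a" using a by simp
    moreover have Q: "\<gamma> * Q2 y = 2 * (f0 y - Q1 y - \<beta> * Q0 y)" unfolding Q2_def using \<gamma> by simp
    ultimately show "odd_smooth.f ?q0 ?q1 ?q2 \<beta> \<gamma> y = step0 (real n * (y - a))"
      unfolding odd_smooth.f_def[OF os] using \<gamma> Q by (simp add: zQ f0_def m_def field_simps)
  qed
qed

lemma odd_smooth_sin:
  assumes "0 < \<beta>" "0 < \<gamma>"
  shows "odd_smooth sin cos (\<lambda>v. - sin v) (\<lambda>v. - cos v) sin 1 \<beta> \<gamma>"
proof
  show "\<bar>sin u - sin v\<bar> \<le> 1 * \<bar>u - v\<bar>" for u v :: real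
    using field_differentiable_bound[of UNIV sin cos 1 u v] by (auto intro!: derivative_eq_intros)
qed (use assms in \<open>auto intro!: derivative_eq_intros\<close>)

section \<open>Identification of the law\<close>

context brownian_local_time
begin

text \<open>Both sides equal the heat flow of the test function at time \<open>T\<close> and
  position \<open>x\<close>, the left one by the martingale argument and the right one by the method
  of images.\<close>

lemma sticky_law_test:
  assumes os: "odd_smooth q0 q1 q2 q3 q4 K \<beta> \<gamma>" and T: "0 < T" and x: "0 \<le> x"
  shows "(\<integral>y. odd_smooth.f q0 q1 q2 \<beta> \<gamma> y \<partial>sticky_law \<beta> \<gamma> T x)
    = (\<integral>y. indicator {0<..} y * (p_D T x y + 2 * g_density \<beta> \<gamma> T (x + y)) * odd_smooth.f q0 q1 q2 \<beta> \<gamma> y \<partial>lborel)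
      + \<gamma> * g_density \<beta> \<gamma> T x * odd_smooth.f q0 q1 q2 \<beta> \<gamma> 0"
proof -
  interpret odd_smooth q0 q1 q2 q3 q4 K \<beta> \<gamma> by (rule os)
  interpret I: image_data q0 q1 q2 K \<beta> \<gamma> T x by (rule image_data[OF T x])
  have fe: "I.fe = f" unfolding I.fe_def[abs_def] f_def[abs_def] ..
  have m: "f \<in> borel_measurable borel" using I.q_meas(4) unfolding fe .
  show ?thesis
    using sticky_law(4)[OF \<beta> \<gamma> less_imp_le[OF T] m, of x] sticky_expectation[OF boundary_fun x T] I.explicit_heat
    unfolding fe by simp
qed

end

lemma (in image_data) density_integrable:
  "integrable lborel (\<lambda>y. indicator {0<..} y * (p_D T x y + 2 * g_density \<beta> \<gamma> T (x + y)))"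
  using Bochner_Integration.integrable_add[OF p_D_integrable integrable_mult_right[OF g_density_integrable, of 2]]
  by (simp add: distrib_left mult.left_commute)

context brownian_local_time
begin

text \<open>The law is cut off at 0 so that the atom does not interfere. Sharpening the smooth steps
  identifies the mass of each half-line beyond a positive level, and continuity from below extends
  this to \<open>{0<..}\<close>.\<close>

lemma sticky_law_density:
  assumes \<beta>: "0 < \<beta>" and \<gamma>: "0 < \<gamma>" and T: "0 < T" and x: "0 \<le> x"
  shows "density (sticky_law \<beta> \<gamma> T x) (indicator {0<..})
    = density lborel (\<lambda>y. ennreal (indicator {0<..} y * (p_D T x y + 2 * g_density \<beta> \<gamma> T (x + y))))"
proof -
  let ?\<mu> = "sticky_law \<beta> \<gamma> T x"
  define k where "k y = indicator {0<..} y * (p_D T x y + 2 * g_density \<beta> \<gamma> T (x + y))" for y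
  \<comment> \<open>The function \<open>sin\<close> merely instantiates the locale; the facts drawn
    from it here concern \<open>p_D\<close> and \<open>g_density\<close>, which do not involve the
    test function.\<close>
  interpret S: odd_smooth sin cos "\<lambda>v. - sin v" "\<lambda>v. - cos v" sin 1 \<beta> \<gamma> by (rule odd_smooth_sin[OF \<beta> \<gamma>])
  interpret I: image_data sin cos "\<lambda>v. - sin v" 1 \<beta> \<gamma> T x by (rule S.image_data[OF T x])
  interpret M: finite_measure ?\<mu> by (rule sticky_law(3)[OF \<beta> \<gamma> less_imp_le[OF T]])
  have sets\<mu>[simp, measurable_cong]: "sets ?\<mu> = sets borel" by (rule sticky_law(1)[OF \<beta> \<gamma> less_imp_le[OF T]])
  have ik: "integrable lborel k" unfolding k_def by (rule I.density_integrable)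
  have km[measurable]: "k \<in> borel_measurable borel" using borel_measurable_integrable[OF ik] by simp
  have k0: "0 \<le> k y" for y
    unfolding k_def using I.p_D_nonneg[of y] I.g_density_nonneg[of "x + y"] x by (auto split: split_indicator)
  have s0m[measurable]: "step0 \<in> borel_measurable borel"
    using step_deriv(1) by (intro borel_measurable_continuous_onI DERIV_continuous_on) (auto simp: has_field_derivative_at_within)
  have nonneg_ae: "AE y in ?\<mu>. 0 \<le> y"
    using sticky_law(5)[OF \<beta> \<gamma> less_imp_le[OF T], of x] by (intro AE_I[of _ _ "{..<0}"]) auto
  have tail: "emeasure (density ?\<mu> (indicator {0<..})) {a<..} = emeasure (density lborel (\<lambda>y. ennreal (k y))) {a<..}" if a: "0 < a" for a
  proof -
    have eq: "(\<integral>y. step0 (real n * (y - a)) \<partial>?\<mu>) = (\<integral>y. k y * step0 (real n * (y - a)) \<partial>lborel)" for n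
    proof -
      obtain q0 q1 q2 q3 q4 K where os: "odd_smooth q0 q1 q2 q3 q4 K \<beta> \<gamma>"
        and f: "\<And>y. 0 \<le> y \<Longrightarrow> odd_smooth.f q0 q1 q2 \<beta> \<gamma> y = step0 (real n * (y - a))"
        using odd_smooth_step[OF \<beta> \<gamma> a] by metis
      interpret O: odd_smooth q0 q1 q2 q3 q4 K \<beta> \<gamma> by (rule os)
      interpret B: boundary_fun O.f "\<lambda>v. q2 v + \<beta> * q1 v + \<gamma> / 2 * q3 v" "\<lambda>v. q3 v + \<beta> * q2 v + \<gamma> / 2 * q4 v" "K + \<beta> * K + \<gamma> / 2 * K" \<beta> \<gamma>
        by (rule O.boundary_fun)
      have "real n * (0 - a) \<le> 0" using a by (simp add: mult_nonneg_nonpos)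
      \<comment> \<open>The step vanishes at 0, so the atom drops out of the test identity.\<close>
      then have z: "O.f 0 = 0" using f[of 0] step_nonpos(1) by simp
      have "(\<integral>y. step0 (real n * (y - a)) \<partial>?\<mu>) = (\<integral>y. O.f y \<partial>?\<mu>)"
        using nonneg_ae B.meas(1) by (intro integral_cong_AE) (auto simp: f)
      also have "\<dots> = (\<integral>y. k y * O.f y \<partial>lborel)"
        using sticky_law_test[OF os T x] z by (simp add: k_def)
      also have "\<dots> = (\<integral>y. k y * step0 (real n * (y - a)) \<partial>lborel)"
        by (intro Bochner_Integration.integral_cong refl) (auto simp: k_def f split: split_indicator)
      finally show ?thesis .
    qed
    have lim: "(\<lambda>n. step0 (real n * (y - a))) \<longlonglongrightarrow> indicator {a<..} y" for y
    proof (cases "a < y")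
      case True
      then show ?thesis using step0_tendsto[of "y - a"] by simp
    next
      case False
      then have "real n * (y - a) \<le> 0" for n by (simp add: mult_nonneg_nonpos)
      then show ?thesis using False by (simp add: step_nonpos(1))
    qed
    have "(\<lambda>n. \<integral>y. step0 (real n * (y - a)) \<partial>?\<mu>) \<longlonglongrightarrow> (\<integral>y. indicator {a<..} y \<partial>?\<mu>)"
      using lim step_bounds by (intro integral_dominated_convergence[where w = "\<lambda>_. 1"]) auto
    moreover have "(\<lambda>n. \<integral>y. k y * step0 (real n * (y - a)) \<partial>lborel) \<longlonglongrightarrow> (\<integral>y. k y * indicator {a<..} y \<partial>lborel)"
    proof (rule integral_dominated_convergence[where w = k])
      show "AE y in lborel. norm (k y * step0 (real n * (y - a))) \<le> k y" for n
        using k0 step_bounds(1,2) by (intro AE_I2) (simp add: abs_mult mult_left_le)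
    qed (use lim in \<open>auto intro!: tendsto_mult ik\<close>)
    ultimately have e: "(\<integral>y. indicator {a<..} y \<partial>?\<mu>) = (\<integral>y. k y * indicator {a<..} y \<partial>lborel)"
      unfolding eq by (rule LIMSEQ_unique)
    have "emeasure (density ?\<mu> (indicator {0<..})) {a<..} = emeasure ?\<mu> {a<..}"
    proof -
      have "emeasure (density ?\<mu> (indicator {0<..})) {a<..} = (\<integral>\<^sup>+y. indicator {a<..} y \<partial>?\<mu>)"
        by (subst emeasure_density, simp, simp, rule nn_integral_cong) (use a in \<open>auto split: split_indicator\<close>)
      then show ?thesis by simp
    qed
    also have "\<dots> = ennreal (\<integral>y. indicator {a<..} y \<partial>?\<mu>)" by (simp add: M.emeasure_eq_measure)
    also have "\<dots> = ennreal (\<integral>y. k y * indicator {a<..} y \<partial>lborel)" by (simp only: e)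
    also have "\<dots> = (\<integral>\<^sup>+y. ennreal (k y * indicator {a<..} y) \<partial>lborel)"
      using k0 by (intro nn_integral_eq_integral[symmetric] integrable_real_mult_indicator ik) auto
    also have "\<dots> = emeasure (density lborel (\<lambda>y. ennreal (k y))) {a<..}"
      by (subst emeasure_density) (auto intro!: nn_integral_cong split: split_indicator)
    finally show ?thesis .
  qed
  have union: "(\<Union>n. {inverse (real (Suc n))<..}) = {0<..}"
  proof safe
    fix n y assume "inverse (real (Suc n)) < y"
    then show "0 < y" by (rule less_trans[rotated]) simp
  next
    fix y :: real assume "0 < y"
    then obtain n where "inverse (real (Suc n)) < y" using reals_Archimedean by blast
    then show "y \<in> (\<Union>n. {inverse (real (Suc n))<..})" by auto
  qed
  have inc: "incseq (\<lambda>n. {inverse (real (Suc n))<..})"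
    by (rule incseq_SucI) (auto intro: le_less_trans[rotated] simp: field_simps)
  have zero: "emeasure (density ?\<mu> (indicator {0<..})) {0<..} = emeasure (density lborel (\<lambda>y. ennreal (k y))) {0<..}"
  proof (rule LIMSEQ_unique)
    have "(\<lambda>n. emeasure (density ?\<mu> (indicator {0<..})) {inverse (real (Suc n))<..}) \<longlonglongrightarrow> emeasure (density ?\<mu> (indicator {0<..})) {0<..}"
      using Lim_emeasure_incseq[OF _ inc, of "density ?\<mu> (indicator {0<..})"] unfolding union by (simp add: image_subset_iff)
    then show "(\<lambda>n. emeasure (density lborel (\<lambda>y. ennreal (k y))) {inverse (real (Suc n))<..}) \<longlonglongrightarrow> emeasure (density ?\<mu> (indicator {0<..})) {0<..}"
      by (subst (asm) tail) simp_all
    show "(\<lambda>n. emeasure (density lborel (\<lambda>y. ennreal (k y))) {inverse (real (Suc n))<..}) \<longlonglongrightarrow> emeasure (density lborel (\<lambda>y. ennreal (k y))) {0<..}"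
      using Lim_emeasure_incseq[OF _ inc, of "density lborel (\<lambda>y. ennreal (k y))"] unfolding union by (simp add: image_subset_iff)
  qed
  have "density ?\<mu> (indicator {0<..}) = density lborel (\<lambda>y. ennreal (k y))"
  proof (rule measure_eqI_lessThan)
    fix c :: real
    show "emeasure (density ?\<mu> (indicator {0<..})) {c<..} < \<infinity>"
    proof -
      have "emeasure (density ?\<mu> (indicator {0<..})) {c<..} \<le> (\<integral>\<^sup>+y. 1 \<partial>?\<mu>)"
        by (subst emeasure_density, simp, simp, rule nn_integral_mono) (auto split: split_indicator)
      also have "\<dots> < \<infinity>" using M.emeasure_finite by (simp add: less_top[symmetric])
      finally show ?thesis .
    qed
    show "emeasure (density ?\<mu> (indicator {0<..})) {c<..} = emeasure (density lborel (\<lambda>y. ennreal (k y))) {c<..}"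
    proof (cases "0 < c")
      \<comment> \<open>The uniqueness criterion asks for all half-lines. Both measures are carried
        by \<open>{0<..}\<close>, so for \<open>c \<le> 0\<close> the masses are those of
        \<open>{0<..}\<close>.\<close>
      case False
      have "emeasure (density ?\<mu> (indicator {0<..})) {c<..} = emeasure (density ?\<mu> (indicator {0<..})) {0<..}"
        by (subst (1 2) emeasure_density, simp_all, rule nn_integral_cong) (use False in \<open>auto split: split_indicator\<close>)
      moreover have "emeasure (density lborel (\<lambda>y. ennreal (k y))) {c<..} = emeasure (density lborel (\<lambda>y. ennreal (k y))) {0<..}"
        by (subst (1 2) emeasure_density, simp_all, rule nn_integral_cong) (use False in \<open>auto simp: k_def split: split_indicator\<close>)
      ultimately show ?thesis using zero by simp
    qed (rule tail)
  qed simp_all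
  then show ?thesis unfolding k_def .
qed

text \<open>In the test identity for \<open>q = sin\<close>, where \<open>f 0 = 1\<close>, the
  integrals over \<open>{0<..}\<close> agree by the density already found; the difference is the
  mass at 0.\<close>

lemma sticky_law_atom:
  assumes \<beta>: "0 < \<beta>" and \<gamma>: "0 < \<gamma>" and T: "0 < T" and x: "0 \<le> x"
  shows "emeasure (sticky_law \<beta> \<gamma> T x) {0} = ennreal (\<gamma> * g_density \<beta> \<gamma> T x)"
proof -
  let ?\<mu> = "sticky_law \<beta> \<gamma> T x"
  let ?k = "\<lambda>y. indicator {0<..} y * (p_D T x y + 2 * g_density \<beta> \<gamma> T (x + y))"
  interpret S: odd_smooth sin cos "\<lambda>v. - sin v" "\<lambda>v. - cos v" sin 1 \<beta> \<gamma> by (rule odd_smooth_sin[OF \<beta> \<gamma>])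
  interpret I: image_data sin cos "\<lambda>v. - sin v" 1 \<beta> \<gamma> T x by (rule S.image_data[OF T x])
  interpret bf: boundary_fun S.f "\<lambda>v. - sin v + \<beta> * cos v + \<gamma> / 2 * - cos v" "\<lambda>v. - cos v + \<beta> * - sin v + \<gamma> / 2 * sin v" "1 + \<beta> * 1 + \<gamma> / 2 * 1" \<beta> \<gamma>
    by (rule S.boundary_fun)
  interpret M: finite_measure ?\<mu> by (rule sticky_law(3)[OF \<beta> \<gamma> less_imp_le[OF T]])
  have sets\<mu>[simp, measurable_cong]: "sets ?\<mu> = sets borel" by (rule sticky_law(1)[OF \<beta> \<gamma> less_imp_le[OF T]])
  note [measurable] = bf.meas(1)
  have km[measurable]: "?k \<in> borel_measurable borel" using borel_measurable_integrable[OF I.density_integrable] by simp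
  have k0: "0 \<le> ?k y" for y
    using I.p_D_nonneg[of y] I.g_density_nonneg[of "x + y"] x by (auto split: split_indicator)
  have f0: "S.f 0 = 1" by (simp add: S.f_def)
  have i1: "integrable ?\<mu> (\<lambda>y. indicator {0<..} y * S.f y)"
    using bf.bound0 bf.K_nonneg by (intro M.integrable_const_bound[where B = "1 + \<beta> * 1 + \<gamma> / 2 * 1"]) (auto split: split_indicator)
  have i2: "integrable ?\<mu> (\<lambda>y. indicator {0::real} y :: real)"
    by (intro integrable_real_indicator) (auto simp: M.emeasure_finite less_top[symmetric])
  have nonneg_ae: "AE y in ?\<mu>. 0 \<le> y"
    using sticky_law(5)[OF \<beta> \<gamma> less_imp_le[OF T], of x] by (intro AE_I[of _ _ "{..<0}"]) auto
  have "(\<integral>y. S.f y \<partial>?\<mu>) = (\<integral>y. indicator {0<..} y * S.f y + indicator {0} y \<partial>?\<mu>)"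
    using nonneg_ae f0 by (intro integral_cong_AE) (auto split: split_indicator elim!: eventually_mono)
  also have "\<dots> = (\<integral>y. indicator {0<..} y * S.f y \<partial>?\<mu>) + measure ?\<mu> {0}"
    using i1 i2 by simp
  also have "(\<integral>y. indicator {0<..} y * S.f y \<partial>?\<mu>) = (\<integral>y. S.f y \<partial>density ?\<mu> (indicator {0<..}))"
  proof -
    have "density ?\<mu> (indicator {0<..}) = density ?\<mu> (\<lambda>y. ennreal (indicator {0<..} y))"
      by (intro density_cong) (auto split: split_indicator)
    then show ?thesis by (simp add: integral_density)
  qed
  also have "\<dots> = (\<integral>y. ?k y * S.f y \<partial>lborel)"
    unfolding sticky_law_density[OF \<beta> \<gamma> T x] using k0 by (subst integral_density) auto
  finally have "measure ?\<mu> {0} = \<gamma> * g_density \<beta> \<gamma> T x"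
    using sticky_law_test[OF S.odd_smooth_axioms T x] f0 by simp
  then show ?thesis by (simp add: M.emeasure_eq_measure)
qed

end

theorem corollary4p6:
  fixes A :: "'a measure"
    and P :: "real \<Rightarrow> 'a measure"
    and F :: "real \<Rightarrow> 'a measure"
    and B L :: "real \<Rightarrow> 'a \<Rightarrow> real"
    and \<theta> :: "real \<Rightarrow> 'a \<Rightarrow> 'a"
    and \<beta> \<gamma> t x :: real
    and C :: "real set"
  assumes "brownian_local_time A P F B \<theta> L"
    and "\<beta> > 0" and "\<gamma> > 0"
    and "t > 0" and "x \<ge> 0"
    and "C \<in> sets borel" and "C \<subseteq> {0..}"
  shows "transition_kernel P B L \<beta> \<gamma> t x C =
      (\<integral>\<^sup>+y\<in>C. ennreal (p_D t x y) \<partial>lborel)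
    + (\<integral>\<^sup>+y\<in>C. ennreal (2 * g_density \<beta> \<gamma> t (x + y)) \<partial>lborel)
    + ennreal (\<gamma> * g_density \<beta> \<gamma> t x) * emeasure (return borel 0) C"
proof -
  interpret brownian_local_time A P F B \<theta> L by fact
  note \<beta> = \<open>\<beta> > 0\<close> and \<gamma> = \<open>\<gamma> > 0\<close> and T = \<open>t > 0\<close> and x = \<open>x \<ge> 0\<close>
  note C[measurable] = \<open>C \<in> sets borel\<close>
  let ?\<mu> = "sticky_law \<beta> \<gamma> t x"
  interpret S: odd_smooth sin cos "\<lambda>v. - sin v" "\<lambda>v. - cos v" sin 1 \<beta> \<gamma> by (rule odd_smooth_sin[OF \<beta> \<gamma>])
  interpret I: image_data sin cos "\<lambda>v. - sin v" 1 \<beta> \<gamma> t x by (rule S.image_data[OF T x])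
  have sets\<mu>[simp, measurable_cong]: "sets ?\<mu> = sets borel" by (rule sticky_law(1)[OF \<beta> \<gamma> less_imp_le[OF T]])
  have [measurable]: "p_D t x \<in> borel_measurable borel" unfolding I.p_D_eq[abs_def] by measurable
  have "transition_kernel P B L \<beta> \<gamma> t x C = emeasure ?\<mu> C"
    by (rule sticky_law(2)[OF \<beta> \<gamma> less_imp_le[OF T] C, symmetric])
  also have "\<dots> = emeasure ?\<mu> (C \<inter> {0<..}) + emeasure ?\<mu> (C \<inter> {0})"
  proof -
    have "C = (C \<inter> {0<..}) \<union> (C \<inter> {0})" using \<open>C \<subseteq> {0..}\<close> by force
    then show ?thesis by (subst plus_emeasure) auto
  qed
  also have "emeasure ?\<mu> (C \<inter> {0}) = ennreal (\<gamma> * g_density \<beta> \<gamma> t x) * emeasure (return borel 0) C"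
    using sticky_law_atom[OF \<beta> \<gamma> T x] by (cases "0 \<in> C") (auto simp: Int_insert_right)
  also have "emeasure ?\<mu> (C \<inter> {0<..}) = emeasure (density ?\<mu> (indicator {0<..})) C"
    by (subst emeasure_density) (auto simp: indicator_inter_arith[symmetric] Int_commute)
  also have "\<dots> = (\<integral>\<^sup>+y. ennreal (indicator {0<..} y * (p_D t x y + 2 * g_density \<beta> \<gamma> t (x + y))) * indicator C y \<partial>lborel)"
    unfolding sticky_law_density[OF \<beta> \<gamma> T x] by (rule emeasure_density) auto
  also have "\<dots> = (\<integral>\<^sup>+y. ennreal (p_D t x y) * indicator C y + ennreal (2 * g_density \<beta> \<gamma> t (x + y)) * indicator C y \<partial>lborel)"
  \<comment> \<open>The two integrands may differ at \<open>y = 0\<close>, a Lebesgue null set.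
    Nonnegativity of both densities allows the sum to be split after conversion to
    \<open>ennreal\<close>.\<close>
  proof (rule nn_integral_cong_AE)
    show "AE y in lborel. ennreal (indicator {0<..} y * (p_D t x y + 2 * g_density \<beta> \<gamma> t (x + y))) * indicator C y
      = ennreal (p_D t x y) * indicator C y + ennreal (2 * g_density \<beta> \<gamma> t (x + y)) * indicator C y"
      using AE_lborel_singleton[of "0::real"]
    proof eventually_elim
      case (elim y)
      show ?case
      proof (cases "y \<in> C")
        case True
        then have "0 < y" using elim \<open>C \<subseteq> {0..}\<close> by force
        then show ?thesis using True I.p_D_nonneg[of y] I.g_density_nonneg[of "x + y"] x by (simp add: ennreal_plus)
      qed simp
    qed
  qed
  also have "\<dots> = (\<integral>\<^sup>+y\<in>C. ennreal (p_D t x y) \<partial>lborel) + (\<integral>\<^sup>+y\<in>C. ennreal (2 * g_density \<beta> \<gamma> t (x + y)) \<partial>lborel)"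
    by (rule nn_integral_add) auto
  finally show ?thesis .
qed

end
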